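(* Let $X$ be a locally compact Hausdorff space and $\kappa$ a perfect kernel on $X$. Let $f=\psi+U^\vartheta$ with $\psi\in\Phi(X)$ and $\vartheta\in\mathcal E$, and let $A\subset X$ be such that $-\infty<w_f(A)<\infty$, the class $\mathcal E^+(A)$ is closed in the strong topology on $\mathcal E^+$, and ${\rm cap}_*(A)<\infty$. Then there exists a (unique) $\lambda=\lambda_{A,f}\in\breve{\mathcal E}^+_f(A)$ with $I_f(\lambda)=w_f(A)$. With $$c_{A,f}:=\int U_f^{\lambda}\,d\lambda=w_f(A)-\int f\,d\lambda\in(-\infty,\infty),$$ it satisfies $$U_f^{\lambda}\geqslant c_{A,f}\ \text{ n.e. on }A,\qquad U_f^{\lambda}\leqslant c_{A,f}\ \ \lambda\text{-a.e. on }X.$$ Furthermore, $\lambda_{A,f}$ is uniquely determined within $\breve{\mathcal E}^+_f(A)$ by either of these two properties, in the following sense: a measure $\mu\in\breve{\mathcal E}^+_f(A)$ equals $\lambda_{A,f}$ if and only if $$U_f^\mu\geqslant\int U_f^\mu\,d\mu\ \text{ n.e. on }A,$$ and also if and only if $$U_f^\mu\leqslant w_f(A)-\int f\,d\mu\ \ \mu\text{-a.e. on }X.$$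
   Context: Measures: $\mathfrak M$ is the space of real-valued (signed) Radon measures on $X$ with the vague (weak$^*$) topology of pointwise convergence on continuous functions of compact support; $\mathfrak M^+$ is the cone of positive ones. A measure $\mu\in\mathfrak M^+$ is concentrated on $A\subset X$ if $X\setminus A$ is locally $\mu$-negligible. $\Phi(Y)$ is the set of lower semicontinuous functions $g:Y\to(-\infty,\infty]$ which are $\geqslant0$ unless the topological space $Y$ is compact. A kernel is a symmetric function $\kappa\in\Phi(X\times X)$. For $\mu\in\mathfrak M$, $U^\mu(x)=\int\kappa(x,y)\,d\mu(y)$ is the potential, $I(\mu,\nu)=\int\kappa\,d(\mu\otimes\nu)$ the mutual energy, $I(\mu)=I(\mu,\mu)$ the energy, whenever well defined. Energy principle: $I(\mu)\geqslant0$ for all $\mu\in\mathfrak M$ for which $I(\mu)$ is well defined, and $I(\mu)=0$ only for $\mu=0$. Then $\mathcal E=\{\mu\in\mathfrak M: I(\mu)\text{ well defined},\ I(\mu)<\infty\}$ is a pre-Hilbert space with inner product $\langle\mu,\nu\rangle=I(\mu,\nu)$ and norm $\|\mu\|=\sqrt{I(\mu)}$; the norm topology is called strong. $\mathcal E^+=\mathcal E\cap\mathfrak M^+$. The kernel is perfect if it satisfies the energy principle, $\mathcal E^+$ is strongly complete, and the strong topology on $\mathcal E^+$ is finer than the vague topology. $\mathcal E^+(A)$ is the set of $\mu\in\mathcal E^+$ concentrated on $A$; $\breve{\mathcal E}^+(A)=\{\mu\in\mathcal E^+(A):\mu(X)=1\}$. ${\rm cap}_*(A)=1/w(A)$ with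 $w(A)=\inf_{\mu\in\breve{\mathcal E}^+(A)}I(\mu)$ is the inner capacity (conventions: $\inf\varnothing=+\infty$, $1/(+\infty)=0$, $1/0=+\infty$). "N.e. on $A$" means: except on a subset of $A$ of inner capacity zero. The function $f=\psi+U^\vartheta$ is well defined with values in $(-\infty,\infty]$ n.e. on $X$ (sets of inner capacity zero, when $\mu$-measurable, are negligible for bounded $\mu\in\mathcal E^+$). $\breve{\mathcal E}^+_f(A)$ is the set of $\mu\in\breve{\mathcal E}^+(A)$ for which $f$ is $\mu$-integrable; $I_f(\mu)=I(\mu)+2\int f\,d\mu$; $w_f(A)=\inf_{\mu\in\breve{\mathcal E}^+_f(A)}I_f(\mu)$; $U_f^\mu=U^\mu+f$. *)

theory Defs
  imports "HOL-Analysis.Analysis"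
begin

text \<open>
  The underlying space is a type \<open>'a::t2_space\<close>; local compactness is an explicit hypothesis of
  the theorem.  No countability or metrizability is assumed, so Radon measures are set up as in
  Bourbaki: a signed Radon measure is a relatively bounded linear functional on the space of
  continuous functions of compact support.  This makes sense of signed measures
  both of whose Jordan parts are infinite, and of product measures when the Borel sets of
  \<open>'a \<times> 'a\<close> are not generated by rectangles.
\<close>

section \<open>Radon measures\<close>

definition Cc :: "('a::topological_space \<Rightarrow> real) set" where
  "Cc = {\<phi>. continuous_on UNIV \<phi> \<and> compact (closure {x. \<phi> x \<noteq> 0})}"

text \<open>A functional is normalised to be 0 outside \<open>Cc\<close>, so that equality in
  \<open>signed_radon\<close> is equality on \<open>Cc\<close>.\<close>

definition signed_radon :: "(('a::t2_space \<Rightarrow> real) \<Rightarrow> real) set" where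
  "signed_radon = {T.
     (\<forall>\<phi>. \<phi> \<notin> Cc \<longrightarrow> T \<phi> = 0) \<and>
     (\<forall>\<phi>\<in>Cc. \<forall>\<psi>\<in>Cc. \<forall>a b. T (\<lambda>x. a * \<phi> x + b * \<psi> x) = a * T \<phi> + b * T \<psi>) \<and>
     (\<forall>K. compact K \<longrightarrow>
        (\<exists>C. \<forall>\<phi>\<in>Cc. {x. \<phi> x \<noteq> 0} \<subseteq> K \<longrightarrow> \<bar>T \<phi>\<bar> \<le> C * (SUP x. \<bar>\<phi> x\<bar>)))}"

definition pos_radon :: "(('a::t2_space \<Rightarrow> real) \<Rightarrow> real) set" where
  "pos_radon = {T \<in> signed_radon. \<forall>\<phi>\<in>Cc. (\<forall>x. 0 \<le> \<phi> x) \<longrightarrow> 0 \<le> T \<phi>}"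

text \<open>The topology of the function type is that of pointwise convergence; as all functionals in
  \<open>signed_radon\<close> vanish off \<open>Cc\<close>, its restriction is pointwise convergence on \<open>Cc\<close>.\<close>

definition vague_topology :: "(('a::t2_space \<Rightarrow> real) \<Rightarrow> real) topology" where
  "vague_topology = top_of_set signed_radon"

text \<open>The Borel measure representing a positive functional.  Existence and uniqueness are the
  Riesz--Markov theorem on locally compact Hausdorff spaces.  The outer regular representative
  yields Bourbaki's negligible sets and upper integrals of lower semicontinuous functions.\<close>

definition borel_of :: "(('a::t2_space \<Rightarrow> real) \<Rightarrow> real) \<Rightarrow> 'a measure" where
  "borel_of T = (THE M.
     sets M = sets borel \<and>
     (\<forall>K. compact K \<longrightarrow> emeasure M K < \<infinity>) \<and>
     (\<forall>B\<in>sets borel. emeasure M B = (INF U\<in>{U. open U \<and> B \<subseteq> U}. emeasure M U)) \<and>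
     (\<forall>U. open U \<longrightarrow> emeasure M U = (SUP K\<in>{K. compact K \<and> K \<subseteq> U}. emeasure M K)) \<and>
     (\<forall>\<phi>\<in>Cc. T \<phi> = (LINT x|M. \<phi> x)))"

text \<open>Jordan decomposition in the vector lattice of functionals: for \<open>\<phi> \<ge> 0\<close>, the positive part
  is \<open>sup {T \<eta> | 0 \<le> \<eta> \<le> \<phi>}\<close>, extended linearly to all of \<open>Cc\<close>.\<close>

definition pos_part :: "(('a::t2_space \<Rightarrow> real) \<Rightarrow> real) \<Rightarrow> ('a \<Rightarrow> real) \<Rightarrow> real" where
  "pos_part T = (\<lambda>\<phi>. if \<phi> \<in> Cc then
       Sup {T \<eta> |\<eta>. \<eta> \<in> Cc \<and> (\<forall>x. 0 \<le> \<eta> x \<and> \<eta> x \<le> max 0 (\<phi> x))}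
     - Sup {T \<eta> |\<eta>. \<eta> \<in> Cc \<and> (\<forall>x. 0 \<le> \<eta> x \<and> \<eta> x \<le> max 0 (- \<phi> x))}
     else 0)"

definition neg_part :: "(('a::t2_space \<Rightarrow> real) \<Rightarrow> real) \<Rightarrow> ('a \<Rightarrow> real) \<Rightarrow> real" where
  "neg_part T = pos_part (\<lambda>\<phi>. - T \<phi>)"

definition radon_prod ::
  "(('a::t2_space \<Rightarrow> real) \<Rightarrow> real) \<Rightarrow> (('b::t2_space \<Rightarrow> real) \<Rightarrow> real) \<Rightarrow> ('a \<times> 'b \<Rightarrow> real) \<Rightarrow> real" where
  "radon_prod \<mu> \<nu> = (\<lambda>F. if F \<in> Cc then \<mu> (\<lambda>x. \<nu> (\<lambda>y. F (x, y))) else 0)"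

section \<open>Integrals of extended real functions against signed Radon measures\<close>

text \<open>\<open>e2ennreal\<close> sends negative numbers to 0, hence gives the positive part of an \<open>ereal\<close>.\<close>

definition integral_pos :: "(('a::t2_space \<Rightarrow> real) \<Rightarrow> real) \<Rightarrow> ('a \<Rightarrow> ereal) \<Rightarrow> ennreal" where
  "integral_pos \<mu> g = (\<integral>\<^sup>+x. e2ennreal (g x) \<partial>borel_of (pos_part \<mu>))
                    + (\<integral>\<^sup>+x. e2ennreal (- g x) \<partial>borel_of (neg_part \<mu>))"

definition integral_neg :: "(('a::t2_space \<Rightarrow> real) \<Rightarrow> real) \<Rightarrow> ('a \<Rightarrow> ereal) \<Rightarrow> ennreal" where
  "integral_neg \<mu> g = (\<integral>\<^sup>+x. e2ennreal (- g x) \<partial>borel_of (pos_part \<mu>))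
                    + (\<integral>\<^sup>+x. e2ennreal (g x) \<partial>borel_of (neg_part \<mu>))"

definition integral_defined :: "(('a::t2_space \<Rightarrow> real) \<Rightarrow> real) \<Rightarrow> ('a \<Rightarrow> ereal) \<Rightarrow> bool" where
  "integral_defined \<mu> g \<longleftrightarrow>
     g \<in> borel_measurable borel \<and> (integral_pos \<mu> g < \<infinity> \<or> integral_neg \<mu> g < \<infinity>)"

definition radon_integrable :: "(('a::t2_space \<Rightarrow> real) \<Rightarrow> real) \<Rightarrow> ('a \<Rightarrow> ereal) \<Rightarrow> bool" where
  "radon_integrable \<mu> g \<longleftrightarrow>
     g \<in> borel_measurable borel \<and> integral_pos \<mu> g < \<infinity> \<and> integral_neg \<mu> g < \<infinity>"

text \<open>Only meaningful under \<open>integral_defined\<close>.\<close>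

definition radon_integral :: "(('a::t2_space \<Rightarrow> real) \<Rightarrow> real) \<Rightarrow> ('a \<Rightarrow> ereal) \<Rightarrow> ereal" where
  "radon_integral \<mu> g = enn2ereal (integral_pos \<mu> g) - enn2ereal (integral_neg \<mu> g)"

section \<open>Kernels, potentials and energies\<close>

definition Phi :: "('a::topological_space \<Rightarrow> ereal) set" where
  "Phi = {g. (\<forall>a. open {y. a < g y}) \<and> (\<forall>y. g y \<noteq> -\<infinity>) \<and>
             (compact (UNIV :: 'a set) \<or> (\<forall>y. 0 \<le> g y))}"

definition kernel :: "('a::t2_space \<times> 'a \<Rightarrow> ereal) \<Rightarrow> bool" where
  "kernel \<kappa> \<longleftrightarrow> \<kappa> \<in> Phi \<and> (\<forall>x y. \<kappa> (x, y) = \<kappa> (y, x))"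

definition potential_defined ::
  "('a::t2_space \<times> 'a \<Rightarrow> ereal) \<Rightarrow> (('a \<Rightarrow> real) \<Rightarrow> real) \<Rightarrow> 'a \<Rightarrow> bool" where
  "potential_defined \<kappa> \<mu> x \<longleftrightarrow> integral_defined \<mu> (\<lambda>y. \<kappa> (x, y))"

definition potential ::
  "('a::t2_space \<times> 'a \<Rightarrow> ereal) \<Rightarrow> (('a \<Rightarrow> real) \<Rightarrow> real) \<Rightarrow> 'a \<Rightarrow> ereal" where
  "potential \<kappa> \<mu> x = radon_integral \<mu> (\<lambda>y. \<kappa> (x, y))"

definition energy_defined ::
  "('a::t2_space \<times> 'a \<Rightarrow> ereal) \<Rightarrow> (('a \<Rightarrow> real) \<Rightarrow> real) \<Rightarrow> bool" where
  "energy_defined \<kappa> \<mu> \<longleftrightarrow> integral_defined (radon_prod \<mu> \<mu>) \<kappa>"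

definition mutual_energy ::
  "('a::t2_space \<times> 'a \<Rightarrow> ereal) \<Rightarrow> (('a \<Rightarrow> real) \<Rightarrow> real) \<Rightarrow> (('a \<Rightarrow> real) \<Rightarrow> real) \<Rightarrow> ereal" where
  "mutual_energy \<kappa> \<mu> \<nu> = radon_integral (radon_prod \<mu> \<nu>) \<kappa>"

definition energy ::
  "('a::t2_space \<times> 'a \<Rightarrow> ereal) \<Rightarrow> (('a \<Rightarrow> real) \<Rightarrow> real) \<Rightarrow> ereal" where
  "energy \<kappa> \<mu> = mutual_energy \<kappa> \<mu> \<mu>"

definition energy_principle :: "('a::t2_space \<times> 'a \<Rightarrow> ereal) \<Rightarrow> bool" where
  "energy_principle \<kappa> \<longleftrightarrow>
     (\<forall>\<mu>\<in>signed_radon. energy_defined \<kappa> \<mu> \<longrightarrow>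
        0 \<le> energy \<kappa> \<mu> \<and> (energy \<kappa> \<mu> = 0 \<longrightarrow> \<mu> = (\<lambda>\<phi>. 0)))"

definition energy_space :: "('a::t2_space \<times> 'a \<Rightarrow> ereal) \<Rightarrow> (('a \<Rightarrow> real) \<Rightarrow> real) set" where
  "energy_space \<kappa> = {\<mu> \<in> signed_radon. energy_defined \<kappa> \<mu> \<and> energy \<kappa> \<mu> < \<infinity>}"

definition energy_cone :: "('a::t2_space \<times> 'a \<Rightarrow> ereal) \<Rightarrow> (('a \<Rightarrow> real) \<Rightarrow> real) set" where
  "energy_cone \<kappa> = energy_space \<kappa> \<inter> pos_radon"

definition energy_norm ::
  "('a::t2_space \<times> 'a \<Rightarrow> ereal) \<Rightarrow> (('a \<Rightarrow> real) \<Rightarrow> real) \<Rightarrow> real" where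
  "energy_norm \<kappa> \<mu> = sqrt (real_of_ereal (energy \<kappa> \<mu>))"

text \<open>The value 0 outside the energy space is there because the locale \<open>Metric_space\<close> requires
  nonnegativity and symmetry for all arguments.\<close>

definition strong_dist ::
  "('a::t2_space \<times> 'a \<Rightarrow> ereal) \<Rightarrow> (('a \<Rightarrow> real) \<Rightarrow> real) \<Rightarrow> (('a \<Rightarrow> real) \<Rightarrow> real) \<Rightarrow> real" where
  "strong_dist \<kappa> \<mu> \<nu> =
     (if \<mu> \<in> energy_space \<kappa> \<and> \<nu> \<in> energy_space \<kappa>
      then energy_norm \<kappa> (\<lambda>\<phi>. \<mu> \<phi> - \<nu> \<phi>) else 0)"

definition strong_topology ::
  "('a::t2_space \<times> 'a \<Rightarrow> ereal) \<Rightarrow> (('a \<Rightarrow> real) \<Rightarrow> real) topology" where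
  "strong_topology \<kappa> = Metric_space.mtopology (energy_space \<kappa>) (strong_dist \<kappa>)"

definition perfect_kernel :: "('a::t2_space \<times> 'a \<Rightarrow> ereal) \<Rightarrow> bool" where
  "perfect_kernel \<kappa> \<longleftrightarrow>
     kernel \<kappa> \<and> energy_principle \<kappa> \<and>
     Metric_space.mcomplete (energy_cone \<kappa>) (strong_dist \<kappa>) \<and>
     (\<forall>W. openin (subtopology vague_topology (energy_cone \<kappa>)) W \<longrightarrow>
          openin (subtopology (strong_topology \<kappa>) (energy_cone \<kappa>)) W)"

section \<open>Inner capacity\<close>

text \<open>The complement of \<open>A\<close> is locally negligible: its trace on each compact set is negligible.
  \<open>A\<close> need not be measurable; \<open>AE\<close> refers to null sets of the completion.\<close>

definition concentrated_on :: "(('a::t2_space \<Rightarrow> real) \<Rightarrow> real) \<Rightarrow> 'a set \<Rightarrow> bool" where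
  "concentrated_on \<mu> A \<longleftrightarrow> (\<forall>K. compact K \<longrightarrow> (AE x in borel_of \<mu>. x \<in> K \<longrightarrow> x \<in> A))"

definition energy_cone_on ::
  "('a::t2_space \<times> 'a \<Rightarrow> ereal) \<Rightarrow> 'a set \<Rightarrow> (('a \<Rightarrow> real) \<Rightarrow> real) set" where
  "energy_cone_on \<kappa> A = {\<mu> \<in> energy_cone \<kappa>. concentrated_on \<mu> A}"

definition unit_cone_on ::
  "('a::t2_space \<times> 'a \<Rightarrow> ereal) \<Rightarrow> 'a set \<Rightarrow> (('a \<Rightarrow> real) \<Rightarrow> real) set" where
  "unit_cone_on \<kappa> A = {\<mu> \<in> energy_cone_on \<kappa> A. emeasure (borel_of \<mu>) UNIV = 1}"

text \<open>In \<open>ereal\<close>, the infimum of the empty set is \<open>\<infinity>\<close>, \<open>1 / \<infinity> = 0\<close> and \<open>1 / 0 = \<infinity>\<close>.\<close>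

definition inner_cap :: "('a::t2_space \<times> 'a \<Rightarrow> ereal) \<Rightarrow> 'a set \<Rightarrow> ereal" where
  "inner_cap \<kappa> A = 1 / (INF \<mu>\<in>unit_cone_on \<kappa> A. energy \<kappa> \<mu>)"

definition nearly_everywhere_on ::
  "('a::t2_space \<times> 'a \<Rightarrow> ereal) \<Rightarrow> 'a set \<Rightarrow> ('a \<Rightarrow> bool) \<Rightarrow> bool" where
  "nearly_everywhere_on \<kappa> A P \<longleftrightarrow> inner_cap \<kappa> {x \<in> A. \<not> P x} = 0"

section \<open>The Gauss problem with external field\<close>

definition external_field ::
  "('a::t2_space \<times> 'a \<Rightarrow> ereal) \<Rightarrow> ('a \<Rightarrow> ereal) \<Rightarrow> (('a \<Rightarrow> real) \<Rightarrow> real) \<Rightarrow> 'a \<Rightarrow> ereal" where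
  "external_field \<kappa> \<psi> \<theta> x = \<psi> x + potential \<kappa> \<theta> x"

text \<open>The points at which the field has a well-defined value in \<open>(-\<infinity>, \<infinity>]\<close>
  (here \<open>\<psi> \<in> Phi\<close> never takes the value \<open>-\<infinity>\<close>).  For \<open>\<theta>\<close> of finite energy these are nearly all
  points, so that the value given to \<open>external_field\<close> elsewhere is immaterial.\<close>

definition field_defined ::
  "('a::t2_space \<times> 'a \<Rightarrow> ereal) \<Rightarrow> (('a \<Rightarrow> real) \<Rightarrow> real) \<Rightarrow> 'a \<Rightarrow> bool" where
  "field_defined \<kappa> \<theta> x \<longleftrightarrow> potential_defined \<kappa> \<theta> x \<and> potential \<kappa> \<theta> x \<noteq> -\<infinity>"

definition gauss_class ::
  "('a::t2_space \<times> 'a \<Rightarrow> ereal) \<Rightarrow> ('a \<Rightarrow> ereal) \<Rightarrow> 'a set \<Rightarrow> (('a \<Rightarrow> real) \<Rightarrow> real) set" where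
  "gauss_class \<kappa> f A = {\<mu> \<in> unit_cone_on \<kappa> A. radon_integrable \<mu> f}"

definition gauss_energy ::
  "('a::t2_space \<times> 'a \<Rightarrow> ereal) \<Rightarrow> ('a \<Rightarrow> ereal) \<Rightarrow> (('a \<Rightarrow> real) \<Rightarrow> real) \<Rightarrow> ereal" where
  "gauss_energy \<kappa> f \<mu> = energy \<kappa> \<mu> + 2 * radon_integral \<mu> f"

definition gauss_inf :: "('a::t2_space \<times> 'a \<Rightarrow> ereal) \<Rightarrow> ('a \<Rightarrow> ereal) \<Rightarrow> 'a set \<Rightarrow> ereal" where
  "gauss_inf \<kappa> f A = (INF \<mu>\<in>gauss_class \<kappa> f A. gauss_energy \<kappa> f \<mu>)"

definition weighted_potential ::
  "('a::t2_space \<times> 'a \<Rightarrow> ereal) \<Rightarrow> ('a \<Rightarrow> ereal) \<Rightarrow> (('a \<Rightarrow> real) \<Rightarrow> real) \<Rightarrow> 'a \<Rightarrow> ereal" where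
  "weighted_potential \<kappa> f \<mu> x = potential \<kappa> \<mu> x + f x"

end

theory Submission
  imports Defs "HOL-Probability.Probability_Measure"
begin

text \<open>
  The Riesz--Markov theorem and a Dini argument for directed families give Fubini's theorem for lower
  semicontinuous kernels without any countability assumption.  The energy principle then makes
  mutual energies finite, so that the energy is a quadratic form on \<open>\<E>\<close>.

  The Gauss functional is this quadratic form plus an affine term.  By the parallelogram identity minimizing
  sequences are strong Cauchy sequences, and their limit has finite energy, is carried by \<open>A\<close>, and
  minimizes because the integral of \<open>\<psi>\<close> is vaguely lower semicontinuous.  What could be lost is
  mass at infinity.  This is excluded by \<open>cap A < \<infinity>\<close>: the least energy of unit measures on
  \<open>A - K\<close> tends to infinity with \<open>K\<close>, as otherwise near-minimizers would converge strongly to a measure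
  vanishing on every compact set, that is to 0, although their energies are bounded away from 0.

  Differentiating along segments gives \<open>\<integral> U\<^sub>f \<lambda> d\<mu> \<ge> c\<close> for all admissible \<open>\<mu>\<close>, from which the
  pointwise inequalities follow, and the converse implications come from integrating them.
\<close>

section \<open>Continuous functions of compact support\<close>

text \<open>Rectangles need not generate the Borel sets of the square, so the classical Fubini
  theorem is available at first only for functions in \<open>Cc\<close>, after cutting both measures
  down to compact sets. The positive part of a kernel is then reached through its minorants in
  \<open>Cc\<close>. Its negative part is not lower semicontinuous; but it vanishes unless the space
  is compact, and there it is a constant minus a lower semicontinuous function.

  Finite energy of a signed measure is a condition on the Jordan parts of its square, not on the
  products of its own Jordan parts. One inequality for positive parts links the two. It makes every
  element of the energy space a difference of two elements of the cone \<open>E\<close>, and from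
  then on all energy arguments run on pairs of positive measures and the real-valued form
  \<open>ener\<close>.

  Compact and noncompact spaces part ways once more where mass could be lost: on a compact space the
  constant 1 is a test function, and on any other space the kernel is nonnegative, so that
  restricting a measure cannot raise its energy.\<close>

abbreviation lch :: "'a::t2_space itself \<Rightarrow> bool" where
  "lch t \<equiv> locally_compact_space (euclidean :: 'a topology)"

lemma CcI:
  fixes \<phi> :: "'a::t2_space \<Rightarrow> real"
  assumes "continuous_on UNIV \<phi>" "compact K" "\<And>x. x \<notin> K \<Longrightarrow> \<phi> x = 0"
  shows "\<phi> \<in> Cc"
proof -
  have "closure {x. \<phi> x \<noteq> 0} \<subseteq> K"
    using assms(2,3) by (intro closure_minimal compact_imp_closed) auto
  then have "compact (closure {x. \<phi> x \<noteq> 0})"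
    using assms(2) by (metis closed_Int_compact closed_closure inf.absorb1)
  with assms(1) show ?thesis by (simp add: Cc_def)
qed

lemma Cc_continuous: "\<phi> \<in> Cc \<Longrightarrow> continuous_on S \<phi>"
  unfolding Cc_def by (auto intro: continuous_on_subset)

lemma Cc_support: "\<phi> \<in> Cc \<Longrightarrow> compact (closure {x. \<phi> x \<noteq> 0})"
  by (simp add: Cc_def)

lemma not_in_support: "x \<notin> closure {x. \<phi> x \<noteq> 0} \<Longrightarrow> \<phi> x = (0::real)"
  using closure_subset[of "{x. \<phi> x \<noteq> 0}"] by blast

lemma Cc_measurable [measurable]: "\<phi> \<in> Cc \<Longrightarrow> \<phi> \<in> borel_measurable borel"
  by (intro borel_measurable_continuous_onI Cc_continuous)

lemma Cc_compose2:
  fixes \<phi> \<psi> :: "'a::t2_space \<Rightarrow> real" and h :: "real \<Rightarrow> real \<Rightarrow> real"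
  assumes "\<phi> \<in> Cc" "\<psi> \<in> Cc" "continuous_on UNIV (\<lambda>(s, t). h s t)" "h 0 0 = 0"
  shows "(\<lambda>x. h (\<phi> x) (\<psi> x)) \<in> Cc"
proof (rule CcI)
  have "continuous_on UNIV ((\<lambda>(s, t). h s t) \<circ> (\<lambda>x. (\<phi> x, \<psi> x)))"
    by (intro continuous_on_compose continuous_on_Pair Cc_continuous assms(1,2)
          continuous_on_subset[OF assms(3)] subset_UNIV)
  then show "continuous_on UNIV (\<lambda>x. h (\<phi> x) (\<psi> x))" by (simp add: o_def)
  show "compact (closure {x. \<phi> x \<noteq> 0} \<union> closure {x. \<psi> x \<noteq> 0})"
    using assms(1,2) by (intro compact_Un Cc_support)
  show "h (\<phi> x) (\<psi> x) = 0" if "x \<notin> closure {x. \<phi> x \<noteq> 0} \<union> closure {x. \<psi> x \<noteq> 0}" for x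
    using that assms(4) not_in_support[of x \<phi>] not_in_support[of x \<psi>] by simp
qed

lemma Cc_zero: "(\<lambda>x. 0) \<in> (Cc :: ('a::t2_space \<Rightarrow> real) set)"
  by (rule CcI[of _ "{}"]) auto

lemma Cc_lincomb:
  fixes \<phi> \<psi> :: "'a::t2_space \<Rightarrow> real"
  shows "\<phi> \<in> Cc \<Longrightarrow> \<psi> \<in> Cc \<Longrightarrow> (\<lambda>x. a * \<phi> x + b * \<psi> x) \<in> Cc"
  by (rule Cc_compose2[where h = "\<lambda>s t. a * s + b * t"]) (auto simp: split_def intro!: continuous_intros)

lemma Cc_add:
  fixes \<phi> \<psi> :: "'a::t2_space \<Rightarrow> real"
  shows "\<phi> \<in> Cc \<Longrightarrow> \<psi> \<in> Cc \<Longrightarrow> (\<lambda>x. \<phi> x + \<psi> x) \<in> Cc"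
  using Cc_lincomb[of \<phi> \<psi> 1 1] by simp

lemma Cc_diff:
  fixes \<phi> \<psi> :: "'a::t2_space \<Rightarrow> real"
  shows "\<phi> \<in> Cc \<Longrightarrow> \<psi> \<in> Cc \<Longrightarrow> (\<lambda>x. \<phi> x - \<psi> x) \<in> Cc"
  using Cc_lincomb[of \<phi> \<psi> 1 "-1"] by simp

lemma Cc_scale:
  fixes \<phi> :: "'a::t2_space \<Rightarrow> real"
  shows "\<phi> \<in> Cc \<Longrightarrow> (\<lambda>x. a * \<phi> x) \<in> Cc"
  using Cc_lincomb[of \<phi> \<phi> a 0] by simp

lemma Cc_uminus:
  fixes \<phi> :: "'a::t2_space \<Rightarrow> real"
  shows "\<phi> \<in> Cc \<Longrightarrow> (\<lambda>x. - \<phi> x) \<in> Cc"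
  using Cc_scale[of \<phi> "-1"] by simp

lemma Cc_max:
  fixes \<phi> \<psi> :: "'a::t2_space \<Rightarrow> real"
  shows "\<phi> \<in> Cc \<Longrightarrow> \<psi> \<in> Cc \<Longrightarrow> (\<lambda>x. max (\<phi> x) (\<psi> x)) \<in> Cc"
  by (rule Cc_compose2[where h = max]) (auto simp: split_def intro!: continuous_intros)

lemma Cc_min:
  fixes \<phi> \<psi> :: "'a::t2_space \<Rightarrow> real"
  shows "\<phi> \<in> Cc \<Longrightarrow> \<psi> \<in> Cc \<Longrightarrow> (\<lambda>x. min (\<phi> x) (\<psi> x)) \<in> Cc"
  by (rule Cc_compose2[where h = min]) (auto simp: split_def intro!: continuous_intros)

lemma Cc_compose:
  fixes \<phi> :: "'a::t2_space \<Rightarrow> real"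
  assumes "\<phi> \<in> Cc" "continuous_on UNIV h" "h 0 = 0"
  shows "(\<lambda>x. h (\<phi> x)) \<in> Cc"
proof (rule Cc_compose2[of \<phi> \<phi> "\<lambda>s t. h s"])
  show "continuous_on UNIV (\<lambda>(s, t :: real). h s)"
    unfolding split_def by (rule continuous_on_compose2[OF assms(2)]) (auto intro: continuous_intros)
qed (use assms in auto)

lemma Cc_mult:
  fixes \<phi> g :: "'a::t2_space \<Rightarrow> real"
  assumes "\<phi> \<in> Cc" "continuous_on UNIV g"
  shows "(\<lambda>x. \<phi> x * g x) \<in> Cc"
proof (rule CcI[OF _ Cc_support[OF assms(1)]])
  show "continuous_on UNIV (\<lambda>x. \<phi> x * g x)"
    by (intro continuous_on_mult Cc_continuous assms)
  show "\<phi> x * g x = 0" if "x \<notin> closure {x. \<phi> x \<noteq> 0}" for x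
    using not_in_support[OF that] by simp
qed

lemma Cc_bounded:
  fixes \<phi> :: "'a::t2_space \<Rightarrow> real"
  assumes "\<phi> \<in> Cc"
  obtains B where "0 < B" "\<And>x. \<bar>\<phi> x\<bar> \<le> B"
proof -
  have "compact (\<phi> ` closure {x. \<phi> x \<noteq> 0})"
    using assms by (intro compact_continuous_image Cc_continuous Cc_support)
  then obtain B where B: "\<And>y. y \<in> \<phi> ` closure {x. \<phi> x \<noteq> 0} \<Longrightarrow> \<bar>y\<bar> \<le> B"
    using compact_imp_bounded bounded_iff by (metis real_norm_def)
  have "\<bar>\<phi> x\<bar> \<le> max B 1" for x
    using B[of "\<phi> x"] not_in_support[of x \<phi>] by (cases "x \<in> closure {x. \<phi> x \<noteq> 0}") (auto simp: max_def)
  then show ?thesis by (intro that[of "max B 1"]) auto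
qed

lemma lch_Urysohn:
  fixes K U :: "'a::t2_space set"
  assumes lc: "lch TYPE('a)"
    and K: "compact K" and U: "open U" and KU: "K \<subseteq> U"
  shows "\<exists>\<phi>\<in>Cc. (\<forall>x. 0 \<le> \<phi> x \<and> \<phi> x \<le> 1) \<and> (\<forall>x\<in>K. \<phi> x = 1) \<and> closure {x. \<phi> x \<noteq> 0} \<subseteq> U"
proof -
  have haus: "Hausdorff_space (euclidean :: 'a topology)"
    unfolding Hausdorff_space_def disjnt_def using hausdorff by (metis open_openin)
  have cr: "completely_regular_space (euclidean :: 'a topology)"
    using locally_compact_regular_imp_completely_regular_space[OF lc] haus by blast
  obtain V L where V: "open V" "compact L" "K \<subseteq> V" "V \<subseteq> L"
    using lc K locally_compact_space_compact_closed_compact[of "euclidean :: 'a topology"] haus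
    by (auto simp: compactin_euclidean_iff)
  have cl: "closedin euclidean (- (V \<inter> U))"
    unfolding closed_closedin[symmetric] by (intro closed_Compl open_Int V(1) U)
  obtain f where f: "continuous_map euclidean (top_of_set {0..1::real}) f"
      "f ` K \<subseteq> {0}" "f ` (- (V \<inter> U)) \<subseteq> {1}"
    using Urysohn_completely_regular_closed_compact[OF zero_le_one cr cl, of K] K KU V(3)
    by (auto simp: compactin_euclidean_iff disjnt_def)
  have cont: "continuous_on UNIV f" and f01: "\<And>x. 0 \<le> f x \<and> f x \<le> 1"
    using f(1) by (auto simp: continuous_map_in_subtopology)
  \<comment> \<open>Cutting off at level 1/2 puts the closed support into the closed set where
    \<open>f x \<le> 1 / 2\<close>, hence inside \<open>V \<inter> U\<close>. The function
    \<open>1 - f\<close> also vanishes off \<open>V \<inter> U\<close>, but its closed support could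
    leave that set.\<close>
  define \<phi> where "\<phi> x = max 0 (1 - 2 * f x)" for x
  have sub: "closure {x. \<phi> x \<noteq> 0} \<subseteq> {x. f x \<le> 1 / 2}"
    using cont by (intro closure_minimal closed_Collect_le) (auto simp: \<phi>_def)
  have sub2: "{x. f x \<le> 1 / 2} \<subseteq> V \<inter> U"
    using f(3) by force
  show ?thesis
  proof (intro bexI[of _ \<phi>] conjI allI ballI)
    show "\<phi> \<in> Cc"
    proof (rule CcI[OF _ V(2)])
      show "continuous_on UNIV \<phi>" unfolding \<phi>_def by (intro continuous_intros cont)
      show "\<phi> x = 0" if "x \<notin> L" for x
      proof -
        have "x \<notin> closure {x. \<phi> x \<noteq> 0}" using that sub sub2 V(4) by blast
        then show ?thesis by (rule not_in_support)
      qed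
    qed
    show "0 \<le> \<phi> x" "\<phi> x \<le> 1" for x using f01[of x] by (auto simp: \<phi>_def)
    show "\<phi> x = 1" if "x \<in> K" for x using that f(2) by (auto simp: \<phi>_def)
    show "closure {x. \<phi> x \<noteq> 0} \<subseteq> U" using sub sub2 by blast
  qed
qed

section \<open>Positive functionals\<close>

lemma radon_off_Cc: "T \<in> signed_radon \<Longrightarrow> \<phi> \<notin> Cc \<Longrightarrow> T \<phi> = 0"
  by (simp add: signed_radon_def)

lemma radon_lincomb:
  "T \<in> signed_radon \<Longrightarrow> \<phi> \<in> Cc \<Longrightarrow> \<psi> \<in> Cc \<Longrightarrow> T (\<lambda>x. a * \<phi> x + b * \<psi> x) = a * T \<phi> + b * T \<psi>"
  by (simp add: signed_radon_def)

lemma radon_add: "T \<in> signed_radon \<Longrightarrow> \<phi> \<in> Cc \<Longrightarrow> \<psi> \<in> Cc \<Longrightarrow> T (\<lambda>x. \<phi> x + \<psi> x) = T \<phi> + T \<psi>"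
  using radon_lincomb[of T \<phi> \<psi> 1 1] by simp

lemma radon_diff: "T \<in> signed_radon \<Longrightarrow> \<phi> \<in> Cc \<Longrightarrow> \<psi> \<in> Cc \<Longrightarrow> T (\<lambda>x. \<phi> x - \<psi> x) = T \<phi> - T \<psi>"
  using radon_lincomb[of T \<phi> \<psi> 1 "-1"] by simp

lemma radon_scale: "T \<in> signed_radon \<Longrightarrow> \<phi> \<in> Cc \<Longrightarrow> T (\<lambda>x. a * \<phi> x) = a * T \<phi>"
  using radon_lincomb[of T \<phi> \<phi> a 0] by simp

lemma radon_uminus: "T \<in> signed_radon \<Longrightarrow> \<phi> \<in> Cc \<Longrightarrow> T (\<lambda>x. - \<phi> x) = - T \<phi>"
  using radon_scale[of T \<phi> "-1"] by simp

lemma radon_zero: "T \<in> signed_radon \<Longrightarrow> T (\<lambda>x. 0) = 0"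
  using radon_scale[OF _ Cc_zero, of T 0] by simp

lemma pos_radon_signed: "T \<in> pos_radon \<Longrightarrow> T \<in> signed_radon"
  by (simp add: pos_radon_def)

lemma pos_radon_nonneg: "T \<in> pos_radon \<Longrightarrow> (\<And>x. 0 \<le> \<phi> x) \<Longrightarrow> 0 \<le> T \<phi>"
  by (cases "\<phi> \<in> Cc") (auto simp: pos_radon_def radon_off_Cc)

lemma pos_radon_mono:
  "T \<in> pos_radon \<Longrightarrow> \<phi> \<in> Cc \<Longrightarrow> \<psi> \<in> Cc \<Longrightarrow> (\<And>x. \<phi> x \<le> \<psi> x) \<Longrightarrow> T \<phi> \<le> T \<psi>"
  using pos_radon_nonneg[of T "\<lambda>x. \<psi> x - \<phi> x"] radon_diff[of T \<psi> \<phi>] pos_radon_signed[of T] by simp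

lemma radon_sum:
  assumes "T \<in> signed_radon" "finite I" "\<And>i. i \<in> I \<Longrightarrow> \<phi> i \<in> Cc"
  shows "(\<lambda>x. \<Sum>i\<in>I. \<phi> i x) \<in> Cc \<and> T (\<lambda>x. \<Sum>i\<in>I. \<phi> i x) = (\<Sum>i\<in>I. T (\<phi> i))"
  using assms(2,3)
proof (induction I)
  case empty
  then show ?case using assms(1) by (simp add: Cc_zero radon_zero)
next
  case (insert i I)
  then show ?case using assms(1) radon_add[of T "\<phi> i" "\<lambda>x. \<Sum>i\<in>I. \<phi> i x"] by (simp add: Cc_add)
qed

lemma abs_le_SUP_Cc:
  fixes \<phi> :: "'a::t2_space \<Rightarrow> real"
  assumes "\<phi> \<in> Cc"
  shows "\<bar>\<phi> x\<bar> \<le> (SUP x. \<bar>\<phi> x\<bar>)"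
proof -
  obtain B where "\<And>x. \<bar>\<phi> x\<bar> \<le> B" using Cc_bounded[OF assms] by blast
  then show ?thesis by (intro cSUP_upper bdd_aboveI[of _ B]) auto
qed

text \<open>Positivity implies relative boundedness. If \<open>g\<close> is a Urysohn function equal
  to 1 on \<open>K\<close> and \<open>B\<close> is the supremum norm of \<phi>, then both
  \<open>B * g + \<phi>\<close> and \<open>B * g - \<phi>\<close> are nonnegative, so
  \<open>T g\<close> is a bound for functions supported in \<open>K\<close>.\<close>

lemma positive_functional_is_radon:
  fixes T :: "('a::t2_space \<Rightarrow> real) \<Rightarrow> real"
  assumes lc: "lch TYPE('a)"
    and off: "\<And>\<phi>. \<phi> \<notin> Cc \<Longrightarrow> T \<phi> = 0"
    and lin: "\<And>\<phi> \<psi> a b. \<phi> \<in> Cc \<Longrightarrow> \<psi> \<in> Cc \<Longrightarrow> T (\<lambda>x. a * \<phi> x + b * \<psi> x) = a * T \<phi> + b * T \<psi>"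
    and pos: "\<And>\<phi>. \<phi> \<in> Cc \<Longrightarrow> (\<And>x. 0 \<le> \<phi> x) \<Longrightarrow> 0 \<le> T \<phi>"
  shows "T \<in> pos_radon"
proof -
  have "\<exists>C. \<forall>\<phi>\<in>Cc. {x. \<phi> x \<noteq> 0} \<subseteq> K \<longrightarrow> \<bar>T \<phi>\<bar> \<le> C * (SUP x. \<bar>\<phi> x\<bar>)" if K: "compact K" for K
  proof -
    obtain g :: "'a \<Rightarrow> real" where g: "g \<in> Cc" "\<And>x. 0 \<le> g x" "\<And>x. x \<in> K \<Longrightarrow> g x = 1"
      using lch_Urysohn[OF lc K open_UNIV subset_UNIV] by blast
    have "\<bar>T \<phi>\<bar> \<le> T g * (SUP x. \<bar>\<phi> x\<bar>)" if \<phi>: "\<phi> \<in> Cc" "{x. \<phi> x \<noteq> 0} \<subseteq> K" for \<phi>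
    proof -
      define B where "B = (SUP x. \<bar>\<phi> x\<bar>)"
      have le: "\<bar>\<phi> x\<bar> \<le> B * g x" for x
      proof (cases "x \<in> K")
        case True
        then show ?thesis using abs_le_SUP_Cc[OF \<phi>(1), of x] g(3) by (simp add: B_def)
      next
        case False
        then have "\<phi> x = 0" using \<phi>(2) by blast
        moreover have "0 \<le> B" using abs_le_SUP_Cc[OF \<phi>(1), of x] by (simp add: B_def)
        ultimately show ?thesis using g(2)[of x] by simp
      qed
      have "0 \<le> T (\<lambda>x. B * g x + (-1) * \<phi> x)"
      proof (rule pos[OF Cc_lincomb[OF g(1) \<phi>(1)]])
        show "0 \<le> B * g x + (-1) * \<phi> x" for x using le[of x] by linarith
      qed
      then have 1: "T \<phi> \<le> B * T g"
        using lin[OF g(1) \<phi>(1), of B "-1"] by linarith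
      have "0 \<le> T (\<lambda>x. B * g x + 1 * \<phi> x)"
      proof (rule pos[OF Cc_lincomb[OF g(1) \<phi>(1)]])
        show "0 \<le> B * g x + 1 * \<phi> x" for x using le[of x] by linarith
      qed
      then have 2: "- T \<phi> \<le> B * T g"
        using lin[OF g(1) \<phi>(1), of B 1] by linarith
      show ?thesis unfolding B_def[symmetric] using 1 2 by (simp add: mult.commute)
    qed
    then show ?thesis by blast
  qed
  then show ?thesis
    unfolding pos_radon_def signed_radon_def mem_Collect_eq
    by (intro conjI ballI allI impI off lin pos) auto
qed

section \<open>The Riesz--Markov theorem\<close>

text \<open>The usual test functions subordinate to an open set. It is the closed support that lies
  in \<open>U\<close>, not merely the set where \<phi> is nonzero; finite subcovers of this compact
  support are used for countable subadditivity.\<close>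

definition test_below :: "'a::t2_space set \<Rightarrow> ('a \<Rightarrow> real) set" where
  "test_below U = {\<phi> \<in> Cc. (\<forall>x. 0 \<le> \<phi> x \<and> \<phi> x \<le> 1) \<and> closure {x. \<phi> x \<noteq> 0} \<subseteq> U}"

definition radon_content :: "(('a::t2_space \<Rightarrow> real) \<Rightarrow> real) \<Rightarrow> 'a set \<Rightarrow> ennreal" where
  "radon_content T U = (SUP \<phi>\<in>test_below U. ennreal (T \<phi>))"

definition radon_outer :: "(('a::t2_space \<Rightarrow> real) \<Rightarrow> real) \<Rightarrow> 'a set \<Rightarrow> ennreal" where
  "radon_outer T E = (INF U\<in>{U. open U \<and> E \<subseteq> U}. radon_content T U)"

text \<open>The description under \<open>THE\<close> in \<open>borel_of\<close>, named so that
  existence and uniqueness can be treated separately.\<close>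

definition represents :: "'a::t2_space measure \<Rightarrow> (('a \<Rightarrow> real) \<Rightarrow> real) \<Rightarrow> bool" where
  "represents M T \<longleftrightarrow>
     sets M = sets borel \<and>
     (\<forall>K. compact K \<longrightarrow> emeasure M K < \<infinity>) \<and>
     (\<forall>B\<in>sets borel. emeasure M B = (INF U\<in>{U. open U \<and> B \<subseteq> U}. emeasure M U)) \<and>
     (\<forall>U. open U \<longrightarrow> emeasure M U = (SUP K\<in>{K. compact K \<and> K \<subseteq> U}. emeasure M K)) \<and>
     (\<forall>\<phi>\<in>Cc. T \<phi> = (LINT x|M. \<phi> x))"

lemma test_belowD:
  assumes "\<phi> \<in> test_below U"
  shows "\<phi> \<in> Cc" "0 \<le> \<phi> x" "\<phi> x \<le> 1" "closure {x. \<phi> x \<noteq> 0} \<subseteq> U" "x \<notin> U \<Longrightarrow> \<phi> x = 0"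
  using assms not_in_support[of x \<phi>] unfolding test_below_def by blast+

lemma radon_content_upper: "\<phi> \<in> test_below U \<Longrightarrow> ennreal (T \<phi>) \<le> radon_content T U"
  unfolding radon_content_def by (rule SUP_upper)

lemma radon_content_mono: "U \<subseteq> V \<Longrightarrow> radon_content T U \<le> radon_content T V"
  unfolding radon_content_def by (rule SUP_subset_mono) (auto simp: test_below_def)

lemma radon_outer_open: "open U \<Longrightarrow> radon_outer T U = radon_content T U"
  unfolding radon_outer_def
  by (intro antisym INF_lower INF_greatest) (auto intro: radon_content_mono)

lemma radon_outer_mono: "E \<subseteq> F \<Longrightarrow> radon_outer T E \<le> radon_outer T F"
  unfolding radon_outer_def by (rule INF_superset_mono) auto

lemma zero_test_below: "(\<lambda>x. 0) \<in> test_below U"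
  by (simp add: test_below_def Cc_zero)

lemma pos_radon_zero: "T \<in> pos_radon \<Longrightarrow> T (\<lambda>x. 0) = 0"
  by (simp add: pos_radon_signed radon_zero)

lemma radon_content_empty:
  assumes "T \<in> pos_radon"
  shows "radon_content T {} = 0"
proof -
  have "T \<phi> = 0" if "\<phi> \<in> test_below {}" for \<phi>
  proof -
    have "\<phi> = (\<lambda>x. 0)" using test_belowD(5)[OF that] by auto
    then show ?thesis using pos_radon_zero[OF assms] by simp
  qed
  then have "radon_content T {} \<le> 0"
    unfolding radon_content_def by (intro SUP_least) simp
  then show ?thesis by simp
qed

text \<open>A two-piece partition of unity: a competitor \<phi> for \<open>U \<union> V\<close>
  splits into \<open>\<phi> * h\<close>, supported in \<open>U\<close>, and
  \<open>\<phi> * (1 - h)\<close>, supported in \<open>V\<close>.\<close>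

lemma radon_content_Un:
  fixes T :: "('a::t2_space \<Rightarrow> real) \<Rightarrow> real"
  assumes lc: "lch TYPE('a)"
    and T: "T \<in> pos_radon" and U: "open U" and V: "open V"
  shows "radon_content T (U \<union> V) \<le> radon_content T U + radon_content T V"
  unfolding radon_content_def[of T "U \<union> V"]
proof (rule SUP_least)
  fix \<phi> assume \<phi>: "\<phi> \<in> test_below (U \<union> V)"
  define K where "K = closure {x. \<phi> x \<noteq> 0}"
  have K: "compact K" "K \<subseteq> U \<union> V" "\<And>x. x \<notin> K \<Longrightarrow> \<phi> x = 0"
    unfolding K_def
    by (rule Cc_support[OF test_belowD(1)[OF \<phi>]], rule test_belowD(4)[OF \<phi>], rule not_in_support)
  have KV: "compact (K - V)" "K - V \<subseteq> U" using K(1,2) V by (auto intro: compact_diff)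
  obtain g where g: "g \<in> Cc" "\<And>x. 0 \<le> g x" "\<And>x. g x \<le> 1" "\<And>x. x \<in> K - V \<Longrightarrow> g x = 1"
      "closure {x. g x \<noteq> 0} \<subseteq> U"
    using lch_Urysohn[OF lc KV(1) U KV(2)] by blast
  \<comment> \<open>Doubling makes \<open>h\<close> equal to 1 on a neighbourhood of \<open>K - V\<close>, which pushes the closed
      support of \<open>\<phi> * (1 - h)\<close> into \<open>V\<close>.\<close>
  define h where "h x = min 1 (2 * g x)" for x
  have hc: "continuous_on UNIV h" unfolding h_def by (intro continuous_intros Cc_continuous g(1))
  have h01: "0 \<le> h x" "h x \<le> 1" for x using g(2)[of x] by (auto simp: h_def)
  have \<phi>01: "0 \<le> \<phi> x" "\<phi> x \<le> 1" for x using test_belowD(2,3)[OF \<phi>] by auto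
  have 1: "(\<lambda>x. \<phi> x * h x) \<in> test_below U"
  proof -
    have "closure {x. \<phi> x * h x \<noteq> 0} \<subseteq> closure {x. g x \<noteq> 0}"
      by (intro closure_mono) (auto simp: h_def)
    then show ?thesis
      using g(5) Cc_mult[OF test_belowD(1)[OF \<phi>] hc] h01 \<phi>01
      by (auto simp: test_below_def mult_le_one)
  qed
  have 2: "(\<lambda>x. \<phi> x * (1 - h x)) \<in> test_below V"
  proof -
    have "closed (K \<inter> {x. g x \<le> 1 / 2})"
      by (intro closed_Int closed_Collect_le Cc_continuous g(1) compact_imp_closed[OF K(1)] continuous_on_const)
    then have "closure {x. \<phi> x * (1 - h x) \<noteq> 0} \<subseteq> K \<inter> {x. g x \<le> 1 / 2}"
      using K(3) by (intro closure_minimal) (auto simp: h_def min_def split: if_splits)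
    also have "\<dots> \<subseteq> V" using g(4) by force
    finally show ?thesis
      using Cc_mult[OF test_belowD(1)[OF \<phi>] continuous_on_diff[OF continuous_on_const hc], of 1] h01 \<phi>01
      by (auto simp: test_below_def mult_le_one)
  qed
  have "T \<phi> = T (\<lambda>x. \<phi> x * h x) + T (\<lambda>x. \<phi> x * (1 - h x))"
    using radon_add[OF pos_radon_signed[OF T] test_belowD(1)[OF 1] test_belowD(1)[OF 2]]
    by (simp add: algebra_simps)
  then have "ennreal (T \<phi>) = ennreal (T (\<lambda>x. \<phi> x * h x)) + ennreal (T (\<lambda>x. \<phi> x * (1 - h x)))"
    using pos_radon_nonneg[OF T] h01 \<phi>01 by (simp add: ennreal_plus)
  also have "\<dots> \<le> radon_content T U + radon_content T V"
    by (intro add_mono radon_content_upper 1 2)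
  finally show "ennreal (T \<phi>) \<le> radon_content T U + radon_content T V" .
qed

lemma radon_content_finite_UN:
  fixes T :: "('a::t2_space \<Rightarrow> real) \<Rightarrow> real"
  assumes lc: "lch TYPE('a)" and T: "T \<in> pos_radon"
    and "finite I" "\<And>i. i \<in> I \<Longrightarrow> open (U i)"
  shows "radon_content T (\<Union>i\<in>I. U i) \<le> (\<Sum>i\<in>I. radon_content T (U i))"
  using assms(3,4)
proof (induction I)
  case empty
  then show ?case by (simp add: radon_content_empty[OF T])
next
  case (insert i I)
  have "radon_content T (U i \<union> (\<Union>i\<in>I. U i)) \<le> radon_content T (U i) + radon_content T (\<Union>i\<in>I. U i)"
    using insert.prems by (intro radon_content_Un lc T open_UN) auto
  also have "\<dots> \<le> radon_content T (U i) + (\<Sum>i\<in>I. radon_content T (U i))"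
    using insert by (intro add_left_mono) auto
  finally show ?case using insert by simp
qed

text \<open>The support of a competitor is compact and so is already covered by finitely many of the
  sets.\<close>

lemma radon_content_UN:
  fixes T :: "('a::t2_space \<Rightarrow> real) \<Rightarrow> real" and U :: "nat \<Rightarrow> 'a set"
  assumes lc: "lch TYPE('a)" and T: "T \<in> pos_radon"
    and U: "\<And>i. open (U i)"
  shows "radon_content T (\<Union>i. U i) \<le> (\<Sum>i. radon_content T (U i))"
  unfolding radon_content_def[of T "\<Union>i. U i"]
proof (rule SUP_least)
  fix \<phi> assume \<phi>: "\<phi> \<in> test_below (\<Union>i. U i)"
  have "compact (closure {x. \<phi> x \<noteq> 0})" by (rule Cc_support[OF test_belowD(1)[OF \<phi>]])
  then obtain I where I: "finite I" "closure {x. \<phi> x \<noteq> 0} \<subseteq> (\<Union>i\<in>I. U i)"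
    using compactE_image[of _ UNIV U] U test_belowD(4)[OF \<phi>] by metis
  have "\<phi> \<in> test_below (\<Union>i\<in>I. U i)" using \<phi> I(2) by (simp add: test_below_def)
  then have "ennreal (T \<phi>) \<le> radon_content T (\<Union>i\<in>I. U i)" by (rule radon_content_upper)
  also have "\<dots> \<le> (\<Sum>i\<in>I. radon_content T (U i))"
    by (intro radon_content_finite_UN lc T I U)
  also have "\<dots> \<le> (\<Sum>i. radon_content T (U i))" by (intro sum_le_suminf I) auto
  finally show "ennreal (T \<phi>) \<le> (\<Sum>i. radon_content T (U i))" .
qed

lemma radon_outer_close:
  assumes "radon_outer T E < top" "0 < (e :: real)"
  shows "\<exists>U. open U \<and> E \<subseteq> U \<and> radon_content T U \<le> radon_outer T E + e"
proof -
  have "radon_outer T E < radon_outer T E + e" using assms by (auto simp: less_top)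
  then obtain U where "open U" "E \<subseteq> U" "radon_content T U < radon_outer T E + e"
    unfolding radon_outer_def[of T E] INF_less_iff by blast
  then show ?thesis using less_imp_le by blast
qed

lemma outer_measure_radon_outer:
  fixes T :: "('a::t2_space \<Rightarrow> real) \<Rightarrow> real"
  assumes lc: "lch TYPE('a)" and T: "T \<in> pos_radon"
  shows "outer_measure_space (Pow UNIV) (radon_outer T)"
  unfolding outer_measure_space_def
proof (intro conjI)
  have "radon_outer T {} = 0" by (simp add: radon_outer_open radon_content_empty[OF T])
  then show "positive (Pow UNIV) (radon_outer T)" by (simp add: positive_def)
  show "increasing (Pow UNIV) (radon_outer T)" by (simp add: increasing_def radon_outer_mono)
  show "countably_subadditive (Pow UNIV) (radon_outer T)"
    unfolding countably_subadditive_def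
  proof (intro allI impI)
    fix A :: "nat \<Rightarrow> 'a set"
    show "radon_outer T (\<Union>i. A i) \<le> (\<Sum>i. radon_outer T (A i))"
    proof (rule ennreal_le_epsilon)
      fix e :: real assume e: "0 < e" and fin: "(\<Sum>i. radon_outer T (A i)) < top"
      have "\<exists>U. open U \<and> A n \<subseteq> U \<and> radon_content T U \<le> radon_outer T (A n) + ennreal (e * (1/2)^Suc n)" for n
      proof -
        have "radon_outer T (A n) < top"
          using fin by (auto simp add: less_top dest!: ennreal_suminf_lessD)
        then show ?thesis using radon_outer_close[of T "A n" "e * (1/2)^Suc n"] e by auto
      qed
      then obtain U where U: "\<And>n. open (U n)" "\<And>n. A n \<subseteq> U n"
          "\<And>n. radon_content T (U n) \<le> radon_outer T (A n) + ennreal (e * (1/2)^Suc n)"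
        by metis
      have "radon_outer T (\<Union>i. A i) \<le> radon_outer T (\<Union>i. U i)"
        using U(2) by (intro radon_outer_mono) blast
      also have "\<dots> = radon_content T (\<Union>i. U i)" using U(1) by (intro radon_outer_open) auto
      also have "\<dots> \<le> (\<Sum>i. radon_content T (U i))" by (rule radon_content_UN[OF lc T U(1)])
      also have "\<dots> \<le> (\<Sum>n. radon_outer T (A n) + e * (1/2) ^ Suc n)"
        by (intro suminf_le U(3)) auto
      also have "\<dots> = (\<Sum>n. radon_outer T (A n)) + (\<Sum>n. ennreal e * ennreal ((1/2) ^ Suc n))"
        using e by (subst suminf_add[symmetric])
                       (auto simp del: ennreal_suminf_cmult simp add: ennreal_mult[symmetric])
      also have "\<dots> = (\<Sum>n. radon_outer T (A n)) + e"
        unfolding ennreal_suminf_cmult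
        by (subst suminf_ennreal_eq[OF zero_le_power power_half_series]) auto
      finally show "radon_outer T (\<Union>i. A i) \<le> (\<Sum>i. radon_outer T (A i)) + e" .
    qed
  qed
qed

lemma radon_outer_Un:
  fixes T :: "('a::t2_space \<Rightarrow> real) \<Rightarrow> real"
  assumes lc: "lch TYPE('a)" and T: "T \<in> pos_radon"
  shows "radon_outer T (A \<union> B) \<le> radon_outer T A + radon_outer T B"
proof (rule ennreal_le_epsilon)
  fix e :: real assume e: "0 < e" and fin: "radon_outer T A + radon_outer T B < top"
  obtain U where U: "open U" "A \<subseteq> U" "radon_content T U \<le> radon_outer T A + ennreal (e/2)"
    using radon_outer_close[of T A "e/2"] e fin by (metis half_gt_zero ennreal_add_eq_top less_top)
  obtain V where V: "open V" "B \<subseteq> V" "radon_content T V \<le> radon_outer T B + ennreal (e/2)"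
    using radon_outer_close[of T B "e/2"] e fin by (metis half_gt_zero ennreal_add_eq_top less_top)
  have "radon_outer T (A \<union> B) \<le> radon_content T (U \<union> V)"
    unfolding radon_outer_def using U V by (intro INF_lower) auto
  also have "\<dots> \<le> radon_content T U + radon_content T V" by (intro radon_content_Un lc T U V)
  also have "\<dots> \<le> (radon_outer T A + ennreal (e/2)) + (radon_outer T B + ennreal (e/2))"
    by (intro add_mono U V)
  also have "\<dots> = radon_outer T A + radon_outer T B + (ennreal (e/2) + ennreal (e/2))"
    by (simp add: ac_simps)
  also have "ennreal (e/2) + ennreal (e/2) = ennreal e"
    using e by (simp flip: ennreal_plus)
  finally show "radon_outer T (A \<union> B) \<le> radon_outer T A + radon_outer T B + ennreal e" .
qed

text \<open>Caratheodory's condition. Given a competitor \<phi> for \<open>U \<inter> V\<close> with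
  support \<open>K\<close>, the open set \<open>U - K\<close> contains \<open>U - V\<close>. A
  competitor \<psi> for \<open>U - K\<close> vanishes on \<open>K\<close>, so
  \<open>\<phi> + \<psi>\<close> stays below 1 and competes for \<open>U\<close>. Optimizing first
  over \<psi> and then over \<phi> gives the inequality for open \<open>U\<close>, and the outer
  measure of an arbitrary set is an infimum over such \<open>U\<close>.\<close>

lemma open_in_lambda_system:
  fixes T :: "('a::t2_space \<Rightarrow> real) \<Rightarrow> real"
  assumes lc: "lch TYPE('a)" and T: "T \<in> pos_radon"
    and V: "open V"
  shows "V \<in> lambda_system UNIV (Pow UNIV) (radon_outer T)"
proof -
  have "radon_outer T (E \<inter> V) + radon_outer T (E - V) \<le> radon_content T U" if U: "open U" "E \<subseteq> U" for E U
  proof -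
    have "radon_outer T (E \<inter> V) + radon_outer T (E - V) \<le> radon_content T (U \<inter> V) + radon_outer T (U - V)"
      unfolding radon_outer_open[OF open_Int[OF U(1) V], symmetric]
      using U(2) by (intro add_mono radon_outer_mono) auto
    also have "\<dots> \<le> radon_content T U"
      unfolding radon_content_def[of T "U \<inter> V"]
    proof (subst ennreal_SUP_add_left[symmetric])
      show "test_below (U \<inter> V) \<noteq> {}" using zero_test_below by blast
      show "(SUP \<phi>\<in>test_below (U \<inter> V). ennreal (T \<phi>) + radon_outer T (U - V)) \<le> radon_content T U"
      proof (rule SUP_least)
        fix \<phi> assume \<phi>: "\<phi> \<in> test_below (U \<inter> V)"
        define K where "K = closure {x. \<phi> x \<noteq> 0}"
        have K: "closed K" "K \<subseteq> U \<inter> V" "\<And>x. x \<notin> K \<Longrightarrow> \<phi> x = 0"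
          unfolding K_def by (rule closed_closure, rule test_belowD(4)[OF \<phi>], rule not_in_support)
        have "radon_outer T (U - V) \<le> radon_content T (U - K)"
          unfolding radon_outer_def using K U by (intro INF_lower) auto
        then have "ennreal (T \<phi>) + radon_outer T (U - V) \<le> ennreal (T \<phi>) + radon_content T (U - K)"
          by (rule add_left_mono)
        also have "\<dots> \<le> radon_content T U"
          unfolding radon_content_def[of T "U - K"]
        proof (subst ennreal_SUP_add_right)
          show "test_below (U - K) \<noteq> {}" using zero_test_below by blast
          show "(SUP \<psi>\<in>test_below (U - K). ennreal (T \<phi>) + ennreal (T \<psi>)) \<le> radon_content T U"
          proof (rule SUP_least)
            fix \<psi> assume \<psi>: "\<psi> \<in> test_below (U - K)"
            have le1: "\<phi> x + \<psi> x \<le> 1" for x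
              using test_belowD(3,5)[OF \<psi>, of x] test_belowD(3)[OF \<phi>, of x] K(3)[of x] by (cases "x \<in> K") auto
            have "closure {x. \<phi> x + \<psi> x \<noteq> 0} \<subseteq> closure ({x. \<phi> x \<noteq> 0} \<union> {x. \<psi> x \<noteq> 0})"
              by (intro closure_mono) auto
            also have "\<dots> \<subseteq> U" using test_belowD(4)[OF \<phi>] test_belowD(4)[OF \<psi>] by auto
            finally have "(\<lambda>x. \<phi> x + \<psi> x) \<in> test_below U"
              using le1 test_belowD(1,2)[OF \<phi>] test_belowD(1,2)[OF \<psi>] by (simp add: test_below_def Cc_add)
            then have "ennreal (T (\<lambda>x. \<phi> x + \<psi> x)) \<le> radon_content T U" by (rule radon_content_upper)
            then show "ennreal (T \<phi>) + ennreal (T \<psi>) \<le> radon_content T U"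
              using pos_radon_nonneg[OF T] test_belowD(2)[OF \<phi>] test_belowD(2)[OF \<psi>]
              by (simp add: radon_add[OF pos_radon_signed[OF T] test_belowD(1)[OF \<phi>] test_belowD(1)[OF \<psi>]] ennreal_plus)
          qed
        qed
        finally show "ennreal (T \<phi>) + radon_outer T (U - V) \<le> radon_content T U" .
      qed
    qed
    finally show ?thesis .
  qed
  then have "radon_outer T (E \<inter> V) + radon_outer T (E - V) \<le> radon_outer T E" for E
    unfolding radon_outer_def[of T E] by (intro INF_greatest) auto
  moreover have "radon_outer T E \<le> radon_outer T (E \<inter> V) + radon_outer T (E - V)" for E
    using radon_outer_Un[OF lc T, of "E \<inter> V" "E - V"] by (simp add: Int_Diff_Un)
  ultimately have "radon_outer T (E \<inter> V) + radon_outer T (E - V) = radon_outer T E" for E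
    by (intro antisym)
  moreover have "algebra UNIV (Pow (UNIV :: 'a set))"
    by (rule algebra_Pow)
  ultimately show ?thesis by (simp add: algebra.lambda_system_eq)
qed

lemma radon_outer_measure:
  fixes T :: "('a::t2_space \<Rightarrow> real) \<Rightarrow> real"
  assumes lc: "lch TYPE('a)" and T: "T \<in> pos_radon"
  obtains M where "sets M = sets borel" "\<And>B. B \<in> sets borel \<Longrightarrow> emeasure M B = radon_outer T B"
proof -
  define L where "L = lambda_system UNIV (Pow UNIV) (radon_outer T)"
  have ms: "measure_space UNIV L (radon_outer T)"
    unfolding L_def
    by (intro sigma_algebra.caratheodory_lemma sigma_algebra_Pow outer_measure_radon_outer lc T)
  have "{S. open S} \<subseteq> L" using open_in_lambda_system[OF lc T] by (auto simp: L_def)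
  then have "sigma_sets UNIV {S. open S} \<subseteq> L"
    using ms by (intro sigma_algebra.sigma_sets_subset) (auto simp: measure_space_def)
  then have sub: "sets borel \<subseteq> L" by (simp add: borel_def)
  have sa: "sigma_algebra UNIV (sets (borel :: 'a measure))"
    using sets.sigma_algebra_axioms[of "borel :: 'a measure"] by simp
  have ms2: "measure_space UNIV (sets borel) (radon_outer T)"
    by (rule measure_down[OF ms sa sub])
  define M where "M = measure_of UNIV (sets borel) (radon_outer T)"
  have "sets M = sets borel"
    unfolding M_def by (simp add: sigma_algebra.sigma_sets_eq[OF sa])
  moreover have "emeasure M B = radon_outer T B" if "B \<in> sets borel" for B
    unfolding M_def using sa ms2 that by (intro emeasure_measure_of_sigma) (auto simp: measure_space_def)
  ultimately show ?thesis by (rule that)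
qed

lemma radon_outer_le:
  assumes T: "T \<in> pos_radon" and \<phi>: "\<phi> \<in> Cc" "\<And>x. 0 \<le> \<phi> x" "\<And>x. x \<in> K \<Longrightarrow> 1 \<le> \<phi> x"
  shows "radon_outer T K \<le> ennreal (T \<phi>)"
proof (rule ennreal_le_epsilon)
  fix e :: real assume e: "0 < e"
  have T0: "0 \<le> T \<phi>" by (rule pos_radon_nonneg[OF T \<phi>(2)])
  \<comment> \<open>The factor must exceed 1, so that \<open>1 < b * \<phi> x\<close> holds strictly
    on \<open>K\<close> and defines an open neighbourhood. It must also satisfy
    \<open>b * T \<phi> \<le> T \<phi> + e\<close>. The 1 in the denominator covers the case
    \<open>T \<phi> = 0\<close>.\<close>
  define b where "b = 1 + e / (T \<phi> + 1)"
  have b: "1 < b" using e T0 by (simp add: b_def)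
  have bT: "b * T \<phi> \<le> T \<phi> + e"
  proof -
    have "e * T \<phi> \<le> e * (T \<phi> + 1)" using e by simp
    then have "e / (T \<phi> + 1) * T \<phi> \<le> e" using T0 by (simp add: field_simps)
    then show ?thesis by (simp add: b_def algebra_simps)
  qed
  define U where "U = {x. 1 < b * \<phi> x}"
  have "open U" unfolding U_def by (intro open_Collect_less continuous_intros Cc_continuous \<phi>(1))
  moreover have "K \<subseteq> U"
  proof
    fix x assume "x \<in> K"
    then have "1 \<le> \<phi> x" by (rule \<phi>(3))
    then have "1 * 1 < b * \<phi> x" using b by (intro mult_less_le_imp_less) auto
    then show "x \<in> U" by (simp add: U_def)
  qed
  ultimately have "radon_outer T K \<le> radon_content T U"
    unfolding radon_outer_def by (intro INF_lower) auto
  also have "\<dots> \<le> ennreal (b * T \<phi>)"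
    unfolding radon_content_def
  proof (rule SUP_least)
    fix \<eta> assume \<eta>: "\<eta> \<in> test_below U"
    have "\<eta> x \<le> b * \<phi> x" for x
      using test_belowD(3,5)[OF \<eta>, of x] b \<phi>(2)[of x] by (cases "x \<in> U") (auto simp: U_def)
    then have "T \<eta> \<le> T (\<lambda>x. b * \<phi> x)"
      by (intro pos_radon_mono[OF T test_belowD(1)[OF \<eta>] Cc_scale[OF \<phi>(1)]])
    then show "ennreal (T \<eta>) \<le> ennreal (b * T \<phi>)"
      by (simp add: radon_scale[OF pos_radon_signed[OF T] \<phi>(1)] ennreal_leI)
  qed
  also have "\<dots> \<le> ennreal (T \<phi>) + ennreal e"
    using ennreal_leI[OF bT] T0 e by (simp add: ennreal_plus)
  finally show "radon_outer T K \<le> ennreal (T \<phi>) + ennreal e" .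
qed

lemma le_radon_outer:
  assumes "\<phi> \<in> Cc" "\<And>x. 0 \<le> \<phi> x" "\<And>x. \<phi> x \<le> 1" "closure {x. \<phi> x \<noteq> 0} \<subseteq> K"
  shows "ennreal (T \<phi>) \<le> radon_outer T K"
  unfolding radon_outer_def
  using assms by (intro INF_greatest radon_content_upper) (auto simp: test_below_def)

section \<open>The integral representation of a positive functional\<close>

lemma integrable_Cc:
  assumes sM: "sets M = sets borel" and fin: "\<And>K. compact K \<Longrightarrow> emeasure M K < \<infinity>" and \<phi>: "\<phi> \<in> Cc"
  shows "integrable M (\<phi> :: 'a::t2_space \<Rightarrow> real)"
proof -
  obtain B where B: "\<And>x. \<bar>\<phi> x\<bar> \<le> B" using Cc_bounded[OF \<phi>] by metis
  show ?thesis
  proof (rule integrableI_bounded_set[where A = "closure {x. \<phi> x \<noteq> 0}" and B = B])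
    show "closure {x. \<phi> x \<noteq> 0} \<in> sets M" by (simp add: sM)
    show "\<phi> \<in> borel_measurable M"
      using Cc_measurable[OF \<phi>] by (simp add: measurable_cong_sets[OF sM refl])
    show "emeasure M (closure {x. \<phi> x \<noteq> 0}) < \<infinity>" by (rule fin[OF Cc_support[OF \<phi>]])
    show "AE x in M. x \<notin> closure {x. \<phi> x \<noteq> 0} \<longrightarrow> \<phi> x = 0"
      by (intro AE_I2 impI not_in_support)
  qed (use B in auto)
qed

lemma ennreal_integral_Cc:
  fixes \<phi> :: "'a::t2_space \<Rightarrow> real"
  assumes sM: "sets M = sets borel" and fin: "\<And>K. compact K \<Longrightarrow> emeasure M K < \<infinity>" and \<phi>: "\<phi> \<in> Cc"
    and "\<And>x. 0 \<le> \<phi> x"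
  shows "ennreal (LINT x|M. \<phi> x) = (\<integral>\<^sup>+x. ennreal (\<phi> x) \<partial>M)"
  using nn_integral_eq_integral[OF integrable_Cc[OF sM fin \<phi>]] assms(4) by simp

text \<open>Layer \<open>i\<close> measures the part of the interval from 0 to \<open>t\<close> that
  lies between \<open>i\<close> and \<open>i + 1\<close>.\<close>

lemma sum_clip: "0 \<le> t \<Longrightarrow> (\<Sum>i<m. min 1 (max 0 (t - real i))) = min t (real m)"
  by (induction m) (auto simp: min_def max_def)

text \<open>Cutting \<open>n \<phi>\<close> into layers of height 1 sandwiches \<open>S \<phi>\<close> between two Riemann sums that
  depend on \<open>\<nu>\<close> only and differ by at most a constant over \<open>n\<close>.\<close>

lemma layer_cake_unique:
  fixes S S' :: "('a::t2_space \<Rightarrow> real) \<Rightarrow> real" and \<nu> :: "'a set \<Rightarrow> real"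
  assumes add: "\<And>(I :: nat set) \<phi>. finite I \<Longrightarrow> (\<And>i. i \<in> I \<Longrightarrow> \<phi> i \<in> Cc) \<Longrightarrow> S (\<lambda>x. \<Sum>i\<in>I. \<phi> i x) = (\<Sum>i\<in>I. S (\<phi> i))"
      "\<And>(I :: nat set) \<phi>. finite I \<Longrightarrow> (\<And>i. i \<in> I \<Longrightarrow> \<phi> i \<in> Cc) \<Longrightarrow> S' (\<lambda>x. \<Sum>i\<in>I. \<phi> i x) = (\<Sum>i\<in>I. S' (\<phi> i))"
    and scale: "\<And>a \<phi>. \<phi> \<in> Cc \<Longrightarrow> S (\<lambda>x. a * \<phi> x) = a * S \<phi>" "\<And>a \<phi>. \<phi> \<in> Cc \<Longrightarrow> S' (\<lambda>x. a * \<phi> x) = a * S' \<phi>"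
    and low: "\<And>K \<phi>. compact K \<Longrightarrow> \<phi> \<in> Cc \<Longrightarrow> (\<And>x. 0 \<le> \<phi> x) \<Longrightarrow> (\<And>x. x \<in> K \<Longrightarrow> 1 \<le> \<phi> x) \<Longrightarrow> \<nu> K \<le> S \<phi> \<and> \<nu> K \<le> S' \<phi>"
    and upp: "\<And>K \<phi>. compact K \<Longrightarrow> \<phi> \<in> Cc \<Longrightarrow> (\<And>x. 0 \<le> \<phi> x) \<Longrightarrow> (\<And>x. \<phi> x \<le> 1) \<Longrightarrow> closure {x. \<phi> x \<noteq> 0} \<subseteq> K \<Longrightarrow> S \<phi> \<le> \<nu> K \<and> S' \<phi> \<le> \<nu> K"
    and \<nu>0: "\<And>K. compact K \<Longrightarrow> 0 \<le> \<nu> K"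
    and \<phi>: "\<phi> \<in> Cc" "\<And>x. 0 \<le> \<phi> x"
  shows "S \<phi> = S' \<phi>"
proof -
  define K0 where "K0 = closure {x. \<phi> x \<noteq> 0}"
  have K0: "compact K0" unfolding K0_def by (rule Cc_support[OF \<phi>(1)])
  obtain B where B: "\<And>x. \<bar>\<phi> x\<bar> \<le> B" "0 < B" using Cc_bounded[OF \<phi>(1)] by metis
  have main: "n * \<bar>S \<phi> - S' \<phi>\<bar> \<le> \<nu> K0" if n: "0 < n" for n :: real
  proof -
    obtain m where m: "n * B \<le> real m" using real_arch_simple by blast
    \<comment> \<open>The lowest level set would be the whole space, which need not be compact; the
      support \<open>K0\<close> replaces it.\<close>
    define L where "L i = (if i = 0 then K0 else {x. real i \<le> n * \<phi> x})" for i :: nat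
    define \<phi>i where "\<phi>i i x = min 1 (max 0 (n * \<phi> x - real i))" for i :: nat and x
    have clL: "closed {x. real i \<le> n * \<phi> x}" for i
      by (intro closed_Collect_le continuous_intros Cc_continuous \<phi>(1))
    have subK0: "{x. real i \<le> n * \<phi> x} \<subseteq> K0" if "i \<noteq> 0" for i
    proof
      fix x assume "x \<in> {x. real i \<le> n * \<phi> x}"
      then have "\<phi> x \<noteq> 0" using that by auto
      then show "x \<in> K0" unfolding K0_def using not_in_support[of x \<phi>] by blast
    qed
    have cL: "compact (L i)" for i
      using compact_Int_closed[OF K0 clL[of i]] subK0[of i] K0 by (auto simp: L_def Int_absorb1)
    have Cci: "\<phi>i i \<in> Cc" for i
      unfolding \<phi>i_def
      by (rule Cc_compose[OF \<phi>(1), of "\<lambda>t. min 1 (max 0 (n * t - real i))"]) (auto intro!: continuous_intros)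
    have \<phi>i01: "0 \<le> \<phi>i i x" "\<phi>i i x \<le> 1" for i x by (auto simp: \<phi>i_def)
    have one: "1 \<le> \<phi>i i x" if "x \<in> L (Suc i)" for i x using that by (auto simp: \<phi>i_def L_def)
    have supp: "closure {x. \<phi>i i x \<noteq> 0} \<subseteq> L i" for i
    proof (cases "i = 0")
      case True
      have "closure {x. \<phi>i i x \<noteq> 0} \<subseteq> closure {x. \<phi> x \<noteq> 0}"
        using True by (intro closure_mono) (auto simp: \<phi>i_def)
      then show ?thesis using True by (simp add: L_def K0_def)
    next
      case False
      have "closure {x. \<phi>i i x \<noteq> 0} \<subseteq> {x. real i \<le> n * \<phi> x}"
        by (intro closure_minimal clL) (auto simp: \<phi>i_def)
      then show ?thesis using False by (simp add: L_def)
    qed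
    have sum_eq: "(\<lambda>x. \<Sum>i<m. \<phi>i i x) = (\<lambda>x. n * \<phi> x)"
    proof
      fix x
      have "n * \<phi> x \<le> n * B" using B(1)[of x] n by (intro mult_left_mono) auto
      then have "n * \<phi> x \<le> real m" using m by linarith
      then show "(\<Sum>i<m. \<phi>i i x) = n * \<phi> x"
        unfolding \<phi>i_def using n \<phi>(2)[of x] by (subst sum_clip) auto
    qed
    have S1: "n * S \<phi> = (\<Sum>i<m. S (\<phi>i i))" "n * S' \<phi> = (\<Sum>i<m. S' (\<phi>i i))"
      using add(1)[of "{..<m}" \<phi>i] add(2)[of "{..<m}" \<phi>i] Cci
      by (simp_all add: sum_eq scale[OF \<phi>(1)])
    have bd: "\<nu> (L (Suc i)) \<le> S (\<phi>i i)" "\<nu> (L (Suc i)) \<le> S' (\<phi>i i)"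
        "S (\<phi>i i) \<le> \<nu> (L i)" "S' (\<phi>i i) \<le> \<nu> (L i)" for i
      using low[of "L (Suc i)" "\<phi>i i", OF cL Cci \<phi>i01(1) one]
        upp[of "L i" "\<phi>i i", OF cL Cci \<phi>i01 supp] by auto
    have "(\<Sum>i<m. \<nu> (L i)) - (\<Sum>i<m. \<nu> (L (Suc i))) = \<nu> (L 0) - \<nu> (L m)"
      using sum_lessThan_telescope'[of "\<lambda>i. \<nu> (L i)" m] by (simp add: sum_subtractf)
    also have "\<dots> \<le> \<nu> K0" using \<nu>0[OF cL[of m]] by (simp add: L_def)
    finally have tel: "(\<Sum>i<m. \<nu> (L i)) - (\<Sum>i<m. \<nu> (L (Suc i))) \<le> \<nu> K0" .
    have "n * S \<phi> \<le> (\<Sum>i<m. \<nu> (L i))" "n * S' \<phi> \<le> (\<Sum>i<m. \<nu> (L i))"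
      "(\<Sum>i<m. \<nu> (L (Suc i))) \<le> n * S \<phi>" "(\<Sum>i<m. \<nu> (L (Suc i))) \<le> n * S' \<phi>"
      unfolding S1 by (intro sum_mono bd)+
    then have "\<bar>n * S \<phi> - n * S' \<phi>\<bar> \<le> \<nu> K0" using tel by linarith
    then show ?thesis using n by (simp add: abs_mult flip: right_diff_distrib)
  qed
  show ?thesis
  proof (rule ccontr)
    assume "S \<phi> \<noteq> S' \<phi>"
    then have pos: "0 < \<bar>S \<phi> - S' \<phi>\<bar>" by simp
    \<comment> \<open>The scale \<open>n\<close> is chosen such that
      \<open>n * \<bar>S \<phi> - S' \<phi>\<bar>\<close> equals \<open>\<nu> K0 + 1\<close>, which
      is over the bound.\<close>
    have "(\<nu> K0 + 1) / \<bar>S \<phi> - S' \<phi>\<bar> * \<bar>S \<phi> - S' \<phi>\<bar> \<le> \<nu> K0"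
      using \<nu>0[OF K0] pos by (intro main) auto
    then show False using pos by simp
  qed
qed

text \<open>The measure comes from Caratheodory's construction. That it represents \<open>T\<close>
  follows from \<open>layer_cake_unique\<close>: \<open>T\<close> and integration against
  \<open>M\<close> are both squeezed by the \<open>M\<close>-measures of compact sets, hence agree
  on nonnegative functions, and then on all of \<open>Cc\<close> by splitting into positive and
  negative parts.\<close>

lemma Riesz_Markov_exists:
  fixes T :: "('a::t2_space \<Rightarrow> real) \<Rightarrow> real"
  assumes lc: "lch TYPE('a)" and T: "T \<in> pos_radon"
  shows "\<exists>M. represents M T"
proof -
  obtain M where sM: "sets M = sets borel"
      and eM: "\<And>B. B \<in> sets borel \<Longrightarrow> emeasure M B = radon_outer T B"
    using radon_outer_measure[OF lc T] by blast
  have fin: "emeasure M K < \<infinity>" if K: "compact K" for K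
  proof -
    obtain g :: "'a \<Rightarrow> real" where g: "g \<in> Cc" "\<And>x. 0 \<le> g x" "\<And>x. x \<in> K \<Longrightarrow> g x = 1"
      using lch_Urysohn[OF lc K open_UNIV subset_UNIV] by blast
    have "emeasure M K \<le> ennreal (T g)"
      using radon_outer_le[OF T g(1,2), of K] g(3) eM[of K] K by (simp add: compact_imp_closed)
    then show ?thesis by (metis ennreal_less_top infinity_ennreal_def le_less_trans)
  qed
  have outer: "emeasure M B = (INF U\<in>{U. open U \<and> B \<subseteq> U}. emeasure M U)" if "B \<in> sets borel" for B
    unfolding eM[OF that] radon_outer_def[of T B]
    by (intro INF_cong refl) (simp add: eM radon_outer_open)
  have inner: "emeasure M U = (SUP K\<in>{K. compact K \<and> K \<subseteq> U}. emeasure M K)" if U: "open U" for U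
  proof (rule antisym)
    show "emeasure M U \<le> (SUP K\<in>{K. compact K \<and> K \<subseteq> U}. emeasure M K)"
      unfolding eM[OF borel_open[OF U]] radon_outer_open[OF U] radon_content_def
    proof (rule SUP_least)
      fix \<phi> assume \<phi>: "\<phi> \<in> test_below U"
      have "ennreal (T \<phi>) \<le> radon_outer T (closure {x. \<phi> x \<noteq> 0})"
        by (rule le_radon_outer[OF test_belowD(1-3)[OF \<phi>] subset_refl])
      also have "\<dots> = emeasure M (closure {x. \<phi> x \<noteq> 0})" by (simp add: eM)
      also have "\<dots> \<le> (SUP K\<in>{K. compact K \<and> K \<subseteq> U}. emeasure M K)"
        using test_belowD(4)[OF \<phi>] Cc_support[OF test_belowD(1)[OF \<phi>]] by (intro SUP_upper) simp
      finally show "ennreal (T \<phi>) \<le> (SUP K\<in>{K. compact K \<and> K \<subseteq> U}. emeasure M K)" .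
    qed
    show "(SUP K\<in>{K. compact K \<and> K \<subseteq> U}. emeasure M K) \<le> emeasure M U"
      using U by (intro SUP_least emeasure_mono) (auto simp: sM)
  qed
  have iCc: "integrable M \<phi>" if "\<phi> \<in> Cc" for \<phi> by (rule integrable_Cc[OF sM fin that])
  have eq: "T \<phi> = (LINT x|M. \<phi> x)" if \<phi>: "\<phi> \<in> Cc" "\<And>x. 0 \<le> \<phi> x" for \<phi>
  proof (rule layer_cake_unique[where \<nu> = "\<lambda>K. measure M K" and S = T and S' = "\<lambda>\<phi>. LINT x|M. \<phi> x", OF _ _ _ _ _ _ _ \<phi>])
    show "T (\<lambda>x. \<Sum>i\<in>I. \<phi> i x) = (\<Sum>i\<in>I. T (\<phi> i))" if "finite I" "\<And>i. i \<in> I \<Longrightarrow> \<phi> i \<in> Cc"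
      for I :: "nat set" and \<phi> using radon_sum[OF pos_radon_signed[OF T] that] by simp
    show "(LINT x|M. (\<Sum>i\<in>I. \<phi> i x)) = (\<Sum>i\<in>I. LINT x|M. \<phi> i x)" if "finite I" "\<And>i. i \<in> I \<Longrightarrow> \<phi> i \<in> Cc"
      for I :: "nat set" and \<phi> using that by (intro Bochner_Integration.integral_sum iCc)
    show "T (\<lambda>x. a * \<phi> x) = a * T \<phi>" if "\<phi> \<in> Cc" for a \<phi>
      by (rule radon_scale[OF pos_radon_signed[OF T] that])
    show "(LINT x|M. a * \<phi> x) = a * (LINT x|M. \<phi> x)" if "\<phi> \<in> Cc" for a \<phi> by simp
    show "measure M K \<le> T \<phi> \<and> measure M K \<le> (LINT x|M. \<phi> x)"
      if K: "compact K" and \<phi>: "\<phi> \<in> Cc" "\<And>x. 0 \<le> \<phi> x" and one: "\<And>x. x \<in> K \<Longrightarrow> 1 \<le> \<phi> x" for K \<phi>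
    proof
      have Kb: "K \<in> sets borel" using K by (simp add: compact_imp_closed)
      have "emeasure M K \<le> ennreal (T \<phi>)" unfolding eM[OF Kb] by (rule radon_outer_le[OF T \<phi> one])
      then show "measure M K \<le> T \<phi>"
        using fin[OF K] pos_radon_nonneg[OF T \<phi>(2)]
        by (simp add: emeasure_eq_ennreal_measure less_top)
      have "integrable M (indicator K :: 'a \<Rightarrow> real)" using fin[OF K] Kb by (simp add: sM)
      moreover have "indicator K x \<le> \<phi> x" for x using \<phi>(2)[of x] one[of x] by (simp add: indicator_def)
      ultimately have "(LINT x|M. indicator K x) \<le> (LINT x|M. \<phi> x)"
        by (rule integral_mono[OF _ iCc[OF \<phi>(1)]])
      then show "measure M K \<le> (LINT x|M. \<phi> x)" using Kb by (simp add: sM)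
    qed
    show "T \<phi> \<le> measure M K \<and> (LINT x|M. \<phi> x) \<le> measure M K"
      if K: "compact K" and \<phi>: "\<phi> \<in> Cc" "\<And>x. 0 \<le> \<phi> x" "\<And>x. \<phi> x \<le> 1" and supp: "closure {x. \<phi> x \<noteq> 0} \<subseteq> K" for K \<phi>
    proof
      have Kb: "K \<in> sets borel" using K by (simp add: compact_imp_closed)
      have "ennreal (T \<phi>) \<le> emeasure M K" unfolding eM[OF Kb] by (rule le_radon_outer[OF \<phi> supp])
      then show "T \<phi> \<le> measure M K"
        using fin[OF K] by (simp add: emeasure_eq_ennreal_measure less_top)
      have "integrable M (indicator K :: 'a \<Rightarrow> real)" using fin[OF K] Kb by (simp add: sM)
      moreover have "\<phi> x \<le> indicator K x" for x
        using \<phi>(3)[of x] subsetD[OF supp, of x] not_in_support[of x \<phi>] by (cases "x \<in> K") (simp, force)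
      ultimately have "(LINT x|M. \<phi> x) \<le> (LINT x|M. indicator K x)"
        by (intro integral_mono[OF iCc[OF \<phi>(1)]])
      then show "(LINT x|M. \<phi> x) \<le> measure M K" using Kb by (simp add: sM)
    qed
  qed simp
  have "T \<phi> = (LINT x|M. \<phi> x)" if \<phi>: "\<phi> \<in> Cc" for \<phi>
  proof -
    let ?p = "\<lambda>x. max (\<phi> x) 0" and ?n = "\<lambda>x. max (- \<phi> x) 0"
    have pn: "?p \<in> Cc" "?n \<in> Cc" by (intro Cc_max Cc_uminus \<phi> Cc_zero)+
    have split: "\<phi> = (\<lambda>x. ?p x - ?n x)" by auto
    have "T \<phi> = T ?p - T ?n" by (subst split) (rule radon_diff[OF pos_radon_signed[OF T] pn])
    also have "\<dots> = (LINT x|M. ?p x) - (LINT x|M. ?n x)" using pn by (simp add: eq)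
    also have "\<dots> = (LINT x|M. ?p x - ?n x)" using pn by (simp add: iCc)
    finally show ?thesis using split by simp
  qed
  then have "represents M T"
    unfolding represents_def by (intro conjI ballI allI impI sM fin outer inner)
  then show ?thesis by blast
qed

lemma representsD:
  assumes "represents M T"
  shows "sets M = sets borel" "\<And>K. compact K \<Longrightarrow> emeasure M K < \<infinity>"
    "\<And>B. B \<in> sets borel \<Longrightarrow> emeasure M B = (INF U\<in>{U. open U \<and> B \<subseteq> U}. emeasure M U)"
    "\<And>U. open U \<Longrightarrow> emeasure M U = (SUP K\<in>{K. compact K \<and> K \<subseteq> U}. emeasure M K)"
    "\<And>\<phi>. \<phi> \<in> Cc \<Longrightarrow> T \<phi> = (LINT x|M. \<phi> x)" "\<And>\<phi>. \<phi> \<in> Cc \<Longrightarrow> integrable M \<phi>"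
    "\<And>\<phi>. \<phi> \<in> Cc \<Longrightarrow> (\<And>x. 0 \<le> \<phi> x) \<Longrightarrow> ennreal (T \<phi>) = (\<integral>\<^sup>+x. ennreal (\<phi> x) \<partial>M)"
proof -
  note a = assms[unfolded represents_def]
  show 1: "sets M = sets borel" using a by (rule conjunct1)
  show 2: "emeasure M K < \<infinity>" if "compact K" for K
    using a[THEN conjunct2, THEN conjunct1] that by blast
  show "emeasure M B = (INF U\<in>{U. open U \<and> B \<subseteq> U}. emeasure M U)" if "B \<in> sets borel" for B
    using a[THEN conjunct2, THEN conjunct2, THEN conjunct1] that by (rule bspec)
  show "emeasure M U = (SUP K\<in>{K. compact K \<and> K \<subseteq> U}. emeasure M K)" if "open U" for U
    using a[THEN conjunct2, THEN conjunct2, THEN conjunct2, THEN conjunct1, rule_format, OF that] .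
  show 3: "T \<phi> = (LINT x|M. \<phi> x)" if "\<phi> \<in> Cc" for \<phi>
    using a[THEN conjunct2, THEN conjunct2, THEN conjunct2, THEN conjunct2] that by (rule bspec)
  show "integrable M \<phi>" if "\<phi> \<in> Cc" for \<phi> by (rule integrable_Cc[OF 1 2 that])
  show "ennreal (T \<phi>) = (\<integral>\<^sup>+x. ennreal (\<phi> x) \<partial>M)" if "\<phi> \<in> Cc" "\<And>x. 0 \<le> \<phi> x" for \<phi>
    unfolding 3[OF that(1)] by (rule ennreal_integral_Cc[OF 1 2 that])
qed

text \<open>By inner regularity and Urysohn functions, the values of \<open>T\<close> determine the
  measure of every open set; outer regularity carries this over to Borel sets.\<close>

lemma represents_unique:
  fixes T :: "('a::t2_space \<Rightarrow> real) \<Rightarrow> real"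
  assumes lc: "lch TYPE('a)"
    and M: "represents M T" and N: "represents N T"
  shows "M = N"
proof -
  have le: "emeasure M U \<le> emeasure N U"
    if U: "open U" and M: "represents M T" and N: "represents N T" for U M N
    unfolding representsD(4)[OF M U]
  proof (rule SUP_least, safe)
    fix K assume K: "compact K" "K \<subseteq> U"
    obtain g :: "'a \<Rightarrow> real" where g: "g \<in> Cc" "\<And>x. 0 \<le> g x" "\<And>x. g x \<le> 1" "\<And>x. x \<in> K \<Longrightarrow> g x = 1"
        "closure {x. g x \<noteq> 0} \<subseteq> U"
      using lch_Urysohn[OF lc K(1) U K(2)] by blast
    have "emeasure M K = (\<integral>\<^sup>+x. indicator K x \<partial>M)"
      using K(1) by (simp add: representsD(1)[OF M] compact_imp_closed)
    also have "\<dots> \<le> (\<integral>\<^sup>+x. ennreal (g x) \<partial>M)"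
      using g(4) by (intro nn_integral_mono) (auto simp: indicator_def)
    also have "\<dots> = (\<integral>\<^sup>+x. ennreal (g x) \<partial>N)"
      using representsD(7)[OF M g(1,2)] representsD(7)[OF N g(1,2)] by simp
    also have "\<dots> \<le> (\<integral>\<^sup>+x. indicator U x \<partial>N)"
    proof (rule nn_integral_mono)
      fix x show "ennreal (g x) \<le> indicator U x"
        using g(3)[of x] not_in_support[of x g] subsetD[OF g(5), of x] by (cases "x \<in> U") (simp, force)
    qed
    also have "\<dots> = emeasure N U" using U by (simp add: representsD(1)[OF N])
    finally show "emeasure M K \<le> emeasure N U" .
  qed
  show ?thesis
  proof (rule measure_eqI)
    show "sets M = sets N" using representsD(1)[OF M] representsD(1)[OF N] by simp
    fix B assume "B \<in> sets M"
    then have B: "B \<in> sets borel" using representsD(1)[OF M] by simp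
    show "emeasure M B = emeasure N B"
      unfolding representsD(3)[OF M B] representsD(3)[OF N B]
      using le[OF _ M N] le[OF _ N M] by (intro INF_cong refl antisym) auto
  qed
qed

lemma borel_of_eqI:
  fixes T :: "('a::t2_space \<Rightarrow> real) \<Rightarrow> real"
  assumes "lch TYPE('a)" and "represents M T"
  shows "borel_of T = M"
  unfolding borel_of_def represents_def[symmetric]
  using represents_unique[OF assms(1)] assms(2) by blast

theorem Riesz_Markov:
  fixes T :: "('a::t2_space \<Rightarrow> real) \<Rightarrow> real"
  assumes "lch TYPE('a)" and "T \<in> pos_radon"
  shows "represents (borel_of T) T"
  using Riesz_Markov_exists[OF assms] borel_of_eqI[OF assms(1)] by metis

section \<open>Integrals of lower semicontinuous functions\<close>

text \<open>The minorants whose supremum under \<open>T\<close> is Bourbaki's upper integral of a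
  lower semicontinuous \<open>g\<close>.\<close>

definition below :: "('a::t2_space \<Rightarrow> ennreal) \<Rightarrow> ('a \<Rightarrow> real) set" where
  "below g = {\<phi> \<in> Cc. (\<forall>x. 0 \<le> \<phi> x) \<and> (\<forall>x. ennreal (\<phi> x) \<le> g x)}"

lemma belowD:
  assumes "\<phi> \<in> below g"
  shows "\<phi> \<in> Cc" "0 \<le> \<phi> x" "ennreal (\<phi> x) \<le> g x"
  using assms by (simp_all add: below_def)

lemma zero_below: "(\<lambda>x. 0) \<in> below g"
  by (simp add: below_def Cc_zero)

lemma borel_measurable_lsc:
  fixes g :: "'a::topological_space \<Rightarrow> 'b::{second_countable_topology, linorder_topology}"
  assumes "\<And>a. open {x. a < g x}"
  shows "g \<in> borel_measurable borel"
  using assms by (intro borel_measurableI_greater) simp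

lemma SUP_below_add:
  assumes T: "T \<in> pos_radon"
  shows "(SUP \<phi>\<in>below g. ennreal (T \<phi>)) + (SUP \<phi>\<in>below h. ennreal (T \<phi>))
    \<le> (SUP \<phi>\<in>below (\<lambda>x. g x + h x). ennreal (T \<phi>))"
proof -
  have "ennreal (T \<phi>) + ennreal (T \<psi>) \<le> (SUP \<phi>\<in>below (\<lambda>x. g x + h x). ennreal (T \<phi>))"
    if \<phi>: "\<phi> \<in> below g" and \<psi>: "\<psi> \<in> below h" for \<phi> \<psi>
  proof -
    note c = belowD(1)[OF \<phi>] belowD(1)[OF \<psi>] belowD(2)[OF \<phi>] belowD(2)[OF \<psi>]
    have "ennreal (T \<phi>) + ennreal (T \<psi>) = ennreal (T (\<lambda>x. \<phi> x + \<psi> x))"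
      using pos_radon_nonneg[OF T, of \<phi>] pos_radon_nonneg[OF T, of \<psi>] c
      by (simp add: radon_add[OF pos_radon_signed[OF T] c(1,2)] ennreal_plus)
    also have "\<dots> \<le> (SUP \<phi>\<in>below (\<lambda>x. g x + h x). ennreal (T \<phi>))"
      using \<phi> \<psi> by (intro SUP_upper) (auto simp: below_def Cc_add ennreal_plus intro: add_mono)
    finally show ?thesis .
  qed
  moreover have "below g \<noteq> {}" "below h \<noteq> {}" using zero_below by blast+
  ultimately show ?thesis
    by (simp add: ennreal_SUP_add_left[symmetric] ennreal_SUP_add_right SUP_le_iff)
qed

lemma SUP_below_scale:
  assumes T: "T \<in> pos_radon" and c: "0 \<le> c"
  shows "ennreal c * (SUP \<phi>\<in>below g. ennreal (T \<phi>)) \<le> (SUP \<phi>\<in>below (\<lambda>x. ennreal c * g x). ennreal (T \<phi>))"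
  unfolding SUP_mult_left_ennreal
proof (rule SUP_least)
  fix \<phi> assume \<phi>: "\<phi> \<in> below g"
  have "ennreal c * ennreal (T \<phi>) = ennreal (T (\<lambda>x. c * \<phi> x))"
    using \<phi> c pos_radon_nonneg[OF T, of \<phi>]
    by (simp add: below_def radon_scale[OF pos_radon_signed[OF T]] ennreal_mult)
  also have "\<dots> \<le> (SUP \<phi>\<in>below (\<lambda>x. ennreal c * g x). ennreal (T \<phi>))"
    using \<phi> c by (intro SUP_upper) (auto simp: below_def Cc_scale ennreal_mult intro: mult_left_mono)
  finally show "ennreal c * ennreal (T \<phi>) \<le> (SUP \<phi>\<in>below (\<lambda>x. ennreal c * g x). ennreal (T \<phi>))" .
qed

lemma emeasure_open_le_SUP_below:
  fixes T :: "('a::t2_space \<Rightarrow> real) \<Rightarrow> real"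
  assumes lc: "lch TYPE('a)" and M: "represents M T" and U: "open U"
  shows "emeasure M U \<le> (SUP \<phi>\<in>below (indicator U). ennreal (T \<phi>))"
  unfolding representsD(4)[OF M U]
proof (rule SUP_least, safe)
  fix K assume K: "compact K" "K \<subseteq> U"
  obtain g :: "'a \<Rightarrow> real" where g: "g \<in> Cc" "\<And>x. 0 \<le> g x" "\<And>x. g x \<le> 1" "\<And>x. x \<in> K \<Longrightarrow> g x = 1"
      "closure {x. g x \<noteq> 0} \<subseteq> U"
    using lch_Urysohn[OF lc K(1) U K(2)] by blast
  have "ennreal (g x) \<le> indicator U x" for x
    using g(3)[of x] not_in_support[of x g] subsetD[OF g(5), of x] by (cases "x \<in> U") (simp, force)
  then have gb: "g \<in> below (indicator U)" using g(1,2) by (simp add: below_def)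
  have "emeasure M K = (\<integral>\<^sup>+x. indicator K x \<partial>M)"
    using K(1) by (simp add: representsD(1)[OF M] compact_imp_closed)
  also have "\<dots> \<le> (\<integral>\<^sup>+x. ennreal (g x) \<partial>M)"
    using g(4) by (intro nn_integral_mono) (auto simp: indicator_def)
  also have "\<dots> = ennreal (T g)" using representsD(7)[OF M g(1,2)] by simp
  also have "\<dots> \<le> (SUP \<phi>\<in>below (indicator U). ennreal (T \<phi>))" by (rule SUP_upper[OF gb])
  finally show "emeasure M K \<le> (SUP \<phi>\<in>below (indicator U). ennreal (T \<phi>))" .
qed

text \<open>An approximation of \<open>t\<close> from below by steps of height \<open>1 / n\<close>,
  capped at height \<open>n\<close>. It is a sum of indicators of strict upper level sets, because
  for lower semicontinuous \<open>g\<close> these pull back to open sets. The level is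
  \<open>Suc i\<close> rather than \<open>i\<close>, which keeps the sum below
  \<open>t\<close>.\<close>

definition stair :: "nat \<Rightarrow> ennreal \<Rightarrow> ennreal" where
  "stair n t = (\<Sum>i<n * n. ennreal (1 / real n) * indicator {s. ennreal (real (Suc i) / real n) < s} t)"

lemma card_le_stair:
  assumes n: "0 < n" and k: "k \<le> n * n" and t: "ennreal (real k / real n) < t"
  shows "ennreal (real k / real n) \<le> stair n t"
proof -
  have "ennreal (real k / real n) = (\<Sum>i<k. ennreal (1 / real n))"
    by (simp add: ennreal_of_nat_eq_real_of_nat flip: ennreal_mult)
  also have "\<dots> = (\<Sum>i<k. ennreal (1 / real n) * indicator {s. ennreal (real (Suc i) / real n) < s} t)"
  proof (rule sum.cong)
    fix i assume "i \<in> {..<k}"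
    then have "real (Suc i) / real n \<le> real k / real n" using n by (intro divide_right_mono) auto
    then have "ennreal (real (Suc i) / real n) < t" using t by (meson ennreal_leI le_less_trans)
    then show "ennreal (1 / real n) = ennreal (1 / real n) * indicator {s. ennreal (real (Suc i) / real n) < s} t"
      by simp
  qed simp
  also have "\<dots> \<le> stair n t" unfolding stair_def using k by (intro sum_mono2) auto
  finally show ?thesis .
qed

lemma stair_le: "stair n t \<le> t"
proof (cases "n = 0")
  case True
  then show ?thesis by (simp add: stair_def)
next
  case False
  define I where "I = {i. i < n * n \<and> ennreal (real (Suc i) / real n) < t}"
  have fI: "finite I" by (simp add: I_def)
  have "stair n t = (\<Sum>i\<in>I. ennreal (1 / real n))"
    unfolding stair_def I_def by (simp add: sum.If_cases indicator_def Int_def)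
  also have "\<dots> = ennreal (real (card I) / real n)"
    by (simp add: ennreal_of_nat_eq_real_of_nat flip: ennreal_mult)
  also have "\<dots> \<le> t"
  proof (cases "I = {}")
    case nonempty: False
    define m where "m = Max I"
    have "m \<in> I" using fI nonempty by (simp add: m_def)
    have "I \<subseteq> {..m}" using fI by (auto simp: m_def)
    then have "card I \<le> Suc m" using card_mono[of "{..m}" I] by simp
    then have "ennreal (real (card I) / real n) \<le> ennreal (real (Suc m) / real n)"
      by (intro ennreal_leI divide_right_mono) auto
    also have "\<dots> \<le> t" using \<open>m \<in> I\<close> unfolding I_def by (simp add: less_imp_le)
    finally show ?thesis .
  qed simp
  finally show ?thesis .
qed

text \<open>The approximations need not increase with \<open>n\<close>, so the limit is taken as a
  lower limit and will be combined with Fatou's lemma.\<close>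

lemma le_liminf_stair: "t \<le> liminf (\<lambda>n. stair n t)"
  unfolding le_Liminf_iff
proof (intro allI impI)
  fix y assume "y < t"
  then obtain z where z: "y < z" "z < t" using dense by blast
  obtain y' where y': "y = ennreal y'" "0 \<le> y'" using z by (cases y) auto
  obtain z' where z': "z = ennreal z'" "0 \<le> z'" using z by (cases z) auto
  have lt: "y' < z'" using z y' z' by (simp add: ennreal_less_iff)
  \<comment> \<open>The first condition makes the cap \<open>n\<close> exceed \<open>z'\<close>. The
    second makes the mesh \<open>1 / n\<close> smaller than \<open>z' - y'\<close>, so that some
    multiple of \<open>1 / n\<close> lies above \<open>y'\<close> and is at most
    \<open>z'\<close>.\<close>
  obtain N where N: "z' \<le> real N" "1 / (z' - y') < real N"
    using reals_Archimedean2[of "max z' (1 / (z' - y'))"] by (metis less_imp_le max_less_iff_conj)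
  show "\<forall>\<^sub>F n in sequentially. y < stair n t"
    unfolding eventually_sequentially
  proof (intro exI[of _ "Suc N"] allI impI)
    fix n assume n: "Suc N \<le> n"
    define k where "k = nat \<lfloor>real n * z'\<rfloor>"
    have k: "real k \<le> real n * z'" "real n * z' - 1 < real k" using z' by (auto simp: k_def)
    have nN: "real N \<le> real n" "0 < real n" using n by auto
    have "real n * z' \<le> real n * real n" using N(1) nN by (intro mult_left_mono) auto
    then have "real k \<le> real (n * n)" using k(1) by simp
    then have kn: "k \<le> n * n" by linarith
    have "real k / real n \<le> z'" using k(1) nN by (simp add: field_simps)
    then have "ennreal (real k / real n) < t" using z(2) z'(1) by (meson ennreal_leI le_less_trans)
    then have st: "ennreal (real k / real n) \<le> stair n t" using kn n by (intro card_le_stair) auto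
    have "1 < real n * (z' - y')"
      using N(2) nN lt by (metis less_le_trans diff_gt_0_iff_gt divide_less_eq)
    then have "y' < real k / real n" using k(2) nN by (simp add: field_simps)
    then have "y < ennreal (real k / real n)" using y' by (simp add: ennreal_lessI)
    then show "y < stair n t" using st by (rule less_le_trans)
  qed
qed

text \<open>For the indicator of an open set this is inner regularity plus Urysohn functions.
  Suprema over \<open>below\<close> are superadditive and respect positive scalars, which extends
  the inequality to \<open>stair n \<circ> g\<close>; Fatou's lemma then reaches \<open>g\<close>.
  In the other direction every minorant has a smaller integral.\<close>

lemma nn_integral_lsc:
  fixes T :: "('a::t2_space \<Rightarrow> real) \<Rightarrow> real"
  assumes lc: "lch TYPE('a)" and T: "T \<in> pos_radon" and M: "represents M T"
    and g: "\<And>a. open {x. a < g x}"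
  shows "(\<integral>\<^sup>+x. g x \<partial>M) = (SUP \<phi>\<in>below g. ennreal (T \<phi>))"
proof (rule antisym)
  have U: "open {x. ennreal (real (Suc i) / real n) < g x}" for i n by (rule g)
  have sU: "{x. ennreal (real (Suc i) / real n) < g x} \<in> sets M" for i n
    unfolding representsD(1)[OF M] using U by (rule borel_open)
  have stair_g: "stair n (g x) = (\<Sum>i<n*n. ennreal (1 / real n) * indicator {x. ennreal (real (Suc i) / real n) < g x} x)" for n x
    by (simp add: stair_def indicator_def)
  have meas: "(\<lambda>x. stair n (g x)) \<in> borel_measurable M" for n
    unfolding stair_g using sU by (intro borel_measurable_sum borel_measurable_times) auto
  have "(\<integral>\<^sup>+x. stair n (g x) \<partial>M) \<le> (SUP \<phi>\<in>below g. ennreal (T \<phi>))" for n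
  proof -
    define c where "c i x = ennreal (1 / real n) * indicator {x. ennreal (real (Suc i) / real n) < g x} x" for i x
    have "(\<integral>\<^sup>+x. (\<Sum>i<m. c i x) \<partial>M) \<le> (SUP \<phi>\<in>below (\<lambda>x. \<Sum>i<m. c i x). ennreal (T \<phi>))" for m
    proof (induction m)
      case (Suc m)
      have cm: "c i \<in> borel_measurable M" for i unfolding c_def using sU by measurable
      have "(\<integral>\<^sup>+x. c m x \<partial>M) = ennreal (1 / real n) * emeasure M {x. ennreal (real (Suc m) / real n) < g x}"
        unfolding c_def using sU by (simp add: nn_integral_cmult)
      also have "\<dots> \<le> ennreal (1 / real n) * (SUP \<phi>\<in>below (indicator {x. ennreal (real (Suc m) / real n) < g x}). ennreal (T \<phi>))"
        by (intro mult_left_mono emeasure_open_le_SUP_below lc M U) auto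
      also have "\<dots> \<le> (SUP \<phi>\<in>below (c m). ennreal (T \<phi>))"
        unfolding c_def by (intro SUP_below_scale T) auto
      finally have le: "(\<integral>\<^sup>+x. c m x \<partial>M) \<le> (SUP \<phi>\<in>below (c m). ennreal (T \<phi>))" .
      have "(\<integral>\<^sup>+x. (\<Sum>i<Suc m. c i x) \<partial>M) = (\<integral>\<^sup>+x. (\<Sum>i<m. c i x) \<partial>M) + (\<integral>\<^sup>+x. c m x \<partial>M)"
        using cm by (simp add: nn_integral_add)
      also have "\<dots> \<le> (SUP \<phi>\<in>below (\<lambda>x. \<Sum>i<m. c i x). ennreal (T \<phi>)) + (SUP \<phi>\<in>below (c m). ennreal (T \<phi>))"
        by (intro add_mono Suc le)
      also have "\<dots> \<le> (SUP \<phi>\<in>below (\<lambda>x. (\<Sum>i<m. c i x) + c m x). ennreal (T \<phi>))"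
        by (rule SUP_below_add[OF T])
      finally show ?case by (simp add: add.commute)
    qed simp
    from this[of "n * n"] have "(\<integral>\<^sup>+x. stair n (g x) \<partial>M) \<le> (SUP \<phi>\<in>below (\<lambda>x. stair n (g x)). ennreal (T \<phi>))"
      by (simp add: stair_g c_def)
    also have "\<dots> \<le> (SUP \<phi>\<in>below g. ennreal (T \<phi>))"
      using stair_le order_trans by (intro SUP_subset_mono) (auto simp: below_def, blast)
    finally show ?thesis .
  qed
  note bound = this
  have "(\<integral>\<^sup>+x. g x \<partial>M) \<le> (\<integral>\<^sup>+x. liminf (\<lambda>n. stair n (g x)) \<partial>M)"
    by (intro nn_integral_mono le_liminf_stair)
  also have "\<dots> \<le> liminf (\<lambda>n. \<integral>\<^sup>+x. stair n (g x) \<partial>M)"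
    by (rule nn_integral_liminf[OF meas])
  also have "\<dots> \<le> (SUP \<phi>\<in>below g. ennreal (T \<phi>))"
    by (rule Liminf_le) (auto simp: bound)
  finally show "(\<integral>\<^sup>+x. g x \<partial>M) \<le> (SUP \<phi>\<in>below g. ennreal (T \<phi>))" .
  show "(SUP \<phi>\<in>below g. ennreal (T \<phi>)) \<le> (\<integral>\<^sup>+x. g x \<partial>M)"
  proof (rule SUP_least)
    fix \<phi> assume "\<phi> \<in> below g"
    note \<phi> = belowD[OF this]
    show "ennreal (T \<phi>) \<le> (\<integral>\<^sup>+x. g x \<partial>M)"
      unfolding representsD(7)[OF M \<phi>(1,2)] by (intro nn_integral_mono \<phi>(3))
  qed
qed

section \<open>Suprema of directed families\<close>

lemma directed_upper_bound:
  fixes D :: "('a \<Rightarrow> 'b::preorder) set"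
  assumes "D \<noteq> {}" and dir: "\<And>f g. f \<in> D \<Longrightarrow> g \<in> D \<Longrightarrow> \<exists>h\<in>D. (\<forall>x. f x \<le> h x) \<and> (\<forall>x. g x \<le> h x)"
    and "finite F" "F \<subseteq> D"
  shows "\<exists>h\<in>D. \<forall>f\<in>F. \<forall>x. f x \<le> h x"
  using assms(3,4)
proof (induction F)
  case (insert f F)
  then obtain h where "h \<in> D" "\<forall>f\<in>F. \<forall>x. f x \<le> h x" by auto
  moreover obtain k where "k \<in> D" "\<forall>x. f x \<le> k x" "\<forall>x. h x \<le> k x" using dir[of f h] insert.prems \<open>h \<in> D\<close> by blast
  ultimately show ?case by (metis insert_iff order_trans)
qed (use assms(1) in auto)

text \<open>A function of compact support below the supremum is below a single member up to a uniform
  error, as in Dini's theorem.\<close>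

lemma nn_integral_directed_SUP:
  fixes T :: "('a::t2_space \<Rightarrow> real) \<Rightarrow> real"
  assumes lc: "lch TYPE('a)" and T: "T \<in> pos_radon" and M: "represents M T"
    and D: "D \<noteq> {}" "D \<subseteq> Cc" "\<And>f x. f \<in> D \<Longrightarrow> 0 \<le> f x"
    and dir: "\<And>f g. f \<in> D \<Longrightarrow> g \<in> D \<Longrightarrow> \<exists>h\<in>D. (\<forall>x. f x \<le> h x) \<and> (\<forall>x. g x \<le> h x)"
  shows "(\<integral>\<^sup>+x. (SUP f\<in>D. ennreal (f x)) \<partial>M) = (SUP f\<in>D. ennreal (T f))"
proof (rule antisym)
  have "open {x. a < (SUP f\<in>D. ennreal (f x))}" for a
  proof -
    have "{x. a < (SUP f\<in>D. ennreal (f x))} = (\<Union>f\<in>D. {x. a < ennreal (f x)})"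
      by (auto simp: less_SUP_iff)
    also have "open \<dots>"
      using D(2) by (intro open_UN ballI open_Collect_less continuous_on_const continuous_on_ennreal Cc_continuous) auto
    finally show ?thesis .
  qed
  from nn_integral_lsc[OF lc T M this]
  have "(\<integral>\<^sup>+x. (SUP f\<in>D. ennreal (f x)) \<partial>M) = (SUP \<phi>\<in>below (\<lambda>x. SUP f\<in>D. ennreal (f x)). ennreal (T \<phi>))" .
  also have "\<dots> \<le> (SUP f\<in>D. ennreal (T f))"
  proof (rule SUP_least, rule ennreal_le_epsilon)
    fix \<phi> and e :: real assume \<phi>b: "\<phi> \<in> below (\<lambda>x. SUP f\<in>D. ennreal (f x))" and e: "0 < e"
    note \<phi> = belowD[OF \<phi>b]
    define K where "K = closure {x. \<phi> x \<noteq> 0}"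
    have K: "compact K" unfolding K_def by (rule Cc_support[OF \<phi>(1)])
    obtain u :: "'a \<Rightarrow> real" where u: "u \<in> Cc" "\<And>x. 0 \<le> u x" "\<And>x. x \<in> K \<Longrightarrow> u x = 1"
      using lch_Urysohn[OF lc K open_UNIV subset_UNIV] by blast
    have Tu: "0 \<le> T u" by (rule pos_radon_nonneg[OF T u(2)])
    define d where "d = e / (T u + 1)"
    have d: "0 < d" "d * T u \<le> e" using e Tu by (auto simp: d_def field_simps)
    define O' where "O' f = {x. \<phi> x < f x + d}" for f
    have "open (O' f)" if "f \<in> D" for f
      unfolding O'_def using that D(2) \<phi>(1)
      by (intro open_Collect_less continuous_intros Cc_continuous) auto
    moreover have "K \<subseteq> (\<Union>f\<in>D. O' f)"
    proof
      fix x
      have "\<exists>f\<in>D. \<phi> x < f x + d"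
      proof (rule ccontr)
        assume "\<not> ?thesis"
        then have "f x \<le> \<phi> x - d" if "f \<in> D" for f using that by force
        then have "(SUP f\<in>D. ennreal (f x)) \<le> ennreal (\<phi> x - d)"
          by (intro SUP_least ennreal_leI)
        then have "ennreal (\<phi> x) \<le> ennreal (\<phi> x - d)" using \<phi>(3)[of x] by (rule order_trans[rotated])
        \<comment> \<open>A member of \<open>D\<close> shows that \<open>\<phi> x - d\<close> is
          nonnegative; otherwise \<open>ennreal\<close> would truncate it to 0 and the comparison of
          real numbers could not be recovered.\<close>
        moreover obtain f where "f \<in> D" using D(1) by blast
        ultimately have "\<phi> x \<le> \<phi> x - d"
          using D(3)[of f x] \<open>\<And>f. f \<in> D \<Longrightarrow> f x \<le> \<phi> x - d\<close>[of f]
          by (subst (asm) ennreal_le_iff) auto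
        then show False using d by simp
      qed
      then show "x \<in> (\<Union>f\<in>D. O' f)" by (auto simp: O'_def)
    qed
    ultimately obtain F where F: "F \<subseteq> D" "finite F" "K \<subseteq> (\<Union>f\<in>F. O' f)"
      using compactE_image[OF K, of D O'] by metis
    obtain h where h: "h \<in> D" "\<And>f x. f \<in> F \<Longrightarrow> f x \<le> h x"
      using directed_upper_bound[OF D(1) dir F(2,1)] by blast
    have hC: "h \<in> Cc" using h D by auto
    have le: "\<phi> x \<le> 1 * h x + d * u x" for x
    proof (cases "x \<in> K")
      case True
      then obtain f where "f \<in> F" "\<phi> x < f x + d" using F(3) by (auto simp: O'_def)
      then show ?thesis using h(2)[of f x] u(3)[OF True] by simp
    next
      case False
      then have "\<phi> x = 0" unfolding K_def by (rule not_in_support)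
      then show ?thesis using D(3)[OF h(1), of x] u(2)[of x] d by simp
    qed
    have "T \<phi> \<le> T (\<lambda>x. 1 * h x + d * u x)"
      by (rule pos_radon_mono[OF T \<phi>(1) Cc_lincomb[OF hC u(1)] le])
    also have "\<dots> = T h + d * T u" using radon_lincomb[OF pos_radon_signed[OF T] hC u(1), of 1 d] by simp
    also have "\<dots> \<le> T h + e" using d by simp
    finally have "ennreal (T \<phi>) \<le> ennreal (T h + e)" by (rule ennreal_leI)
    also have "\<dots> = ennreal (T h) + ennreal e"
      using pos_radon_nonneg[OF T, of h] D(3)[OF h(1)] e by (intro ennreal_plus) auto
    also have "\<dots> \<le> (SUP f\<in>D. ennreal (T f)) + ennreal e"
      by (intro add_right_mono SUP_upper h(1))
    finally show "ennreal (T \<phi>) \<le> (SUP f\<in>D. ennreal (T f)) + ennreal e" .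
  qed
  finally show "(\<integral>\<^sup>+x. (SUP f\<in>D. ennreal (f x)) \<partial>M) \<le> (SUP f\<in>D. ennreal (T f))" .
  show "(SUP f\<in>D. ennreal (T f)) \<le> (\<integral>\<^sup>+x. (SUP f\<in>D. ennreal (f x)) \<partial>M)"
  proof (rule SUP_least)
    fix f assume f: "f \<in> D"
    then have fC: "f \<in> Cc" "\<And>x. 0 \<le> f x" using D by auto
    show "ennreal (T f) \<le> (\<integral>\<^sup>+x. (SUP f\<in>D. ennreal (f x)) \<partial>M)"
      unfolding representsD(7)[OF M fC] using f by (intro nn_integral_mono SUP_upper)
  qed
qed

lemma below_directed:
  "f \<in> below g \<Longrightarrow> h \<in> below g \<Longrightarrow> \<exists>k\<in>below g. (\<forall>x. f x \<le> k x) \<and> (\<forall>x. h x \<le> k x)"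
  using Cc_max[of f h]
  by (intro bexI[of _ "\<lambda>x. max (f x) (h x)"]) (auto simp: below_def le_max_iff_disj, auto simp: max_def)

text \<open>For \<open>y < g x\<close>, a Urysohn function of height \<open>y\<close> at
  \<open>x\<close> whose support lies in the open set where \<open>g\<close> exceeds
  \<open>y\<close> is a minorant of \<open>g\<close>.\<close>

lemma lsc_eq_SUP_below:
  fixes g :: "'a::t2_space \<Rightarrow> ennreal"
  assumes lc: "lch TYPE('a)" and g: "\<And>a. open {x. a < g x}"
  shows "g x = (SUP \<phi>\<in>below g. ennreal (\<phi> x))"
proof (rule antisym)
  show "g x \<le> (SUP \<phi>\<in>below g. ennreal (\<phi> x))"
  proof (rule dense_le)
    fix y assume y: "y < g x"
    then obtain r where r: "y = ennreal r" "0 \<le> r" by (cases y) auto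
    obtain u :: "'a \<Rightarrow> real" where u: "u \<in> Cc" "\<And>x. 0 \<le> u x" "\<And>x. u x \<le> 1" "u x = 1"
        "closure {x. u x \<noteq> 0} \<subseteq> {x. y < g x}"
      using lch_Urysohn[OF lc _ g, of "{x}" y] y by auto
    have "ennreal (r * u z) \<le> g z" for z
    proof (cases "y < g z")
      case True
      have "r * u z \<le> r * 1" using r u(3)[of z] by (intro mult_left_mono)
      then show ?thesis using True r by (metis ennreal_leI less_imp_le mult.right_neutral order_trans)
    next
      case False
      then have "u z = 0" using subsetD[OF u(5), of z] not_in_support[of z u] by force
      then show ?thesis by simp
    qed
    then have "(\<lambda>z. r * u z) \<in> below g" using u(1,2) r by (simp add: below_def Cc_scale)
    then have "ennreal (r * u x) \<le> (SUP \<phi>\<in>below g. ennreal (\<phi> x))" by (rule SUP_upper2) simp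
    then show "y \<le> (SUP \<phi>\<in>below g. ennreal (\<phi> x))" using r u(4) by simp
  qed
  show "(SUP \<phi>\<in>below g. ennreal (\<phi> x)) \<le> g x" by (rule SUP_least) (simp add: below_def)
qed

section \<open>Linear combinations and restrictions\<close>

lemma signed_radon_lincomb:
  assumes T: "T \<in> signed_radon" and S: "S \<in> signed_radon"
  shows "(\<lambda>\<phi>. a * T \<phi> + b * S \<phi>) \<in> signed_radon"
proof -
  have off: "\<forall>\<phi>. \<phi> \<notin> Cc \<longrightarrow> a * T \<phi> + b * S \<phi> = 0"
    using radon_off_Cc[OF T] radon_off_Cc[OF S] by simp
  have lin: "\<forall>\<phi>\<in>Cc. \<forall>\<psi>\<in>Cc. \<forall>c d. a * T (\<lambda>x. c * \<phi> x + d * \<psi> x) + b * S (\<lambda>x. c * \<phi> x + d * \<psi> x)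
      = c * (a * T \<phi> + b * S \<phi>) + d * (a * T \<psi> + b * S \<psi>)"
  proof (intro ballI allI)
    fix \<phi> \<psi> :: "'a \<Rightarrow> real" and c d assume \<phi>: "\<phi> \<in> Cc" "\<psi> \<in> Cc"
    show "a * T (\<lambda>x. c * \<phi> x + d * \<psi> x) + b * S (\<lambda>x. c * \<phi> x + d * \<psi> x)
      = c * (a * T \<phi> + b * S \<phi>) + d * (a * T \<psi> + b * S \<psi>)"
      unfolding radon_lincomb[OF T \<phi>] radon_lincomb[OF S \<phi>] by (simp add: algebra_simps)
  qed
  have "\<forall>K. compact K \<longrightarrow> (\<exists>C. \<forall>\<phi>\<in>Cc. {x. \<phi> x \<noteq> 0} \<subseteq> K \<longrightarrow> \<bar>a * T \<phi> + b * S \<phi>\<bar> \<le> C * (SUP x. \<bar>\<phi> x\<bar>))"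
  proof (intro allI impI)
  fix K :: "'a set" assume K: "compact K"
  obtain C where C: "\<And>\<phi>. \<phi> \<in> Cc \<Longrightarrow> {x. \<phi> x \<noteq> 0} \<subseteq> K \<Longrightarrow> \<bar>T \<phi>\<bar> \<le> C * (SUP x. \<bar>\<phi> x\<bar>)"
    using T[unfolded signed_radon_def mem_Collect_eq, THEN conjunct2, THEN conjunct2, rule_format, OF K] by blast
  obtain C' where C': "\<And>\<phi>. \<phi> \<in> Cc \<Longrightarrow> {x. \<phi> x \<noteq> 0} \<subseteq> K \<Longrightarrow> \<bar>S \<phi>\<bar> \<le> C' * (SUP x. \<bar>\<phi> x\<bar>)"
    using S[unfolded signed_radon_def mem_Collect_eq, THEN conjunct2, THEN conjunct2, rule_format, OF K] by blast
  show "\<exists>C. \<forall>\<phi>\<in>Cc. {x. \<phi> x \<noteq> 0} \<subseteq> K \<longrightarrow> \<bar>a * T \<phi> + b * S \<phi>\<bar> \<le> C * (SUP x. \<bar>\<phi> x\<bar>)"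
  proof (intro exI[of _ "\<bar>a\<bar> * C + \<bar>b\<bar> * C'"] ballI impI)
    fix \<phi> :: "'a \<Rightarrow> real" assume \<phi>: "\<phi> \<in> Cc" "{x. \<phi> x \<noteq> 0} \<subseteq> K"
    have "\<bar>a * T \<phi> + b * S \<phi>\<bar> \<le> \<bar>a\<bar> * \<bar>T \<phi>\<bar> + \<bar>b\<bar> * \<bar>S \<phi>\<bar>"
      by (metis abs_mult abs_triangle_ineq)
    also have "\<dots> \<le> \<bar>a\<bar> * (C * (SUP x. \<bar>\<phi> x\<bar>)) + \<bar>b\<bar> * (C' * (SUP x. \<bar>\<phi> x\<bar>))"
      by (intro add_mono mult_left_mono C C' \<phi>) auto
    finally show "\<bar>a * T \<phi> + b * S \<phi>\<bar> \<le> (\<bar>a\<bar> * C + \<bar>b\<bar> * C') * (SUP x. \<bar>\<phi> x\<bar>)"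
      by (simp add: algebra_simps)
  qed
  qed
  with off lin show ?thesis unfolding signed_radon_def mem_Collect_eq by (intro conjI)
qed

lemma pos_radon_lincomb:
  assumes T: "T \<in> pos_radon" and S: "S \<in> pos_radon" and "0 \<le> a" "0 \<le> b"
  shows "(\<lambda>\<phi>. a * T \<phi> + b * S \<phi>) \<in> pos_radon"
proof -
  have "0 \<le> a * T \<phi> + b * S \<phi>" if "\<forall>x. 0 \<le> \<phi> x" for \<phi>
    using pos_radon_nonneg[OF T, of \<phi>] pos_radon_nonneg[OF S, of \<phi>] assms that by simp
  then show ?thesis
    using signed_radon_lincomb[OF pos_radon_signed[OF T] pos_radon_signed[OF S]]
    unfolding pos_radon_def by blast
qed

section \<open>Measures and integrals of linear combinations\<close>

lemma emeasure_open_eq_SUP_below: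
  fixes T :: "('a::t2_space \<Rightarrow> real) \<Rightarrow> real"
  assumes lc: "lch TYPE('a)" and T: "T \<in> pos_radon" and M: "represents M T" and U: "open U"
  shows "emeasure M U = (SUP \<phi>\<in>below (indicator U). ennreal (T \<phi>))"
proof -
  have "{x. a < indicator U x} = (if a < 0 then UNIV else if a < 1 then U else {})" for a :: ennreal
    by (auto simp: indicator_def not_less)
  then have op: "open {x. a < (indicator U x :: ennreal)}" for a using U by simp
  show ?thesis using nn_integral_lsc[OF lc T M op] U by (simp add: representsD(1)[OF M])
qed

lemma emeasure_scaled_close:
  fixes a e :: real
  assumes M: "represents M T" and B: "B \<in> sets borel" and a: "0 \<le> a" and e: "0 < e"
    and fin: "ennreal a * emeasure M B < top"
  shows "\<exists>U. open U \<and> B \<subseteq> U \<and> ennreal a * emeasure M U \<le> ennreal a * emeasure M B + ennreal e"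
\<comment> \<open>For \<open>a = 0\<close> the measure of \<open>B\<close> may be infinite. The
  whole space then serves as \<open>U\<close>, since 0 times infinity is 0 in
  \<open>ennreal\<close>.\<close>
proof (cases "a = 0")
  case True
  then show ?thesis by (intro exI[of _ UNIV]) auto
next
  case False
  then have a: "0 < a" using a by simp
  then have "emeasure M B \<noteq> \<infinity>" using fin by (auto simp: ennreal_mult_less_top)
  then have "emeasure M B < emeasure M B + ennreal (e / a)" using a e by (simp add: less_top)
  then obtain U where U: "open U" "B \<subseteq> U" "emeasure M U < emeasure M B + ennreal (e / a)"
    using representsD(3)[OF M B] by (auto simp: INF_less_iff)
  have "ennreal a * emeasure M U \<le> ennreal a * (emeasure M B + ennreal (e / a))"
    using U(3) by (intro mult_left_mono) auto
  also have "\<dots> = ennreal a * emeasure M B + ennreal e"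
    using a e by (simp add: distrib_left flip: ennreal_mult)
  finally show ?thesis using U by blast
qed

text \<open>On open sets both sides are suprema over \<open>below (indicator U)\<close>, and
  directedness of that family allows the supremum of a sum to be split. For Borel sets each of the
  two measures supplies its own outer neighbourhood, and their intersection is close for
  both.\<close>

lemma emeasure_lincomb:
  fixes T S :: "('a::t2_space \<Rightarrow> real) \<Rightarrow> real"
  assumes lc: "lch TYPE('a)" and T: "T \<in> pos_radon" and S: "S \<in> pos_radon" and ab: "0 \<le> a" "0 \<le> b"
    and B: "B \<in> sets borel"
  shows "emeasure (borel_of (\<lambda>\<phi>. a * T \<phi> + b * S \<phi>)) B
    = ennreal a * emeasure (borel_of T) B + ennreal b * emeasure (borel_of S) B"
proof -
  define R where "R = (\<lambda>\<phi>. a * T \<phi> + b * S \<phi>)"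
  have R: "R \<in> pos_radon" unfolding R_def by (rule pos_radon_lincomb[OF T S ab])
  note rT = Riesz_Markov[OF lc T] and rS = Riesz_Markov[OF lc S] and rR = Riesz_Markov[OF lc R]
  have op: "emeasure (borel_of R) U = ennreal a * emeasure (borel_of T) U + ennreal b * emeasure (borel_of S) U"
    if U: "open U" for U
  proof -
    have "emeasure (borel_of R) U = (SUP \<phi>\<in>below (indicator U). ennreal (R \<phi>))"
      by (rule emeasure_open_eq_SUP_below[OF lc R rR U])
    also have "\<dots> = (SUP \<phi>\<in>below (indicator U). ennreal a * ennreal (T \<phi>) + ennreal b * ennreal (S \<phi>))"
    proof (rule SUP_cong)
      fix \<phi> :: "'a \<Rightarrow> real" assume "\<phi> \<in> below (indicator U)"
      then have "\<And>x. 0 \<le> \<phi> x" by (simp add: below_def)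
      then show "ennreal (R \<phi>) = ennreal a * ennreal (T \<phi>) + ennreal b * ennreal (S \<phi>)"
        using pos_radon_nonneg[OF T, of \<phi>] pos_radon_nonneg[OF S, of \<phi>] ab
        by (simp add: R_def ennreal_plus ennreal_mult)
    qed simp
    also have "\<dots> = (SUP \<phi>\<in>below (indicator U). ennreal a * ennreal (T \<phi>)) + (SUP \<phi>\<in>below (indicator U). ennreal b * ennreal (S \<phi>))"
    proof (rule SUP_add_directed_ennreal)
      fix f g :: "'a \<Rightarrow> real" assume f: "f \<in> below (indicator U)" and g: "g \<in> below (indicator U)"
      obtain k where k: "k \<in> below (indicator U)" "\<forall>x. f x \<le> k x" "\<forall>x. g x \<le> k x"
        using below_directed[OF f g] by blast
      have "T f \<le> T k" "S g \<le> S k"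
        using f g k by (auto intro!: pos_radon_mono[OF T] pos_radon_mono[OF S] simp: below_def)
      then show "\<exists>k\<in>below (indicator U). ennreal a * ennreal (T f) + ennreal b * ennreal (S g)
          \<le> ennreal a * ennreal (T k) + ennreal b * ennreal (S k)"
        using k(1) by (intro bexI[of _ k] add_mono mult_left_mono ennreal_leI) auto
    qed
    also have "\<dots> = ennreal a * emeasure (borel_of T) U + ennreal b * emeasure (borel_of S) U"
      unfolding emeasure_open_eq_SUP_below[OF lc T rT U] emeasure_open_eq_SUP_below[OF lc S rS U] SUP_mult_left_ennreal ..
    finally show ?thesis .
  qed
  show ?thesis unfolding R_def[symmetric]
  proof (rule antisym)
    show "ennreal a * emeasure (borel_of T) B + ennreal b * emeasure (borel_of S) B \<le> emeasure (borel_of R) B"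
      unfolding representsD(3)[OF rR B]
    proof (rule INF_greatest, safe)
      fix U assume U: "open U" "B \<subseteq> U"
      show "ennreal a * emeasure (borel_of T) B + ennreal b * emeasure (borel_of S) B \<le> emeasure (borel_of R) U"
        unfolding op[OF U(1)] using U
        by (intro add_mono mult_left_mono emeasure_mono) (auto simp: representsD(1)[OF rT] representsD(1)[OF rS])
    qed
    show "emeasure (borel_of R) B \<le> ennreal a * emeasure (borel_of T) B + ennreal b * emeasure (borel_of S) B"
    proof (rule ennreal_le_epsilon)
      fix e :: real assume e: "0 < e"
        and fin: "ennreal a * emeasure (borel_of T) B + ennreal b * emeasure (borel_of S) B < top"
      obtain U where U: "open U" "B \<subseteq> U" "ennreal a * emeasure (borel_of T) U \<le> ennreal a * emeasure (borel_of T) B + ennreal (e/2)"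
        using emeasure_scaled_close[OF rT B ab(1), of "e/2"] e fin by auto
      obtain V where V: "open V" "B \<subseteq> V" "ennreal b * emeasure (borel_of S) V \<le> ennreal b * emeasure (borel_of S) B + ennreal (e/2)"
        using emeasure_scaled_close[OF rS B ab(2), of "e/2"] e fin by auto
      have "emeasure (borel_of R) B \<le> emeasure (borel_of R) (U \<inter> V)"
        using U V by (intro emeasure_mono) (auto simp: representsD(1)[OF rR])
      also have "\<dots> = ennreal a * emeasure (borel_of T) (U \<inter> V) + ennreal b * emeasure (borel_of S) (U \<inter> V)"
        using U V by (intro op) auto
      also have "\<dots> \<le> ennreal a * emeasure (borel_of T) U + ennreal b * emeasure (borel_of S) V"
        using U V by (intro add_mono mult_left_mono emeasure_mono) (auto simp: representsD(1)[OF rT] representsD(1)[OF rS])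
      also have "\<dots> \<le> (ennreal a * emeasure (borel_of T) B + ennreal (e/2)) + (ennreal b * emeasure (borel_of S) B + ennreal (e/2))"
        by (intro add_mono U V)
      also have "\<dots> = ennreal a * emeasure (borel_of T) B + ennreal b * emeasure (borel_of S) B + (ennreal (e/2) + ennreal (e/2))"
        by (simp add: ac_simps)
      also have "ennreal (e/2) + ennreal (e/2) = ennreal e" using e by (simp flip: ennreal_plus)
      finally show "emeasure (borel_of R) B \<le> ennreal a * emeasure (borel_of T) B + ennreal b * emeasure (borel_of S) B + ennreal e" .
    qed
  qed
qed

lemma nn_integral_emeasure_lincomb:
  assumes sets: "sets N = sets M" "sets L = sets M"
    and em: "\<And>B. B \<in> sets M \<Longrightarrow> emeasure L B = a * emeasure M B + b * emeasure N B"
    and g: "g \<in> borel_measurable M"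
  shows "(\<integral>\<^sup>+x. g x \<partial>L) = a * (\<integral>\<^sup>+x. g x \<partial>M) + b * (\<integral>\<^sup>+x. g x \<partial>N)"
  using g
proof (induct rule: borel_measurable_induct)
  case (cong f g)
  have "space L = space M" "space N = space M" using sets by (auto dest: sets_eq_imp_space_eq)
  then have "integral\<^sup>N L f = integral\<^sup>N L g" "integral\<^sup>N M f = integral\<^sup>N M g" "integral\<^sup>N N f = integral\<^sup>N N g"
    using cong(3) by (auto intro!: nn_integral_cong)
  then show ?case using cong(4) by simp
next
  case (set A)
  then show ?case using em sets by simp
next
  case (mult u c)
  then show ?case
    using sets by (simp add: nn_integral_cmult distrib_left mult.left_commute cong: measurable_cong_sets)
next
  case (add u v)
  then show ?case
    using sets by (simp add: nn_integral_add distrib_left ac_simps cong: measurable_cong_sets)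
next
  case (seq U)
  have m: "U i \<in> borel_measurable N" "U i \<in> borel_measurable L" for i
    using seq(1)[of i] sets by (simp_all cong: measurable_cong_sets)
  have inc: "incseq (\<lambda>i. integral\<^sup>N K (U i))" for K :: "'a measure"
    using seq(4) by (auto simp: incseq_def le_fun_def intro!: nn_integral_mono)
  have "(\<integral>\<^sup>+x. (SUP i. U i) x \<partial>K) = (SUP i. integral\<^sup>N K (U i))" if "\<And>i. U i \<in> borel_measurable K" for K
    using nn_integral_monotone_convergence_SUP[OF seq(4) that] by (simp add: image_comp)
  then have *: "(\<integral>\<^sup>+x. (SUP i. U i) x \<partial>M) = (SUP i. integral\<^sup>N M (U i))"
     "(\<integral>\<^sup>+x. (SUP i. U i) x \<partial>N) = (SUP i. integral\<^sup>N N (U i))"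
     "(\<integral>\<^sup>+x. (SUP i. U i) x \<partial>L) = (SUP i. integral\<^sup>N L (U i))"
    using m seq(1) by blast+
  have "(SUP i. integral\<^sup>N L (U i)) = (SUP i. a * integral\<^sup>N M (U i) + b * integral\<^sup>N N (U i))"
    using seq(3) by simp
  also have "\<dots> = (SUP i. a * integral\<^sup>N M (U i)) + (SUP i. b * integral\<^sup>N N (U i))"
    using inc[of M] inc[of N] by (intro ennreal_SUP_add) (auto simp: incseq_def intro!: mult_left_mono)
  finally show ?case unfolding * SUP_mult_left_ennreal .
qed

lemma nn_integral_lincomb:
  fixes T S :: "('a::t2_space \<Rightarrow> real) \<Rightarrow> real"
  assumes lc: "lch TYPE('a)" and T: "T \<in> pos_radon" and S: "S \<in> pos_radon" and ab: "0 \<le> a" "0 \<le> b"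
    and g: "g \<in> borel_measurable borel"
  shows "(\<integral>\<^sup>+x. g x \<partial>borel_of (\<lambda>\<phi>. a * T \<phi> + b * S \<phi>))
    = ennreal a * (\<integral>\<^sup>+x. g x \<partial>borel_of T) + ennreal b * (\<integral>\<^sup>+x. g x \<partial>borel_of S)"
proof (rule nn_integral_emeasure_lincomb)
  show "emeasure (borel_of (\<lambda>\<phi>. a * T \<phi> + b * S \<phi>)) B
    = ennreal a * emeasure (borel_of T) B + ennreal b * emeasure (borel_of S) B" if "B \<in> sets (borel_of T)" for B
    using that representsD(1)[OF Riesz_Markov[OF lc T]] by (intro emeasure_lincomb[OF lc T S ab]) simp
qed (use g in \<open>simp_all add: representsD(1)[OF Riesz_Markov[OF lc T]] representsD(1)[OF Riesz_Markov[OF lc S]]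
    representsD(1)[OF Riesz_Markov[OF lc pos_radon_lincomb[OF T S ab]]] cong: measurable_cong_sets\<close>)

text \<open>Regularity is inherited under domination: the differences \<open>U - B\<close> and
  \<open>U - K\<close> in outer and inner approximation are small for \<open>M\<close>, hence for
  \<open>N\<close>. This identifies restrictions of a unit measure with the representatives of their
  own functionals.\<close>

lemma represents_dominated:
  fixes T :: "('a::t2_space \<Rightarrow> real) \<Rightarrow> real"
  assumes lc: "lch TYPE('a)" and M: "represents M T" and fin: "emeasure M UNIV < top"
    and sN: "sets N = sets borel" and c: "0 \<le> c"
    and dom: "\<And>B. B \<in> sets borel \<Longrightarrow> emeasure N B \<le> ennreal c * emeasure M B"
  defines "S \<equiv> (\<lambda>\<phi>. if \<phi> \<in> Cc then LINT x|N. \<phi> x else 0)"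
  shows "S \<in> pos_radon" "represents N S"
proof -
  have finM: "emeasure M B < top" if "B \<in> sets borel" for B
    using fin emeasure_mono[of B UNIV M] representsD(1)[OF M] by (simp add: le_less_trans)
  have finN: "emeasure N B < top" if "B \<in> sets borel" for B
    using dom[OF that] finM[OF that] c by (meson ennreal_less_top ennreal_mult_less_top le_less_trans)
  have iCc: "integrable N \<phi>" if "\<phi> \<in> Cc" for \<phi> :: "'a \<Rightarrow> real"
    using finN by (intro integrable_Cc[OF sN _ that]) (simp add: compact_imp_closed)
  show "S \<in> pos_radon"
  proof (rule positive_functional_is_radon[OF lc])
    show "S \<phi> = 0" if "\<phi> \<notin> Cc" for \<phi> using that by (simp add: S_def)
    show "S (\<lambda>x. a * \<phi> x + b * \<psi> x) = a * S \<phi> + b * S \<psi>" if "\<phi> \<in> Cc" "\<psi> \<in> Cc" for \<phi> \<psi> a b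
      using that iCc by (simp add: S_def Cc_lincomb)
    show "0 \<le> S \<phi>" if "\<phi> \<in> Cc" "\<And>x. 0 \<le> \<phi> x" for \<phi>
      using that by (simp add: S_def integral_nonneg_AE)
  qed
  have small: "\<exists>d>0. ennreal c * ennreal d \<le> ennreal e" if "0 < e" for e
    using that c by (intro exI[of _ "e / (c + 1)"]) (auto simp: field_simps simp flip: ennreal_mult intro!: ennreal_leI)
  show "represents N S"
    unfolding represents_def
  proof (intro conjI allI impI ballI)
    show "sets N = sets borel" by (rule sN)
    show "emeasure N K < \<infinity>" if "compact K" for K using finN[of K] that by (simp add: compact_imp_closed)
    show "S \<phi> = (LINT x|N. \<phi> x)" if "\<phi> \<in> Cc" for \<phi> using that by (simp add: S_def)
    show "emeasure N B = (INF U\<in>{U. open U \<and> B \<subseteq> U}. emeasure N U)" if B: "B \<in> sets borel" for B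
    proof (rule antisym)
      show "emeasure N B \<le> (INF U\<in>{U. open U \<and> B \<subseteq> U}. emeasure N U)"
        using B by (intro INF_greatest emeasure_mono) (auto simp: sN)
      show "(INF U\<in>{U. open U \<and> B \<subseteq> U}. emeasure N U) \<le> emeasure N B"
      proof (rule ennreal_le_epsilon)
        fix e :: real assume "0 < e"
        then obtain d where d: "0 < d" "ennreal c * ennreal d \<le> ennreal e" using small by blast
        have "emeasure M B < emeasure M B + ennreal d" using finM[OF B] d by simp
        then obtain U where U: "open U" "B \<subseteq> U" "emeasure M U < emeasure M B + ennreal d"
          using representsD(3)[OF M B] by (auto simp: INF_less_iff)
        have "emeasure M (U - B) = emeasure M U - emeasure M B"
          using U B finM[OF B] by (intro emeasure_Diff) (auto simp: representsD(1)[OF M] less_top)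
        also have "\<dots> \<le> ennreal d"
          using less_imp_le[OF U(3)] finM[OF B] by (auto simp: ennreal_minus_le_iff)
        finally have "emeasure N (U - B) \<le> ennreal c * ennreal d"
          using dom[of "U - B"] U(1) B by (meson borel_open sets.Diff mult_left_mono order_trans zero_le)
        have "(INF U\<in>{U. open U \<and> B \<subseteq> U}. emeasure N U) \<le> emeasure N U"
          using U by (intro INF_lower) auto
        also have "\<dots> = emeasure N (B \<union> (U - B))" using U(2) by (simp add: Un_absorb1)
        also have "\<dots> \<le> emeasure N B + emeasure N (U - B)"
          using U B by (intro emeasure_subadditive) (auto simp: sN)
        also have "\<dots> \<le> emeasure N B + ennreal e"
          using \<open>emeasure N (U - B) \<le> ennreal c * ennreal d\<close> d by (intro add_left_mono) (rule order_trans)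
        finally show "(INF U\<in>{U. open U \<and> B \<subseteq> U}. emeasure N U) \<le> emeasure N B + ennreal e" .
      qed
    qed
    show "emeasure N U = (SUP K\<in>{K. compact K \<and> K \<subseteq> U}. emeasure N K)" if U: "open U" for U
    proof (rule antisym)
      show "(SUP K\<in>{K. compact K \<and> K \<subseteq> U}. emeasure N K) \<le> emeasure N U"
        using U by (intro SUP_least emeasure_mono) (auto simp: sN)
      show "emeasure N U \<le> (SUP K\<in>{K. compact K \<and> K \<subseteq> U}. emeasure N K)"
      proof (rule ennreal_le_epsilon)
        fix e :: real assume "0 < e"
        then obtain d where d: "0 < d" "ennreal c * ennreal d \<le> ennreal e" using small by blast
        obtain K where K: "compact K" "K \<subseteq> U" "emeasure M U \<le> emeasure M K + ennreal d"
        \<comment> \<open>If \<open>U\<close> has measure 0 there is no smaller value to approximate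
          from, and the empty set serves as \<open>K\<close>.\<close>
        proof (cases "emeasure M U = 0")
          case True
          then show ?thesis using that[of "{}"] by simp
        next
          case False
          then have 1: "emeasure M U - ennreal d < emeasure M U"
            using d finM[of U] U by (intro ennreal_between) (auto simp: less_top zero_less_iff_neq_zero)
          obtain K where K: "compact K" "K \<subseteq> U" "emeasure M U - ennreal d < emeasure M K"
            using 1[unfolded representsD(4)[OF M U]] representsD(4)[OF M U] by (auto simp: less_SUP_iff)
          then have "emeasure M U \<le> ennreal d + emeasure M K"
            using less_imp_le[OF K(3)] by (simp add: ennreal_minus_le_iff)
          then show ?thesis using that[of K] K by (simp add: add.commute)
        qed
        have Kb: "K \<in> sets borel" using K(1) by (simp add: compact_imp_closed)
        have "emeasure M (U - K) = emeasure M U - emeasure M K"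
          using U K Kb finM[OF Kb] by (intro emeasure_Diff) (auto simp: representsD(1)[OF M] less_top)
        also have "\<dots> \<le> ennreal d"
          using K(3) finM[OF Kb] by (auto simp: ennreal_minus_le_iff)
        finally have "emeasure N (U - K) \<le> ennreal c * ennreal d"
          using dom[of "U - K"] U Kb by (meson borel_open sets.Diff mult_left_mono order_trans zero_le)
        have "emeasure N U = emeasure N (K \<union> (U - K))" using K(2) by (simp add: Un_absorb1)
        also have "\<dots> \<le> emeasure N K + emeasure N (U - K)"
          using U Kb by (intro emeasure_subadditive) (auto simp: sN)
        also have "\<dots> \<le> (SUP K\<in>{K. compact K \<and> K \<subseteq> U}. emeasure N K) + ennreal e"
          using \<open>emeasure N (U - K) \<le> ennreal c * ennreal d\<close> d K by (intro add_mono SUP_upper) auto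
        finally show "emeasure N U \<le> (SUP K\<in>{K. compact K \<and> K \<subseteq> U}. emeasure N K) + ennreal e" .
      qed
    qed
  qed
qed

section \<open>Jordan decomposition\<close>

text \<open>One of the two suprema in \<open>pos_part\<close>. It is studied on nonnegative
  functions, where it is additive and positively homogeneous; \<open>pos_part\<close> is its linear
  extension.\<close>

definition order_sup :: "(('a::t2_space \<Rightarrow> real) \<Rightarrow> real) \<Rightarrow> ('a \<Rightarrow> real) \<Rightarrow> real" where
  "order_sup W \<phi> = Sup {W \<eta> |\<eta>. \<eta> \<in> Cc \<and> (\<forall>x. 0 \<le> \<eta> x \<and> \<eta> x \<le> \<phi> x)}"

lemma pos_part_eq:
  "pos_part W \<phi> = (if \<phi> \<in> Cc then order_sup W (\<lambda>x. max 0 (\<phi> x)) - order_sup W (\<lambda>x. max 0 (- \<phi> x)) else 0)"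
  by (simp add: pos_part_def order_sup_def)

text \<open>The bound in a form for use: any \<open>B\<close> may replace the supremum norm, and the
  constant is positive so that one may divide by it.\<close>

lemma signed_radon_bound:
  assumes "W \<in> signed_radon" "compact K"
  obtains C where "0 < C"
    "\<And>\<eta> B. \<eta> \<in> Cc \<Longrightarrow> (\<And>x. x \<notin> K \<Longrightarrow> \<eta> x = 0) \<Longrightarrow> (\<And>x. \<bar>\<eta> x\<bar> \<le> B) \<Longrightarrow> \<bar>W \<eta>\<bar> \<le> C * B"
proof -
  obtain C where C: "\<forall>\<phi>\<in>Cc. {x. \<phi> x \<noteq> 0} \<subseteq> K \<longrightarrow> \<bar>W \<phi>\<bar> \<le> C * (SUP x. \<bar>\<phi> x\<bar>)"
    using assms(1)[unfolded signed_radon_def mem_Collect_eq, THEN conjunct2, THEN conjunct2, rule_format, OF assms(2)]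
    by blast
  have "\<bar>W \<eta>\<bar> \<le> (\<bar>C\<bar> + 1) * B"
    if \<eta>: "\<eta> \<in> Cc" "\<And>x. x \<notin> K \<Longrightarrow> \<eta> x = 0" and B: "\<And>x. \<bar>\<eta> x\<bar> \<le> B" for \<eta> B
  proof -
    have "\<bar>W \<eta>\<bar> \<le> C * (SUP x. \<bar>\<eta> x\<bar>)"
      using C \<eta>(1) \<eta>(2) by (metis (mono_tags, lifting) mem_Collect_eq subsetI)
    also have "\<dots> \<le> (\<bar>C\<bar> + 1) * (SUP x. \<bar>\<eta> x\<bar>)"
      using abs_le_SUP_Cc[OF \<eta>(1), of undefined] by (intro mult_right_mono) auto
    also have "\<dots> \<le> (\<bar>C\<bar> + 1) * B"
      by (intro mult_left_mono cSUP_least B) auto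
    finally show ?thesis .
  qed
  then show ?thesis by (intro that[of "\<bar>C\<bar> + 1"]) auto
qed

lemma order_sup_bdd:
  assumes W: "W \<in> signed_radon" and \<phi>: "\<phi> \<in> Cc"
  shows "bdd_above {W \<eta> |\<eta>. \<eta> \<in> Cc \<and> (\<forall>x. 0 \<le> \<eta> x \<and> \<eta> x \<le> \<phi> x)}"
proof -
  obtain B where B: "\<And>x. \<bar>\<phi> x\<bar> \<le> B" using Cc_bounded[OF \<phi>] by metis
  obtain C where C: "\<And>\<eta> B. \<eta> \<in> Cc \<Longrightarrow> (\<And>x. x \<notin> closure {x. \<phi> x \<noteq> 0} \<Longrightarrow> \<eta> x = 0) \<Longrightarrow> (\<And>x. \<bar>\<eta> x\<bar> \<le> B) \<Longrightarrow> \<bar>W \<eta>\<bar> \<le> C * B"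
    using signed_radon_bound[OF W Cc_support[OF \<phi>]] by metis
  have "W \<eta> \<le> C * B" if \<eta>: "\<eta> \<in> Cc" "\<forall>x. 0 \<le> \<eta> x \<and> \<eta> x \<le> \<phi> x" for \<eta>
  proof -
    have "\<eta> x = 0" if "x \<notin> closure {x. \<phi> x \<noteq> 0}" for x
      using not_in_support[OF that] \<eta>(2) by (metis order_antisym)
    moreover have "\<bar>\<eta> x\<bar> \<le> B" for x using \<eta>(2) B[of x] by (smt (verit))
    ultimately have "\<bar>W \<eta>\<bar> \<le> C * B" by (rule C[OF \<eta>(1)])
    then show ?thesis by simp
  qed
  then show ?thesis by (intro bdd_aboveI[of _ "C * B"]) blast
qed

lemma order_sup_upper:
  assumes "W \<in> signed_radon" "\<phi> \<in> Cc" "\<eta> \<in> Cc" "\<And>x. 0 \<le> \<eta> x" "\<And>x. \<eta> x \<le> \<phi> x"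
  shows "W \<eta> \<le> order_sup W \<phi>"
  unfolding order_sup_def using assms by (intro cSup_upper order_sup_bdd) blast+

lemma order_sup_least:
  assumes "\<And>x. 0 \<le> \<phi> x"
    and "\<And>\<eta>. \<eta> \<in> Cc \<Longrightarrow> (\<And>x. 0 \<le> \<eta> x) \<Longrightarrow> (\<And>x. \<eta> x \<le> \<phi> x) \<Longrightarrow> W \<eta> \<le> c"
  shows "order_sup W \<phi> \<le> c"
  unfolding order_sup_def
proof (rule cSup_least)
  show "{W \<eta> |\<eta>. \<eta> \<in> Cc \<and> (\<forall>x. 0 \<le> \<eta> x \<and> \<eta> x \<le> \<phi> x)} \<noteq> {}" using assms(1) Cc_zero by blast
next
  fix r assume "r \<in> {W \<eta> |\<eta>. \<eta> \<in> Cc \<and> (\<forall>x. 0 \<le> \<eta> x \<and> \<eta> x \<le> \<phi> x)}"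
  then obtain \<eta> where "r = W \<eta>" "\<eta> \<in> Cc" "\<forall>x. 0 \<le> \<eta> x \<and> \<eta> x \<le> \<phi> x" by blast
  then show "r \<le> c" using assms(2)[of \<eta>] by simp
qed

text \<open>Riesz decomposition: a competitor \<eta> for the sum splits into
  \<open>min (\<eta> x) (\<phi> x)\<close>, which competes for \<phi>, and the remainder, which
  competes for \<psi>. Conversely, sums of competitors compete for the sum.\<close>

lemma order_sup_add:
  assumes W: "W \<in> signed_radon" and \<phi>: "\<phi> \<in> Cc" "\<And>x. 0 \<le> \<phi> x" and \<psi>: "\<psi> \<in> Cc" "\<And>x. 0 \<le> \<psi> x"
  shows "order_sup W (\<lambda>x. \<phi> x + \<psi> x) = order_sup W \<phi> + order_sup W \<psi>"
proof (rule antisym)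
  show "order_sup W (\<lambda>x. \<phi> x + \<psi> x) \<le> order_sup W \<phi> + order_sup W \<psi>"
  proof (rule order_sup_least)
    fix \<eta> assume \<eta>: "\<eta> \<in> Cc" "\<And>x. 0 \<le> \<eta> x" "\<And>x. \<eta> x \<le> \<phi> x + \<psi> x"
    define \<eta>1 where "\<eta>1 x = min (\<eta> x) (\<phi> x)" for x
    have 1: "\<eta>1 \<in> Cc" "\<And>x. 0 \<le> \<eta>1 x" "\<And>x. \<eta>1 x \<le> \<phi> x"
      unfolding \<eta>1_def using \<eta> \<phi> by (auto intro: Cc_min)
    have 2: "(\<lambda>x. \<eta> x - \<eta>1 x) \<in> Cc" by (rule Cc_diff[OF \<eta>(1) 1(1)])
    have "W \<eta> = W \<eta>1 + W (\<lambda>x. \<eta> x - \<eta>1 x)" using radon_diff[OF W \<eta>(1) 1(1)] by simp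
    also have "\<dots> \<le> order_sup W \<phi> + order_sup W \<psi>"
    proof (intro add_mono order_sup_upper W \<phi>(1) \<psi>(1) 1 2)
      show "0 \<le> \<eta> x - \<eta>1 x" "\<eta> x - \<eta>1 x \<le> \<psi> x" for x
        using \<eta>(3)[of x] \<psi>(2)[of x] by (auto simp: \<eta>1_def min_def)
    qed
    finally show "W \<eta> \<le> order_sup W \<phi> + order_sup W \<psi>" .
  qed (use \<phi> \<psi> in auto)
  have "order_sup W \<psi> \<le> order_sup W (\<lambda>x. \<phi> x + \<psi> x) - order_sup W \<phi>"
  proof (rule order_sup_least[OF \<psi>(2)])
    fix \<eta>2 assume 2: "\<eta>2 \<in> Cc" "\<And>x. 0 \<le> \<eta>2 x" "\<And>x. \<eta>2 x \<le> \<psi> x"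
    have "order_sup W \<phi> \<le> order_sup W (\<lambda>x. \<phi> x + \<psi> x) - W \<eta>2"
    proof (rule order_sup_least[OF \<phi>(2)])
      fix \<eta>1 assume 1: "\<eta>1 \<in> Cc" "\<And>x. 0 \<le> \<eta>1 x" "\<And>x. \<eta>1 x \<le> \<phi> x"
      have "W (\<lambda>x. \<eta>1 x + \<eta>2 x) \<le> order_sup W (\<lambda>x. \<phi> x + \<psi> x)"
        by (intro order_sup_upper W Cc_add \<phi>(1) \<psi>(1) 1(1) 2(1) add_nonneg_nonneg add_mono 1 2)
      then show "W \<eta>1 \<le> order_sup W (\<lambda>x. \<phi> x + \<psi> x) - W \<eta>2"
        using radon_add[OF W 1(1) 2(1)] by simp
    qed
    then show "W \<eta>2 \<le> order_sup W (\<lambda>x. \<phi> x + \<psi> x) - order_sup W \<phi>" by simp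
  qed
  then show "order_sup W \<phi> + order_sup W \<psi> \<le> order_sup W (\<lambda>x. \<phi> x + \<psi> x)" by simp
qed

lemma order_sup_zero:
  assumes "W \<in> signed_radon"
  shows "order_sup W (\<lambda>x. 0) = 0"
  using order_sup_add[OF assms Cc_zero _ Cc_zero] by simp

lemma order_sup_scale:
  assumes W: "W \<in> signed_radon" and \<phi>: "\<phi> \<in> Cc" "\<And>x. 0 \<le> \<phi> x" and a: "0 \<le> a"
  shows "order_sup W (\<lambda>x. a * \<phi> x) = a * order_sup W \<phi>"
proof (cases "a = 0")
  case True
  then show ?thesis by (simp add: order_sup_zero[OF W])
next
  case False
  have le: "order_sup W (\<lambda>x. b * \<psi> x) \<le> b * order_sup W \<psi>"
    if b: "0 < b" and \<psi>: "\<psi> \<in> Cc" "\<And>x. 0 \<le> \<psi> x" for b \<psi>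
  proof (rule order_sup_least)
    fix \<eta> assume \<eta>: "\<eta> \<in> Cc" "\<And>x. 0 \<le> \<eta> x" "\<And>x. \<eta> x \<le> b * \<psi> x"
    have "W (\<lambda>x. (1 / b) * \<eta> x) \<le> order_sup W \<psi>"
      using b \<eta> by (intro order_sup_upper W Cc_scale \<psi>) (auto simp: field_simps)
    then have "(1 / b) * W \<eta> \<le> order_sup W \<psi>" unfolding radon_scale[OF W \<eta>(1)] .
    then show "W \<eta> \<le> b * order_sup W \<psi>" using b by (simp add: field_simps)
  qed (use b \<psi> in auto)
  have a: "0 < a" using False a by simp
  have "order_sup W (\<lambda>x. (1 / a) * (a * \<phi> x)) \<le> (1 / a) * order_sup W (\<lambda>x. a * \<phi> x)"
    using a \<phi> by (intro le Cc_scale) auto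
  then have "a * order_sup W \<phi> \<le> order_sup W (\<lambda>x. a * \<phi> x)"
    using a by (simp add: field_simps)
  then show ?thesis using le[OF a \<phi>] by simp
qed

text \<open>The value of the linear extension does not depend on how a function is written as a
  difference of nonnegative ones. Linearity of \<open>pos_part\<close> is then read off from
  convenient representations.\<close>

lemma pos_part_diff:
  assumes W: "W \<in> signed_radon" and u: "u \<in> Cc" "\<And>x. 0 \<le> u x" and v: "v \<in> Cc" "\<And>x. 0 \<le> v x"
  shows "pos_part W (\<lambda>x. u x - v x) = order_sup W u - order_sup W v"
proof -
  let ?p = "\<lambda>x. max 0 (u x - v x)" and ?n = "\<lambda>x. max 0 (- (u x - v x))"
  have pn: "?p \<in> Cc" "?n \<in> Cc"
    by (intro Cc_max[OF Cc_zero] Cc_diff u v, intro Cc_max[OF Cc_zero] Cc_uminus Cc_diff u v)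
  have "(\<lambda>x. ?p x + v x) = (\<lambda>x. ?n x + u x)" by auto
  then have "order_sup W ?p + order_sup W v = order_sup W ?n + order_sup W u"
    using order_sup_add[OF W pn(1) _ v] order_sup_add[OF W pn(2) _ u] by simp
  then show ?thesis using Cc_diff[OF u(1) v(1)] by (simp add: pos_part_eq)
qed

lemma pos_part_nonneg:
  assumes W: "W \<in> signed_radon" and \<phi>: "\<phi> \<in> Cc" "\<And>x. 0 \<le> \<phi> x"
  shows "pos_part W \<phi> = order_sup W \<phi>"
  using pos_part_diff[OF W \<phi> Cc_zero] by (simp add: order_sup_zero[OF W])

lemma pos_part_pos_radon:
  fixes W :: "('a::t2_space \<Rightarrow> real) \<Rightarrow> real"
  assumes lc: "lch TYPE('a)" and W: "W \<in> signed_radon"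
  shows "pos_part W \<in> pos_radon"
proof (rule positive_functional_is_radon[OF lc])
  show "pos_part W \<phi> = 0" if "\<phi> \<notin> Cc" for \<phi> using that by (simp add: pos_part_eq)
  have pm: "(\<lambda>x. max 0 (\<phi> x)) \<in> Cc" "(\<lambda>x. max 0 (- \<phi> x)) \<in> Cc" if "\<phi> \<in> Cc" for \<phi> :: "'a \<Rightarrow> real"
    using that by (auto intro: Cc_max[OF Cc_zero] Cc_uminus)
  have add: "pos_part W (\<lambda>x. \<phi> x + \<psi> x) = pos_part W \<phi> + pos_part W \<psi>" if \<phi>: "\<phi> \<in> Cc" and \<psi>: "\<psi> \<in> Cc" for \<phi> \<psi>
  proof -
    have "(\<lambda>x. \<phi> x + \<psi> x) = (\<lambda>x. (max 0 (\<phi> x) + max 0 (\<psi> x)) - (max 0 (- \<phi> x) + max 0 (- \<psi> x)))" by auto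
    then have "pos_part W (\<lambda>x. \<phi> x + \<psi> x) = order_sup W (\<lambda>x. max 0 (\<phi> x) + max 0 (\<psi> x)) - order_sup W (\<lambda>x. max 0 (- \<phi> x) + max 0 (- \<psi> x))"
      using pos_part_diff[OF W Cc_add[OF pm(1)[OF \<phi>] pm(1)[OF \<psi>]] _ Cc_add[OF pm(2)[OF \<phi>] pm(2)[OF \<psi>]]] by simp
    also have "\<dots> = pos_part W \<phi> + pos_part W \<psi>"
      using \<phi> \<psi> by (simp add: order_sup_add[OF W pm(1)[OF \<phi>] _ pm(1)[OF \<psi>]] order_sup_add[OF W pm(2)[OF \<phi>] _ pm(2)[OF \<psi>]] pos_part_eq)
    finally show ?thesis .
  qed
  have scale: "pos_part W (\<lambda>x. a * \<phi> x) = a * pos_part W \<phi>" if \<phi>: "\<phi> \<in> Cc" for a \<phi>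
  proof (cases "0 \<le> a")
    case True
    have "(\<lambda>x. a * \<phi> x) = (\<lambda>x. a * max 0 (\<phi> x) - a * max 0 (- \<phi> x))"
      by (auto simp: max_def)
    then have "pos_part W (\<lambda>x. a * \<phi> x) = order_sup W (\<lambda>x. a * max 0 (\<phi> x)) - order_sup W (\<lambda>x. a * max 0 (- \<phi> x))"
      using pos_part_diff[OF W Cc_scale[OF pm(1)[OF \<phi>]] _ Cc_scale[OF pm(2)[OF \<phi>]], of a a] True by simp
    then show ?thesis
      using order_sup_scale[OF W pm(1)[OF \<phi>] _ True] order_sup_scale[OF W pm(2)[OF \<phi>] _ True] \<phi>
      by (simp add: pos_part_eq right_diff_distrib)
  next
    case False
    then have a: "0 \<le> - a" by simp
    have "(\<lambda>x. a * \<phi> x) = (\<lambda>x. (- a) * max 0 (- \<phi> x) - (- a) * max 0 (\<phi> x))"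
      by (auto simp: max_def)
    then have "pos_part W (\<lambda>x. a * \<phi> x) = order_sup W (\<lambda>x. (- a) * max 0 (- \<phi> x)) - order_sup W (\<lambda>x. (- a) * max 0 (\<phi> x))"
      using pos_part_diff[OF W Cc_scale[OF pm(2)[OF \<phi>]] _ Cc_scale[OF pm(1)[OF \<phi>]], of "- a" "- a"] a by (simp add: mult_nonpos_nonneg)
    then show ?thesis
      unfolding order_sup_scale[OF W pm(1)[OF \<phi>] max.cobounded1 a] order_sup_scale[OF W pm(2)[OF \<phi>] max.cobounded1 a]
      using \<phi> by (simp add: pos_part_eq algebra_simps)
  qed
  show "pos_part W (\<lambda>x. a * \<phi> x + b * \<psi> x) = a * pos_part W \<phi> + b * pos_part W \<psi>"
    if "\<phi> \<in> Cc" "\<psi> \<in> Cc" for \<phi> \<psi> a b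
    using that by (simp add: add Cc_scale scale)
  show "0 \<le> pos_part W \<phi>" if \<phi>: "\<phi> \<in> Cc" "\<And>x. 0 \<le> \<phi> x" for \<phi>
    unfolding pos_part_nonneg[OF W \<phi>]
    using order_sup_upper[OF W \<phi>(1) Cc_zero _ \<phi>(2)] radon_zero[OF W] by simp
qed

lemma signed_radon_uminus: "W \<in> signed_radon \<Longrightarrow> (\<lambda>\<phi>. - W \<phi>) \<in> signed_radon"
  using signed_radon_lincomb[of W W "-1" 0] by simp

lemma neg_part_pos_radon:
  fixes W :: "('a::t2_space \<Rightarrow> real) \<Rightarrow> real"
  assumes "lch TYPE('a)" "W \<in> signed_radon"
  shows "neg_part W \<in> pos_radon"
  unfolding neg_part_def by (intro pos_part_pos_radon assms signed_radon_uminus)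

lemma signed_radon_eqI:
  assumes T: "T \<in> signed_radon" and S: "S \<in> signed_radon"
    and eq: "\<And>\<phi>. \<phi> \<in> Cc \<Longrightarrow> (\<And>x. 0 \<le> \<phi> x) \<Longrightarrow> T \<phi> = S \<phi>"
  shows "T = S"
proof
  fix \<phi> show "T \<phi> = S \<phi>"
  proof (cases "\<phi> \<in> Cc")
    case True
    let ?p = "\<lambda>x. max 0 (\<phi> x)" and ?n = "\<lambda>x. max 0 (- \<phi> x)"
    have pn: "?p \<in> Cc" "?n \<in> Cc" using True by (auto intro: Cc_max[OF Cc_zero] Cc_uminus)
    have "\<phi> = (\<lambda>x. ?p x - ?n x)" by auto
    moreover have "T (\<lambda>x. ?p x - ?n x) = S (\<lambda>x. ?p x - ?n x)"
      unfolding radon_diff[OF T pn] radon_diff[OF S pn] using eq[OF pn(1)] eq[OF pn(2)] by simp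
    ultimately show ?thesis by simp
  qed (simp add: radon_off_Cc[OF T] radon_off_Cc[OF S])
qed

text \<open>The substitution of \<open>\<phi> - \<eta>\<close> for \<eta> exchanges the competitors
  for \<open>W\<close> and for \<open>- W\<close> and shifts the values by \<open>W \<phi>\<close>,
  so the two suprema differ by exactly \<open>W \<phi>\<close>.\<close>

lemma Jordan_decomposition:
  fixes W :: "('a::t2_space \<Rightarrow> real) \<Rightarrow> real"
  assumes lc: "lch TYPE('a)" and W: "W \<in> signed_radon"
  shows "W = (\<lambda>\<phi>. pos_part W \<phi> - neg_part W \<phi>)"
proof (rule signed_radon_eqI[OF W])
  note P = pos_part_pos_radon[OF lc W, THEN pos_radon_signed] and N = neg_part_pos_radon[OF lc W, THEN pos_radon_signed]
  show "(\<lambda>\<phi>. pos_part W \<phi> - neg_part W \<phi>) \<in> signed_radon"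
    using signed_radon_lincomb[OF P N, of 1 "-1"] by simp
  fix \<phi> :: "'a \<Rightarrow> real" assume \<phi>: "\<phi> \<in> Cc" "\<And>x. 0 \<le> \<phi> x"
  let ?V = "\<lambda>\<phi>. - W \<phi>"
  note V = signed_radon_uminus[OF W]
  have "order_sup ?V \<phi> \<le> order_sup W \<phi> - W \<phi>"
  proof (rule order_sup_least[OF \<phi>(2)])
    fix \<eta> assume \<eta>: "\<eta> \<in> Cc" "\<And>x. 0 \<le> \<eta> x" "\<And>x. \<eta> x \<le> \<phi> x"
    have "W (\<lambda>x. \<phi> x - \<eta> x) \<le> order_sup W \<phi>"
      using \<eta> by (intro order_sup_upper W \<phi> Cc_diff) auto
    then show "- W \<eta> \<le> order_sup W \<phi> - W \<phi>" using radon_diff[OF W \<phi>(1) \<eta>(1)] by simp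
  qed
  moreover have "order_sup W \<phi> \<le> order_sup ?V \<phi> + W \<phi>"
  proof (rule order_sup_least[OF \<phi>(2)])
    fix \<eta> assume \<eta>: "\<eta> \<in> Cc" "\<And>x. 0 \<le> \<eta> x" "\<And>x. \<eta> x \<le> \<phi> x"
    have "?V (\<lambda>x. \<phi> x - \<eta> x) \<le> order_sup ?V \<phi>"
      using \<eta> by (intro order_sup_upper V \<phi> Cc_diff) auto
    then show "W \<eta> \<le> order_sup ?V \<phi> + W \<phi>" using radon_diff[OF W \<phi>(1) \<eta>(1)] by simp
  qed
  ultimately show "W \<phi> = pos_part W \<phi> - neg_part W \<phi>"
    unfolding neg_part_def pos_part_nonneg[OF W \<phi>] pos_part_nonneg[OF V \<phi>] by simp
qed

lemma pos_part_of_pos: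
  fixes T :: "('a::t2_space \<Rightarrow> real) \<Rightarrow> real"
  assumes lc: "lch TYPE('a)" and T: "T \<in> pos_radon"
  shows "pos_part T = T" "neg_part T = (\<lambda>\<phi>. 0)"
proof -
  note sT = pos_radon_signed[OF T]
  show 1: "pos_part T = T"
  proof (rule signed_radon_eqI[OF pos_part_pos_radon[OF lc sT, THEN pos_radon_signed] sT])
    fix \<phi> :: "'a \<Rightarrow> real" assume \<phi>: "\<phi> \<in> Cc" "\<And>x. 0 \<le> \<phi> x"
    have "order_sup T \<phi> \<le> T \<phi>" by (intro order_sup_least \<phi> pos_radon_mono[OF T])
    moreover have "T \<phi> \<le> order_sup T \<phi>" by (intro order_sup_upper sT \<phi>) auto
    ultimately show "pos_part T \<phi> = T \<phi>" unfolding pos_part_nonneg[OF sT \<phi>] by simp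
  qed
  have "T \<phi> = pos_part T \<phi> - neg_part T \<phi>" for \<phi> using Jordan_decomposition[OF lc sT] by metis
  then show "neg_part T = (\<lambda>\<phi>. 0)" unfolding 1 by auto
qed

text \<open>Minimality of the Jordan decomposition: every competitor satisfies
  \<open>W \<eta> \<le> T \<eta> \<le> T \<phi>\<close>, so \<open>T\<close> dominates
  \<open>pos_part W\<close>. The excess \<open>R\<close> is the same for \<open>T\<close> and
  \<open>S\<close> because both pairs have the difference \<open>W\<close>; it therefore cancels in
  energy computations.\<close>

lemma common_part:
  fixes T S :: "('a::t2_space \<Rightarrow> real) \<Rightarrow> real"
  assumes lc: "lch TYPE('a)" and T: "T \<in> pos_radon" and S: "S \<in> pos_radon"
  defines "W \<equiv> \<lambda>\<phi>. T \<phi> - S \<phi>"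
  obtains R where "R \<in> pos_radon" "T = (\<lambda>\<phi>. pos_part W \<phi> + R \<phi>)" "S = (\<lambda>\<phi>. neg_part W \<phi> + R \<phi>)"
proof
  have W: "W \<in> signed_radon"
    unfolding W_def using signed_radon_lincomb[OF pos_radon_signed[OF T] pos_radon_signed[OF S], of 1 "-1"] by simp
  define R where "R = (\<lambda>\<phi>. T \<phi> - pos_part W \<phi>)"
  note P = pos_part_pos_radon[OF lc W, THEN pos_radon_signed]
  have "R \<in> signed_radon"
    unfolding R_def using signed_radon_lincomb[OF pos_radon_signed[OF T] P, of 1 "-1"] by simp
  moreover have "0 \<le> R \<phi>" if \<phi>: "\<phi> \<in> Cc" "\<And>x. 0 \<le> \<phi> x" for \<phi>
  proof -
    have "order_sup W \<phi> \<le> T \<phi>"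
    proof (rule order_sup_least[OF \<phi>(2)])
      fix \<eta> assume \<eta>: "\<eta> \<in> Cc" "\<And>x. 0 \<le> \<eta> x" "\<And>x. \<eta> x \<le> \<phi> x"
      then show "W \<eta> \<le> T \<phi>"
        using pos_radon_mono[OF T \<eta>(1) \<phi>(1) \<eta>(3)] pos_radon_nonneg[OF S, of \<eta>] by (simp add: W_def)
    qed
    then show ?thesis using pos_part_nonneg[OF W \<phi>] by (simp add: R_def)
  qed
  ultimately show "R \<in> pos_radon" by (simp add: pos_radon_def)
  show "T = (\<lambda>\<phi>. pos_part W \<phi> + R \<phi>)" by (simp add: R_def)
  have "W \<phi> = pos_part W \<phi> - neg_part W \<phi>" for \<phi> using Jordan_decomposition[OF lc W] by metis
  then have *: "T \<phi> - S \<phi> = pos_part W \<phi> - neg_part W \<phi>" for \<phi> unfolding W_def .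
  have "S \<phi> = neg_part W \<phi> + R \<phi>" for \<phi> using *[of \<phi>] by (simp add: R_def)
  then show "S = (\<lambda>\<phi>. neg_part W \<phi> + R \<phi>)" by blast
qed

section \<open>Products\<close>

lemma lch_prod:
  assumes "lch TYPE('a::t2_space)" "lch TYPE('b::t2_space)"
  shows "lch TYPE('a \<times> 'b)"
  using assms locally_compact_space_prod_topology[of "euclidean :: 'a topology" "euclidean :: 'b topology"] by simp

lemma prod_support:
  fixes F :: "'a::t2_space \<times> 'b::t2_space \<Rightarrow> real"
  assumes "F \<in> Cc"
  obtains K L where "compact K" "compact L" "\<And>x y. x \<notin> K \<Longrightarrow> F (x, y) = 0" "\<And>x y. y \<notin> L \<Longrightarrow> F (x, y) = 0"
proof
  let ?S = "closure {z. F z \<noteq> 0}"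
  show "compact (fst ` ?S)" "compact (snd ` ?S)"
    by (intro compact_continuous_image Cc_support[OF assms] continuous_intros)+
  show "F (x, y) = 0" if "x \<notin> fst ` ?S" for x y
    using that not_in_support[of "(x, y)" F] by force
  show "F (x, y) = 0" if "y \<notin> snd ` ?S" for x y
    using that not_in_support[of "(x, y)" F] by force
qed

lemma Cc_slice:
  fixes F :: "'a::t2_space \<times> 'b::t2_space \<Rightarrow> real"
  assumes "F \<in> Cc"
  shows "(\<lambda>y. F (x, y)) \<in> Cc" "(\<lambda>x. F (x, y)) \<in> Cc"
proof -
  obtain K L where K: "compact K" "compact L" "\<And>x y. x \<notin> K \<Longrightarrow> F (x, y) = 0" "\<And>x y. y \<notin> L \<Longrightarrow> F (x, y) = 0"
    using prod_support[OF assms] by blast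
  show "(\<lambda>y. F (x, y)) \<in> Cc"
    by (rule CcI[OF _ K(2) K(4)]) (auto intro!: continuous_on_compose2[OF Cc_continuous[OF assms, of UNIV]] continuous_intros)
  show "(\<lambda>x. F (x, y)) \<in> Cc"
    by (rule CcI[OF _ K(1) K(3)]) (auto intro!: continuous_on_compose2[OF Cc_continuous[OF assms, of UNIV]] continuous_intros)
qed

lemma Cc_swap:
  fixes F :: "'a::t2_space \<times> 'b::t2_space \<Rightarrow> real"
  assumes "F \<in> Cc"
  shows "(\<lambda>(y, x). F (x, y)) \<in> Cc"
proof -
  obtain K L where K: "compact K" "compact L" "\<And>x y. x \<notin> K \<Longrightarrow> F (x, y) = 0" "\<And>x y. y \<notin> L \<Longrightarrow> F (x, y) = 0"
    using prod_support[OF assms] by blast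
  show ?thesis
  proof (rule CcI[OF _ compact_Times[OF K(2,1)]])
    show "continuous_on UNIV (\<lambda>(y, x). F (x, y))"
      unfolding split_def
      by (intro continuous_on_compose2[OF Cc_continuous[OF assms, of UNIV]] continuous_intros) auto
    show "(case z of (y, x) \<Rightarrow> F (x, y)) = 0" if "z \<notin> L \<times> K" for z
      using that K(3)[of "snd z" "fst z"] K(4)[of "fst z" "snd z"] by (cases z) auto
  qed
qed

lemma Cc_tensor:
  fixes u :: "'a::t2_space \<Rightarrow> real" and v :: "'b::t2_space \<Rightarrow> real"
  assumes u: "u \<in> Cc" and v: "v \<in> Cc"
  shows "(\<lambda>(x, y). u x * v y) \<in> Cc"
proof (rule CcI[OF _ compact_Times[OF Cc_support[OF u] Cc_support[OF v]]])
  show "continuous_on UNIV (\<lambda>(x, y). u x * v y)"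
    unfolding split_def
    by (intro continuous_intros continuous_on_compose2[OF Cc_continuous[OF u, of UNIV]]
        continuous_on_compose2[OF Cc_continuous[OF v, of UNIV]]) auto
  show "(case z of (x, y) \<Rightarrow> u x * v y) = 0" if "z \<notin> closure {x. u x \<noteq> 0} \<times> closure {x. v x \<noteq> 0}" for z
    using that not_in_support[of "fst z" u] not_in_support[of "snd z" v] by (cases z) auto
qed

text \<open>Uniformity in \<open>y\<close> holds by compactness of the projection of the support;
  off that projection both values are 0.\<close>

lemma uniform_slices:
  fixes F :: "'a::t2_space \<times> 'b::t2_space \<Rightarrow> real"
  assumes F: "F \<in> Cc" and e: "0 < e"
  shows "\<exists>V. open V \<and> x0 \<in> V \<and> (\<forall>x\<in>V. \<forall>y. \<bar>F (x, y) - F (x0, y)\<bar> \<le> e)"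
proof -
  obtain K L where K: "compact K" "compact L" "\<And>x y. x \<notin> K \<Longrightarrow> F (x, y) = 0" "\<And>x y. y \<notin> L \<Longrightarrow> F (x, y) = 0"
    using prod_support[OF F] by blast
  obtain V where V: "x0 \<in> V" "open V" "\<forall>x\<in>V \<inter> UNIV. \<forall>t\<in>L. dist (F (x, t)) (F (x0, t)) \<le> e"
    by (rule continuous_on_prod_compactE[OF Cc_continuous[OF F] K(2) UNIV_I e])
  have "\<bar>F (x, y) - F (x0, y)\<bar> \<le> e" if "x \<in> V" for x y
    using V(3) that K(4)[of y] e by (cases "y \<in> L") (auto simp: dist_real_def)
  then show ?thesis using V by blast
qed

lemma Cc_partial_integral:
  fixes F :: "'a::t2_space \<times> 'b::t2_space \<Rightarrow> real"
  assumes \<nu>: "\<nu> \<in> signed_radon" and F: "F \<in> Cc"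
  shows "(\<lambda>x. \<nu> (\<lambda>y. F (x, y))) \<in> Cc"
proof -
  obtain K L where K: "compact K" "compact L" "\<And>x y. x \<notin> K \<Longrightarrow> F (x, y) = 0" "\<And>x y. y \<notin> L \<Longrightarrow> F (x, y) = 0"
    using prod_support[OF F] by blast
  obtain C where C: "0 < C" "\<And>\<eta> B. \<eta> \<in> Cc \<Longrightarrow> (\<And>x. x \<notin> L \<Longrightarrow> \<eta> x = 0) \<Longrightarrow> (\<And>x. \<bar>\<eta> x\<bar> \<le> B) \<Longrightarrow> \<bar>\<nu> \<eta>\<bar> \<le> C * B"
    using signed_radon_bound[OF \<nu> K(2)] by metis
  show ?thesis
  proof (rule CcI[OF _ K(1)])
    show "\<nu> (\<lambda>y. F (x, y)) = 0" if "x \<notin> K" for x using K(3)[OF that] radon_zero[OF \<nu>] by simp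
    show "continuous_on UNIV (\<lambda>x. \<nu> (\<lambda>y. F (x, y)))"
    proof (rule continuous_at_imp_continuous_on, rule ballI)
      fix x0
      show "isCont (\<lambda>x. \<nu> (\<lambda>y. F (x, y))) x0"
        unfolding isCont_def
      proof (rule tendstoI)
        fix e :: real assume e: "0 < e"
        then have "0 < e / (2 * C)" using C(1) by simp
        then obtain V where V: "open V" "x0 \<in> V" "\<And>x y. x \<in> V \<Longrightarrow> \<bar>F (x, y) - F (x0, y)\<bar> \<le> e / (2 * C)"
          using uniform_slices[OF F] by meson
        have "dist (\<nu> (\<lambda>y. F (x, y))) (\<nu> (\<lambda>y. F (x0, y))) < e" if x: "x \<in> V" for x
        proof -
          have "\<bar>\<nu> (\<lambda>y. F (x, y) - F (x0, y))\<bar> \<le> C * (e / (2 * C))"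
            using K(4) V(3)[OF x] by (intro C(2) Cc_diff Cc_slice F) auto
          also have "\<dots> < e" using C(1) e by simp
          finally show ?thesis
            using radon_diff[OF \<nu> Cc_slice(1)[OF F] Cc_slice(1)[OF F], of x x0] by (simp add: dist_real_def)
        qed
        then show "\<forall>\<^sub>F x in at x0. dist (\<nu> (\<lambda>y. F (x, y))) (\<nu> (\<lambda>y. F (x0, y))) < e"
          unfolding eventually_at_topological using V(1,2) by blast
      qed
    qed
  qed
qed

lemma radon_prod_Cc: "F \<in> Cc \<Longrightarrow> radon_prod \<mu> \<nu> F = \<mu> (\<lambda>x. \<nu> (\<lambda>y. F (x, y)))"
  by (simp add: radon_prod_def)

lemma radon_prod_pos:
  fixes \<mu> :: "('a::t2_space \<Rightarrow> real) \<Rightarrow> real" and \<nu> :: "('b::t2_space \<Rightarrow> real) \<Rightarrow> real"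
  assumes lc: "lch TYPE('a)" "lch TYPE('b)" and \<mu>: "\<mu> \<in> pos_radon" and \<nu>: "\<nu> \<in> pos_radon"
  shows "radon_prod \<mu> \<nu> \<in> pos_radon"
proof (rule positive_functional_is_radon[OF lch_prod[OF lc]])
  show "radon_prod \<mu> \<nu> F = 0" if "F \<notin> Cc" for F using that by (simp add: radon_prod_def)
  show "radon_prod \<mu> \<nu> (\<lambda>z. a * F z + b * G z) = a * radon_prod \<mu> \<nu> F + b * radon_prod \<mu> \<nu> G"
    if FG: "F \<in> Cc" "G \<in> Cc" for F G a b
    unfolding radon_prod_Cc[OF FG(1)] radon_prod_Cc[OF FG(2)] radon_prod_Cc[OF Cc_lincomb[OF FG]]
      radon_lincomb[OF pos_radon_signed[OF \<nu>] Cc_slice(1)[OF FG(1)] Cc_slice(1)[OF FG(2)]]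
    by (rule radon_lincomb[OF pos_radon_signed[OF \<mu>]]; intro Cc_partial_integral pos_radon_signed \<nu> FG)
  show "0 \<le> radon_prod \<mu> \<nu> F" if "F \<in> Cc" "\<And>z. 0 \<le> F z" for F
    unfolding radon_prod_Cc[OF that(1)] by (intro pos_radon_nonneg[OF \<mu>] pos_radon_nonneg[OF \<nu>] that)
qed

lemma radon_prod_lincomb_left:
  "radon_prod (\<lambda>\<phi>. a * \<mu> \<phi> + b * \<mu>' \<phi>) \<nu> = (\<lambda>F. a * radon_prod \<mu> \<nu> F + b * radon_prod \<mu>' \<nu> F)"
  by (auto simp: radon_prod_def)

lemma radon_prod_lincomb_right:
  fixes \<mu> :: "('a::t2_space \<Rightarrow> real) \<Rightarrow> real" and \<nu> \<nu>' :: "('b::t2_space \<Rightarrow> real) \<Rightarrow> real"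
  assumes \<mu>: "\<mu> \<in> signed_radon" and \<nu>: "\<nu> \<in> signed_radon" and \<nu>': "\<nu>' \<in> signed_radon"
  shows "radon_prod \<mu> (\<lambda>\<phi>. a * \<nu> \<phi> + b * \<nu>' \<phi>) = (\<lambda>F. a * radon_prod \<mu> \<nu> F + b * radon_prod \<mu> \<nu>' F)"
proof
  fix F :: "'a \<times> 'b \<Rightarrow> real"
  show "radon_prod \<mu> (\<lambda>\<phi>. a * \<nu> \<phi> + b * \<nu>' \<phi>) F = a * radon_prod \<mu> \<nu> F + b * radon_prod \<mu> \<nu>' F"
  proof (cases "F \<in> Cc")
    case True
    then show ?thesis
      unfolding radon_prod_Cc[OF True]
      by (intro radon_lincomb[OF \<mu>] Cc_partial_integral \<nu> \<nu>')
  qed (simp add: radon_prod_def)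
qed

lemma radon_prod_tensor:
  fixes \<mu> :: "('a::t2_space \<Rightarrow> real) \<Rightarrow> real" and \<nu> :: "('b::t2_space \<Rightarrow> real) \<Rightarrow> real"
  assumes \<mu>: "\<mu> \<in> signed_radon" and \<nu>: "\<nu> \<in> signed_radon" and u: "u \<in> Cc" and v: "v \<in> Cc"
  shows "radon_prod \<mu> \<nu> (\<lambda>(x, y). u x * v y) = \<mu> u * \<nu> v"
proof -
  have "radon_prod \<mu> \<nu> (\<lambda>(x, y). u x * v y) = \<mu> (\<lambda>x. \<nu> (\<lambda>y. u x * v y))"
    by (simp add: radon_prod_Cc Cc_tensor u v)
  also have "(\<lambda>x. \<nu> (\<lambda>y. u x * v y)) = (\<lambda>x. \<nu> v * u x)" by (simp add: radon_scale[OF \<nu> v] mult.commute)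
  finally show ?thesis by (simp add: radon_scale[OF \<mu> u])
qed

text \<open>Continuity alone does not give measurability for the product of the Borel algebras.
  Compact support does: up to a uniform error, \<open>F\<close> equals \<open>F (c, y)\<close> on
  each of finitely many strips \<open>V c\<close>, which is a function built from rectangles, and
  uniform limits stay measurable.\<close>

lemma Cc_pair_measurable:
  fixes F :: "'a::t2_space \<times> 'b::t2_space \<Rightarrow> real"
  assumes F: "F \<in> Cc"
  shows "F \<in> borel_measurable (borel \<Otimes>\<^sub>M borel)"
proof -
  obtain K L where K: "compact K" "\<And>x y. x \<notin> K \<Longrightarrow> F (x, y) = 0"
    using prod_support[OF F] by metis
  have Fm: "(\<lambda>z. F (c, snd z)) \<in> borel_measurable (borel \<Otimes>\<^sub>M borel)" for c
    using Cc_measurable[OF Cc_slice(1)[OF F, of c]] by measurable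
  have "\<exists>G. G \<in> borel_measurable (borel \<Otimes>\<^sub>M borel) \<and> (\<forall>z. \<bar>G z - F z\<bar> \<le> e)" if e: "0 < e" for e
  proof -
    obtain V where V: "\<And>c. open (V c)" "\<And>c. c \<in> V c" "\<And>c x y. x \<in> V c \<Longrightarrow> \<bar>F (x, y) - F (c, y)\<bar> \<le> e"
      using uniform_slices[OF F e] by metis
    have ex: "\<exists>G. G \<in> borel_measurable (borel \<Otimes>\<^sub>M borel) \<and> (\<forall>x y. x \<in> K \<inter> (\<Union>c\<in>I. V c) \<longrightarrow> \<bar>G (x, y) - F (x, y)\<bar> \<le> e)
        \<and> (\<forall>x y. x \<notin> K \<longrightarrow> G (x, y) = 0)" if "finite I" for I
      using that
    proof induction
      case empty
      then show ?case by (intro exI[of _ "\<lambda>z. 0"]) auto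
    next
      case (insert c I)
      then obtain G where G: "G \<in> borel_measurable (borel \<Otimes>\<^sub>M borel)"
          "\<And>x y. x \<in> K \<inter> (\<Union>c\<in>I. V c) \<Longrightarrow> \<bar>G (x, y) - F (x, y)\<bar> \<le> e" "\<And>x y. x \<notin> K \<Longrightarrow> G (x, y) = 0"
        by blast
      have [measurable]: "K \<in> sets borel" "V c \<in> sets borel" using V(1) K(1) by (simp_all add: compact_imp_closed)
      have "(\<lambda>z. if fst z \<in> K \<inter> V c then F (c, snd z) else G z) \<in> borel_measurable (borel \<Otimes>\<^sub>M borel)"
        by (intro measurable_If Fm G(1)) measurable
      then show ?case
        using G(2,3) V(3) by (intro exI[of _ "\<lambda>z. if fst z \<in> K \<inter> V c then F (c, snd z) else G z"]) (auto simp: abs_minus_commute)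
    qed
    obtain I where I: "finite I" "K \<subseteq> (\<Union>c\<in>I. V c)"
      using compactE_image[OF K(1), of UNIV V] V(1,2) by (metis UNIV_I UN_I subsetI)
    obtain G where G: "G \<in> borel_measurable (borel \<Otimes>\<^sub>M borel)"
       "\<forall>x y. x \<in> K \<inter> (\<Union>c\<in>I. V c) \<longrightarrow> \<bar>G (x, y) - F (x, y)\<bar> \<le> e" "\<forall>x y. x \<notin> K \<longrightarrow> G (x, y) = 0"
      using ex[OF I(1)] by (elim exE conjE)
    have "\<bar>G (x, y) - F (x, y)\<bar> \<le> e" for x y
    proof (cases "x \<in> K")
      case True
      then have "x \<in> K \<inter> (\<Union>c\<in>I. V c)" using I(2) by blast
      then show ?thesis using G(2) by blast
    next
      case False
      then show ?thesis using G(3) K(2)[OF False] e by simp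
    qed
    then show ?thesis using G(1) by auto
  qed
  then have "\<forall>n. \<exists>G. G \<in> borel_measurable (borel \<Otimes>\<^sub>M borel) \<and> (\<forall>z. \<bar>G z - F z\<bar> \<le> inverse (real (Suc n)))"
    by simp
  then obtain G where G: "\<And>n. G n \<in> borel_measurable (borel \<Otimes>\<^sub>M borel)"
     "\<And>n z. \<bar>G n z - F z\<bar> \<le> inverse (real (Suc n))"
    by (metis (no_types, lifting))
  have "(\<lambda>n. G n z) \<longlonglongrightarrow> F z" for z
  proof -
    have "(\<lambda>n. G n z - F z) \<longlonglongrightarrow> 0"
      using G(2)[of _ z] by (intro Lim_null_comparison[OF _ LIMSEQ_inverse_real_of_nat] always_eventually) simp
    then show ?thesis by (simp add: LIM_zero_iff)
  qed
  then show ?thesis by (intro borel_measurable_LIMSEQ_real[OF _ G(1)])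
qed

text \<open>Restricted to the compact projections of the support of \<open>F\<close>, both measures
  are finite, and the classical theorem applies on the product algebra, for which \<open>F\<close>
  is measurable.\<close>

lemma radon_prod_commute:
  fixes \<mu> :: "('a::t2_space \<Rightarrow> real) \<Rightarrow> real" and \<nu> :: "('b::t2_space \<Rightarrow> real) \<Rightarrow> real"
  assumes lc: "lch TYPE('a)" "lch TYPE('b)" and \<mu>: "\<mu> \<in> pos_radon" and \<nu>: "\<nu> \<in> pos_radon" and F: "F \<in> Cc"
  shows "\<mu> (\<lambda>x. \<nu> (\<lambda>y. F (x, y))) = \<nu> (\<lambda>y. \<mu> (\<lambda>x. F (x, y)))"
proof -
  obtain K L where K: "compact K" "compact L" "\<And>x y. x \<notin> K \<Longrightarrow> F (x, y) = 0" "\<And>x y. y \<notin> L \<Longrightarrow> F (x, y) = 0"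
    using prod_support[OF F] by blast
  define M N where "M = density (borel_of \<mu>) (\<lambda>x. ennreal (indicator K x))" and "N = density (borel_of \<nu>) (\<lambda>x. ennreal (indicator L x))"
  note r\<mu> = Riesz_Markov[OF lc(1) \<mu>] and r\<nu> = Riesz_Markov[OF lc(2) \<nu>]
  have Kb: "K \<in> sets (borel_of \<mu>)" "L \<in> sets (borel_of \<nu>)"
    using K by (simp_all add: representsD(1)[OF r\<mu>] representsD(1)[OF r\<nu>] compact_imp_closed)
  have sM: "sets M = sets borel" "sets N = sets borel"
    by (simp_all add: M_def N_def representsD(1)[OF r\<mu>] representsD(1)[OF r\<nu>])
  have fM: "finite_measure M" "finite_measure N"
    using representsD(2)[OF r\<mu> K(1)] representsD(2)[OF r\<nu> K(2)] Kb
    by (auto intro!: finite_measureI simp: M_def N_def emeasure_density ennreal_indicator less_top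
        simp del: infinity_ennreal_def)
  interpret M: finite_measure M by (rule fM)
  interpret N: finite_measure N by (rule fM)
  interpret pair_sigma_finite M N ..
  have Fm: "F \<in> borel_measurable (M \<Otimes>\<^sub>M N)"
    using Cc_pair_measurable[OF F] by (simp add: sM cong: measurable_cong_sets sets_pair_measure_cong)
  obtain B where B: "\<And>z. \<bar>F z\<bar> \<le> B" using Cc_bounded[OF F] by metis
  interpret P: finite_measure "M \<Otimes>\<^sub>M N" by (rule finite_measure_pair_measure) (rule fM)+
  have int: "integrable (M \<Otimes>\<^sub>M N) F"
    using B by (intro P.integrable_const_bound[of _ B] Fm) auto
  have LM: "\<mu> \<phi> = (LINT x|M. \<phi> x)" if "\<phi> \<in> Cc" "\<And>x. x \<notin> K \<Longrightarrow> \<phi> x = 0" for \<phi>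
  proof -
    have "(LINT x|M. \<phi> x) = (LINT x|borel_of \<mu>. indicator K x * \<phi> x)"
      unfolding M_def using that Kb Cc_measurable[OF that(1)]
      by (intro integral_real_density) (simp_all add: representsD(1)[OF r\<mu>] cong: measurable_cong_sets)
    also have "\<dots> = (LINT x|borel_of \<mu>. \<phi> x)"
      using that(2) by (intro Bochner_Integration.integral_cong) (auto simp: indicator_def)
    finally show ?thesis using representsD(5)[OF r\<mu> that(1)] by simp
  qed
  have LN: "\<nu> \<phi> = (LINT x|N. \<phi> x)" if "\<phi> \<in> Cc" "\<And>x. x \<notin> L \<Longrightarrow> \<phi> x = 0" for \<phi>
  proof -
    have "(LINT x|N. \<phi> x) = (LINT x|borel_of \<nu>. indicator L x * \<phi> x)"
      unfolding N_def using that Kb Cc_measurable[OF that(1)]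
      by (intro integral_real_density) (simp_all add: representsD(1)[OF r\<nu>] cong: measurable_cong_sets)
    also have "\<dots> = (LINT x|borel_of \<nu>. \<phi> x)"
      using that(2) by (intro Bochner_Integration.integral_cong) (auto simp: indicator_def)
    finally show ?thesis using representsD(5)[OF r\<nu> that(1)] by simp
  qed
  have 1: "\<nu> (\<lambda>y. F (x, y)) = (LINT y|N. F (x, y))" for x
    by (intro LN Cc_slice F K(4))
  have 2: "\<mu> (\<lambda>x. F (x, y)) = (LINT x|M. F (x, y))" for y
    by (intro LM Cc_slice F K(3))
  have "\<mu> (\<lambda>x. \<nu> (\<lambda>y. F (x, y))) = (LINT x|M. \<nu> (\<lambda>y. F (x, y)))"
    using K(3) radon_zero[OF pos_radon_signed[OF \<nu>]] by (intro LM Cc_partial_integral pos_radon_signed \<nu> F) simp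
  also have "\<dots> = (LINT x|M. LINT y|N. F (x, y))" by (simp add: 1)
  also have "\<dots> = (LINT y|N. LINT x|M. F (x, y))"
    using Fubini_integral[of "\<lambda>x y. F (x, y)"] int by simp
  also have "\<dots> = (LINT y|N. \<mu> (\<lambda>x. F (x, y)))" by (simp add: 2)
  also have "\<dots> = \<nu> (\<lambda>y. \<mu> (\<lambda>x. F (x, y)))"
    using K(4) radon_zero[OF pos_radon_signed[OF \<mu>]]
      Cc_partial_integral[OF pos_radon_signed[OF \<mu>] Cc_swap[OF F]] by (intro LN[symmetric]) simp_all
  finally show ?thesis .
qed

text \<open>Measurability of the inner integral is part of the property, since iterated integrals
  will be added and subtracted.\<close>

definition fubini_holds where
  "fubini_holds \<mu> \<nu> k \<longleftrightarrow> k \<in> borel_measurable borel \<and>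
     (\<lambda>x. \<integral>\<^sup>+y. k (x, y) \<partial>borel_of \<nu>) \<in> borel_measurable borel \<and>
     (\<integral>\<^sup>+z. k z \<partial>borel_of (radon_prod \<mu> \<nu>)) = (\<integral>\<^sup>+x. \<integral>\<^sup>+y. k (x, y) \<partial>borel_of \<nu> \<partial>borel_of \<mu>)"

lemma open_slice:
  fixes A :: "('a::topological_space \<times> 'b::topological_space) set"
  assumes "open A"
  shows "open {y. (x, y) \<in> A}"
  using continuous_on_open_vimage[of UNIV "\<lambda>y. (x, y)"] assms
  by (auto simp: vimage_def intro!: continuous_intros)

text \<open>All the integrals are suprema over the one family \<open>below k\<close>. Its slices
  form a directed family in \<open>y\<close>, and their integrals form a directed family in
  \<open>Cc\<close> in \<open>x\<close>, so the theorem on directed suprema applies twice. The inner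
  integral is thereby a supremum of continuous functions, hence lower semicontinuous.\<close>

lemma fubini_lsc:
  fixes \<mu> :: "('a::t2_space \<Rightarrow> real) \<Rightarrow> real" and \<nu> :: "('b::t2_space \<Rightarrow> real) \<Rightarrow> real"
  assumes lc: "lch TYPE('a)" "lch TYPE('b)" and \<mu>: "\<mu> \<in> pos_radon" and \<nu>: "\<nu> \<in> pos_radon"
    and k: "\<And>a. open {z. a < k z}"
  shows "fubini_holds \<mu> \<nu> k"
    and "(\<integral>\<^sup>+z. k z \<partial>borel_of (radon_prod \<mu> \<nu>)) = (SUP F\<in>below k. ennreal (\<mu> (\<lambda>x. \<nu> (\<lambda>y. F (x, y)))))"
proof -
  note lcp = lch_prod[OF lc] and pp = radon_prod_pos[OF lc \<mu> \<nu>]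
  have ne: "below k \<noteq> {}" using zero_below by blast
  have inner: "(\<integral>\<^sup>+y. k (x, y) \<partial>borel_of \<nu>) = (SUP F\<in>below k. ennreal (\<nu> (\<lambda>y. F (x, y))))" for x
  proof -
    let ?D = "(\<lambda>F y. F (x, y)) ` below k"
    have "(\<integral>\<^sup>+y. k (x, y) \<partial>borel_of \<nu>) = (\<integral>\<^sup>+y. (SUP f\<in>?D. ennreal (f y)) \<partial>borel_of \<nu>)"
      by (simp add: lsc_eq_SUP_below[OF lcp k, of "(x, _)"] image_comp)
    also have "\<dots> = (SUP f\<in>?D. ennreal (\<nu> f))"
    proof (rule nn_integral_directed_SUP[OF lc(2) \<nu> Riesz_Markov[OF lc(2) \<nu>]])
      show "?D \<noteq> {}" using ne by simp
      show "?D \<subseteq> Cc" using belowD(1) Cc_slice(1) by blast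
      show "0 \<le> f y" if "f \<in> ?D" for f y using that belowD(2) by auto
      fix f g assume "f \<in> ?D" "g \<in> ?D"
      then obtain F G where FG: "F \<in> below k" "G \<in> below k" "f = (\<lambda>y. F (x, y))" "g = (\<lambda>y. G (x, y))" by blast
      then obtain H where "H \<in> below k" "\<forall>z. F z \<le> H z" "\<forall>z. G z \<le> H z" using below_directed by blast
      then show "\<exists>h\<in>?D. (\<forall>y. f y \<le> h y) \<and> (\<forall>y. g y \<le> h y)"
        using FG by (intro bexI[of _ "\<lambda>y. H (x, y)"]) auto
    qed
    finally show ?thesis by (simp add: image_comp)
  qed
  let ?E = "(\<lambda>F x. \<nu> (\<lambda>y. F (x, y))) ` below k"
  have EC: "?E \<subseteq> Cc" using belowD(1) Cc_partial_integral[OF pos_radon_signed[OF \<nu>]] by blast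
  have "open {x. a < (\<integral>\<^sup>+y. k (x, y) \<partial>borel_of \<nu>)}" for a
  proof -
    have "{x. a < (\<integral>\<^sup>+y. k (x, y) \<partial>borel_of \<nu>)} = (\<Union>f\<in>?E. {x. a < ennreal (f x)})"
      by (auto simp: inner less_SUP_iff)
    also have "open \<dots>"
      using EC by (intro open_UN ballI open_Collect_less continuous_on_const continuous_on_ennreal Cc_continuous) auto
    finally show ?thesis .
  qed
  then have meas: "(\<lambda>x. \<integral>\<^sup>+y. k (x, y) \<partial>borel_of \<nu>) \<in> borel_measurable borel" by (rule borel_measurable_lsc)
  have outer: "(\<integral>\<^sup>+x. \<integral>\<^sup>+y. k (x, y) \<partial>borel_of \<nu> \<partial>borel_of \<mu>) = (SUP F\<in>below k. ennreal (\<mu> (\<lambda>x. \<nu> (\<lambda>y. F (x, y)))))"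
  proof -
    have "(\<integral>\<^sup>+x. \<integral>\<^sup>+y. k (x, y) \<partial>borel_of \<nu> \<partial>borel_of \<mu>) = (\<integral>\<^sup>+x. (SUP f\<in>?E. ennreal (f x)) \<partial>borel_of \<mu>)"
      by (simp add: inner image_comp)
    also have "\<dots> = (SUP f\<in>?E. ennreal (\<mu> f))"
    proof (rule nn_integral_directed_SUP[OF lc(1) \<mu> Riesz_Markov[OF lc(1) \<mu>] _ EC])
      show "?E \<noteq> {}" using ne by simp
      show "0 \<le> f y" if "f \<in> ?E" for f y using that belowD(2) by (auto intro!: pos_radon_nonneg[OF \<nu>])
      fix f g assume "f \<in> ?E" "g \<in> ?E"
      then obtain F G where FG: "F \<in> below k" "G \<in> below k" "f = (\<lambda>x. \<nu> (\<lambda>y. F (x, y)))" "g = (\<lambda>x. \<nu> (\<lambda>y. G (x, y)))" by blast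
      then obtain H where H: "H \<in> below k" "\<forall>z. F z \<le> H z" "\<forall>z. G z \<le> H z" using below_directed by blast
      then have "\<nu> (\<lambda>y. F (x, y)) \<le> \<nu> (\<lambda>y. H (x, y))" "\<nu> (\<lambda>y. G (x, y)) \<le> \<nu> (\<lambda>y. H (x, y))" for x
        using FG(1,2) belowD(1) by (auto intro!: pos_radon_mono[OF \<nu>] Cc_slice)
      then show "\<exists>h\<in>?E. (\<forall>y. f y \<le> h y) \<and> (\<forall>y. g y \<le> h y)"
        using FG H(1) by (intro bexI[of _ "\<lambda>x. \<nu> (\<lambda>y. H (x, y))"]) auto
    qed
    finally show ?thesis by (simp add: image_comp)
  qed
  have "(\<integral>\<^sup>+z. k z \<partial>borel_of (radon_prod \<mu> \<nu>)) = (SUP F\<in>below k. ennreal (radon_prod \<mu> \<nu> F))"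
    by (rule nn_integral_lsc[OF lcp pp Riesz_Markov[OF lcp pp] k])
  also have "\<dots> = (SUP F\<in>below k. ennreal (\<mu> (\<lambda>x. \<nu> (\<lambda>y. F (x, y)))))"
    by (intro SUP_cong refl) (simp add: radon_prod_Cc belowD(1))
  finally show 2: "(\<integral>\<^sup>+z. k z \<partial>borel_of (radon_prod \<mu> \<nu>)) = (SUP F\<in>below k. ennreal (\<mu> (\<lambda>x. \<nu> (\<lambda>y. F (x, y)))))" .
  then show "fubini_holds \<mu> \<nu> k"
    unfolding fubini_holds_def using borel_measurable_lsc[OF k] meas outer by simp
qed

text \<open>Exchanging the coordinates maps \<open>below k\<close> to itself for symmetric
  \<open>k\<close>, and for its members the order of integration is irrelevant.\<close>

lemma nn_integral_prod_commute_lsc: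
  fixes \<mu> \<nu> :: "('a::t2_space \<Rightarrow> real) \<Rightarrow> real"
  assumes lc: "lch TYPE('a)" and \<mu>: "\<mu> \<in> pos_radon" and \<nu>: "\<nu> \<in> pos_radon"
    and k: "\<And>a. open {z. a < k z}" and sym: "\<And>x y. k (x, y) = k (y, x)"
  shows "(\<integral>\<^sup>+z. k z \<partial>borel_of (radon_prod \<mu> \<nu>)) = (\<integral>\<^sup>+z. k z \<partial>borel_of (radon_prod \<nu> \<mu>))"
proof -
  have le: "(SUP F\<in>below k. ennreal (\<mu> (\<lambda>x. \<nu> (\<lambda>y. F (x, y))))) \<le> (SUP F\<in>below k. ennreal (\<nu> (\<lambda>x. \<mu> (\<lambda>y. F (x, y)))))"
    if \<mu>: "\<mu> \<in> pos_radon" and \<nu>: "\<nu> \<in> pos_radon" for \<mu> \<nu>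
  proof (rule SUP_least)
    fix F assume F: "F \<in> below k"
    let ?G = "\<lambda>(y, x). F (x, y)"
    have G: "?G \<in> below k"
      using Cc_swap[OF belowD(1)[OF F]] belowD(2,3)[OF F] sym by (auto simp: below_def) metis
    have "ennreal (\<mu> (\<lambda>x. \<nu> (\<lambda>y. F (x, y)))) = ennreal (\<nu> (\<lambda>y. \<mu> (\<lambda>x. ?G (y, x))))"
      using radon_prod_commute[OF lc lc \<mu> \<nu> belowD(1)[OF F]] by simp
    also have "\<dots> \<le> (SUP F\<in>below k. ennreal (\<nu> (\<lambda>x. \<mu> (\<lambda>y. F (x, y)))))" by (rule SUP_upper[OF G])
    finally show "ennreal (\<mu> (\<lambda>x. \<nu> (\<lambda>y. F (x, y)))) \<le> (SUP F\<in>below k. ennreal (\<nu> (\<lambda>x. \<mu> (\<lambda>y. F (x, y)))))" .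
  qed
  show ?thesis
    unfolding fubini_lsc(2)[OF lc lc \<mu> \<nu> k] fubini_lsc(2)[OF lc lc \<nu> \<mu> k]
    using le[OF \<mu> \<nu>] le[OF \<nu> \<mu>] by (rule antisym)
qed

text \<open>An \<open>\<eta> \<le> g\<close> that almost attains the positive part of \<open>\<theta>\<close> on \<open>g\<close> carries almost all of the positive part
  and almost nothing of the negative part, so \<open>F(x, y) \<eta>(x) \<eta>(y)\<close> is a competitor for the
  positive part of the square.\<close>

lemma pos_part_square_ge:
  fixes \<theta> :: "('a::t2_space \<Rightarrow> real) \<Rightarrow> real"
  assumes lc: "lch TYPE('a)" and \<theta>: "\<theta> \<in> signed_radon" and F: "F \<in> Cc" "\<And>z. 0 \<le> F z"
  shows "radon_prod \<theta> \<theta> \<in> signed_radon"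
    and "radon_prod (pos_part \<theta>) (pos_part \<theta>) F \<le> pos_part (radon_prod \<theta> \<theta>) F"
proof -
  define a b where "a = pos_part \<theta>" and "b = neg_part \<theta>"
  have ab: "a \<in> pos_radon" "b \<in> pos_radon"
    unfolding a_def b_def by (intro pos_part_pos_radon neg_part_pos_radon lc \<theta>)+
  note sab = ab[THEN pos_radon_signed]
  have th: "\<theta> = (\<lambda>\<phi>. a \<phi> - b \<phi>)" unfolding a_def b_def by (rule Jordan_decomposition[OF lc \<theta>])
  have thF: "radon_prod \<theta> \<theta> = (\<lambda>F. (radon_prod a a F + radon_prod b b F) - (radon_prod a b F + radon_prod b a F))"
  proof -
    have "radon_prod \<theta> \<theta> = (\<lambda>F. 1 * radon_prod a \<theta> F + (-1) * radon_prod b \<theta> F)"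
      using radon_prod_lincomb_left[of 1 a "-1" b \<theta>] th by simp
    moreover have "radon_prod c \<theta> = (\<lambda>F. 1 * radon_prod c a F + (-1) * radon_prod c b F)" if "c \<in> signed_radon" for c :: "('a \<Rightarrow> real) \<Rightarrow> real"
      using radon_prod_lincomb_right[OF that sab, of 1 "-1"] th by simp
    ultimately show ?thesis using sab by (simp add: fun_eq_iff)
  qed
  note pr = radon_prod_pos[OF lc lc]
  have "(\<lambda>F. 1 * (1 * radon_prod a a F + 1 * radon_prod b b F) + (-1) * (1 * radon_prod a b F + 1 * radon_prod b a F)) \<in> signed_radon"
    by (intro signed_radon_lincomb pos_radon_signed pr ab)
  then show sW: "radon_prod \<theta> \<theta> \<in> signed_radon" unfolding thF by (simp add: algebra_simps)
  obtain K L where KL: "compact K" "compact L" "\<And>x y. x \<notin> K \<Longrightarrow> F (x, y) = 0" "\<And>x y. y \<notin> L \<Longrightarrow> F (x, y) = 0"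
    using prod_support[OF F(1)] by blast
  obtain g :: "'a \<Rightarrow> real" where g: "g \<in> Cc" "\<And>x. 0 \<le> g x" "\<And>x. g x \<le> 1" "\<And>x. x \<in> K \<union> L \<Longrightarrow> g x = 1"
    using lch_Urysohn[OF lc compact_Un[OF KL(1,2)] open_UNIV subset_UNIV] by blast
  obtain B where B: "0 < B" "\<And>z. \<bar>F z\<bar> \<le> B" using Cc_bounded[OF F(1)] by metis
  have ag: "0 \<le> a g" by (rule pos_radon_nonneg[OF ab(1) g(2)])
  \<comment> \<open>The factor 4 counts two error terms in passing from \<open>F\<close> to
    \<open>H\<close> and the two cross terms of \<open>a\<close> with \<open>b\<close>; each is at
    most \<open>B * (a g * e)\<close>.\<close>
  have main: "radon_prod a a F \<le> pos_part (radon_prod \<theta> \<theta>) F + e * (4 * B * a g)" if e: "0 < e" for e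
  proof -
    have "a g = order_sup \<theta> g" unfolding a_def by (rule pos_part_nonneg[OF \<theta> g(1,2)])
    have "\<exists>\<eta>\<in>Cc. (\<forall>x. 0 \<le> \<eta> x \<and> \<eta> x \<le> g x) \<and> a g - e < \<theta> \<eta>"
    proof (rule ccontr)
      assume "\<not> ?thesis"
      then have "order_sup \<theta> g \<le> a g - e" by (intro order_sup_least g(2)) force
      then show False using \<open>a g = order_sup \<theta> g\<close> e by simp
    qed
    then obtain \<eta> where \<eta>: "\<eta> \<in> Cc" "\<And>x. 0 \<le> \<eta> x" "\<And>x. \<eta> x \<le> g x" "a g - e < \<theta> \<eta>" by blast
    have d: "(\<lambda>x. g x - \<eta> x) \<in> Cc" by (rule Cc_diff[OF g(1) \<eta>(1)])
    have ad: "a (\<lambda>x. g x - \<eta> x) = a g - a \<eta>" by (rule radon_diff[OF sab(1) g(1) \<eta>(1)])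
    have a\<eta>: "a \<eta> \<le> a g" "0 \<le> a \<eta>" "0 \<le> b \<eta>"
      by (intro pos_radon_mono[OF ab(1)] pos_radon_nonneg[OF ab(1)] pos_radon_nonneg[OF ab(2)] g \<eta>)+
    \<comment> \<open>Both follow from \<open>a g - e < a \<eta> - b \<eta>\<close>: the first with
      \<open>a \<eta> \<le> a g\<close>, the second with \<open>0 \<le> b \<eta>\<close>.\<close>
    have small: "b \<eta> \<le> e" "a (\<lambda>x. g x - \<eta> x) \<le> e"
      using \<eta>(4) a\<eta> unfolding ad th by auto
    have \<eta>1: "\<eta> x \<le> 1" for x using \<eta>(3)[of x] g(3)[of x] by simp
    define H where "H z = F z * (\<eta> (fst z) * \<eta> (snd z))" for z
    have HC: "H \<in> Cc" unfolding H_def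
      by (intro Cc_mult[OF F(1)] continuous_intros continuous_on_compose2[OF Cc_continuous[OF \<eta>(1), of UNIV]]) auto
    have H0: "0 \<le> H z" for z by (simp add: H_def F \<eta>)
    have HF: "H z \<le> F z" for z
      unfolding H_def using F(2)[of z] \<eta>(2) \<eta>1 by (intro mult_left_le mult_le_one) auto
    have HB: "H (x, y) \<le> B * (\<eta> x * \<eta> y)" for x y
      unfolding H_def using B(2)[of "(x, y)"] \<eta>(2) by (auto intro!: mult_right_mono mult_nonneg_nonneg)
    have tens: "(\<lambda>z. B * (case z of (x, y) \<Rightarrow> \<eta> x * \<eta> y)) \<in> Cc" by (intro Cc_scale Cc_tensor \<eta>)
    have cross: "radon_prod c d H \<le> B * (c \<eta> * d \<eta>)" if "c \<in> pos_radon" "d \<in> pos_radon" for c d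
    proof -
      have "radon_prod c d H \<le> radon_prod c d (\<lambda>z. B * (case z of (x, y) \<Rightarrow> \<eta> x * \<eta> y))"
        using HB by (intro pos_radon_mono[OF pr[OF that] HC tens]) (auto simp: split_def)
      also have "\<dots> = B * (c \<eta> * d \<eta>)"
        using that \<eta> by (simp add: radon_scale[OF pos_radon_signed[OF pr[OF that]] Cc_tensor[OF \<eta>(1) \<eta>(1)]]
            radon_prod_tensor pos_radon_signed)
      finally show ?thesis .
    qed
    have prod1: "a \<eta> * b \<eta> \<le> a g * e" "b \<eta> * a \<eta> \<le> a g * e"
      using a\<eta> small ag by (auto intro!: mult_mono simp: mult.commute[of "b \<eta>"])
    have ab1: "radon_prod a b H \<le> B * (a g * e)" "radon_prod b a H \<le> B * (a g * e)"
      using cross[OF ab] cross[OF ab(2,1)] prod1 B(1) by (auto intro: order_trans mult_left_mono)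
    have bb: "0 \<le> radon_prod b b H" by (rule pos_radon_nonneg[OF pr[OF ab(2) ab(2)] H0])
    \<comment> \<open>A majorant of \<open>F - H\<close> made of tensor products, suggested by
      \<open>1 - s * t = (1 - s) + s * (1 - t)\<close> with \<open>s\<close> and \<open>t\<close>
      the two values of \<eta>. Each summand contains the factor \<open>g - \<eta>\<close>, on which
      \<open>a\<close> is small.\<close>
    define G where "G = (\<lambda>z :: 'a \<times> 'a. B * (case z of (x, y) \<Rightarrow> (g x - \<eta> x) * g y) + B * (case z of (x, y) \<Rightarrow> g x * (g y - \<eta> y)))"
    have GC: "G \<in> Cc" unfolding G_def by (intro Cc_lincomb Cc_tensor d g)
    have FG: "F z - H z \<le> G z" for z
    proof (cases z)
      case (Pair x y)
      show ?thesis
      proof (cases "x \<in> K \<and> y \<in> L")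
        case True
        then have g1: "g x = 1" "g y = 1" using g(4) by auto
        have "F z - H z = F z * (1 - \<eta> x * \<eta> y)" by (simp add: H_def Pair algebra_simps)
        also have "\<dots> \<le> B * (1 - \<eta> x * \<eta> y)"
          using B(2)[of z] \<eta>(2) \<eta>1 by (intro mult_right_mono) (auto simp: mult_le_one)
        also have "1 - \<eta> x * \<eta> y = (1 - \<eta> x) + \<eta> x * (1 - \<eta> y)" by (simp add: algebra_simps)
        also have "B * \<dots> \<le> B * ((1 - \<eta> x) + 1 * (1 - \<eta> y))"
          using \<eta>1 \<eta>(2) B(1) by (intro mult_left_mono add_left_mono mult_right_mono) auto
        also have "\<dots> = G z" by (simp add: G_def Pair g1 algebra_simps)
        finally show ?thesis .
      next
        case False
        then have "F z = 0" using KL(3,4) Pair by auto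
        moreover have "0 \<le> G z" using B(1) g(2) \<eta>(3) by (simp add: G_def Pair)
        ultimately show ?thesis by (simp add: H_def)
      qed
    qed
    have saa: "radon_prod a a \<in> signed_radon" by (rule pos_radon_signed[OF pr[OF ab(1) ab(1)]])
    have "radon_prod a a F - radon_prod a a H = radon_prod a a (\<lambda>z. F z - H z)"
      by (rule radon_diff[OF saa F(1) HC, symmetric])
    also have "\<dots> \<le> radon_prod a a G" by (rule pos_radon_mono[OF pr[OF ab(1) ab(1)] Cc_diff[OF F(1) HC] GC FG])
    also have "\<dots> = B * (a (\<lambda>x. g x - \<eta> x) * a g) + B * (a g * a (\<lambda>x. g x - \<eta> x))"
      unfolding G_def radon_lincomb[OF saa Cc_tensor[OF d g(1)] Cc_tensor[OF g(1) d]]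
      by (simp add: radon_prod_tensor[OF sab(1) sab(1)] d g(1))
    also have "\<dots> = B * (a g * a (\<lambda>x. g x - \<eta> x)) + B * (a g * a (\<lambda>x. g x - \<eta> x))" by (simp add: mult.commute)
    also have "\<dots> \<le> B * (a g * e) + B * (a g * e)"
      using B(1) ag small(2) by (intro add_mono mult_left_mono) auto
    finally have aa: "radon_prod a a F - radon_prod a a H \<le> B * (a g * e) + B * (a g * e)" .
    have "radon_prod \<theta> \<theta> H \<le> pos_part (radon_prod \<theta> \<theta>) F"
      unfolding pos_part_nonneg[OF sW F] by (rule order_sup_upper[OF sW F(1) HC H0 HF])
    then have "(radon_prod a a H + radon_prod b b H) - (radon_prod a b H + radon_prod b a H) \<le> pos_part (radon_prod \<theta> \<theta>) F"
      unfolding thF .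
    then have "radon_prod a a F \<le> pos_part (radon_prod \<theta> \<theta>) F + 4 * (B * (a g * e))"
      using aa bb ab1 by linarith
    then show ?thesis by (simp add: mult_ac)
  qed
  show "radon_prod (pos_part \<theta>) (pos_part \<theta>) F \<le> pos_part (radon_prod \<theta> \<theta>) F"
    unfolding a_def[symmetric]
  proof (rule field_le_epsilon)
    fix e :: real assume e: "0 < e"
    have "0 \<le> 4 * B * a g" using B ag by simp
    moreover have "radon_prod a a F \<le> pos_part (radon_prod \<theta> \<theta>) F + e / (4 * B * a g + 1) * (4 * B * a g)"
      using e B ag by (intro main) (auto intro!: divide_pos_pos add_nonneg_pos)
    moreover have "e / (4 * B * a g + 1) * (4 * B * a g) \<le> e"
      using \<open>0 \<le> 4 * B * a g\<close> e by (simp add: field_simps)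
    ultimately show "radon_prod a a F \<le> pos_part (radon_prod \<theta> \<theta>) F + e" by linarith
  qed
qed

section \<open>Lower semicontinuous kernels\<close>

lemma less_e2ennreal_iff: "a < e2ennreal t \<longleftrightarrow> enn2ereal a < t"
proof (cases "0 \<le> t")
  case True
  then show ?thesis by (metis enn2ereal_e2ennreal less_ennreal.rep_eq)
next
  case False
  then have "e2ennreal t = 0" by (simp add: e2ennreal_neg)
  moreover have "\<not> enn2ereal a < t" using False enn2ereal_nonneg[of a] by (meson less_imp_le not_le order_trans)
  ultimately show ?thesis by simp
qed

lemma Phi_open: "g \<in> Phi \<Longrightarrow> open {y. a < g y}"
  by (simp add: Phi_def)

lemma Phi_pos_lsc: "g \<in> Phi \<Longrightarrow> open {y. a < e2ennreal (g y)}"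
  unfolding less_e2ennreal_iff by (rule Phi_open)

lemma Phi_measurable: "g \<in> Phi \<Longrightarrow> g \<in> borel_measurable borel"
  by (rule borel_measurable_lsc) (rule Phi_open)

text \<open>On a compact space finitely many of the open sets on which \<open>g\<close> exceeds
  \<open>- n\<close> form a cover. Elsewhere nonnegativity is part of \<open>Phi\<close>, and the
  bound is 0.\<close>

lemma Phi_bounded_below:
  fixes g :: "'a::t2_space \<Rightarrow> ereal"
  assumes g: "g \<in> Phi"
  obtains c :: real where "0 \<le> c" "\<And>y. - ereal c \<le> g y" "c = 0 \<or> compact (UNIV :: 'a set)"
proof (cases "compact (UNIV :: 'a set)")
  case True
  have "UNIV \<subseteq> (\<Union>n::nat. {y. - ereal (real n) < g y})"
  proof
    fix y
    obtain n :: nat where "- g y < ereal (real n)"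
      using less_PInf_Ex_of_nat[of "- g y"] g by (auto simp: Phi_def ereal_uminus_eq_reorder)
    then show "y \<in> (\<Union>n::nat. {y. - ereal (real n) < g y})"
      using ereal_minus_less_minus[of "g y" "- ereal (real n)"] by (auto intro!: exI[of _ n] simp: ereal_uminus_less_reorder)
  qed
  then obtain I :: "nat set" where I: "finite I" "UNIV \<subseteq> (\<Union>n\<in>I. {y. - ereal (real n) < g y})"
    using compactE_image[OF True, of UNIV "\<lambda>n. {y. - ereal (real n) < g y}"] Phi_open[OF g] by metis
  have "- ereal (real (Max (insert 0 I))) \<le> g y" for y
  proof -
    obtain n where n: "n \<in> I" "- ereal (real n) < g y" using I(2) by blast
    have "n \<le> Max (insert 0 I)" using n I(1) by simp
    then have "- ereal (real (Max (insert 0 I))) \<le> - ereal (real n)" by simp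
    then show ?thesis using n(2) by (meson less_imp_le order_trans)
  qed
  then show ?thesis using that[of "real (Max (insert 0 I))"] True by simp
next
  case False
  then show ?thesis using that[of 0] g by (simp add: Phi_def zero_ereal_def)
qed

text \<open>This reduces integrals of negative parts to those of lower semicontinuous functions.\<close>

lemma Phi_neg_cases:
  fixes g :: "'a::t2_space \<Rightarrow> ereal"
  assumes g: "g \<in> Phi"
  shows "(\<forall>y. e2ennreal (- g y) = 0) \<or>
    (compact (UNIV :: 'a set) \<and>
      (\<exists>c h. (\<forall>a. open {y. a < h y}) \<and> (\<forall>y. e2ennreal (- g y) + h y = ennreal c)))"
proof -
  obtain c :: real where c: "0 \<le> c" "\<And>y. - ereal c \<le> g y" "c = 0 \<or> compact (UNIV :: 'a set)"
    using Phi_bounded_below[OF g] by blast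
  show ?thesis
  proof (cases "compact (UNIV :: 'a set)")
    case False
    then have "0 \<le> g y" for y using g by (simp add: Phi_def)
    then show ?thesis by (simp add: e2ennreal_neg)
  next
    case True
    define h where "h y = e2ennreal (min (g y) 0 + ereal c)" for y
    have "open {y. a < h y}" for a
    proof -
      have "(enn2ereal a < min t 0 + ereal c) = (enn2ereal a - ereal c < t \<and> enn2ereal a - ereal c < 0)" for t
        by (cases t; cases "enn2ereal a") (auto simp: min_def)
      then have "{y. a < h y} = {y. enn2ereal a - ereal c < g y} \<inter> {y. enn2ereal a - ereal c < 0}"
        by (auto simp: h_def less_e2ennreal_iff)
      then show ?thesis using Phi_open[OF g] by (simp add: open_Int)
    qed
    moreover have "e2ennreal (- g y) + h y = ennreal c" for y
    proof (cases "0 \<le> g y")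
      case True
      then show ?thesis by (simp add: h_def e2ennreal_neg ennreal.rep_eq min_def flip: e2ennreal_ereal)
    next
      case False
      then obtain t where t: "g y = ereal t" "t < 0" using c(2)[of y] by (cases "g y") auto
      then have "- c \<le> t" using c(2)[of y] by simp
      then show ?thesis using t by (simp add: h_def min_def flip: ennreal_plus)
    qed
    ultimately show ?thesis using True by blast
  qed
qed

lemma compact_UNIV_finite:
  fixes T :: "('a::t2_space \<Rightarrow> real) \<Rightarrow> real"
  assumes "lch TYPE('a)" "T \<in> pos_radon" "compact (UNIV :: 'a set)"
  shows "emeasure (borel_of T) UNIV < top"
  using representsD(2)[OF Riesz_Markov[OF assms(1,2)] assms(3)] by simp

lemma Phi_neg_finite:
  fixes T :: "('a::t2_space \<Rightarrow> real) \<Rightarrow> real"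
  assumes lc: "lch TYPE('a)" and T: "T \<in> pos_radon" and g: "g \<in> Phi"
  shows "(\<integral>\<^sup>+y. e2ennreal (- g y) \<partial>borel_of T) < top"
  using Phi_neg_cases[OF g]
proof (elim disjE conjE exE)
  assume "\<forall>y. e2ennreal (- g y) = 0"
  then show ?thesis by simp
next
  fix c h assume cpt: "compact (UNIV :: 'a set)" and h: "\<forall>y. e2ennreal (- g y) + h y = ennreal c"
  have sp: "space (borel_of T) = UNIV"
    using sets_eq_imp_space_eq[OF representsD(1)[OF Riesz_Markov[OF lc T]]] by simp
  have "(\<integral>\<^sup>+y. e2ennreal (- g y) \<partial>borel_of T) \<le> (\<integral>\<^sup>+y. ennreal c \<partial>borel_of T)"
    using h by (intro nn_integral_mono) (metis add.right_neutral add_left_mono zero_le)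
  also have "\<dots> < top"
    using compact_UNIV_finite[OF lc T cpt] by (simp add: sp ennreal_mult_less_top)
  finally show ?thesis .
qed

lemma const_lsc: "open {z. a < (\<lambda>z. c) z}"
  by simp

text \<open>Fubini's theorem and symmetry pass from \<open>h\<close> and from constants to their
  difference \<open>k\<close>. Subtraction is legitimate because on a compact space every Radon
  measure is finite and \<open>h\<close> is bounded.\<close>

lemma fubini_complement:
  fixes \<mu> \<nu> :: "('a::t2_space \<Rightarrow> real) \<Rightarrow> real" and k h :: "'a \<times> 'a \<Rightarrow> ennreal"
  assumes lc: "lch TYPE('a)" and \<mu>: "\<mu> \<in> pos_radon" and \<nu>: "\<nu> \<in> pos_radon"
    and h: "\<And>a. open {z. a < h z}" and k: "\<And>z. k z + h z = ennreal c"
    and cpt: "compact (UNIV :: ('a \<times> 'a) set)"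
  shows "fubini_holds \<mu> \<nu> k"
    and "(\<And>x y. k (x, y) = k (y, x)) \<Longrightarrow>
      (\<integral>\<^sup>+z. k z \<partial>borel_of (radon_prod \<mu> \<nu>)) = (\<integral>\<^sup>+z. k z \<partial>borel_of (radon_prod \<nu> \<mu>))"
proof -
  have cpt1: "compact (UNIV :: 'a set)"
    using compact_continuous_image[OF continuous_on_fst[OF continuous_on_id] cpt] by simp
  note r\<mu> = Riesz_Markov[OF lc \<mu>] and r\<nu> = Riesz_Markov[OF lc \<nu>]
  note sets1 = representsD(1)[OF r\<mu>] representsD(1)[OF r\<nu>]
  have hle: "h z \<le> ennreal c" for z using k[of z] by (metis add.commute le_iff_add)
  have kh: "k z = ennreal c - h z" for z
    using k[of z] hle[of z] by (metis ennreal_add_diff_cancel_right ennreal_less_top le_less_trans less_top)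
  have hm: "h \<in> borel_measurable borel" by (rule borel_measurable_lsc[OF h])
  have km: "k \<in> borel_measurable borel" unfolding kh using hm by measurable
  have slice: "(\<lambda>y. h (x, y)) \<in> borel_measurable borel" for x
    using open_slice[OF h] by (intro borel_measurable_lsc) simp
  have kslice: "(\<lambda>y. k (x, y)) \<in> borel_measurable borel" for x
    unfolding kh using slice by measurable
  have prod: "fubini_holds \<mu> \<nu> h" "fubini_holds \<mu> \<nu> (\<lambda>z. ennreal c)" if "\<mu> \<in> pos_radon" "\<nu> \<in> pos_radon" for \<mu> \<nu> :: "('a \<Rightarrow> real) \<Rightarrow> real"
    by (rule fubini_lsc(1)[OF lc lc that h], rule fubini_lsc(1)[OF lc lc that const_lsc])
  have finh: "(\<integral>\<^sup>+z. h z \<partial>borel_of (radon_prod \<mu> \<nu>)) < top" 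
    and add: "(\<integral>\<^sup>+z. k z \<partial>borel_of (radon_prod \<mu> \<nu>)) + (\<integral>\<^sup>+z. h z \<partial>borel_of (radon_prod \<mu> \<nu>)) = (\<integral>\<^sup>+z. ennreal c \<partial>borel_of (radon_prod \<mu> \<nu>))"
    if "\<mu> \<in> pos_radon" "\<nu> \<in> pos_radon" for \<mu> \<nu> :: "('a \<Rightarrow> real) \<Rightarrow> real"
  proof -
    note pp = radon_prod_pos[OF lc lc that]
    note sp = representsD(1)[OF Riesz_Markov[OF lch_prod[OF lc lc] pp]]
    have "space (borel_of (radon_prod \<mu> \<nu>)) = UNIV" using sets_eq_imp_space_eq[OF sp] by simp
    moreover have "(\<integral>\<^sup>+z. h z \<partial>borel_of (radon_prod \<mu> \<nu>)) \<le> (\<integral>\<^sup>+z. ennreal c \<partial>borel_of (radon_prod \<mu> \<nu>))"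
      by (intro nn_integral_mono hle)
    ultimately show "(\<integral>\<^sup>+z. h z \<partial>borel_of (radon_prod \<mu> \<nu>)) < top"
      using compact_UNIV_finite[OF lch_prod[OF lc lc] pp cpt]
      by (simp add: ennreal_mult_less_top le_less_trans)
    show "(\<integral>\<^sup>+z. k z \<partial>borel_of (radon_prod \<mu> \<nu>)) + (\<integral>\<^sup>+z. h z \<partial>borel_of (radon_prod \<mu> \<nu>)) = (\<integral>\<^sup>+z. ennreal c \<partial>borel_of (radon_prod \<mu> \<nu>))"
      using km hm sp by (subst nn_integral_add[symmetric]) (simp_all add: k cong: measurable_cong_sets)
  qed
  have sp\<nu>: "space (borel_of \<nu>) = UNIV" using sets_eq_imp_space_eq[OF sets1(2)] by simp
  have finx: "(\<integral>\<^sup>+y. h (x, y) \<partial>borel_of \<nu>) < top" for x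
  proof -
    have "(\<integral>\<^sup>+y. h (x, y) \<partial>borel_of \<nu>) \<le> (\<integral>\<^sup>+y. ennreal c \<partial>borel_of \<nu>)" by (intro nn_integral_mono hle)
    also have "\<dots> < top" using compact_UNIV_finite[OF lc \<nu> cpt1] by (simp add: sp\<nu> ennreal_mult_less_top)
    finally show ?thesis .
  qed
  have inner_add: "(\<integral>\<^sup>+y. k (x, y) \<partial>borel_of \<nu>) + (\<integral>\<^sup>+y. h (x, y) \<partial>borel_of \<nu>) = (\<integral>\<^sup>+y. ennreal c \<partial>borel_of \<nu>)" for x
    using kslice slice sets1 by (subst nn_integral_add[symmetric]) (simp_all add: k cong: measurable_cong_sets)
  then have inner: "(\<integral>\<^sup>+y. k (x, y) \<partial>borel_of \<nu>) = (\<integral>\<^sup>+y. ennreal c \<partial>borel_of \<nu>) - (\<integral>\<^sup>+y. h (x, y) \<partial>borel_of \<nu>)" for x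
    using finx[of x] by (metis ennreal_add_diff_cancel_right less_top)
  have hinner: "(\<lambda>x. \<integral>\<^sup>+y. h (x, y) \<partial>borel_of \<nu>) \<in> borel_measurable borel"
    using prod(1)[OF \<mu> \<nu>] by (simp add: fubini_holds_def)
  then have minner: "(\<lambda>x. \<integral>\<^sup>+y. k (x, y) \<partial>borel_of \<nu>) \<in> borel_measurable borel"
    unfolding inner by measurable
  have "(\<integral>\<^sup>+x. \<integral>\<^sup>+y. k (x, y) \<partial>borel_of \<nu> \<partial>borel_of \<mu>) + (\<integral>\<^sup>+x. \<integral>\<^sup>+y. h (x, y) \<partial>borel_of \<nu> \<partial>borel_of \<mu>)
      = (\<integral>\<^sup>+x. \<integral>\<^sup>+y. ennreal c \<partial>borel_of \<nu> \<partial>borel_of \<mu>)"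
    using minner hinner sets1 by (subst nn_integral_add[symmetric]) (simp_all add: inner_add cong: measurable_cong_sets)
  then have "(\<integral>\<^sup>+x. \<integral>\<^sup>+y. k (x, y) \<partial>borel_of \<nu> \<partial>borel_of \<mu>) + (\<integral>\<^sup>+z. h z \<partial>borel_of (radon_prod \<mu> \<nu>))
      = (\<integral>\<^sup>+z. k z \<partial>borel_of (radon_prod \<mu> \<nu>)) + (\<integral>\<^sup>+z. h z \<partial>borel_of (radon_prod \<mu> \<nu>))"
    using prod[OF \<mu> \<nu>] add[OF \<mu> \<nu>] by (simp add: fubini_holds_def)
  then have "(\<integral>\<^sup>+x. \<integral>\<^sup>+y. k (x, y) \<partial>borel_of \<nu> \<partial>borel_of \<mu>) = (\<integral>\<^sup>+z. k z \<partial>borel_of (radon_prod \<mu> \<nu>))"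
    using finh[OF \<mu> \<nu>] by (metis ennreal_add_diff_cancel_right less_top)
  then show "fubini_holds \<mu> \<nu> k" using km minner by (simp add: fubini_holds_def)
  assume sym: "\<And>x y. k (x, y) = k (y, x)"
  have hsym: "h (x, y) = h (y, x)" for x y
  proof -
    have "k (x, y) \<noteq> top" using k[of "(x, y)"] by (metis add_top_right_ennreal ennreal_neq_top add.commute)
    moreover have "k (x, y) + h (x, y) = k (x, y) + h (y, x)" using k[of "(x, y)"] k[of "(y, x)"] sym[of x y] by simp
    ultimately show ?thesis by (metis ennreal_add_diff_cancel_left)
  qed
  have "(\<integral>\<^sup>+z. k z \<partial>borel_of (radon_prod \<mu> \<nu>)) + (\<integral>\<^sup>+z. h z \<partial>borel_of (radon_prod \<mu> \<nu>))
     = (\<integral>\<^sup>+z. k z \<partial>borel_of (radon_prod \<nu> \<mu>)) + (\<integral>\<^sup>+z. h z \<partial>borel_of (radon_prod \<mu> \<nu>))"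
    using add[OF \<mu> \<nu>] add[OF \<nu> \<mu>] nn_integral_prod_commute_lsc[OF lc \<mu> \<nu> h hsym]
      nn_integral_prod_commute_lsc[OF lc \<mu> \<nu> const_lsc refl, of "ennreal c"] by simp
  then show "(\<integral>\<^sup>+z. k z \<partial>borel_of (radon_prod \<mu> \<nu>)) = (\<integral>\<^sup>+z. k z \<partial>borel_of (radon_prod \<nu> \<mu>))"
    using finh[OF \<mu> \<nu>] by (metis ennreal_add_diff_cancel_right less_top)
qed

section \<open>Integrals against positive functionals\<close>

lemma borel_of_zero:
  assumes lc: "lch TYPE('a::t2_space)" and g: "g \<in> borel_measurable borel"
  shows "(\<integral>\<^sup>+x. g x \<partial>borel_of (\<lambda>\<phi> :: 'a \<Rightarrow> real. 0)) = 0"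
proof -
  have "(\<lambda>\<phi> :: 'a \<Rightarrow> real. 0 :: real) \<in> pos_radon" by (rule positive_functional_is_radon[OF lc]) auto
  from nn_integral_lincomb[OF lc this this, of 0 0 g] g show ?thesis by simp
qed

lemma integral_pos_neg_of_pos:
  fixes T :: "('a::t2_space \<Rightarrow> real) \<Rightarrow> real"
  assumes lc: "lch TYPE('a)" and T: "T \<in> pos_radon" and [measurable]: "g \<in> borel_measurable borel"
  shows "integral_pos T g = (\<integral>\<^sup>+x. e2ennreal (g x) \<partial>borel_of T)"
    and "integral_neg T g = (\<integral>\<^sup>+x. e2ennreal (- g x) \<partial>borel_of T)"
  unfolding integral_pos_def integral_neg_def pos_part_of_pos[OF lc T]
  by (subst borel_of_zero[OF lc]; simp)+

lemma nn_integral_borel_of_add: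
  fixes T S :: "('a::t2_space \<Rightarrow> real) \<Rightarrow> real"
  assumes "lch TYPE('a)" "T \<in> pos_radon" "S \<in> pos_radon" "g \<in> borel_measurable borel"
  shows "(\<integral>\<^sup>+x. g x \<partial>borel_of (\<lambda>\<phi>. T \<phi> + S \<phi>)) = (\<integral>\<^sup>+x. g x \<partial>borel_of T) + (\<integral>\<^sup>+x. g x \<partial>borel_of S)"
  using nn_integral_lincomb[OF assms(1-3), of 1 1] assms(4) by simp

lemma pos_radon_add: "T \<in> pos_radon \<Longrightarrow> S \<in> pos_radon \<Longrightarrow> (\<lambda>\<phi>. T \<phi> + S \<phi>) \<in> pos_radon"
  using pos_radon_lincomb[of T S 1 1] by simp

section \<open>Energy\<close>

locale energy_kernel =
  fixes \<kappa> :: "'a::t2_space \<times> 'a \<Rightarrow> ereal"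
  assumes lc: "lch TYPE('a)" and ker: "kernel \<kappa>" and ep: "energy_principle \<kappa>"
begin

definition pos_energy where "pos_energy \<mu> \<nu> = (\<integral>\<^sup>+z. e2ennreal (\<kappa> z) \<partial>borel_of (radon_prod \<mu> \<nu>))"
definition neg_energy where "neg_energy \<mu> \<nu> = (\<integral>\<^sup>+z. e2ennreal (- \<kappa> z) \<partial>borel_of (radon_prod \<mu> \<nu>))"
text \<open>Since \<open>enn2real\<close> sends infinity to 0, this is the mutual energy only where
  \<open>pos_energy\<close> is finite. On \<open>E\<close> that is established by
  \<open>energy_diff\<close>.\<close>

definition ener :: "(('a \<Rightarrow> real) \<Rightarrow> real) \<Rightarrow> (('a \<Rightarrow> real) \<Rightarrow> real) \<Rightarrow> real" where
  "ener \<mu> \<nu> = enn2real (pos_energy \<mu> \<nu>) - enn2real (neg_energy \<mu> \<nu>)"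

abbreviation E where "E \<equiv> energy_cone \<kappa>"

lemma kernel_Phi: "\<kappa> \<in> Phi" and kernel_sym: "\<kappa> (x, y) = \<kappa> (y, x)"
  using ker by (auto simp: kernel_def)

lemmas lc2 = lch_prod[OF lc lc]

lemmas prod_pos = radon_prod_pos[OF lc lc]

lemma measurable_kernel [measurable]: "\<kappa> \<in> borel_measurable borel"
  by (rule Phi_measurable[OF kernel_Phi])

lemma fubini_pos: "\<mu> \<in> pos_radon \<Longrightarrow> \<nu> \<in> pos_radon \<Longrightarrow> fubini_holds \<mu> \<nu> (\<lambda>z. e2ennreal (\<kappa> z))"
  by (intro fubini_lsc(1) lc Phi_pos_lsc kernel_Phi)

lemma fubini_neg_sym:
  assumes \<mu>: "\<mu> \<in> pos_radon" and \<nu>: "\<nu> \<in> pos_radon"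
  shows "fubini_holds \<mu> \<nu> (\<lambda>z. e2ennreal (- \<kappa> z)) \<and> neg_energy \<mu> \<nu> = neg_energy \<nu> \<mu>"
  using Phi_neg_cases[OF kernel_Phi]
proof (elim disjE conjE exE)
  assume "\<forall>z. e2ennreal (- \<kappa> z) = 0"
  then have "e2ennreal (- \<kappa> z) = 0" for z by blast
  then show ?thesis by (simp add: fubini_holds_def neg_energy_def)
next
  fix c h assume cpt: "compact (UNIV :: ('a \<times> 'a) set)" and h: "\<forall>a. open {z. a < h z}"
    and k: "\<forall>z. e2ennreal (- \<kappa> z) + h z = ennreal c"
  note f = fubini_complement[OF lc \<mu> \<nu> h[rule_format] k[rule_format] cpt]
  show ?thesis unfolding neg_energy_def using f(1) f(2) kernel_sym by metis
qed

lemma pos_energy_sym: "\<mu> \<in> pos_radon \<Longrightarrow> \<nu> \<in> pos_radon \<Longrightarrow> pos_energy \<mu> \<nu> = pos_energy \<nu> \<mu>"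
  unfolding pos_energy_def by (intro nn_integral_prod_commute_lsc lc Phi_pos_lsc kernel_Phi) (simp_all add: kernel_sym)

lemma ener_sym: "\<mu> \<in> pos_radon \<Longrightarrow> \<nu> \<in> pos_radon \<Longrightarrow> ener \<mu> \<nu> = ener \<nu> \<mu>"
  using pos_energy_sym fubini_neg_sym by (simp add: ener_def)

lemma neg_energy_finite: "\<mu> \<in> pos_radon \<Longrightarrow> \<nu> \<in> pos_radon \<Longrightarrow> neg_energy \<mu> \<nu> < top"
  unfolding neg_energy_def by (intro Phi_neg_finite lc2 prod_pos kernel_Phi)

lemma energy_lincomb_left:
  assumes "\<mu> \<in> pos_radon" "\<mu>' \<in> pos_radon" "\<nu> \<in> pos_radon" "0 \<le> a" "0 \<le> b"
  shows "pos_energy (\<lambda>\<phi>. a * \<mu> \<phi> + b * \<mu>' \<phi>) \<nu> = ennreal a * pos_energy \<mu> \<nu> + ennreal b * pos_energy \<mu>' \<nu>"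
    "neg_energy (\<lambda>\<phi>. a * \<mu> \<phi> + b * \<mu>' \<phi>) \<nu> = ennreal a * neg_energy \<mu> \<nu> + ennreal b * neg_energy \<mu>' \<nu>"
  unfolding pos_energy_def neg_energy_def radon_prod_lincomb_left
  using assms by (auto intro!: nn_integral_lincomb lc2 prod_pos)

text \<open>For positive measures the negative part of the energy is always finite, so the energy is
  well defined and only its positive part can be infinite.\<close>

lemma energy_cone_iff:
  assumes \<mu>: "\<mu> \<in> pos_radon"
  shows "\<mu> \<in> E \<longleftrightarrow> pos_energy \<mu> \<mu> < top"
proof -
  note ip = integral_pos_neg_of_pos[OF lc2 prod_pos[OF \<mu> \<mu>] measurable_kernel]
  have "energy_defined \<kappa> \<mu>"
    using neg_energy_finite[OF \<mu> \<mu>] by (simp add: energy_defined_def integral_defined_def ip neg_energy_def)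
  moreover have "energy \<kappa> \<mu> = enn2ereal (pos_energy \<mu> \<mu>) - enn2ereal (neg_energy \<mu> \<mu>)"
    by (simp add: energy_def mutual_energy_def radon_integral_def ip pos_energy_def neg_energy_def)
  moreover have "(enn2ereal (pos_energy \<mu> \<mu>) - enn2ereal (neg_energy \<mu> \<mu>) < \<infinity>) = (pos_energy \<mu> \<mu> < top)"
    using neg_energy_finite[OF \<mu> \<mu>] by (cases "pos_energy \<mu> \<mu>"; cases "neg_energy \<mu> \<mu>") (auto simp: top_ennreal.rep_eq enn2ereal_ennreal)
  ultimately show ?thesis
    using \<mu> pos_radon_signed[OF \<mu>] by (auto simp: energy_cone_def energy_space_def)
qed

lemma cone_pos: "\<mu> \<in> E \<Longrightarrow> \<mu> \<in> pos_radon"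
  by (simp add: energy_cone_def)

lemma enn2ereal_eq: "a < top \<Longrightarrow> enn2ereal a = ereal (enn2real a)"
  by (cases a) (auto simp: enn2ereal_ennreal)

lemma energy_eq: "\<mu> \<in> E \<Longrightarrow> energy \<kappa> \<mu> = ereal (ener \<mu> \<mu>)"
proof -
  assume \<mu>E: "\<mu> \<in> E"
  note \<mu> = cone_pos[OF \<mu>E]
  note ip = integral_pos_neg_of_pos[OF lc2 prod_pos[OF \<mu> \<mu>] measurable_kernel]
  have "pos_energy \<mu> \<mu> < top" using \<mu>E energy_cone_iff[OF \<mu>] by simp
  then show ?thesis
    using neg_energy_finite[OF \<mu> \<mu>]
    by (simp add: energy_def mutual_energy_def radon_integral_def ip ener_def enn2ereal_eq flip: pos_energy_def neg_energy_def)
qed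

text \<open>The cross terms of the square of the difference exceed its negative part by exactly as much as the
  squares exceed its positive part, and the energy principle bounds the negative part by the positive one.\<close>

lemma energy_diff:
  assumes \<mu>E: "\<mu> \<in> E" and \<nu>E: "\<nu> \<in> E"
  shows "pos_energy \<mu> \<nu> < top" "(\<lambda>\<phi>. \<mu> \<phi> - \<nu> \<phi>) \<in> energy_space \<kappa>"
    "energy \<kappa> (\<lambda>\<phi>. \<mu> \<phi> - \<nu> \<phi>) = ereal (ener \<mu> \<mu> - 2 * ener \<mu> \<nu> + ener \<nu> \<nu>)"
proof -
  note \<mu> = cone_pos[OF \<mu>E] and \<nu> = cone_pos[OF \<nu>E]
  define \<delta> where "\<delta> = (\<lambda>\<phi>. \<mu> \<phi> - \<nu> \<phi>)"
  have s\<delta>: "\<delta> \<in> signed_radon"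
    unfolding \<delta>_def using signed_radon_lincomb[OF pos_radon_signed[OF \<mu>] pos_radon_signed[OF \<nu>], of 1 "-1"] by simp
  define T S where "T = (\<lambda>F. radon_prod \<mu> \<mu> F + radon_prod \<nu> \<nu> F)" and "S = (\<lambda>F. radon_prod \<mu> \<nu> F + radon_prod \<nu> \<mu> F)"
  have T: "T \<in> pos_radon" and S: "S \<in> pos_radon"
    unfolding T_def S_def by (intro pos_radon_add prod_pos \<mu> \<nu>)+
  have W: "radon_prod \<delta> \<delta> = (\<lambda>F. T F - S F)"
  proof -
    have "radon_prod \<delta> \<delta> = (\<lambda>F. 1 * radon_prod \<mu> \<delta> F + (-1) * radon_prod \<nu> \<delta> F)"
      using radon_prod_lincomb_left[of 1 \<mu> "-1" \<nu> \<delta>] by (simp add: \<delta>_def)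
    moreover have "radon_prod c \<delta> = (\<lambda>F. 1 * radon_prod c \<mu> F + (-1) * radon_prod c \<nu> F)" if "c \<in> signed_radon" for c :: "('a \<Rightarrow> real) \<Rightarrow> real"
      using radon_prod_lincomb_right[OF that pos_radon_signed[OF \<mu>] pos_radon_signed[OF \<nu>], of 1 "-1"] by (simp add: \<delta>_def)
    ultimately show ?thesis using pos_radon_signed[OF \<mu>] pos_radon_signed[OF \<nu>] by (simp add: fun_eq_iff T_def S_def)
  qed
  \<comment> \<open>The squares in \<open>T\<close> and the cross terms in \<open>S\<close> exceed
    the Jordan parts of the square of \<delta> by the same \<open>R\<close>. Its energy is finite
    because that of \<open>T\<close> is, and so it drops out of the difference.\<close>
  obtain R where R: "R \<in> pos_radon" "T = (\<lambda>\<phi>. pos_part (radon_prod \<delta> \<delta>) \<phi> + R \<phi>)" "S = (\<lambda>\<phi>. neg_part (radon_prod \<delta> \<delta>) \<phi> + R \<phi>)"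
    by (rule common_part[OF lc2 T S, folded W]) (rule that)
  have sW: "radon_prod \<delta> \<delta> \<in> signed_radon"
    unfolding W using signed_radon_lincomb[OF pos_radon_signed[OF T] pos_radon_signed[OF S], of 1 "-1"] by simp
  define P N where "P = pos_part (radon_prod \<delta> \<delta>)" and "N = neg_part (radon_prod \<delta> \<delta>)"
  have P: "P \<in> pos_radon" and N: "N \<in> pos_radon"
    unfolding P_def N_def by (intro pos_part_pos_radon neg_part_pos_radon lc2 sW)+
  define p n where "p Q = (\<integral>\<^sup>+z. e2ennreal (\<kappa> z) \<partial>borel_of Q)" and "n Q = (\<integral>\<^sup>+z. e2ennreal (- \<kappa> z) \<partial>borel_of Q)" for Q
  have add: "p (\<lambda>F. Q F + Q' F) = p Q + p Q'" "n (\<lambda>F. Q F + Q' F) = n Q + n Q'" if "Q \<in> pos_radon" "Q' \<in> pos_radon" for Q Q'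
    unfolding p_def n_def by (intro nn_integral_borel_of_add lc2 that; measurable)+
  have nfin: "n Q < top" if "Q \<in> pos_radon" for Q unfolding n_def by (rule Phi_neg_finite[OF lc2 that kernel_Phi])
  have pT: "p T = p P + p R" "n T = n P + n R" "p S = p N + p R" "n S = n N + n R"
    using add[OF P R(1)] add[OF N R(1)] R(2,3) unfolding P_def N_def by simp_all
  have pT2: "p T = pos_energy \<mu> \<mu> + pos_energy \<nu> \<nu>" "n T = neg_energy \<mu> \<mu> + neg_energy \<nu> \<nu>"
     "p S = pos_energy \<mu> \<nu> + pos_energy \<nu> \<mu>" "n S = neg_energy \<mu> \<nu> + neg_energy \<nu> \<mu>"
    unfolding T_def S_def pos_energy_def neg_energy_def p_def[symmetric] n_def[symmetric]
    by (intro add prod_pos \<mu> \<nu>)+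
  have fin\<mu>\<nu>: "pos_energy \<mu> \<mu> < top" "pos_energy \<nu> \<nu> < top"
    using \<mu>E \<nu>E energy_cone_iff \<mu> \<nu> by blast+
  then have "p T < top" using pT2 by simp
  then have pPR: "p P < top" "p R < top" using pT by auto
  have ip: "integral_pos (radon_prod \<delta> \<delta>) \<kappa> = p P + n N" "integral_neg (radon_prod \<delta> \<delta>) \<kappa> = n P + p N"
    by (simp_all add: integral_pos_def integral_neg_def P_def N_def p_def n_def)
  have fp: "integral_pos (radon_prod \<delta> \<delta>) \<kappa> < top" unfolding ip using pPR nfin[OF N] by simp
  then have ed: "energy_defined \<kappa> \<delta>"
    by (simp add: energy_defined_def integral_defined_def)
  have en: "energy \<kappa> \<delta> = enn2ereal (p P + n N) - enn2ereal (n P + p N)"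
    by (simp add: energy_def mutual_energy_def radon_integral_def ip)
  \<comment> \<open>The energy principle can be applied before the mutual energy is known to be
    finite: the positive part is finite, which already makes the energy well defined, and an
    infinite \<open>p N\<close> would then give the value \<open>-\<infinity>\<close>.\<close>
  have "0 \<le> energy \<kappa> \<delta>" using ep s\<delta> ed unfolding energy_principle_def by blast
  then have "p N < top"
    unfolding en using fp[unfolded ip] by (cases "p N"; cases "p P + n N") (auto simp: enn2ereal_ennreal top_ennreal.rep_eq)
  then have "p S < top" using pT pPR by simp
  then show fin: "pos_energy \<mu> \<nu> < top" using pT2 by auto
  have "enn2real (p P) + enn2real (n N) - enn2real (n P) - enn2real (p N)
      = (enn2real (p T) - enn2real (n T)) - (enn2real (p S) - enn2real (n S))"
    unfolding pT using pPR \<open>p N < top\<close> nfin P N R(1) by (simp add: enn2real_plus)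
  also have "\<dots> = ener \<mu> \<mu> - 2 * ener \<mu> \<nu> + ener \<nu> \<nu>"
    unfolding pT2 using fin fin\<mu>\<nu> neg_energy_finite \<mu> \<nu> pos_energy_sym[OF \<mu> \<nu>] ener_sym[OF \<mu> \<nu>]
    by (simp add: enn2real_plus ener_def)
  finally have "energy \<kappa> \<delta> = ereal (ener \<mu> \<mu> - 2 * ener \<mu> \<nu> + ener \<nu> \<nu>)"
    unfolding en using pPR \<open>p N < top\<close> nfin P N by (simp add: enn2ereal_eq enn2real_plus algebra_simps)
  then show "energy \<kappa> (\<lambda>\<phi>. \<mu> \<phi> - \<nu> \<phi>) = ereal (ener \<mu> \<mu> - 2 * ener \<mu> \<nu> + ener \<nu> \<nu>)" by (simp add: \<delta>_def)
  then show "(\<lambda>\<phi>. \<mu> \<phi> - \<nu> \<phi>) \<in> energy_space \<kappa>"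
    using s\<delta> ed by (simp add: energy_space_def \<delta>_def)
qed

lemma energy_principle_diff:
  assumes \<mu>: "\<mu> \<in> E" and \<nu>: "\<nu> \<in> E"
  shows "0 \<le> ener \<mu> \<mu> - 2 * ener \<mu> \<nu> + ener \<nu> \<nu>"
    and "ener \<mu> \<mu> - 2 * ener \<mu> \<nu> + ener \<nu> \<nu> = 0 \<Longrightarrow> \<mu> = \<nu>"
proof -
  note d = energy_diff[OF \<mu> \<nu>]
  have pr: "0 \<le> energy \<kappa> (\<lambda>\<phi>. \<mu> \<phi> - \<nu> \<phi>)" "energy \<kappa> (\<lambda>\<phi>. \<mu> \<phi> - \<nu> \<phi>) = 0 \<Longrightarrow> (\<lambda>\<phi>. \<mu> \<phi> - \<nu> \<phi>) = (\<lambda>\<phi>. 0)"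
    using ep d(2) unfolding energy_principle_def energy_space_def by blast+
  show "0 \<le> ener \<mu> \<mu> - 2 * ener \<mu> \<nu> + ener \<nu> \<nu>" using pr(1) unfolding d(3) by simp
  assume "ener \<mu> \<mu> - 2 * ener \<mu> \<nu> + ener \<nu> \<nu> = 0"
  then have "(\<lambda>\<phi>. \<mu> \<phi> - \<nu> \<phi>) = (\<lambda>\<phi>. 0)" using pr(2) unfolding d(3) by simp
  then have "\<mu> \<phi> - \<nu> \<phi> = 0" for \<phi> by meson
  then show "\<mu> = \<nu>" by (simp add: fun_eq_iff)
qed

section \<open>Bilinearity of the mutual energy\<close>

lemma ener_lincomb_left:
  assumes \<mu>: "\<mu> \<in> E" and \<mu>': "\<mu>' \<in> E" and \<nu>: "\<nu> \<in> E" and ab: "0 \<le> a" "0 \<le> b"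
  shows "ener (\<lambda>\<phi>. a * \<mu> \<phi> + b * \<mu>' \<phi>) \<nu> = a * ener \<mu> \<nu> + b * ener \<mu>' \<nu>"
  unfolding ener_def energy_lincomb_left[OF cone_pos[OF \<mu>] cone_pos[OF \<mu>'] cone_pos[OF \<nu>] ab]
  using energy_diff(1)[OF \<mu> \<nu>] energy_diff(1)[OF \<mu>' \<nu>] neg_energy_finite cone_pos \<mu> \<mu>' \<nu> ab
  by (simp add: enn2real_plus ennreal_mult_less_top enn2real_mult algebra_simps)

lemma cone_lincomb:
  assumes \<mu>: "\<mu> \<in> E" and \<mu>': "\<mu>' \<in> E" and ab: "0 \<le> a" "0 \<le> b"
  shows "(\<lambda>\<phi>. a * \<mu> \<phi> + b * \<mu>' \<phi>) \<in> E"
proof -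
  note p = cone_pos[OF \<mu>] cone_pos[OF \<mu>']
  have l: "(\<lambda>\<phi>. a * \<mu> \<phi> + b * \<mu>' \<phi>) \<in> pos_radon" by (intro pos_radon_lincomb p ab)
  have f: "pos_energy (\<lambda>\<phi>. a * \<mu> \<phi> + b * \<mu>' \<phi>) \<nu> < top" if \<nu>: "\<nu> \<in> E" for \<nu>
    unfolding energy_lincomb_left(1)[OF p cone_pos[OF \<nu>] ab]
    using energy_diff(1)[OF \<mu> \<nu>] energy_diff(1)[OF \<mu>' \<nu>] by (simp add: ennreal_mult_less_top)
  have "pos_energy (\<lambda>\<phi>. a * \<mu> \<phi> + b * \<mu>' \<phi>) (\<lambda>\<phi>. a * \<mu> \<phi> + b * \<mu>' \<phi>) < top"
    unfolding energy_lincomb_left(1)[OF p l ab]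
    using f[OF \<mu>] f[OF \<mu>'] pos_energy_sym[OF l p(1)] pos_energy_sym[OF l p(2)] by (simp add: ennreal_mult_less_top)
  then show ?thesis using energy_cone_iff[OF l] by simp
qed

lemma ener_lincomb_right:
  assumes "\<mu> \<in> E" "\<mu>' \<in> E" "\<nu> \<in> E" "0 \<le> a" "0 \<le> b"
  shows "ener \<nu> (\<lambda>\<phi>. a * \<mu> \<phi> + b * \<mu>' \<phi>) = a * ener \<nu> \<mu> + b * ener \<nu> \<mu>'"
  using ener_lincomb_left[OF assms] cone_lincomb[OF assms(1,2,4,5)] assms ener_sym cone_pos by metis

lemma ener_nonneg: "\<mu> \<in> E \<Longrightarrow> 0 \<le> ener \<mu> \<mu>"
proof -
  assume \<mu>: "\<mu> \<in> E"
  have z: "(\<lambda>\<phi>. 0 * \<mu> \<phi> + 0 * \<mu> \<phi>) \<in> E" by (intro cone_lincomb \<mu>) auto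
  have "ener (\<lambda>\<phi>. 0 * \<mu> \<phi> + 0 * \<mu> \<phi>) \<nu> = 0" if "\<nu> \<in> E" for \<nu>
    using ener_lincomb_left[OF \<mu> \<mu> that, of 0 0] by simp
  from this[OF z] this[OF \<mu>] energy_principle_diff(1)[OF z \<mu>] show ?thesis by simp
qed

text \<open>Finite energy bounds the integral of the positive part of the kernel against the
  positive part of the square of \<theta>. By \<open>pos_part_square_ge\<close> this dominates the
  same integral for the square of \<open>pos_part \<theta>\<close>. As \<theta> and
  \<open>- \<theta>\<close> have the same square, \<open>neg_part \<theta>\<close> is covered as
  well.\<close>

lemma energy_space_parts:
  assumes \<theta>: "\<theta> \<in> energy_space \<kappa>"
  shows "pos_part \<theta> \<in> E" "neg_part \<theta> \<in> E" "\<theta> = (\<lambda>\<phi>. pos_part \<theta> \<phi> - neg_part \<theta> \<phi>)"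
proof -
  have s: "\<theta> \<in> signed_radon" and ed: "energy_defined \<kappa> \<theta>" and e: "energy \<kappa> \<theta> < \<infinity>"
    using \<theta> by (auto simp: energy_space_def)
  show "\<theta> = (\<lambda>\<phi>. pos_part \<theta> \<phi> - neg_part \<theta> \<phi>)" by (rule Jordan_decomposition[OF lc s])
  have "0 \<le> energy \<kappa> \<theta>" using ep s ed unfolding energy_principle_def by blast
  then have "integral_pos (radon_prod \<theta> \<theta>) \<kappa> < top"
    using e ed unfolding energy_def mutual_energy_def radon_integral_def energy_defined_def integral_defined_def
    by (cases "integral_pos (radon_prod \<theta> \<theta>) \<kappa>"; cases "integral_neg (radon_prod \<theta> \<theta>) \<kappa>")
       (auto simp: enn2ereal_ennreal top_ennreal.rep_eq)
  then have fin: "(\<integral>\<^sup>+z. e2ennreal (\<kappa> z) \<partial>borel_of (pos_part (radon_prod \<theta> \<theta>))) < top"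
    unfolding integral_pos_def by simp
  have gen: "pos_part \<eta> \<in> E" if \<eta>: "\<eta> \<in> signed_radon" and eq: "radon_prod \<eta> \<eta> = radon_prod \<theta> \<theta>" for \<eta>
  proof -
    have p: "pos_part \<eta> \<in> pos_radon" by (rule pos_part_pos_radon[OF lc \<eta>])
    have W: "radon_prod \<eta> \<eta> \<in> signed_radon"
      using pos_part_square_ge(1)[OF lc \<eta> Cc_zero] by simp
    note P = pos_part_pos_radon[OF lc2 W]
    have "pos_energy (pos_part \<eta>) (pos_part \<eta>) \<le> (\<integral>\<^sup>+z. e2ennreal (\<kappa> z) \<partial>borel_of (pos_part (radon_prod \<eta> \<eta>)))"
      unfolding pos_energy_def nn_integral_lsc[OF lc2 P Riesz_Markov[OF lc2 P] Phi_pos_lsc[OF kernel_Phi]]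
        nn_integral_lsc[OF lc2 prod_pos[OF p p] Riesz_Markov[OF lc2 prod_pos[OF p p]] Phi_pos_lsc[OF kernel_Phi]]
      by (intro SUP_mono' ennreal_leI SUP_mono bexI) (auto intro!: pos_part_square_ge(2)[OF lc \<eta>] dest: belowD)
    then show ?thesis using fin eq energy_cone_iff[OF p] by (simp add: le_less_trans)
  qed
  show "pos_part \<theta> \<in> E" by (rule gen[OF s refl])
  have "radon_prod (\<lambda>\<phi>. - \<theta> \<phi>) (\<lambda>\<phi>. - \<theta> \<phi>) = radon_prod \<theta> \<theta>"
  proof
    fix F :: "'a \<times> 'a \<Rightarrow> real"
    show "radon_prod (\<lambda>\<phi>. - \<theta> \<phi>) (\<lambda>\<phi>. - \<theta> \<phi>) F = radon_prod \<theta> \<theta> F"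
      using radon_uminus[OF s Cc_partial_integral[OF s], of F] by (cases "F \<in> Cc") (auto simp: radon_prod_def)
  qed
  then show "neg_part \<theta> \<in> E" unfolding neg_part_def by (intro gen signed_radon_uminus s)
qed

end

lemma discriminant_le:
  fixes a b c :: real
  assumes "\<And>t. 0 \<le> a + 2 * t * b + t\<^sup>2 * c" and c: "0 \<le> c"
  shows "b\<^sup>2 \<le> a * c"
proof (cases "c = 0")
  case True
  have "b = 0"
  proof (rule ccontr)
    assume b: "b \<noteq> 0"
    \<comment> \<open>At this value of \<open>t\<close> the affine function equals
      \<open>a - (a + 1) = -1\<close>.\<close>
    have "0 \<le> a + 2 * (- (a + 1) / (2 * b)) * b" using assms(1)[of "- (a + 1) / (2 * b)"] True by simp
    then show False using b by (simp add: field_simps)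
  qed
  then show ?thesis using True by simp
next
  case False
  then have "0 < c" using c by simp
  have "0 \<le> a - b\<^sup>2 / c"
    using assms(1)[of "- b / c"] False by (simp add: power2_eq_square field_simps)
  then show ?thesis using \<open>0 < c\<close> by (simp add: field_simps)
qed

context energy_kernel begin

section \<open>The strong metric\<close>

text \<open>The energy of \<mu> - \<nu>, expanded so that only positive measures enter.\<close>

definition dist_sq where "dist_sq \<mu> \<nu> = ener \<mu> \<mu> - 2 * ener \<mu> \<nu> + ener \<nu> \<nu>"

lemma dist_sq_nonneg: "\<mu> \<in> E \<Longrightarrow> \<nu> \<in> E \<Longrightarrow> 0 \<le> dist_sq \<mu> \<nu>"
  unfolding dist_sq_def by (rule energy_principle_diff(1))

lemma dist_sq_eq_0: "\<mu> \<in> E \<Longrightarrow> \<nu> \<in> E \<Longrightarrow> dist_sq \<mu> \<nu> = 0 \<Longrightarrow> \<mu> = \<nu>"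
  unfolding dist_sq_def by (rule energy_principle_diff(2))

lemma cone_space: "\<mu> \<in> E \<Longrightarrow> \<mu> \<in> energy_space \<kappa>"
  by (simp add: energy_cone_def)

lemma zero_cone: "\<mu> \<in> E \<Longrightarrow> (\<lambda>\<phi>. 0) \<in> E"
  using cone_lincomb[of \<mu> \<mu> 0 0] by simp

lemma ener_zero: "\<mu> \<in> E \<Longrightarrow> ener (\<lambda>\<phi>. 0) \<mu> = 0" "\<mu> \<in> E \<Longrightarrow> ener \<mu> (\<lambda>\<phi>. 0) = 0"
  using ener_lincomb_left[of \<mu> \<mu> \<mu> 0 0] ener_lincomb_right[of \<mu> \<mu> \<mu> 0 0] by simp_all

text \<open>The squared norm of \<open>(p - n) + t (p' - n')\<close>, where a signed measure is
  given by a pair of elements of the cone. The restriction to nonnegative \<open>t\<close> keeps the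
  combinations in the cone.\<close>

lemma dist_sq_lincomb:
  assumes E: "p \<in> E" "n \<in> E" "p' \<in> E" "n' \<in> E" and t: "0 \<le> t"
  shows "dist_sq (\<lambda>\<phi>. 1 * p \<phi> + t * p' \<phi>) (\<lambda>\<phi>. 1 * n \<phi> + t * n' \<phi>)
    = dist_sq p n + 2 * t * (ener p p' - ener p n' - ener n p' + ener n n') + t\<^sup>2 * dist_sq p' n'"
proof -
  have gen: "ener (\<lambda>\<phi>. 1 * a \<phi> + t * a' \<phi>) (\<lambda>\<phi>. 1 * b \<phi> + t * b' \<phi>)
      = ener a b + t * ener a b' + t * ener a' b + t\<^sup>2 * ener a' b'"
    if "a \<in> E" "a' \<in> E" "b \<in> E" "b' \<in> E" for a a' b b'
    using ener_lincomb_left[OF that(1,2) cone_lincomb[OF that(3,4) zero_le_one t] zero_le_one t]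
      ener_lincomb_right[OF that(3,4,1) zero_le_one t] ener_lincomb_right[OF that(3,4,2) zero_le_one t]
    by (simp add: power2_eq_square algebra_simps)
  have s: "ener p' p = ener p p'" "ener n' n = ener n n'" "ener p' n = ener n p'"
    by (intro ener_sym cone_pos E)+
  show ?thesis
    unfolding dist_sq_def gen[OF E(1,3,1,3)] gen[OF E(1,3,2,4)] gen[OF E(2,4,2,4)] s
    by (simp add: algebra_simps)
qed

text \<open>The Cauchy-Schwarz inequality for the signed measures \<open>p - n\<close> and
  \<open>p' - n'\<close>, from nonnegativity of the squared norm along a line.\<close>

lemma Cauchy_Schwarz_diff:
  assumes E: "p \<in> E" "n \<in> E" "p' \<in> E" "n' \<in> E"
  shows "(ener p p' - ener p n' - ener n p' + ener n n')\<^sup>2 \<le> dist_sq p n * dist_sq p' n'"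
proof (rule discriminant_le)
  fix t :: real
  show "0 \<le> dist_sq p n + 2 * t * (ener p p' - ener p n' - ener n p' + ener n n') + t\<^sup>2 * dist_sq p' n'"
  proof (cases "0 \<le> t")
    case True
    show ?thesis unfolding dist_sq_lincomb[OF E True, symmetric]
      by (intro dist_sq_nonneg cone_lincomb E True) auto
  next
    case False
    \<comment> \<open>A negative coefficient is turned into a positive one by exchanging
      \<open>p'\<close> and \<open>n'\<close>.\<close>
    then have t: "0 \<le> - t" by simp
    have "0 \<le> dist_sq (\<lambda>\<phi>. 1 * p \<phi> + (- t) * n' \<phi>) (\<lambda>\<phi>. 1 * n \<phi> + (- t) * p' \<phi>)"
      by (intro dist_sq_nonneg cone_lincomb E t) auto
    also have "\<dots> = dist_sq p n + 2 * (- t) * (ener p n' - ener p p' - ener n n' + ener n p') + (- t)\<^sup>2 * dist_sq n' p'"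
      by (rule dist_sq_lincomb[OF E(1,2,4,3) t])
    also have "dist_sq n' p' = dist_sq p' n'"
      unfolding dist_sq_def using ener_sym[OF cone_pos[OF E(3)] cone_pos[OF E(4)]] by simp
    finally show ?thesis by (simp add: algebra_simps)
  qed
qed (rule dist_sq_nonneg[OF E(3,4)])

lemma ener_diff_bound:
  assumes "a \<in> E" "\<mu> \<in> E" "\<nu> \<in> E"
  shows "\<bar>ener a \<mu> - ener a \<nu>\<bar> \<le> sqrt (ener a a) * sqrt (dist_sq \<mu> \<nu>)"
proof -
  have "(ener a \<mu> - ener a \<nu>)\<^sup>2 \<le> ener a a * dist_sq \<mu> \<nu>"
    using Cauchy_Schwarz_diff[OF assms(1) zero_cone[OF assms(1)] assms(2,3)] assms
    by (simp add: ener_zero zero_cone dist_sq_def[of a])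
  then have "sqrt ((ener a \<mu> - ener a \<nu>)\<^sup>2) \<le> sqrt (ener a a * dist_sq \<mu> \<nu>)" by (rule real_sqrt_le_mono)
  then show ?thesis by (simp add: real_sqrt_mult)
qed

lemma triangle_dist_sq:
  assumes E: "p \<in> E" "n \<in> E" "p' \<in> E" "n' \<in> E"
  shows "sqrt (dist_sq (\<lambda>\<phi>. p \<phi> + p' \<phi>) (\<lambda>\<phi>. n \<phi> + n' \<phi>)) \<le> sqrt (dist_sq p n) + sqrt (dist_sq p' n')"
proof (rule real_le_lsqrt)
  define b where "b = ener p p' - ener p n' - ener n p' + ener n n'"
  have nn: "0 \<le> dist_sq p n" "0 \<le> dist_sq p' n'" by (intro dist_sq_nonneg E)+
  then show "0 \<le> sqrt (dist_sq p n) + sqrt (dist_sq p' n')" by simp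
  have "sqrt (b\<^sup>2) \<le> sqrt (dist_sq p n * dist_sq p' n')"
    using Cauchy_Schwarz_diff[OF E] unfolding b_def by (rule real_sqrt_le_mono)
  then have "b \<le> sqrt (dist_sq p n) * sqrt (dist_sq p' n')" by (simp add: real_sqrt_mult)
  moreover have "dist_sq (\<lambda>\<phi>. p \<phi> + p' \<phi>) (\<lambda>\<phi>. n \<phi> + n' \<phi>) = dist_sq p n + 2 * b + dist_sq p' n'"
    using dist_sq_lincomb[OF E zero_le_one] by (simp add: b_def)
  ultimately show "dist_sq (\<lambda>\<phi>. p \<phi> + p' \<phi>) (\<lambda>\<phi>. n \<phi> + n' \<phi>) \<le> (sqrt (dist_sq p n) + sqrt (dist_sq p' n'))\<^sup>2"
    using nn by (simp add: power2_sum)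
qed

lemma strong_dist_cone:
  assumes "\<mu> \<in> E" "\<nu> \<in> E"
  shows "strong_dist \<kappa> \<mu> \<nu> = sqrt (dist_sq \<mu> \<nu>)"
  using cone_space assms energy_diff(3)[OF assms] by (simp add: strong_dist_def energy_norm_def dist_sq_def)

text \<open>The difference of two signed measures is regrouped as a difference of two elements of
  the cone; in this form the metric axioms reduce to facts about \<open>dist_sq\<close>.\<close>

lemma strong_dist_space:
  assumes "\<sigma> \<in> energy_space \<kappa>" "\<tau> \<in> energy_space \<kappa>"
  shows "strong_dist \<kappa> \<sigma> \<tau> = sqrt (dist_sq (\<lambda>\<phi>. pos_part \<sigma> \<phi> + neg_part \<tau> \<phi>) (\<lambda>\<phi>. neg_part \<sigma> \<phi> + pos_part \<tau> \<phi>))"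
proof -
  note s = energy_space_parts[OF assms(1)] and t = energy_space_parts[OF assms(2)]
  have c: "(\<lambda>\<phi>. pos_part \<sigma> \<phi> + neg_part \<tau> \<phi>) \<in> E" "(\<lambda>\<phi>. neg_part \<sigma> \<phi> + pos_part \<tau> \<phi>) \<in> E"
    using cone_lincomb[OF s(1) t(2), of 1 1] cone_lincomb[OF s(2) t(1), of 1 1] by simp_all
  have "\<sigma> \<phi> - \<tau> \<phi> = (pos_part \<sigma> \<phi> + neg_part \<tau> \<phi>) - (neg_part \<sigma> \<phi> + pos_part \<tau> \<phi>)" for \<phi>
    using fun_cong[OF s(3), of \<phi>] fun_cong[OF t(3), of \<phi>] by linarith
  then have "energy_norm \<kappa> (\<lambda>\<phi>. \<sigma> \<phi> - \<tau> \<phi>) = energy_norm \<kappa> (\<lambda>\<phi>. (pos_part \<sigma> \<phi> + neg_part \<tau> \<phi>) - (neg_part \<sigma> \<phi> + pos_part \<tau> \<phi>))"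
    by presburger
  then show ?thesis using assms energy_diff(3)[OF c] by (simp add: strong_dist_def energy_norm_def dist_sq_def)
qed

text \<open>The strong topology and strong completeness are expressed by constants of the locale
  \<open>Metric_space\<close>, whose theorems become available through this instance. The energy
  principle provides that distance 0 implies equality.\<close>

lemma Metric_space_energy: "Metric_space (energy_space \<kappa>) (strong_dist \<kappa>)"
proof
  let ?S = "energy_space \<kappa>"
  have add: "(\<lambda>\<phi>. a \<phi> + b \<phi>) \<in> E" if "a \<in> E" "b \<in> E" for a b :: "('a \<Rightarrow> real) \<Rightarrow> real"
    using cone_lincomb[OF that, of 1 1] by simp
  show "0 \<le> strong_dist \<kappa> \<sigma> \<tau>" for \<sigma> \<tau>
  proof (cases "\<sigma> \<in> ?S \<and> \<tau> \<in> ?S")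
    case True
    then show ?thesis
      using energy_space_parts[of \<sigma>] energy_space_parts[of \<tau>] strong_dist_space[of \<sigma> \<tau>]
      by (simp add: dist_sq_nonneg add)
  next
    case False
    then have "strong_dist \<kappa> \<sigma> \<tau> = 0" by (subst strong_dist_def) (rule if_not_P)
    then show ?thesis by simp
  qed
  show "strong_dist \<kappa> \<sigma> \<tau> = strong_dist \<kappa> \<tau> \<sigma>" for \<sigma> \<tau>
  proof (cases "\<sigma> \<in> ?S \<and> \<tau> \<in> ?S")
    case True
    then have c: "(\<lambda>\<phi>. pos_part \<sigma> \<phi> + neg_part \<tau> \<phi>) \<in> E" "(\<lambda>\<phi>. neg_part \<sigma> \<phi> + pos_part \<tau> \<phi>) \<in> E"
      using energy_space_parts[of \<sigma>] energy_space_parts[of \<tau>] by (auto intro: add)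
    have "dist_sq (\<lambda>\<phi>. pos_part \<sigma> \<phi> + neg_part \<tau> \<phi>) (\<lambda>\<phi>. neg_part \<sigma> \<phi> + pos_part \<tau> \<phi>)
      = dist_sq (\<lambda>\<phi>. neg_part \<sigma> \<phi> + pos_part \<tau> \<phi>) (\<lambda>\<phi>. pos_part \<sigma> \<phi> + neg_part \<tau> \<phi>)"
      unfolding dist_sq_def using ener_sym[OF cone_pos[OF c(1)] cone_pos[OF c(2)]] by simp
    then show ?thesis using True strong_dist_space[of \<sigma> \<tau>] strong_dist_space[of \<tau> \<sigma>] by (simp add: add.commute)
  next
    case False
    then show ?thesis unfolding strong_dist_def by (metis (no_types, lifting))
  qed
  show "strong_dist \<kappa> \<sigma> \<tau> = 0 \<longleftrightarrow> \<sigma> = \<tau>" if st: "\<sigma> \<in> ?S" "\<tau> \<in> ?S" for \<sigma> \<tau>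
  proof -
    note s = energy_space_parts[OF st(1)] and t = energy_space_parts[OF st(2)]
    have c: "(\<lambda>\<phi>. pos_part \<sigma> \<phi> + neg_part \<tau> \<phi>) \<in> E" "(\<lambda>\<phi>. neg_part \<sigma> \<phi> + pos_part \<tau> \<phi>) \<in> E"
      using s t by (auto intro: add)
    have "\<sigma> = \<tau>" if "strong_dist \<kappa> \<sigma> \<tau> = 0"
    proof
      fix \<phi>
      have "(\<lambda>\<phi>. pos_part \<sigma> \<phi> + neg_part \<tau> \<phi>) = (\<lambda>\<phi>. neg_part \<sigma> \<phi> + pos_part \<tau> \<phi>)"
        using that strong_dist_space[OF st] by (intro dist_sq_eq_0 c) simp
      then have "pos_part \<sigma> \<phi> + neg_part \<tau> \<phi> = neg_part \<sigma> \<phi> + pos_part \<tau> \<phi>" by meson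
      then show "\<sigma> \<phi> = \<tau> \<phi>" using fun_cong[OF s(3), of \<phi>] fun_cong[OF t(3), of \<phi>] by linarith
    qed
    moreover have "strong_dist \<kappa> \<sigma> \<sigma> = 0"
      unfolding strong_dist_space[OF st(1) st(1)] by (simp add: dist_sq_def add.commute)
    ultimately show ?thesis by blast
  qed
  show "strong_dist \<kappa> \<sigma> \<rho> \<le> strong_dist \<kappa> \<sigma> \<tau> + strong_dist \<kappa> \<tau> \<rho>" if st: "\<sigma> \<in> ?S" "\<tau> \<in> ?S" "\<rho> \<in> ?S" for \<sigma> \<tau> \<rho>
  proof -
    note s = energy_space_parts[OF st(1)] and t = energy_space_parts[OF st(2)] and r = energy_space_parts[OF st(3)]
    define p n p' n' where d: "p = (\<lambda>\<phi>. pos_part \<sigma> \<phi> + neg_part \<tau> \<phi>)" "n = (\<lambda>\<phi>. neg_part \<sigma> \<phi> + pos_part \<tau> \<phi>)"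
      "p' = (\<lambda>\<phi>. pos_part \<tau> \<phi> + neg_part \<rho> \<phi>)" "n' = (\<lambda>\<phi>. neg_part \<tau> \<phi> + pos_part \<rho> \<phi>)"
    have c: "p \<in> E" "n \<in> E" "p' \<in> E" "n' \<in> E" unfolding d by (intro add s t r)+
    have "(\<lambda>\<phi>. \<sigma> \<phi> - \<rho> \<phi>) = (\<lambda>\<phi>. (p \<phi> + p' \<phi>) - (n \<phi> + n' \<phi>))"
    proof
      fix \<phi> show "\<sigma> \<phi> - \<rho> \<phi> = (p \<phi> + p' \<phi>) - (n \<phi> + n' \<phi>)"
        unfolding d using fun_cong[OF s(3), of \<phi>] fun_cong[OF t(3), of \<phi>] fun_cong[OF r(3), of \<phi>] by linarith
    qed
    then have "strong_dist \<kappa> \<sigma> \<rho> = sqrt (dist_sq (\<lambda>\<phi>. p \<phi> + p' \<phi>) (\<lambda>\<phi>. n \<phi> + n' \<phi>))"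
      using st energy_diff(3)[OF add[OF c(1,3)] add[OF c(2,4)]]
      by (simp add: strong_dist_def energy_norm_def dist_sq_def)
    then show ?thesis
      using triangle_dist_sq[OF c] strong_dist_space[OF st(1,2)] strong_dist_space[OF st(2,3)] by (simp add: d)
  qed
qed

section \<open>Potentials\<close>

definition pos_pot where "pos_pot \<mu> x = (\<integral>\<^sup>+y. e2ennreal (\<kappa> (x, y)) \<partial>borel_of \<mu>)"
definition neg_pot where "neg_pot \<mu> x = (\<integral>\<^sup>+y. e2ennreal (- \<kappa> (x, y)) \<partial>borel_of \<mu>)"
definition real_pot where "real_pot \<mu> x = enn2real (pos_pot \<mu> x) - enn2real (neg_pot \<mu> x)"

lemma pot_measurable:
  assumes "\<mu> \<in> pos_radon"
  shows "pos_pot \<mu> \<in> borel_measurable borel" "neg_pot \<mu> \<in> borel_measurable borel"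
  using fubini_pos[OF assms assms] fubini_neg_sym[OF assms assms]
  unfolding fubini_holds_def pos_pot_def neg_pot_def by simp_all

lemma pot_integral:
  assumes "\<mu> \<in> pos_radon" "\<tau> \<in> pos_radon"
  shows "(\<integral>\<^sup>+x. pos_pot \<mu> x \<partial>borel_of \<tau>) = pos_energy \<tau> \<mu>" "(\<integral>\<^sup>+x. neg_pot \<mu> x \<partial>borel_of \<tau>) = neg_energy \<tau> \<mu>"
  using fubini_pos[OF assms(2,1)] fubini_neg_sym[OF assms(2,1)]
  unfolding fubini_holds_def pos_pot_def neg_pot_def pos_energy_def neg_energy_def by simp_all

lemma slice_measurable: "(\<lambda>y. \<kappa> (x, y)) \<in> borel_measurable borel"
  using open_slice[OF Phi_open[OF kernel_Phi]] by (intro borel_measurable_lsc) simp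

lemma neg_pot_finite:
  assumes \<mu>: "\<mu> \<in> pos_radon"
  shows "neg_pot \<mu> x < top"
  using Phi_neg_cases[OF kernel_Phi]
proof (elim disjE conjE exE)
  assume "\<forall>z. e2ennreal (- \<kappa> z) = 0"
  then have "e2ennreal (- \<kappa> (x, y)) = 0" for y by blast
  then show ?thesis by (simp add: neg_pot_def)
next
  fix c h assume cpt: "compact (UNIV :: ('a \<times> 'a) set)" and k: "\<forall>z. e2ennreal (- \<kappa> z) + h z = ennreal c"
  have cpt1: "compact (UNIV :: 'a set)"
    using compact_continuous_image[OF continuous_on_fst[OF continuous_on_id] cpt] by simp
  have sp: "space (borel_of \<mu>) = UNIV"
    using sets_eq_imp_space_eq[OF representsD(1)[OF Riesz_Markov[OF lc \<mu>]]] by simp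
  have "e2ennreal (- \<kappa> z) \<le> ennreal c" for z using k by (metis le_iff_add)
  then have "neg_pot \<mu> x \<le> (\<integral>\<^sup>+y. ennreal c \<partial>borel_of \<mu>)" unfolding neg_pot_def by (intro nn_integral_mono)
  also have "\<dots> < top"
    using compact_UNIV_finite[OF lc \<mu> cpt1] by (simp add: sp ennreal_mult_less_top)
  finally show ?thesis .
qed

lemma potential_signed:
  "potential \<kappa> \<theta> x = enn2ereal (pos_pot (pos_part \<theta>) x + neg_pot (neg_part \<theta>) x)
     - enn2ereal (neg_pot (pos_part \<theta>) x + pos_pot (neg_part \<theta>) x)"
  by (simp add: potential_def radon_integral_def integral_pos_def integral_neg_def pos_pot_def neg_pot_def)

lemma potential_pos:
  assumes \<mu>: "\<mu> \<in> pos_radon"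
  shows "potential \<kappa> \<mu> x = enn2ereal (pos_pot \<mu> x) - enn2ereal (neg_pot \<mu> x)"
  by (simp add: potential_def radon_integral_def integral_pos_neg_of_pos[OF lc \<mu> slice_measurable] pos_pot_def neg_pot_def)

lemma potential_real: "\<mu> \<in> pos_radon \<Longrightarrow> pos_pot \<mu> x < top \<Longrightarrow> potential \<kappa> \<mu> x = ereal (real_pot \<mu> x)"
  using neg_pot_finite[of \<mu> x] by (simp add: potential_pos real_pot_def enn2ereal_eq)

lemma potential_measurable: "\<mu> \<in> pos_radon \<Longrightarrow> potential \<kappa> \<mu> \<in> borel_measurable borel"
proof -
  assume \<mu>: "\<mu> \<in> pos_radon"
  note [measurable] = pot_measurable[OF \<mu>]
  have "potential \<kappa> \<mu> = (\<lambda>x. enn2ereal (pos_pot \<mu> x) - enn2ereal (neg_pot \<mu> x))"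
    using potential_pos[OF \<mu>] by blast
  then show ?thesis by simp
qed

text \<open>Both occurrences of \<open>neg_pot\<close> are finite. So an infinite
  \<open>pos_pot (neg_part \<theta>) x\<close> is the only obstacle: it makes the potential either
  undefined or equal to \<open>-\<infinity>\<close>.\<close>

lemma field_defined_iff:
  assumes \<theta>: "\<theta> \<in> energy_space \<kappa>"
  shows "field_defined \<kappa> \<theta> x \<longleftrightarrow> pos_pot (neg_part \<theta>) x < top"
proof -
  note p = cone_pos[OF energy_space_parts(1)[OF \<theta>]] cone_pos[OF energy_space_parts(2)[OF \<theta>]]
  have "potential_defined \<kappa> \<theta> x \<longleftrightarrow> (pos_pot (pos_part \<theta>) x + neg_pot (neg_part \<theta>) x < top \<or> neg_pot (pos_part \<theta>) x + pos_pot (neg_part \<theta>) x < top)"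
    using slice_measurable by (simp add: potential_defined_def integral_defined_def integral_pos_def integral_neg_def pos_pot_def neg_pot_def)
  then show ?thesis
    using neg_pot_finite[OF p(1), of x] neg_pot_finite[OF p(2), of x]
    unfolding field_defined_def potential_signed
    by (cases "pos_pot (pos_part \<theta>) x"; cases "neg_pot (pos_part \<theta>) x"; cases "pos_pot (neg_part \<theta>) x"; cases "neg_pot (neg_part \<theta>) x")
      (auto simp: enn2ereal_ennreal top_ennreal.rep_eq simp flip: ennreal_plus)
qed

lemma potential_signed_real:
  assumes \<theta>: "\<theta> \<in> energy_space \<kappa>" and fin: "pos_pot (pos_part \<theta>) x < top" "pos_pot (neg_part \<theta>) x < top"
  shows "potential \<kappa> \<theta> x = ereal (real_pot (pos_part \<theta>) x - real_pot (neg_part \<theta>) x)"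
proof -
  note p = cone_pos[OF energy_space_parts(1)[OF \<theta>]] cone_pos[OF energy_space_parts(2)[OF \<theta>]]
  show ?thesis
    using fin neg_pot_finite[OF p(1), of x] neg_pot_finite[OF p(2), of x]
    by (simp add: potential_signed enn2ereal_eq real_pot_def enn2real_plus)
qed

lemma potential_signed_measurable:
  assumes \<theta>: "\<theta> \<in> energy_space \<kappa>"
  shows "potential \<kappa> \<theta> \<in> borel_measurable borel"
proof -
  note [measurable] = pot_measurable[OF cone_pos[OF energy_space_parts(1)[OF \<theta>]]] pot_measurable[OF cone_pos[OF energy_space_parts(2)[OF \<theta>]]]
  have "potential \<kappa> \<theta> = (\<lambda>x. enn2ereal (pos_pot (pos_part \<theta>) x + neg_pot (neg_part \<theta>) x)
     - enn2ereal (neg_pot (pos_part \<theta>) x + pos_pot (neg_part \<theta>) x))" using potential_signed by blast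
  then show ?thesis by simp
qed

lemma sets_borel_of: "\<mu> \<in> pos_radon \<Longrightarrow> sets (borel_of (\<mu> :: ('a \<Rightarrow> real) \<Rightarrow> real)) = sets borel"
  by (rule representsD(1)[OF Riesz_Markov[OF lc]])

lemma space_borel_of: "\<mu> \<in> pos_radon \<Longrightarrow> space (borel_of (\<mu> :: ('a \<Rightarrow> real) \<Rightarrow> real)) = UNIV"
  using sets_eq_imp_space_eq[OF sets_borel_of] by simp

lemma borel_measurable_borel_of: "\<mu> \<in> pos_radon \<Longrightarrow> borel_measurable (borel_of (\<mu> :: ('a \<Rightarrow> real) \<Rightarrow> real)) = borel_measurable borel"
  by (rule measurable_cong_sets[OF sets_borel_of refl])

text \<open>The integral of the potential of \<mu> against \<tau> is their mutual energy, which is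
  finite on \<open>E\<close>.\<close>

lemma pot_finite_AE:
  assumes \<mu>: "\<mu> \<in> E" and \<tau>: "\<tau> \<in> E"
  shows "AE x in borel_of \<tau>. pos_pot \<mu> x < top"
proof -
  note p = cone_pos[OF \<mu>] cone_pos[OF \<tau>]
  have "(\<integral>\<^sup>+x. pos_pot \<mu> x \<partial>borel_of \<tau>) \<noteq> \<infinity>"
    unfolding pot_integral(1)[OF p] using energy_diff(1)[OF \<tau> \<mu>] by simp
  then show ?thesis
    using nn_integral_noteq_infinite[of "pos_pot \<mu>" "borel_of \<tau>"] pot_measurable(1)[OF p(1)]
    unfolding borel_measurable_borel_of[OF p(2)] by (simp add: less_top)
qed

lemma real_pot_integral:
  assumes \<mu>: "\<mu> \<in> E" and \<tau>: "\<tau> \<in> E"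
  shows "integrable (borel_of \<tau>) (real_pot \<mu>)" "(LINT x|borel_of \<tau>. real_pot \<mu> x) = ener \<tau> \<mu>"
proof -
  note p = cone_pos[OF \<mu>] cone_pos[OF \<tau>]
  have mm: "pos_pot \<mu> \<in> borel_measurable (borel_of \<tau>)" "neg_pot \<mu> \<in> borel_measurable (borel_of \<tau>)"
    unfolding borel_measurable_borel_of[OF p(2)] by (rule pot_measurable[OF p(1)])+
  have pe: "(\<integral>\<^sup>+x. ennreal (enn2real (pos_pot \<mu> x)) \<partial>borel_of \<tau>) = pos_energy \<tau> \<mu>"
    unfolding pot_integral(1)[OF p, symmetric] using pot_finite_AE[OF \<mu> \<tau>] by (intro nn_integral_cong_AE) auto
  have ne: "(\<integral>\<^sup>+x. ennreal (enn2real (neg_pot \<mu> x)) \<partial>borel_of \<tau>) = neg_energy \<tau> \<mu>"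
    unfolding pot_integral(2)[OF p, symmetric] using neg_pot_finite[OF p(1)] by (intro nn_integral_cong) simp
  have i: "integrable (borel_of \<tau>) (\<lambda>x. enn2real (pos_pot \<mu> x))" "integrable (borel_of \<tau>) (\<lambda>x. enn2real (neg_pot \<mu> x))"
    using pe ne energy_diff(1)[OF \<tau> \<mu>] neg_energy_finite[OF p(2,1)] mm
    by (auto intro!: integrableI_nonneg)
  then show "integrable (borel_of \<tau>) (real_pot \<mu>)"
    using Bochner_Integration.integrable_diff[OF i] by (simp add: real_pot_def[abs_def])
  show "(LINT x|borel_of \<tau>. real_pot \<mu> x) = ener \<tau> \<mu>"
    unfolding real_pot_def Bochner_Integration.integral_diff[OF i] ener_def
    using pe ne mm by (simp add: integral_eq_nn_integral)
qed

section \<open>Integration against positive measures\<close>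

text \<open>The bridge from integrals of extended real functions to Bochner integrals: the
  real-valued version has to agree only almost everywhere.\<close>

lemma radon_integral_real:
  fixes \<mu> :: "('a \<Rightarrow> real) \<Rightarrow> real"
  assumes \<mu>: "\<mu> \<in> pos_radon" and g: "g \<in> borel_measurable borel"
    and h: "integrable (borel_of \<mu>) h" and eq: "AE x in borel_of \<mu>. g x = ereal (h x)"
  shows "radon_integrable \<mu> g" "radon_integral \<mu> g = ereal (LINT x|borel_of \<mu>. h x)"
proof -
  note ip = integral_pos_neg_of_pos[OF lc \<mu> g]
  have 1: "integral_pos \<mu> g = (\<integral>\<^sup>+x. ennreal (h x) \<partial>borel_of \<mu>)" "integral_neg \<mu> g = (\<integral>\<^sup>+x. ennreal (- h x) \<partial>borel_of \<mu>)"
    unfolding ip using eq by (auto intro!: nn_integral_cong_AE)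
  have 2: "(\<integral>\<^sup>+x. ennreal (h x) \<partial>borel_of \<mu>) < top" "(\<integral>\<^sup>+x. ennreal (- h x) \<partial>borel_of \<mu>) < top"
    using real_integrable_def h by (auto simp: real_integrable_def less_top)
  show "radon_integrable \<mu> g" using g 1 2 by (simp add: radon_integrable_def)
  show "radon_integral \<mu> g = ereal (LINT x|borel_of \<mu>. h x)"
    unfolding radon_integral_def 1 real_lebesgue_integral_def[OF h] using 2 by (simp add: enn2ereal_eq)
qed

lemma radon_integrableD:
  fixes \<mu> :: "('a \<Rightarrow> real) \<Rightarrow> real"
  assumes \<mu>: "\<mu> \<in> pos_radon" and g: "radon_integrable \<mu> g"
  shows "AE x in borel_of \<mu>. g x = ereal (real_of_ereal (g x))" "integrable (borel_of \<mu>) (\<lambda>x. real_of_ereal (g x))"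
proof -
  have gm[measurable]: "g \<in> borel_measurable borel" using g by (simp add: radon_integrable_def)
  note ip = integral_pos_neg_of_pos[OF lc \<mu> gm]
  have fin: "(\<integral>\<^sup>+x. e2ennreal (g x) \<partial>borel_of \<mu>) < top" "(\<integral>\<^sup>+x. e2ennreal (- g x) \<partial>borel_of \<mu>) < top"
    using g ip by (simp_all add: radon_integrable_def)
  have m: "(\<lambda>x. e2ennreal (g x)) \<in> borel_measurable (borel_of \<mu>)" "(\<lambda>x. e2ennreal (- g x)) \<in> borel_measurable (borel_of \<mu>)"
    "(\<lambda>x. real_of_ereal (g x)) \<in> borel_measurable (borel_of \<mu>)"
    unfolding borel_measurable_borel_of[OF \<mu>] by measurable
  have "AE x in borel_of \<mu>. e2ennreal (g x) \<noteq> \<infinity>" "AE x in borel_of \<mu>. e2ennreal (- g x) \<noteq> \<infinity>"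
    using nn_integral_noteq_infinite[OF m(1)] nn_integral_noteq_infinite[OF m(2)] fin by simp_all
  then show 1: "AE x in borel_of \<mu>. g x = ereal (real_of_ereal (g x))"
  proof eventually_elim
    case (elim x)
    then show ?case by (cases "g x") (auto simp: top_ennreal_def[symmetric] simp flip: infinity_ennreal_def)
  qed
  have "(\<integral>\<^sup>+x. ennreal (real_of_ereal (g x)) \<partial>borel_of \<mu>) = (\<integral>\<^sup>+x. e2ennreal (g x) \<partial>borel_of \<mu>)"
    "(\<integral>\<^sup>+x. ennreal (- real_of_ereal (g x)) \<partial>borel_of \<mu>) = (\<integral>\<^sup>+x. e2ennreal (- g x) \<partial>borel_of \<mu>)"
    using 1 by (auto intro!: nn_integral_cong_AE elim!: eventually_mono) (metis e2ennreal_ereal, metis e2ennreal_ereal uminus_ereal.simps(1))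
  then show "integrable (borel_of \<mu>) (\<lambda>x. real_of_ereal (g x))"
    using fin m(3) by (simp add: real_integrable_def less_top)
qed

section \<open>Unit measures\<close>

text \<open>The exceptional set lies in the intersection of one null set for \<mu> and one for
  \<nu>, and this intersection is null for both. The argument allows a nonmeasurable
  \<open>P\<close>, such as membership in \<open>A\<close>.\<close>

lemma AE_lincomb:
  fixes \<mu> \<nu> :: "('a \<Rightarrow> real) \<Rightarrow> real"
  assumes p: "\<mu> \<in> pos_radon" "\<nu> \<in> pos_radon" and ab: "0 \<le> a" "0 \<le> b"
    and "AE x in borel_of \<mu>. P x" "AE x in borel_of \<nu>. P x"
  shows "AE x in borel_of (\<lambda>\<phi>. a * \<mu> \<phi> + b * \<nu> \<phi>). P x"
proof -
  obtain N where N: "{x \<in> space (borel_of \<mu>). \<not> P x} \<subseteq> N" "emeasure (borel_of \<mu>) N = 0" "N \<in> sets (borel_of \<mu>)"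
    using assms(5) by (rule AE_E)
  obtain N' where N': "{x \<in> space (borel_of \<nu>). \<not> P x} \<subseteq> N'" "emeasure (borel_of \<nu>) N' = 0" "N' \<in> sets (borel_of \<nu>)"
    using assms(6) by (rule AE_E)
  have b: "N \<inter> N' \<in> sets borel" using N(3) N'(3) sets_borel_of p by auto
  have "emeasure (borel_of \<mu>) (N \<inter> N') = 0" "emeasure (borel_of \<nu>) (N \<inter> N') = 0"
    using N(2,3) N'(2,3) b sets_borel_of[OF p(1)] sets_borel_of[OF p(2)]
    by (metis emeasure_mono inf_le1 le_zero_eq, metis emeasure_mono inf_le2 le_zero_eq)
  then have z: "emeasure (borel_of (\<lambda>\<phi>. a * \<mu> \<phi> + b * \<nu> \<phi>)) (N \<inter> N') = 0"
    using emeasure_lincomb[OF lc p ab b] by simp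
  note l = pos_radon_lincomb[OF p ab]
  show ?thesis
  proof (rule AE_I[OF _ z])
    show "{x \<in> space (borel_of (\<lambda>\<phi>. a * \<mu> \<phi> + b * \<nu> \<phi>)). \<not> P x} \<subseteq> N \<inter> N'"
      using N(1) N'(1) by (auto simp: space_borel_of p l)
    show "N \<inter> N' \<in> sets (borel_of (\<lambda>\<phi>. a * \<mu> \<phi> + b * \<nu> \<phi>))"
      using b sets_borel_of[OF l] by simp
  qed
qed

abbreviation unit where "unit A \<equiv> unit_cone_on \<kappa> A"

lemma unitD:
  assumes "\<mu> \<in> unit A"
  shows "\<mu> \<in> E" "\<mu> \<in> pos_radon" "emeasure (borel_of \<mu>) UNIV = 1" "concentrated_on \<mu> A" "\<mu> \<in> energy_cone_on \<kappa> A"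
  using assms by (auto simp: unit_cone_on_def energy_cone_on_def cone_pos)

lemma unitI:
  assumes "\<mu> \<in> E" "emeasure (borel_of \<mu>) UNIV = 1" "AE x in borel_of \<mu>. x \<in> A"
  shows "\<mu> \<in> unit A"
  using assms by (auto simp: unit_cone_on_def energy_cone_on_def concentrated_on_def elim: eventually_mono)

lemma unit_prob: "\<mu> \<in> unit A \<Longrightarrow> prob_space (borel_of \<mu>)"
  using unitD(2,3)[of \<mu> A] by (intro prob_spaceI) (simp add: space_borel_of)

text \<open>By inner regularity a finite measure is carried by a countable union of compact sets, so
  a locally negligible set is negligible.\<close>

lemma unit_AE:
  assumes \<mu>: "\<mu> \<in> unit A"
  shows "AE x in borel_of \<mu>. x \<in> A"
proof -
  note u = unitD[OF \<mu>]
  note r = Riesz_Markov[OF lc u(2)]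
  let ?M = "borel_of \<mu>"
  interpret prob_space ?M by (rule unit_prob[OF \<mu>])
  have "\<exists>K. compact K \<and> ennreal (1 - 1 / real (Suc n)) < emeasure ?M K" for n
  proof -
    have "ennreal (1 - 1 / real (Suc n)) < emeasure ?M UNIV"
      unfolding u(3) by (simp add: ennreal_less_iff)
    then show ?thesis unfolding representsD(4)[OF r open_UNIV] less_SUP_iff by auto
  qed
  then obtain K where K: "\<And>n. compact (K n)" "\<And>n. ennreal (1 - 1 / real (Suc n)) < emeasure ?M (K n)" by metis
  have Kb: "K n \<in> sets ?M" for n using K(1) by (simp add: sets_borel_of[OF u(2)] compact_imp_closed)
  have "prob (\<Union>n. K n) = 1"
  proof (rule antisym)
    show "1 \<le> prob (\<Union>n. K n)"
    proof (rule field_le_epsilon)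
      fix e :: real assume "0 < e"
      then obtain n where n: "1 / real (Suc n) < e" using nat_approx_posE by metis
      have "1 - 1 / real (Suc n) < prob (K n)"
        using K(2)[of n] by (simp add: emeasure_eq_measure ennreal_less_iff)
      also have "\<dots> \<le> prob (\<Union>n. K n)" using Kb by (intro finite_measure_mono) auto
      finally show "1 \<le> prob (\<Union>n. K n) + e" using n by simp
    qed
  qed simp
  then have "AE x in ?M. x \<in> (\<Union>n. K n)" using Kb by (simp add: prob_eq_1)
  moreover have "AE x in ?M. \<forall>n. x \<in> K n \<longrightarrow> x \<in> A"
    unfolding AE_all_countable using u(4) K(1) unfolding concentrated_on_def by blast
  ultimately show ?thesis by eventually_elim auto
qed

lemma unit_mono: "\<mu> \<in> unit A \<Longrightarrow> A \<subseteq> B \<Longrightarrow> \<mu> \<in> unit B"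
  using unitD[of \<mu> A] unit_AE[of \<mu> A] by (intro unitI) (auto elim: eventually_mono)

lemma unit_convex:
  assumes \<mu>: "\<mu> \<in> unit A" and \<nu>: "\<nu> \<in> unit A" and ab: "0 \<le> a" "0 \<le> b" "a + b = 1"
  shows "(\<lambda>\<phi>. a * \<mu> \<phi> + b * \<nu> \<phi>) \<in> unit A"
proof (rule unitI)
  note u = unitD[OF \<mu>] and v = unitD[OF \<nu>]
  show "(\<lambda>\<phi>. a * \<mu> \<phi> + b * \<nu> \<phi>) \<in> E" by (intro cone_lincomb u v ab)
  have "ennreal a + ennreal b = 1" using ab by (simp flip: ennreal_plus)
  then show "emeasure (borel_of (\<lambda>\<phi>. a * \<mu> \<phi> + b * \<nu> \<phi>)) UNIV = 1"
    using emeasure_lincomb[OF lc u(2) v(2) ab(1,2), of UNIV] u(3) v(3) by simp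
  show "AE x in borel_of (\<lambda>\<phi>. a * \<mu> \<phi> + b * \<nu> \<phi>). x \<in> A"
    by (intro AE_lincomb u(2) v(2) ab unit_AE[OF \<mu>] unit_AE[OF \<nu>])
qed

text \<open>Capacity 0 means that the infimum of the energies is \<infinity>. Any unit measure of
  the class has finite energy and would bring the infimum down, so the class is empty; that the
  infimum is nonnegative rules out \<open>-\<infinity>\<close>, whose reciprocal is 0 as
  well.\<close>

lemma nearly_everywhere_iff: "nearly_everywhere_on \<kappa> A P \<longleftrightarrow> unit {x \<in> A. \<not> P x} = {}"
proof -
  let ?I = "INF \<mu>\<in>unit {x \<in> A. \<not> P x}. energy \<kappa> \<mu>"
  have "0 \<le> ?I"
    by (intro INF_greatest) (simp add: energy_eq unitD ener_nonneg)
  moreover have "?I < \<infinity>" if "\<mu> \<in> unit {x \<in> A. \<not> P x}" for \<mu>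
  proof -
    have "?I \<le> energy \<kappa> \<mu>" by (rule INF_lower[OF that])
    then show ?thesis using energy_eq[OF unitD(1)[OF that]] by (auto simp: less_top[symmetric] top_ereal_def)
  qed
  ultimately show ?thesis
    unfolding nearly_everywhere_on_def inner_cap_def
    by (cases ?I) (auto simp: top_ereal_def one_ereal_def divide_ereal_def)
qed

text \<open>By the convention for \<open>1 / 0\<close>, finite capacity says that the infimum of the
  energies is not 0. This positive lower bound is the form in which the capacity assumption is
  used.\<close>

lemma finite_capacity:
  assumes "inner_cap \<kappa> A < \<infinity>"
  obtains w where "0 < w" "\<And>\<mu>. \<mu> \<in> unit A \<Longrightarrow> w \<le> ener \<mu> \<mu>"
proof -
  let ?I = "INF \<mu>\<in>unit A. energy \<kappa> \<mu>"
  have "0 \<le> ?I" by (intro INF_greatest) (simp add: energy_eq unitD ener_nonneg)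
  moreover have "?I \<noteq> 0" using assms by (auto simp: inner_cap_def one_ereal_def divide_ereal_def)
  ultimately have "0 < ?I" by simp
  then obtain w where w: "0 < ereal w" "ereal w < ?I" using ereal_dense2 by blast
  have "w \<le> ener \<mu> \<mu>" if "\<mu> \<in> unit A" for \<mu>
  proof -
    have "ereal w \<le> energy \<kappa> \<mu>" using w(2) INF_lower[OF that, of "energy \<kappa>"] by (meson less_imp_le less_le_trans)
    then show ?thesis using energy_eq[OF unitD(1)[OF that]] by simp
  qed
  then show ?thesis using that w(1) by simp
qed

text \<open>The normalized restriction of \<mu> to \<open>B\<close>. Its density is at most
  \<open>c = 1 / measure (borel_of \<mu>) B\<close>, and this factor enters once for each of the two
  variables of the energy. The bound concerns \<open>pos_energy\<close>, since restriction may raise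
  the energy of a kernel with negative values.\<close>

lemma restrict_unit:
  assumes \<mu>: "\<mu> \<in> E" "emeasure (borel_of \<mu>) UNIV = 1" and B: "B \<in> sets borel" and m: "0 < measure (borel_of \<mu>) B"
  obtains \<tau> where "\<tau> \<in> E" "emeasure (borel_of \<tau>) UNIV = 1"
    "\<And>P. (AE x in borel_of \<mu>. x \<in> B \<longrightarrow> P x) \<Longrightarrow> AE x in borel_of \<tau>. P x"
    "(measure (borel_of \<mu>) B)\<^sup>2 * enn2real (pos_energy \<tau> \<tau>) \<le> enn2real (pos_energy \<mu> \<mu>)"
proof -
  note p = cone_pos[OF \<mu>(1)]
  note r = Riesz_Markov[OF lc p] and sb = sets_borel_of[OF p]
  let ?M = "borel_of \<mu>"
  define c where "c = 1 / measure ?M B"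
  have c: "0 < c" using m by (simp add: c_def)
  define N where "N = density ?M (\<lambda>x. ennreal c * indicator B x)"
  have [measurable]: "B \<in> sets ?M" using B sb by simp
  have sN: "sets N = sets borel" by (simp add: N_def sb)
  have eN: "emeasure N C = ennreal c * emeasure ?M (B \<inter> C)" if "C \<in> sets borel" for C
  proof -
    have [measurable]: "C \<in> sets ?M" using that sb by simp
    have "emeasure N C = (\<integral>\<^sup>+x. ennreal c * indicator (B \<inter> C) x \<partial>?M)"
      by (auto simp: N_def emeasure_density indicator_def intro!: nn_integral_cong)
    also have "\<dots> = ennreal c * emeasure ?M (B \<inter> C)" by (subst nn_integral_cmult_indicator) auto
    finally show ?thesis .
  qed
  have le: "emeasure N C \<le> ennreal c * emeasure ?M C" if "C \<in> sets borel" for C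
    unfolding eN[OF that] using that sb by (intro mult_left_mono emeasure_mono) auto
  define \<tau> where "\<tau> = (\<lambda>\<phi>. if \<phi> \<in> Cc then LINT x|N. \<phi> x else 0)"
  have fin: "emeasure ?M UNIV < top" using \<mu>(2) by simp
  note dom = represents_dominated[OF lc r fin sN less_imp_le[OF c] le, folded \<tau>_def]
  have bt: "borel_of \<tau> = N" by (rule borel_of_eqI[OF lc dom(2)])
  have leint: "(\<integral>\<^sup>+x. g x \<partial>N) \<le> ennreal c * (\<integral>\<^sup>+x. g x \<partial>?M)" if "g \<in> borel_measurable borel" for g
  proof -
    have [measurable]: "g \<in> borel_measurable ?M" unfolding borel_measurable_borel_of[OF p] by (rule that)
    have "(\<integral>\<^sup>+x. g x \<partial>N) = (\<integral>\<^sup>+x. ennreal c * indicator B x * g x \<partial>?M)"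
      unfolding N_def by (subst nn_integral_density) auto
    also have "\<dots> \<le> (\<integral>\<^sup>+x. ennreal c * g x \<partial>?M)"
      by (intro nn_integral_mono) (auto simp: indicator_def)
    also have "\<dots> = ennreal c * (\<integral>\<^sup>+x. g x \<partial>?M)" by (rule nn_integral_cmult) simp
    finally show ?thesis .
  qed
  have "pos_energy \<tau> \<tau> = (\<integral>\<^sup>+x. pos_pot \<tau> x \<partial>N)"
    by (rule pot_integral(1)[OF dom(1) dom(1), unfolded bt, symmetric])
  also have "\<dots> \<le> ennreal c * (\<integral>\<^sup>+x. pos_pot \<tau> x \<partial>?M)" by (intro leint pot_measurable dom(1))
  also have "(\<integral>\<^sup>+x. pos_pot \<tau> x \<partial>?M) \<le> (\<integral>\<^sup>+x. ennreal c * pos_pot \<mu> x \<partial>?M)"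
  proof (rule nn_integral_mono)
    fix x
    have [measurable]: "(\<lambda>y. \<kappa> (x, y)) \<in> borel_measurable borel" by (rule slice_measurable)
    show "pos_pot \<tau> x \<le> ennreal c * pos_pot \<mu> x"
      unfolding pos_pot_def bt by (rule leint) measurable
  qed
  also have "\<dots> = ennreal c * pos_energy \<mu> \<mu>"
    using pot_measurable(1)[OF p] borel_measurable_borel_of[OF p] pot_integral(1)[OF p p]
    by (subst nn_integral_cmult) auto
  finally have pe: "pos_energy \<tau> \<tau> \<le> ennreal c * (ennreal c * pos_energy \<mu> \<mu>)" by (simp add: mult_left_mono)
  have fin\<mu>: "pos_energy \<mu> \<mu> < top" using \<mu>(1) energy_cone_iff[OF p] by simp
  then have fin\<tau>: "pos_energy \<tau> \<tau> < top" using pe by (auto simp: ennreal_mult_less_top intro: le_less_trans)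
  show ?thesis
  proof (rule that[of \<tau>])
    show "\<tau> \<in> E" using energy_cone_iff[OF dom(1)] fin\<tau> by simp
    have mB: "emeasure ?M B = ennreal (measure ?M B)"
      using m by (intro emeasure_eq_ennreal_measure) (auto simp: measure_def)
    show "emeasure (borel_of \<tau>) UNIV = 1"
      unfolding bt using eN[of UNIV] m mB by (simp add: c_def flip: ennreal_mult)
    show "AE x in borel_of \<tau>. P x" if "AE x in ?M. x \<in> B \<longrightarrow> P x" for P
      unfolding bt N_def using that by (subst AE_density) (auto simp: indicator_def elim!: eventually_mono)
    have "enn2real (pos_energy \<tau> \<tau>) \<le> enn2real (ennreal c * (ennreal c * pos_energy \<mu> \<mu>))"
      using pe fin\<mu> by (intro enn2real_mono) (auto simp: ennreal_mult_less_top)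
    also have "\<dots> = c * (c * enn2real (pos_energy \<mu> \<mu>))" using c by (simp add: enn2real_mult)
    finally have "(measure ?M B)\<^sup>2 * enn2real (pos_energy \<tau> \<tau>) \<le> (measure ?M B)\<^sup>2 * (c * (c * enn2real (pos_energy \<mu> \<mu>)))"
      by (intro mult_left_mono) auto
    then show "(measure ?M B)\<^sup>2 * enn2real (pos_energy \<tau> \<tau>) \<le> enn2real (pos_energy \<mu> \<mu>)"
      using m by (simp add: c_def power2_eq_square)
  qed
qed

lemma dist_sq_parallelogram:
  assumes "\<mu> \<in> E" "\<nu> \<in> E"
  shows "dist_sq \<mu> \<nu> = 2 * ener \<mu> \<mu> + 2 * ener \<nu> \<nu>
    - 4 * ener (\<lambda>\<phi>. (1 / 2) * \<mu> \<phi> + (1 / 2) * \<nu> \<phi>) (\<lambda>\<phi>. (1 / 2) * \<mu> \<phi> + (1 / 2) * \<nu> \<phi>)"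
proof -
  have h: "0 \<le> (1 / 2 :: real)" by simp
  have "ener (\<lambda>\<phi>. (1 / 2) * \<mu> \<phi> + (1 / 2) * \<nu> \<phi>) (\<lambda>\<phi>. (1 / 2) * \<mu> \<phi> + (1 / 2) * \<nu> \<phi>)
     = 1 / 2 * (1 / 2 * ener \<mu> \<mu> + 1 / 2 * ener \<mu> \<nu>) + 1 / 2 * (1 / 2 * ener \<nu> \<mu> + 1 / 2 * ener \<nu> \<nu>)"
    unfolding ener_lincomb_left[OF assms cone_lincomb[OF assms h h] h h]
      ener_lincomb_right[OF assms assms(1) h h] ener_lincomb_right[OF assms assms(2) h h] ..
  then show ?thesis using ener_sym[OF cone_pos[OF assms(1)] cone_pos[OF assms(2)]] by (simp add: dist_sq_def field_simps)
qed

end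

section \<open>Perfect kernels\<close>

locale perfect = energy_kernel +
  assumes perf: "perfect_kernel \<kappa>"
begin

lemma strong_ball:
  assumes W: "openin (subtopology (strong_topology \<kappa>) E) W" and l: "l \<in> W"
  shows "\<exists>r>0. \<forall>\<tau>\<in>E. strong_dist \<kappa> l \<tau> < r \<longrightarrow> \<tau> \<in> W"
proof -
  interpret Metric_space "energy_space \<kappa>" "strong_dist \<kappa>" by (rule Metric_space_energy)
  obtain U where U: "openin mtopology U" "W = U \<inter> E"
    using W by (auto simp: openin_subtopology strong_topology_def)
  then obtain r where r: "0 < r" "mball l r \<subseteq> U" using l openin_mtopology by auto
  have "\<tau> \<in> W" if "\<tau> \<in> E" "strong_dist \<kappa> l \<tau> < r" for \<tau>
    using that r(2) U(2) l cone_space by (auto simp: mball_def)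
  then show ?thesis using r(1) by blast
qed

lemma strong_eventually:
  assumes W: "openin (subtopology (strong_topology \<kappa>) E) W" and l: "l \<in> W" "l \<in> E"
    and \<sigma>: "\<And>n. \<sigma> n \<in> E" "(\<lambda>n. dist_sq (\<sigma> n) l) \<longlonglongrightarrow> 0"
  shows "\<forall>\<^sub>F n in sequentially. \<sigma> n \<in> W"
proof -
  obtain r where r: "0 < r" "\<And>\<tau>. \<tau> \<in> E \<Longrightarrow> strong_dist \<kappa> l \<tau> < r \<Longrightarrow> \<tau> \<in> W"
    using strong_ball[OF W l(1)] by blast
  have "(\<lambda>n. sqrt (dist_sq (\<sigma> n) l)) \<longlonglongrightarrow> sqrt 0" by (rule tendsto_real_sqrt[OF \<sigma>(2)])
  then have "\<forall>\<^sub>F n in sequentially. sqrt (dist_sq (\<sigma> n) l) < r"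
    using r(1) by (intro order_tendstoD(2)) auto
  then show ?thesis
  proof eventually_elim
    case (elim n)
    interpret Metric_space "energy_space \<kappa>" "strong_dist \<kappa>" by (rule Metric_space_energy)
    have "strong_dist \<kappa> l (\<sigma> n) < r"
      using elim strong_dist_cone[OF \<sigma>(1) l(2), of n] commute[of l "\<sigma> n"] by simp
    then show ?case by (rule r(2)[OF \<sigma>(1)])
  qed
qed

text \<open>The part of perfectness that compares the two topologies, applied to the neighbourhood
  of \<open>l\<close> given by a single \<phi>.\<close>

lemma vague_limit:
  assumes l: "l \<in> E" and \<sigma>: "\<And>n. \<sigma> n \<in> E" "(\<lambda>n. dist_sq (\<sigma> n) l) \<longlonglongrightarrow> 0"
  shows "(\<lambda>n. \<sigma> n \<phi>) \<longlonglongrightarrow> l \<phi>"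
proof (rule tendstoI)
  fix e :: real assume e: "0 < e"
  define W where "W = {T. dist (T \<phi>) (l \<phi>) < e} \<inter> E"
  have "open {T :: ('a \<Rightarrow> real) \<Rightarrow> real. dist (T \<phi>) (l \<phi>) < e}"
    by (intro open_Collect_less continuous_intros continuous_on_product_coordinates)
  moreover have "E \<subseteq> signed_radon" using cone_pos pos_radon_signed by blast
  ultimately have "openin (subtopology vague_topology E) W"
    by (auto simp: vague_topology_def W_def subtopology_subtopology Int_absorb1 openin_open)
  then have "openin (subtopology (strong_topology \<kappa>) E) W" using perf by (simp add: perfect_kernel_def)
  then have "\<forall>\<^sub>F n in sequentially. \<sigma> n \<in> W"
    using e l by (intro strong_eventually[OF _ _ l \<sigma>]) (auto simp: W_def)
  then show "\<forall>\<^sub>F n in sequentially. dist (\<sigma> n \<phi>) (l \<phi>) < e"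
    by eventually_elim (simp add: W_def)
qed

lemma strong_complete:
  assumes \<sigma>: "\<And>n. \<sigma> n \<in> E" and C: "\<And>n m. n \<le> m \<Longrightarrow> dist_sq (\<sigma> n) (\<sigma> m) \<le> b n" and b: "b \<longlonglongrightarrow> (0::real)"
  obtains l where "l \<in> E" "(\<lambda>n. dist_sq (\<sigma> n) l) \<longlonglongrightarrow> 0"
proof -
  interpret Metric_space E "strong_dist \<kappa>"
    using Metric_space.subspace[OF Metric_space_energy, of E] cone_space by blast
  have "mcomplete" using perf by (simp add: perfect_kernel_def)
  moreover have "MCauchy \<sigma>"
    unfolding MCauchy_def
  proof (intro conjI allI impI)
    show "range \<sigma> \<subseteq> E" using \<sigma> by blast
    fix e :: real assume e: "0 < e"
    then have "\<forall>\<^sub>F n in sequentially. b n < e\<^sup>2" using b by (intro order_tendstoD(2)) auto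
    then obtain N where N: "\<And>n. N \<le> n \<Longrightarrow> b n < e\<^sup>2" unfolding eventually_sequentially by blast
    have lt: "strong_dist \<kappa> (\<sigma> n) (\<sigma> m) < e" if "N \<le> n" "n \<le> m" for n m
    proof -
      have "dist_sq (\<sigma> n) (\<sigma> m) < e\<^sup>2" using C[OF that(2)] N[OF that(1)] by linarith
      then have "sqrt (dist_sq (\<sigma> n) (\<sigma> m)) < sqrt (e\<^sup>2)" by (rule real_sqrt_less_mono)
      then show ?thesis using e strong_dist_cone[OF \<sigma> \<sigma>] by simp
    qed
    show "\<exists>N. \<forall>n n'. N \<le> n \<longrightarrow> N \<le> n' \<longrightarrow> strong_dist \<kappa> (\<sigma> n) (\<sigma> n') < e"
    proof (intro exI[of _ N] allI impI)
      fix n m assume "N \<le> n" "N \<le> m"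
      then show "strong_dist \<kappa> (\<sigma> n) (\<sigma> m) < e"
        using lt[of n m] lt[of m n] commute[of "\<sigma> n" "\<sigma> m"] by (cases "n \<le> m") auto
    qed
  qed
  ultimately obtain l where l: "limitin mtopology \<sigma> l sequentially" unfolding mcomplete_def by blast
  then have lE: "l \<in> E" and ev: "\<And>e. 0 < e \<Longrightarrow> \<forall>\<^sub>F n in sequentially. \<sigma> n \<in> E \<and> strong_dist \<kappa> (\<sigma> n) l < e"
    by (auto simp: limitin_metric)
  have "(\<lambda>n. sqrt (dist_sq (\<sigma> n) l)) \<longlonglongrightarrow> 0"
  proof (rule tendstoI)
    fix e :: real assume "0 < e"
    then show "\<forall>\<^sub>F n in sequentially. dist (sqrt (dist_sq (\<sigma> n) l)) 0 < e"
      using ev[of e] by (auto simp: strong_dist_cone[OF \<sigma> lE] dist_sq_nonneg[OF \<sigma> lE] elim: eventually_mono)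
  qed
  then have "(\<lambda>n. (sqrt (dist_sq (\<sigma> n) l))\<^sup>2) \<longlonglongrightarrow> 0\<^sup>2" by (rule tendsto_power)
  then show ?thesis using that[OF lE] dist_sq_nonneg[OF \<sigma> lE] by simp
qed

lemma ener_limit:
  assumes l: "l \<in> E" and \<sigma>: "\<And>n. \<sigma> n \<in> E" "(\<lambda>n. dist_sq (\<sigma> n) l) \<longlonglongrightarrow> 0"
  shows "a \<in> E \<Longrightarrow> (\<lambda>n. ener (\<sigma> n) a) \<longlonglongrightarrow> ener l a" "(\<lambda>n. ener (\<sigma> n) (\<sigma> n)) \<longlonglongrightarrow> ener l l"
proof -
  have *: "(\<lambda>n. ener (\<sigma> n) a) \<longlonglongrightarrow> ener l a" if a: "a \<in> E" for a
  proof (rule LIM_zero_cancel, rule Lim_null_comparison)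
    have "norm (ener (\<sigma> n) a - ener l a) \<le> sqrt (ener a a) * sqrt (dist_sq (\<sigma> n) l)" for n
      using ener_diff_bound[OF a \<sigma>(1)[of n] l] ener_sym[OF cone_pos[OF a] cone_pos[OF l]]
        ener_sym[OF cone_pos[OF a] cone_pos[OF \<sigma>(1)[of n]]] by simp
    then show "\<forall>\<^sub>F n in sequentially. norm (ener (\<sigma> n) a - ener l a) \<le> sqrt (ener a a) * sqrt (dist_sq (\<sigma> n) l)"
      by simp
    have "(\<lambda>n. sqrt (ener a a) * sqrt (dist_sq (\<sigma> n) l)) \<longlonglongrightarrow> sqrt (ener a a) * sqrt 0"
      by (intro tendsto_mult tendsto_const tendsto_real_sqrt \<sigma>(2))
    then show "(\<lambda>n. sqrt (ener a a) * sqrt (dist_sq (\<sigma> n) l)) \<longlonglongrightarrow> 0" by simp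
  qed
  then show "a \<in> E \<Longrightarrow> (\<lambda>n. ener (\<sigma> n) a) \<longlonglongrightarrow> ener l a" .
  have "(\<lambda>n. dist_sq (\<sigma> n) l + 2 * ener (\<sigma> n) l - ener l l) \<longlonglongrightarrow> 0 + 2 * ener l l - ener l l"
    by (intro tendsto_intros \<sigma>(2) * l)
  then show "(\<lambda>n. ener (\<sigma> n) (\<sigma> n)) \<longlonglongrightarrow> ener l l" by (simp add: dist_sq_def)
qed

text \<open>If the energies stayed bounded, near-minimizers over \<open>A - K\<close> for growing compact \<open>K\<close> would form
  a strong Cauchy sequence, whose vague limit would be carried by the complement of every compact set.\<close>

lemma tail_energy_unbounded:
  assumes w0: "0 < w0" "\<And>\<mu>. \<mu> \<in> unit A \<Longrightarrow> w0 \<le> ener \<mu> \<mu>"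
  shows "\<exists>K. compact K \<and> (\<forall>\<mu>\<in>unit (A - K). C < ener \<mu> \<mu>)"
proof (rule ccontr)
  assume "\<not> ?thesis"
  then have ex: "\<exists>\<mu>\<in>unit (A - K). ener \<mu> \<mu> \<le> C" if "compact K" for K using that by force
  define w where "w K = Inf ((\<lambda>\<mu>. ener \<mu> \<mu>) ` unit (A - K))" for K
  have bdd: "bdd_below ((\<lambda>\<mu>. ener \<mu> \<mu>) ` unit (A - K))" for K
    using w0(2) unit_mono[of _ "A - K" A] by (intro bdd_belowI[of _ w0]) auto
  have w_le: "w K \<le> ener \<mu> \<mu>" if "\<mu> \<in> unit (A - K)" for K \<mu>
    unfolding w_def by (intro cInf_lower bdd imageI that)
  have w_mono: "w K \<le> w L" if "K \<subseteq> L" "compact L" for K L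
    unfolding w_def
  proof (rule cInf_superset_mono[OF _ bdd])
    show "(\<lambda>\<mu>. ener \<mu> \<mu>) ` unit (A - L) \<noteq> {}" using ex[OF that(2)] by blast
    show "(\<lambda>\<mu>. ener \<mu> \<mu>) ` unit (A - L) \<subseteq> (\<lambda>\<mu>. ener \<mu> \<mu>) ` unit (A - K)"
      using unit_mono[of _ "A - L" "A - K"] that(1) by blast
  qed
  have wC: "w K \<le> C" if "compact K" for K using ex[OF that] w_le by (meson order_trans)
  define L where "L = Sup (w ` {K. compact K})"
  have bddL: "bdd_above (w ` {K. compact K})" using wC by (intro bdd_aboveI[of _ C]) auto
  have wL: "w K \<le> L" if "compact K" for K unfolding L_def using that by (intro cSup_upper bddL) auto
  have "\<exists>K. compact K \<and> L - 1 / real (Suc n) < w K" for n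
  proof -
    have "L - 1 / real (Suc n) < L" by simp
    then show ?thesis unfolding L_def using bddL less_cSup_iff[of "w ` {K. compact K}"] compact_empty by blast
  qed
  then obtain k where k: "\<And>n. compact (k n)" "\<And>n. L - 1 / real (Suc n) < w (k n)" by metis
  \<comment> \<open>The space need not be a countable union of compact sets. The increasing sequence
    \<open>K\<close> is only required to bring \<open>w\<close> up to its supremum
    \<open>L\<close>.\<close>
  define K where "K n = (\<Union>i\<le>n. k i)" for n :: nat
  have cK: "compact (K n)" for n unfolding K_def by (intro compact_UN k(1)) auto
  have Kmono: "K n \<subseteq> K m" if "n \<le> m" for n m unfolding K_def using that by force
  have wK: "L - 1 / real (Suc n) < w (K n)" for n
    using k(2)[of n] w_mono[of "k n" "K n"] cK[of n] by (fastforce simp: K_def)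
  have near: "\<exists>\<mu>\<in>unit (A - S). ener \<mu> \<mu> \<le> L + 1 / real (Suc n)" if "compact S" for S n
  proof -
    have "0 < 1 / real (Suc n)" by simp
    then have "w S < L + 1 / real (Suc n)" using wL[OF that] by linarith
    then show ?thesis
      unfolding w_def using cInf_less_iff[OF _ bdd, of S] ex[OF that] by (force intro: less_imp_le)
  qed
  \<comment> \<open>With \<epsilon> = \<open>1 / real (Suc n)\<close> the parallelogram identity
    bounds the distance by
    \<open>2 (L + \<epsilon>) + 2 (L + \<epsilon>) - 4 (L - \<epsilon>)\<close>, that is, 8
    \<epsilon>.\<close>
  have close: "dist_sq \<mu> \<nu> \<le> 8 / real (Suc n)"
    if "\<mu> \<in> unit (A - K n)" "\<nu> \<in> unit (A - K n)" "ener \<mu> \<mu> \<le> L + 1 / real (Suc n)" "ener \<nu> \<nu> \<le> L + 1 / real (Suc n)" for \<mu> \<nu> n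
  proof -
    have "w (K n) \<le> ener (\<lambda>\<phi>. (1 / 2) * \<mu> \<phi> + (1 / 2) * \<nu> \<phi>) (\<lambda>\<phi>. (1 / 2) * \<mu> \<phi> + (1 / 2) * \<nu> \<phi>)"
      by (intro w_le unit_convex that) auto
    moreover have "8 / real (Suc n) = 8 * (1 / real (Suc n))" by simp
    ultimately show ?thesis
      using dist_sq_parallelogram[OF unitD(1)[OF that(1)] unitD(1)[OF that(2)]] wK[of n] that(3,4) by linarith
  qed
  obtain \<gamma> where \<gamma>: "\<And>n. \<gamma> n \<in> unit (A - K n)" "\<And>n. ener (\<gamma> n) (\<gamma> n) \<le> L + 1 / real (Suc n)"
  proof -
    have "\<forall>n. \<exists>\<mu>. \<mu> \<in> unit (A - K n) \<and> ener \<mu> \<mu> \<le> L + 1 / real (Suc n)" using near[OF cK] by blast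
    then show ?thesis using that by (metis (no_types, lifting))
  qed
  have \<gamma>E: "\<gamma> n \<in> E" for n by (rule unitD(1)[OF \<gamma>(1)])
  have lim8: "(\<lambda>n. 8 / real (Suc n)) \<longlonglongrightarrow> 0"
    using LIMSEQ_Suc[OF lim_const_over_n[of 8]] by simp
  obtain g where g: "g \<in> E" "(\<lambda>n. dist_sq (\<gamma> n) g) \<longlonglongrightarrow> 0"
  proof (rule strong_complete[OF \<gamma>E _ lim8])
    fix n m :: nat assume nm: "n \<le> m"
    show "dist_sq (\<gamma> n) (\<gamma> m) \<le> 8 / real (Suc n)"
    proof (rule close[OF \<gamma>(1) _ \<gamma>(2)])
      show "\<gamma> m \<in> unit (A - K n)" using unit_mono[OF \<gamma>(1)[of m], of "A - K n"] Kmono[OF nm] by blast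
      have "1 / real (Suc m) \<le> 1 / real (Suc n)" using nm by (intro divide_left_mono) auto
      then show "ener (\<gamma> m) (\<gamma> m) \<le> L + 1 / real (Suc n)" using \<gamma>(2)[of m] by linarith
    qed
  qed
  have "g \<phi> = 0" if \<phi>: "\<phi> \<in> Cc" for \<phi>
  proof -
    define S where "S = closure {x. \<phi> x \<noteq> 0}"
    have S: "compact S" unfolding S_def by (rule Cc_support[OF \<phi>])
    \<comment> \<open>No \<open>K n\<close> has to contain the support \<open>S\<close>, so the
      measures \<open>\<gamma> n\<close> may charge it. Near-minimizers off
      \<open>K n \<union> S\<close> vanish on \<phi>; as they are also near-minimizers off
      \<open>K n\<close>, they are close to \<open>\<gamma> n\<close> and share its strong
      limit.\<close>
    obtain \<gamma>' where \<gamma>': "\<And>n. \<gamma>' n \<in> unit (A - (K n \<union> S))" "\<And>n. ener (\<gamma>' n) (\<gamma>' n) \<le> L + 1 / real (Suc n)"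
    proof -
      have "\<forall>n. \<exists>\<mu>. \<mu> \<in> unit (A - (K n \<union> S)) \<and> ener \<mu> \<mu> \<le> L + 1 / real (Suc n)"
        using near[OF compact_Un[OF cK S]] by blast
      then show ?thesis using that by (metis (no_types, lifting))
    qed
    have \<gamma>'E: "\<gamma>' n \<in> E" for n by (rule unitD(1)[OF \<gamma>'(1)])
    have d8: "dist_sq (\<gamma>' n) (\<gamma> n) \<le> 8 / real (Suc n)" for n
      by (rule close[OF unit_mono[OF \<gamma>'(1)] \<gamma>(1) \<gamma>'(2) \<gamma>(2)]) auto
    have "(\<lambda>n. dist_sq (\<gamma>' n) (\<gamma> n)) \<longlonglongrightarrow> 0"
      by (rule tendsto_sandwich[OF _ _ tendsto_const lim8]) (simp_all add: d8 dist_sq_nonneg \<gamma>'E \<gamma>E del: of_nat_Suc)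
    then have "(\<lambda>n. sqrt (dist_sq (\<gamma>' n) (\<gamma> n)) + sqrt (dist_sq (\<gamma> n) g)) \<longlonglongrightarrow> sqrt 0 + sqrt 0"
      by (intro tendsto_add tendsto_real_sqrt g(2))
    then have sum0: "(\<lambda>n. sqrt (dist_sq (\<gamma>' n) (\<gamma> n)) + sqrt (dist_sq (\<gamma> n) g)) \<longlonglongrightarrow> 0" by simp
    have tri: "sqrt (dist_sq (\<gamma>' n) g) \<le> sqrt (dist_sq (\<gamma>' n) (\<gamma> n)) + sqrt (dist_sq (\<gamma> n) g)" for n
      using Metric_space.triangle[OF Metric_space_energy cone_space[OF \<gamma>'E[of n]] cone_space[OF \<gamma>E[of n]] cone_space[OF g(1)]]
      by (simp add: strong_dist_cone \<gamma>'E \<gamma>E g(1))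
    have "(\<lambda>n. sqrt (dist_sq (\<gamma>' n) g)) \<longlonglongrightarrow> 0"
    proof (rule tendsto_sandwich[OF _ _ tendsto_const sum0])
      show "\<forall>\<^sub>F n in sequentially. 0 \<le> sqrt (dist_sq (\<gamma>' n) g)"
        by (intro always_eventually allI real_sqrt_ge_zero dist_sq_nonneg \<gamma>'E g(1))
    qed (intro always_eventually allI tri)
    then have "(\<lambda>n. (sqrt (dist_sq (\<gamma>' n) g))\<^sup>2) \<longlonglongrightarrow> 0\<^sup>2" by (rule tendsto_power)
    then have "(\<lambda>n. dist_sq (\<gamma>' n) g) \<longlonglongrightarrow> 0" by (simp add: dist_sq_nonneg \<gamma>'E g(1))
    then have "(\<lambda>n. \<gamma>' n \<phi>) \<longlonglongrightarrow> g \<phi>" by (rule vague_limit[OF g(1) \<gamma>'E])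
    moreover have "\<gamma>' n \<phi> = 0" for n
    proof -
      have "AE x in borel_of (\<gamma>' n). \<phi> x = 0"
        using unit_AE[OF \<gamma>'(1)[of n]]
      proof eventually_elim
        case (elim x)
        then have "x \<notin> S" by blast
        then show ?case unfolding S_def by (rule not_in_support)
      qed
      then have "(LINT x|borel_of (\<gamma>' n). \<phi> x) = 0" by (rule integral_eq_zero_AE)
      then show ?thesis using representsD(5)[OF Riesz_Markov[OF lc unitD(2)[OF \<gamma>'(1)]] \<phi>] by simp
    qed
    ultimately show ?thesis by (simp add: LIMSEQ_const_iff)
  qed
  \<comment> \<open>For the limit 0 the squared distance is the energy itself. The energies would
    thus tend to 0, against the lower bound \<open>w0\<close>.\<close>
  then have "g = (\<lambda>\<phi>. 0)"
    using radon_off_Cc[OF pos_radon_signed[OF cone_pos[OF g(1)]]] by blast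
  then have "dist_sq (\<gamma> n) g = ener (\<gamma> n) (\<gamma> n)" for n
    using \<gamma>E[of n] by (simp add: dist_sq_def ener_zero zero_cone)
  then have "(\<lambda>n. ener (\<gamma> n) (\<gamma> n)) \<longlonglongrightarrow> 0" using g(2) by simp
  then have "w0 \<le> 0"
    using w0(2) unit_mono[OF \<gamma>(1)] by (intro LIMSEQ_le_const[of _ 0 w0]) auto
  then show False using w0(1) by simp
qed

text \<open>Vague convergence preserves the total mass as soon as the masses of the measures outside
  a suitable compact set are uniformly small. A tail of mass \<open>m\<close>, once normalized, has
  energy at most \<open>C / m\<^sup>2\<close>, where \<open>C\<close> bounds the energies along the
  sequence; far out this contradicts \<open>tail_energy_unbounded\<close>.\<close>

lemma unit_mass_limit:
  assumes w0: "0 < w0" "\<And>\<mu>. \<mu> \<in> unit A \<Longrightarrow> w0 \<le> ener \<mu> \<mu>"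
    and \<sigma>: "\<And>n. \<sigma> n \<in> unit A" and l: "l \<in> E" and lim: "(\<lambda>n. dist_sq (\<sigma> n) l) \<longlonglongrightarrow> 0"
  shows "emeasure (borel_of l) UNIV = 1"
proof -
  have \<sigma>E: "\<sigma> n \<in> E" for n by (rule unitD(1)[OF \<sigma>])
  note vl = vague_limit[OF l \<sigma>E lim]
  note r = Riesz_Markov[OF lc cone_pos[OF l]] and rs = Riesz_Markov[OF lc unitD(2)[OF \<sigma>]]
  show ?thesis
  proof (cases "compact (UNIV :: 'a set)")
    case True
    have one: "(\<lambda>x::'a. 1) \<in> Cc" by (rule CcI[OF _ True]) auto
    have "ennreal (\<sigma> n (\<lambda>x. 1)) = 1" for n
      using representsD(7)[OF rs one, of n] unitD(3)[OF \<sigma>[of n]] by (simp add: space_borel_of unitD(2)[OF \<sigma>])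
    then have "\<sigma> n (\<lambda>x. 1) = 1" for n by simp
    then have "l (\<lambda>x. 1) = 1" using vl[of "\<lambda>x. 1"] by (simp add: LIMSEQ_const_iff)
    then show ?thesis
      using representsD(7)[OF r one] by (simp add: space_borel_of cone_pos[OF l])
  next
    case False
    have neg0: "neg_energy \<mu> \<mu> = 0" for \<mu>
    proof -
      have "\<not> compact (UNIV :: ('a \<times> 'a) set)"
        using False compact_continuous_image[OF continuous_on_fst[OF continuous_on_id], of "UNIV :: ('a \<times> 'a) set"] by auto
      then have "0 \<le> \<kappa> z" for z using kernel_Phi unfolding Phi_def by blast
      then show ?thesis by (simp add: neg_energy_def e2ennreal_neg)
    qed
    have ep: "ener \<mu> \<mu> = enn2real (pos_energy \<mu> \<mu>)" for \<mu> by (simp add: ener_def neg0)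
    have "Bseq (\<lambda>n. ener (\<sigma> n) (\<sigma> n))"
      using ener_limit(2)[OF l \<sigma>E lim] by (intro convergent_imp_Bseq convergentI)
    then obtain C where C: "\<And>n. ener (\<sigma> n) (\<sigma> n) \<le> C"
      unfolding Bseq_def by (metis abs_le_D1 real_norm_def)
    show ?thesis
    proof (rule antisym)
      show "emeasure (borel_of l) UNIV \<le> 1"
        unfolding representsD(4)[OF r open_UNIV]
      proof (rule SUP_least, safe)
        fix K :: "'a set" assume K: "compact K"
        obtain u :: "'a \<Rightarrow> real" where u: "u \<in> Cc" "\<And>x. 0 \<le> u x" "\<And>x. u x \<le> 1" "\<And>x. x \<in> K \<Longrightarrow> u x = 1"
          using lch_Urysohn[OF lc K open_UNIV subset_UNIV] by blast
        have "\<sigma> n u \<le> 1" for n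
        proof -
          interpret prob_space "borel_of (\<sigma> n)" by (rule unit_prob[OF \<sigma>])
          show ?thesis unfolding representsD(5)[OF rs u(1)]
            using u by (intro integral_le_const representsD(6)[OF rs]) auto
        qed
        then have "l u \<le> 1" using vl[of u] by (intro LIMSEQ_le_const2) auto
        have "emeasure (borel_of l) K = (\<integral>\<^sup>+x. indicator K x \<partial>borel_of l)"
          using K by (simp add: sets_borel_of[OF cone_pos[OF l]] compact_imp_closed)
        also have "\<dots> \<le> (\<integral>\<^sup>+x. ennreal (u x) \<partial>borel_of l)"
          using u(4) by (intro nn_integral_mono) (auto simp: indicator_def)
        also have "\<dots> = ennreal (l u)" by (rule representsD(7)[OF r u(1,2), symmetric])
        also have "\<dots> \<le> 1" using \<open>l u \<le> 1\<close> by simp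
        finally show "emeasure (borel_of l) K \<le> 1" .
      qed
      show "1 \<le> emeasure (borel_of l) UNIV"
      proof (rule ennreal_le_epsilon)
        fix e :: real assume e: "0 < e"
        \<comment> \<open>A tail of mass greater than \<open>e\<close> would produce a unit measure
          on \<open>A - K\<close> with energy at most \<open>C / e\<^sup>2\<close>.\<close>
        obtain K where K: "compact K" "\<And>\<mu>. \<mu> \<in> unit (A - K) \<Longrightarrow> C / e\<^sup>2 < ener \<mu> \<mu>"
          using tail_energy_unbounded[where A = A and C = "C / e\<^sup>2", OF w0] by blast
        have Kb: "K \<in> sets borel" using K(1) by (simp add: compact_imp_closed)
        have small: "measure (borel_of (\<sigma> n)) (- K) \<le> e" for n
        proof (rule ccontr)
          let ?m = "measure (borel_of (\<sigma> n)) (- K)"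
          assume "\<not> ?m \<le> e"
          then have m: "e < ?m" by simp
          then have m0: "0 < ?m" using e by simp
          obtain \<tau> where \<tau>: "\<tau> \<in> E" "emeasure (borel_of \<tau>) UNIV = 1"
              "\<And>P. (AE x in borel_of (\<sigma> n). x \<in> - K \<longrightarrow> P x) \<Longrightarrow> AE x in borel_of \<tau>. P x"
              "?m\<^sup>2 * enn2real (pos_energy \<tau> \<tau>) \<le> enn2real (pos_energy (\<sigma> n) (\<sigma> n))"
            by (rule restrict_unit[OF \<sigma>E unitD(3)[OF \<sigma>] borel_comp[OF Kb] m0]) (rule that)
          have "AE x in borel_of (\<sigma> n). x \<in> - K \<longrightarrow> x \<in> A - K"
            using unit_AE[OF \<sigma>[of n]] by eventually_elim auto
          then have "AE x in borel_of \<tau>. x \<in> A - K" by (rule \<tau>(3))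
          then have "C / e\<^sup>2 < ener \<tau> \<tau>" using \<tau>(1,2) by (intro K(2) unitI)
          then have "C < ener \<tau> \<tau> * e\<^sup>2" using e by (simp add: divide_less_eq)
          also have "\<dots> \<le> ener \<tau> \<tau> * ?m\<^sup>2"
            using m e ener_nonneg[OF \<tau>(1)] by (intro mult_left_mono power_mono) auto
          also have "\<dots> \<le> ener (\<sigma> n) (\<sigma> n)" using \<tau>(4) by (simp add: ep mult.commute)
          finally show False using C[of n] by simp
        qed
        obtain u :: "'a \<Rightarrow> real" where u: "u \<in> Cc" "\<And>x. 0 \<le> u x" "\<And>x. u x \<le> 1" "\<And>x. x \<in> K \<Longrightarrow> u x = 1"
          using lch_Urysohn[OF lc K(1) open_UNIV subset_UNIV] by blast
        have "1 - e \<le> \<sigma> n u" for n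
        proof -
          interpret prob_space "borel_of (\<sigma> n)" by (rule unit_prob[OF \<sigma>])
          have sb: "K \<in> events" using Kb sets_borel_of[OF unitD(2)[OF \<sigma>]] by simp
          have "1 - e \<le> 1 - prob (- K)" using small[of n] by simp
          also have "\<dots> = prob K"
            using prob_compl[OF sb] space_borel_of[OF unitD(2)[OF \<sigma>[of n]]] by (simp add: Compl_eq_Diff_UNIV)
          also have "\<dots> = (LINT x|borel_of (\<sigma> n). indicator K x)" using sb by simp
          also have "\<dots> \<le> (LINT x|borel_of (\<sigma> n). u x)"
          proof (rule integral_mono[OF _ representsD(6)[OF rs u(1)]])
            show "integrable (borel_of (\<sigma> n)) (indicator K :: 'a \<Rightarrow> real)"
              using sb by (simp add: emeasure_eq_measure)
            show "indicator K x \<le> u x" for x using u(2)[of x] u(4)[of x] by (simp add: indicator_def)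
          qed
          also have "\<dots> = \<sigma> n u" by (rule representsD(5)[OF rs u(1), symmetric])
          finally show ?thesis .
        qed
        then have "1 - e \<le> l u" using vl[of u] by (intro LIMSEQ_le_const) auto
        then have "1 \<le> ennreal (l u) + ennreal e"
          using e pos_radon_nonneg[OF cone_pos[OF l], of u] u(2)
          by (simp flip: ennreal_plus ennreal_1)
        also have "ennreal (l u) = (\<integral>\<^sup>+x. ennreal (u x) \<partial>borel_of l)" by (rule representsD(7)[OF r u(1,2)])
        also have "\<dots> \<le> (\<integral>\<^sup>+x. 1 \<partial>borel_of l)" using u(3) by (intro nn_integral_mono) simp
        also have "\<dots> = emeasure (borel_of l) UNIV" by (simp add: space_borel_of cone_pos[OF l])
        finally show "1 \<le> emeasure (borel_of l) UNIV + ennreal e" by (simp add: add_right_mono)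
      qed
    qed
  qed
qed

end

section \<open>The Gauss problem\<close>

locale gauss_problem = perfect +
  fixes \<psi> :: "'a \<Rightarrow> ereal" and \<theta> :: "('a \<Rightarrow> real) \<Rightarrow> real" and A :: "'a set"
  assumes \<psi>: "\<psi> \<in> Phi" and \<theta>: "\<theta> \<in> energy_space \<kappa>"
begin

abbreviation f where "f \<equiv> external_field \<kappa> \<psi> \<theta>"
abbreviation G where "G \<equiv> gauss_class \<kappa> f A"

definition field_energy where "field_energy \<mu> = ener (pos_part \<theta>) \<mu> - ener (neg_part \<theta>) \<mu>"
definition real_field where "real_field x = real_pot (pos_part \<theta>) x - real_pot (neg_part \<theta>) x"
text \<open>The integral of the field, divided into a part that is vaguely lower semicontinuous on
  unit measures and a part that is strongly continuous.\<close>

definition field_integral where "field_integral \<mu> = (LINT x|borel_of \<mu>. real_of_ereal (\<psi> x)) + field_energy \<mu>"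
definition gaussian where "gaussian \<mu> = ener \<mu> \<mu> + 2 * field_integral \<mu>"

lemmas \<theta>_parts = energy_space_parts(1,2)[OF \<theta>]

lemma \<psi>_measurable [measurable]: "\<psi> \<in> borel_measurable borel"
  by (rule Phi_measurable[OF \<psi>])

lemma f_measurable [measurable]: "f \<in> borel_measurable borel"
proof -
  note [measurable] = potential_signed_measurable[OF \<theta>]
  have "f = (\<lambda>x. \<psi> x + potential \<kappa> \<theta> x)" by (simp add: external_field_def[abs_def])
  then show ?thesis by simp
qed

lemma f_AE:
  assumes \<tau>: "\<tau> \<in> E"
  shows "AE x in borel_of \<tau>. field_defined \<kappa> \<theta> x \<and> f x = \<psi> x + ereal (real_field x)"
  using pot_finite_AE[OF \<theta>_parts(1) \<tau>] pot_finite_AE[OF \<theta>_parts(2) \<tau>]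
  by eventually_elim
    (simp add: field_defined_iff[OF \<theta>] external_field_def potential_signed_real[OF \<theta>] real_field_def)

lemma real_field_integral:
  assumes \<tau>: "\<tau> \<in> E"
  shows "integrable (borel_of \<tau>) real_field" "(LINT x|borel_of \<tau>. real_field x) = field_energy \<tau>"
proof -
  note i = real_pot_integral(1)[OF \<theta>_parts(1) \<tau>] real_pot_integral(1)[OF \<theta>_parts(2) \<tau>]
  show "integrable (borel_of \<tau>) real_field"
    using Bochner_Integration.integrable_diff[OF i] by (simp add: real_field_def[abs_def])
  show "(LINT x|borel_of \<tau>. real_field x) = field_energy \<tau>"
    unfolding real_field_def Bochner_Integration.integral_diff[OF i] field_energy_def
      real_pot_integral(2)[OF \<theta>_parts(1) \<tau>] real_pot_integral(2)[OF \<theta>_parts(2) \<tau>]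
    using ener_sym[OF cone_pos[OF \<tau>] cone_pos[OF \<theta>_parts(1)]] ener_sym[OF cone_pos[OF \<tau>] cone_pos[OF \<theta>_parts(2)]] by simp
qed

text \<open>The potential of \<theta> agrees almost everywhere with an integrable real function for
  each measure in \<open>E\<close>, so \<psi> alone decides.\<close>

lemma f_integrable_iff:
  assumes \<tau>: "\<tau> \<in> E"
  shows "radon_integrable \<tau> f \<longleftrightarrow> radon_integrable \<tau> \<psi>"
proof
  note p = cone_pos[OF \<tau>]
  assume *: "radon_integrable \<tau> f"
  note d = radon_integrableD[OF p *]
  have i: "integrable (borel_of \<tau>) (\<lambda>x. real_of_ereal (f x) - real_field x)"
    by (intro Bochner_Integration.integrable_diff d(2) real_field_integral(1)[OF \<tau>])
  show "radon_integrable \<tau> \<psi>"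
  proof (rule radon_integral_real(1)[OF p \<psi>_measurable i])
    show "AE x in borel_of \<tau>. \<psi> x = ereal (real_of_ereal (f x) - real_field x)"
      using d(1) f_AE[OF \<tau>]
    proof eventually_elim
      case (elim x)
      then show ?case by (cases "\<psi> x"; cases "f x") auto
    qed
  qed
next
  note p = cone_pos[OF \<tau>]
  assume *: "radon_integrable \<tau> \<psi>"
  note d = radon_integrableD[OF p *]
  have i: "integrable (borel_of \<tau>) (\<lambda>x. real_of_ereal (\<psi> x) + real_field x)"
    by (intro Bochner_Integration.integrable_add d(2) real_field_integral(1)[OF \<tau>])
  show "radon_integrable \<tau> f"
  proof (rule radon_integral_real(1)[OF p f_measurable i])
    show "AE x in borel_of \<tau>. f x = ereal (real_of_ereal (\<psi> x) + real_field x)"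
      using d(1) f_AE[OF \<tau>]
    proof eventually_elim
      case (elim x)
      then show ?case by (cases "\<psi> x") auto
    qed
  qed
qed

lemma f_integral:
  assumes \<tau>: "\<tau> \<in> E" and i: "radon_integrable \<tau> f"
  shows "radon_integral \<tau> f = ereal (field_integral \<tau>)"
    and "integrable (borel_of \<tau>) (\<lambda>x. real_of_ereal (\<psi> x))"
    and "AE x in borel_of \<tau>. f x = ereal (real_of_ereal (\<psi> x) + real_field x)"
proof -
  note p = cone_pos[OF \<tau>]
  note d = radon_integrableD[OF p i[unfolded f_integrable_iff[OF \<tau>]]]
  show "integrable (borel_of \<tau>) (\<lambda>x. real_of_ereal (\<psi> x))" by (rule d(2))
  have int: "integrable (borel_of \<tau>) (\<lambda>x. real_of_ereal (\<psi> x) + real_field x)"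
    by (intro Bochner_Integration.integrable_add d(2) real_field_integral(1)[OF \<tau>])
  show eq: "AE x in borel_of \<tau>. f x = ereal (real_of_ereal (\<psi> x) + real_field x)"
    using d(1) f_AE[OF \<tau>]
  proof eventually_elim
    case (elim x)
    then show ?case by (cases "\<psi> x") auto
  qed
  show "radon_integral \<tau> f = ereal (field_integral \<tau>)"
    unfolding radon_integral_real(2)[OF p f_measurable int eq]
      Bochner_Integration.integral_add[OF d(2) real_field_integral(1)[OF \<tau>]] real_field_integral(2)[OF \<tau>] field_integral_def ..
qed

section \<open>The Gauss functional on the admissible class\<close>

lemma gauss_classD:
  assumes "\<mu> \<in> G"
  shows "\<mu> \<in> unit A" "\<mu> \<in> E" "radon_integrable \<mu> f"
  using assms unitD(1) by (auto simp: gauss_class_def)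

lemma gauss_energy_eq: "\<mu> \<in> G \<Longrightarrow> gauss_energy \<kappa> f \<mu> = ereal (gaussian \<mu>)"
  using gauss_classD[of \<mu>] by (simp add: gauss_energy_def energy_eq f_integral(1) gaussian_def)

lemma G_convex:
  assumes \<mu>: "\<mu> \<in> G" and \<nu>: "\<nu> \<in> G" and ab: "0 \<le> a" "0 \<le> b" "a + b = 1"
  shows "(\<lambda>\<phi>. a * \<mu> \<phi> + b * \<nu> \<phi>) \<in> G" "field_integral (\<lambda>\<phi>. a * \<mu> \<phi> + b * \<nu> \<phi>) = a * field_integral \<mu> + b * field_integral \<nu>"
proof -
  let ?T = "\<lambda>\<phi>. a * \<mu> \<phi> + b * \<nu> \<phi>"
  note u = gauss_classD[OF \<mu>] and v = gauss_classD[OF \<nu>]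
  note p = cone_pos[OF u(2)] cone_pos[OF v(2)]
  have T: "?T \<in> unit A" by (rule unit_convex[OF u(1) v(1) ab])
  note l = nn_integral_lincomb[OF lc p ab(1,2)]
  have ipT: "integral_pos ?T \<psi> = ennreal a * integral_pos \<mu> \<psi> + ennreal b * integral_pos \<nu> \<psi>"
    "integral_neg ?T \<psi> = ennreal a * integral_neg \<mu> \<psi> + ennreal b * integral_neg \<nu> \<psi>"
    unfolding integral_pos_neg_of_pos[OF lc p(1) \<psi>_measurable] integral_pos_neg_of_pos[OF lc p(2) \<psi>_measurable]
      integral_pos_neg_of_pos[OF lc unitD(2)[OF T] \<psi>_measurable] by (intro l; measurable)+
  have i\<psi>: "radon_integrable \<mu> \<psi>" "radon_integrable \<nu> \<psi>" using f_integrable_iff u v by blast+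
  then have iT: "radon_integrable ?T \<psi>"
    unfolding radon_integrable_def ipT by (simp add: ennreal_mult_less_top)
  then show "?T \<in> G" using T f_integrable_iff[OF unitD(1)[OF T]] by (simp add: gauss_class_def)
  have L: "(LINT x|borel_of \<tau>. real_of_ereal (\<psi> x)) = enn2real (integral_pos \<tau> \<psi>) - enn2real (integral_neg \<tau> \<psi>)"
    if \<tau>: "\<tau> \<in> E" "radon_integrable \<tau> \<psi>" for \<tau>
  proof -
    have "ereal (LINT x|borel_of \<tau>. real_of_ereal (\<psi> x)) = radon_integral \<tau> \<psi>"
      using radon_integral_real(2)[OF cone_pos[OF \<tau>(1)] \<psi>_measurable radon_integrableD(2,1)[OF cone_pos[OF \<tau>(1)] \<tau>(2)]] by simp
    also have "\<dots> = ereal (enn2real (integral_pos \<tau> \<psi>) - enn2real (integral_neg \<tau> \<psi>))"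
      using \<tau>(2) by (simp add: radon_integral_def radon_integrable_def enn2ereal_eq)
    finally show ?thesis by simp
  qed
  have "(LINT x|borel_of ?T. real_of_ereal (\<psi> x)) = a * (LINT x|borel_of \<mu>. real_of_ereal (\<psi> x)) + b * (LINT x|borel_of \<nu>. real_of_ereal (\<psi> x))"
    unfolding L[OF u(2) i\<psi>(1)] L[OF v(2) i\<psi>(2)] L[OF unitD(1)[OF T] iT] ipT
    using i\<psi> ab by (simp add: radon_integrable_def enn2real_plus ennreal_mult_less_top enn2real_mult algebra_simps)
  moreover have "field_energy ?T = a * field_energy \<mu> + b * field_energy \<nu>"
    unfolding field_energy_def ener_lincomb_right[OF u(2) v(2) \<theta>_parts(1) ab(1,2)] ener_lincomb_right[OF u(2) v(2) \<theta>_parts(2) ab(1,2)]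
    by (simp add: algebra_simps)
  ultimately show "field_integral ?T = a * field_integral \<mu> + b * field_integral \<nu>" by (simp add: field_integral_def algebra_simps)
qed

text \<open>The parallelogram identity for \<open>ener\<close> carries over to
  \<open>gaussian\<close>, because the field integral of the midpoint is the mean of the two field
  integrals.\<close>

lemma dist_sq_gaussian:
  assumes \<mu>: "\<mu> \<in> G" and \<nu>: "\<nu> \<in> G" and w: "\<And>\<tau>. \<tau> \<in> G \<Longrightarrow> w \<le> gaussian \<tau>"
  shows "dist_sq \<mu> \<nu> \<le> 2 * gaussian \<mu> + 2 * gaussian \<nu> - 4 * w"
proof -
  have h: "0 \<le> (1 / 2 :: real)" "(1 / 2 :: real) + 1 / 2 = 1" by simp_all
  define T where "T = (\<lambda>\<phi>. (1 / 2) * \<mu> \<phi> + (1 / 2) * \<nu> \<phi>)"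
  note c = G_convex[OF \<mu> \<nu> h(1) h(1) h(2), folded T_def]
  have "w \<le> ener T T + 2 * field_integral T" using w[OF c(1)] by (simp add: gaussian_def)
  moreover have "2 * field_integral T = field_integral \<mu> + field_integral \<nu>" using c(2) by simp
  moreover note dist_sq_parallelogram[OF gauss_classD(2)[OF \<mu>] gauss_classD(2)[OF \<nu>], folded T_def]
  ultimately show ?thesis by (simp add: gaussian_def)
qed

text \<open>Any nonnegative constant that makes \<open>\<psi> + cutoff\<close> nonnegative serves;
  unit measures turn the shift into the same additive constant.\<close>

definition cutoff :: real where "cutoff = (SOME c. 0 \<le> c \<and> (\<forall>y. - ereal c \<le> \<psi> y))"
definition shifted where "shifted x = e2ennreal (\<psi> x + ereal cutoff)"

lemma cutoff: "0 \<le> cutoff" "- ereal cutoff \<le> \<psi> y"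
proof -
  have "\<exists>c. 0 \<le> c \<and> (\<forall>y. - ereal c \<le> \<psi> y)" using Phi_bounded_below[OF \<psi>] by metis
  from someI_ex[OF this] show "0 \<le> cutoff" "- ereal cutoff \<le> \<psi> y" by (auto simp: cutoff_def)
qed

lemma shifted_lsc: "open {x. a < shifted x}"
proof -
  have "(enn2ereal a < t + ereal cutoff) = (enn2ereal a - ereal cutoff < t)" for t
    by (cases t; cases "enn2ereal a") auto
  then show ?thesis using Phi_open[OF \<psi>] by (simp add: shifted_def less_e2ennreal_iff)
qed

text \<open>The last claim is the criterion for admissibility: the negative part of \<psi> always
  has a finite integral, and the shifted function dominates the positive part.\<close>

lemma shifted_integral:
  assumes \<tau>: "\<tau> \<in> unit B"
  shows "radon_integrable \<tau> \<psi> \<Longrightarrow> (\<integral>\<^sup>+x. shifted x \<partial>borel_of \<tau>) = ennreal ((LINT x|borel_of \<tau>. real_of_ereal (\<psi> x)) + cutoff)"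
    and "radon_integrable \<tau> \<psi> \<Longrightarrow> 0 \<le> (LINT x|borel_of \<tau>. real_of_ereal (\<psi> x)) + cutoff"
    and "(\<integral>\<^sup>+x. shifted x \<partial>borel_of \<tau>) < top \<Longrightarrow> radon_integrable \<tau> \<psi>"
proof -
  note p = unitD(2)[OF \<tau>]
  interpret prob_space "borel_of \<tau>" by (rule unit_prob[OF \<tau>])
  {
    assume i: "radon_integrable \<tau> \<psi>"
    note d = radon_integrableD[OF p i]
    have ic: "integrable (borel_of \<tau>) (\<lambda>x. real_of_ereal (\<psi> x) + cutoff)" using d(2) by simp
    have nn: "AE x in borel_of \<tau>. 0 \<le> real_of_ereal (\<psi> x) + cutoff"
      using d(1)
    proof eventually_elim
      case (elim x)
      then show ?case using cutoff(2)[of x] by (cases "\<psi> x") auto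
    qed
    have val: "(LINT x|borel_of \<tau>. real_of_ereal (\<psi> x) + cutoff) = (LINT x|borel_of \<tau>. real_of_ereal (\<psi> x)) + cutoff"
      using d(2) by (simp add: prob_space)
    have "(\<integral>\<^sup>+x. shifted x \<partial>borel_of \<tau>) = (\<integral>\<^sup>+x. ennreal (real_of_ereal (\<psi> x) + cutoff) \<partial>borel_of \<tau>)"
    proof (rule nn_integral_cong_AE)
      show "AE x in borel_of \<tau>. shifted x = ennreal (real_of_ereal (\<psi> x) + cutoff)"
        using d(1)
      proof eventually_elim
        case (elim x)
        then show ?case by (cases "\<psi> x") (auto simp: shifted_def)
      qed
    qed
    also have "\<dots> = ennreal (LINT x|borel_of \<tau>. real_of_ereal (\<psi> x) + cutoff)"
      by (rule nn_integral_eq_integral[OF ic nn])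
    finally show "(\<integral>\<^sup>+x. shifted x \<partial>borel_of \<tau>) = ennreal ((LINT x|borel_of \<tau>. real_of_ereal (\<psi> x)) + cutoff)"
      unfolding val .
    show "0 \<le> (LINT x|borel_of \<tau>. real_of_ereal (\<psi> x)) + cutoff"
      using integral_nonneg_AE[OF nn] unfolding val .
  }
  assume fin: "(\<integral>\<^sup>+x. shifted x \<partial>borel_of \<tau>) < top"
  have "(\<integral>\<^sup>+x. e2ennreal (\<psi> x) \<partial>borel_of \<tau>) \<le> (\<integral>\<^sup>+x. shifted x \<partial>borel_of \<tau>)"
  proof (rule nn_integral_mono)
    fix x
    have "\<psi> x \<le> \<psi> x + ereal cutoff" using cutoff(1) by (cases "\<psi> x") auto
    then show "e2ennreal (\<psi> x) \<le> shifted x" unfolding shifted_def by (rule e2ennreal_mono)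
  qed
  then show "radon_integrable \<tau> \<psi>"
    using fin Phi_neg_finite[OF lc p \<psi>] integral_pos_neg_of_pos[OF lc p \<psi>_measurable]
    by (simp add: radon_integrable_def le_less_trans)
qed

lemma weighted_potential_integral:
  assumes \<mu>: "\<mu> \<in> E" and \<tau>: "\<tau> \<in> E" "radon_integrable \<tau> f"
  shows "radon_integrable \<tau> (weighted_potential \<kappa> f \<mu>)"
    and "radon_integral \<tau> (weighted_potential \<kappa> f \<mu>) = ereal (ener \<mu> \<tau> + field_integral \<tau>)"
    and "integrable (borel_of \<tau>) (\<lambda>x. real_pot \<mu> x + (real_of_ereal (\<psi> x) + real_field x))"
    and "(LINT x|borel_of \<tau>. real_pot \<mu> x + (real_of_ereal (\<psi> x) + real_field x)) = ener \<mu> \<tau> + field_integral \<tau>"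
    and "AE x in borel_of \<tau>. weighted_potential \<kappa> f \<mu> x = ereal (real_pot \<mu> x + (real_of_ereal (\<psi> x) + real_field x))"
proof -
  note p = cone_pos[OF \<mu>] cone_pos[OF \<tau>(1)]
  note fi = f_integral[OF \<tau>]
  note [measurable] = potential_measurable[OF p(1)]
  have m: "weighted_potential \<kappa> f \<mu> \<in> borel_measurable borel"
    unfolding weighted_potential_def[abs_def] by measurable
  note i = real_pot_integral[OF \<mu> \<tau>(1)] and j = real_field_integral[OF \<tau>(1)]
  have ij: "integrable (borel_of \<tau>) (\<lambda>x. real_of_ereal (\<psi> x) + real_field x)"
    by (intro Bochner_Integration.integrable_add fi(2) j(1))
  show int: "integrable (borel_of \<tau>) (\<lambda>x. real_pot \<mu> x + (real_of_ereal (\<psi> x) + real_field x))"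
    by (intro Bochner_Integration.integrable_add i(1) ij)
  show val: "(LINT x|borel_of \<tau>. real_pot \<mu> x + (real_of_ereal (\<psi> x) + real_field x)) = ener \<mu> \<tau> + field_integral \<tau>"
    unfolding Bochner_Integration.integral_add[OF i(1) ij] Bochner_Integration.integral_add[OF fi(2) j(1)] i(2) j(2) field_integral_def
    using ener_sym[OF p] by simp
  show eq: "AE x in borel_of \<tau>. weighted_potential \<kappa> f \<mu> x = ereal (real_pot \<mu> x + (real_of_ereal (\<psi> x) + real_field x))"
    using fi(3) pot_finite_AE[OF \<mu> \<tau>(1)]
    by eventually_elim (simp add: weighted_potential_def potential_real[OF p(1)])
  show "radon_integrable \<tau> (weighted_potential \<kappa> f \<mu>)"
    by (rule radon_integral_real(1)[OF p(2) m int eq])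
  show "radon_integral \<tau> (weighted_potential \<kappa> f \<mu>) = ereal (ener \<mu> \<tau> + field_integral \<tau>)"
    unfolding radon_integral_real(2)[OF p(2) m int eq] val ..
qed

text \<open>A unit measure on the exceptional set automatically has an integrable field, since there the field is
  bounded above by an integrable function; it would then violate the variational inequality.\<close>

lemma exceptional_set_empty:
  assumes \<mu>: "\<mu> \<in> E" and c: "\<And>\<tau>. \<tau> \<in> G \<Longrightarrow> c \<le> ener \<mu> \<tau> + field_integral \<tau>"
  shows "nearly_everywhere_on \<kappa> A (\<lambda>x. field_defined \<kappa> \<theta> x \<and> ereal c \<le> weighted_potential \<kappa> f \<mu> x)"
  unfolding nearly_everywhere_iff
proof (rule ccontr)
  let ?N = "{x \<in> A. \<not> (field_defined \<kappa> \<theta> x \<and> ereal c \<le> weighted_potential \<kappa> f \<mu> x)}"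
  assume "unit ?N \<noteq> {}"
  then obtain \<tau> where \<tau>: "\<tau> \<in> unit ?N" by blast
  note u = unitD[OF \<tau>] and p = cone_pos[OF \<mu>]
  interpret prob_space "borel_of \<tau>" by (rule unit_prob[OF \<tau>])
  \<comment> \<open>The field is defined almost everywhere for \<tau>, so on the exceptional set it
    is the inequality that fails.\<close>
  have less: "AE x in borel_of \<tau>. weighted_potential \<kappa> f \<mu> x < ereal c"
    using unit_AE[OF \<tau>] f_AE[OF u(1)] by eventually_elim auto
  \<comment> \<open>The failing inequality solved for \<psi>: an integrable function that bounds
    \<psi> from above.\<close>
  define h where "h x = c - real_pot \<mu> x - real_field x" for x
  have ih: "integrable (borel_of \<tau>) (\<lambda>x. h x + cutoff)"
    unfolding h_def using real_pot_integral(1)[OF \<mu> u(1)] real_field_integral(1)[OF u(1)] by simp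
  have "(\<integral>\<^sup>+x. shifted x \<partial>borel_of \<tau>) \<le> (\<integral>\<^sup>+x. ennreal (h x + cutoff) \<partial>borel_of \<tau>)"
  proof (rule nn_integral_mono_AE)
    show "AE x in borel_of \<tau>. shifted x \<le> ennreal (h x + cutoff)"
      using less f_AE[OF u(1)] pot_finite_AE[OF \<mu> u(1)]
    proof eventually_elim
      case (elim x)
      then have "ereal (real_pot \<mu> x) + (\<psi> x + ereal (real_field x)) < ereal c"
        by (simp add: weighted_potential_def potential_real[OF p])
      then have "\<psi> x + ereal cutoff \<le> ereal (h x + cutoff)"
        by (cases "\<psi> x") (auto simp: h_def)
      then show ?case unfolding shifted_def by (metis e2ennreal_mono e2ennreal_ereal)
    qed
  qed
  also have "\<dots> < top" using ih by (simp add: real_integrable_def less_top)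
  finally have "radon_integrable \<tau> \<psi>" by (rule shifted_integral(3)[OF \<tau>])
  then have fi: "radon_integrable \<tau> f" using f_integrable_iff[OF u(1)] by simp
  have "\<tau> \<in> G" using unit_mono[OF \<tau>, of A] fi by (auto simp: gauss_class_def)
  then have "c \<le> ener \<mu> \<tau> + field_integral \<tau>" by (rule c)
  moreover
  note w = weighted_potential_integral[OF \<mu> u(1) fi]
  have "(LINT x|borel_of \<tau>. real_pot \<mu> x + (real_of_ereal (\<psi> x) + real_field x)) < (LINT x|borel_of \<tau>. c)"
  proof (rule integral_less_AE_space)
    show "AE x in borel_of \<tau>. real_pot \<mu> x + (real_of_ereal (\<psi> x) + real_field x) < c"
      using less w(5) by eventually_elim simp
    show "emeasure (borel_of \<tau>) (space (borel_of \<tau>)) \<noteq> 0" using emeasure_space_1 by simp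
  qed (use w(3) in auto)
  ultimately show False unfolding w(4) by (simp add: prob_space)
qed

text \<open>If the inequality failed on a set of positive \<nu>-measure, normalizing the restriction
  of \<nu> to that set would give a unit measure of finite energy on a set of capacity 0.\<close>

lemma nearly_everywhere_imp_AE:
  assumes \<mu>: "\<mu> \<in> E" and ne: "nearly_everywhere_on \<kappa> A (\<lambda>x. field_defined \<kappa> \<theta> x \<and> ereal c \<le> weighted_potential \<kappa> f \<mu> x)"
    and \<nu>: "\<nu> \<in> unit A"
  shows "AE x in borel_of \<nu>. ereal c \<le> weighted_potential \<kappa> f \<mu> x"
proof -
  note u = unitD[OF \<nu>]
  note [measurable] = potential_measurable[OF cone_pos[OF \<mu>]]
  interpret prob_space "borel_of \<nu>" by (rule unit_prob[OF \<nu>])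
  define B where "B = {x. weighted_potential \<kappa> f \<mu> x < ereal c}"
  have "weighted_potential \<kappa> f \<mu> \<in> borel_measurable borel"
    unfolding weighted_potential_def[abs_def] by measurable
  then have B: "B \<in> sets borel" unfolding B_def by (simp add: borel_measurable_less)
  have "\<not> 0 < prob B"
  proof
    assume m: "0 < prob B"
    obtain \<tau> where \<tau>: "\<tau> \<in> E" "emeasure (borel_of \<tau>) UNIV = 1"
        "\<And>P. (AE x in borel_of \<nu>. x \<in> B \<longrightarrow> P x) \<Longrightarrow> AE x in borel_of \<tau>. P x"
        "(prob B)\<^sup>2 * enn2real (pos_energy \<tau> \<tau>) \<le> enn2real (pos_energy \<nu> \<nu>)"
      by (rule restrict_unit[OF u(1,3) B m]) (rule that)
    have "\<tau> \<in> unit {x \<in> A. \<not> (field_defined \<kappa> \<theta> x \<and> ereal c \<le> weighted_potential \<kappa> f \<mu> x)}"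
    proof (rule unitI[OF \<tau>(1,2)], rule \<tau>(3))
      show "AE x in borel_of \<nu>. x \<in> B \<longrightarrow> x \<in> {x \<in> A. \<not> (field_defined \<kappa> \<theta> x \<and> ereal c \<le> weighted_potential \<kappa> f \<mu> x)}"
        using unit_AE[OF \<nu>] by eventually_elim (auto simp: B_def)
    qed
    then show False using ne unfolding nearly_everywhere_iff by blast
  qed
  then have "prob B = 0" using measure_nonneg[of "borel_of \<nu>" B] by linarith
  then have "AE x in borel_of \<nu>. x \<notin> B"
    using B sets_borel_of[OF u(2)] by (intro AE_not_in) (simp add: null_sets_def emeasure_eq_measure)
  then show ?thesis by eventually_elim (simp add: B_def not_less)
qed

section \<open>Minimizers and the variational inequality\<close>

lemma gaussian_le_imp_eq:
  assumes \<mu>: "\<mu> \<in> G" and \<nu>: "\<nu> \<in> G" and w: "\<And>\<tau>. \<tau> \<in> G \<Longrightarrow> w \<le> gaussian \<tau>"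
    and "gaussian \<mu> \<le> w" "gaussian \<nu> \<le> w"
  shows "\<mu> = \<nu>"
proof -
  have "dist_sq \<mu> \<nu> \<le> 0" using dist_sq_gaussian[OF \<mu> \<nu> w] assms(4,5) by linarith
  then show ?thesis using dist_sq_nonneg dist_sq_eq_0 gauss_classD(2)[OF \<mu>] gauss_classD(2)[OF \<nu>] by (metis order_antisym)
qed

lemma variational_inequality:
  assumes l: "l \<in> G" and w: "\<And>\<tau>. \<tau> \<in> G \<Longrightarrow> gaussian l \<le> gaussian \<tau>" and \<mu>: "\<mu> \<in> G"
  shows "ener l l + field_integral l \<le> ener l \<mu> + field_integral \<mu>"
proof (rule ccontr)
  \<comment> \<open>Along the segment from \<open>l\<close> to \<mu> the Gauss functional is a
    quadratic polynomial in \<open>t\<close> with linear coefficient \<open>2 * D\<close> and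
    quadratic coefficient \<open>dist_sq l \<mu>\<close>.\<close>
  define D where "D = (ener l \<mu> + field_integral \<mu>) - (ener l l + field_integral l)"
  assume "\<not> ?thesis"
  then have D: "D < 0" by (simp add: D_def)
  note lE = gauss_classD(2)[OF l] and mE = gauss_classD(2)[OF \<mu>]
  have key: "0 \<le> 2 * D + t * dist_sq l \<mu>" if t: "0 < t" "t \<le> 1" for t
  proof -
    have ab: "0 \<le> 1 - t" "0 \<le> t" "(1 - t) + t = 1" using t by auto
    let ?T = "\<lambda>\<phi>. (1 - t) * l \<phi> + t * \<mu> \<phi>"
    note c = G_convex[OF l \<mu> ab]
    have TE: "?T \<in> E" by (rule gauss_classD(2)[OF c(1)])
    have "ener ?T ?T = (1 - t) * ((1 - t) * ener l l + t * ener l \<mu>) + t * ((1 - t) * ener \<mu> l + t * ener \<mu> \<mu>)"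
      unfolding ener_lincomb_left[OF lE mE TE ab(1,2)] ener_lincomb_right[OF lE mE lE ab(1,2)] ener_lincomb_right[OF lE mE mE ab(1,2)] ..
    then have "gaussian ?T = gaussian l + t * (2 * D + t * dist_sq l \<mu>)"
      unfolding gaussian_def c(2) D_def dist_sq_def ener_sym[OF cone_pos[OF mE] cone_pos[OF lE]]
      by (simp add: algebra_simps power2_eq_square)
    then have "0 \<le> t * (2 * D + t * dist_sq l \<mu>)" using w[OF c(1)] by linarith
    then show ?thesis using t(1) by (simp add: zero_le_mult_iff)
  qed
  define d where "d = dist_sq l \<mu>"
  have d: "0 \<le> d" unfolding d_def by (rule dist_sq_nonneg[OF lE mE])
  \<comment> \<open>With this \<open>t\<close> the quadratic contribution satisfies
    \<open>t * d \<le> - D\<close>, so that \<open>2 * D + t * d \<le> D < 0\<close>. The 1 in the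
    denominator covers \<open>d = 0\<close>.\<close>
  define t where "t = min 1 (- D / (d + 1))"
  have t: "0 < t" "t \<le> 1" using D d by (auto simp: t_def intro!: divide_neg_pos)
  have "t * d \<le> (- D / (d + 1)) * d" using d by (intro mult_right_mono) (auto simp: t_def)
  also have "\<dots> \<le> - D" using D d by (simp add: field_simps)
  finally show False using key[OF t] D by (simp add: d_def)
qed

lemma minimizer_exists:
  assumes w: "\<And>\<tau>. \<tau> \<in> G \<Longrightarrow> w \<le> gaussian \<tau>" and inf: "\<And>e. 0 < e \<Longrightarrow> \<exists>\<tau>\<in>G. gaussian \<tau> < w + e"
    and cl: "closedin (subtopology (strong_topology \<kappa>) E) (energy_cone_on \<kappa> A)"
    and cap: "inner_cap \<kappa> A < \<infinity>"
  shows "\<exists>l\<in>G. gaussian l = w"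
proof -
  have "\<forall>n. \<exists>\<tau>. \<tau> \<in> G \<and> gaussian \<tau> < w + 1 / real (Suc n)" using inf by (simp add: Bex_def)
  then obtain \<sigma> where \<sigma>: "\<And>n. \<sigma> n \<in> G" "\<And>n. gaussian (\<sigma> n) < w + 1 / real (Suc n)" by metis
  note \<sigma>E = gauss_classD(2)[OF \<sigma>(1)]
  have lim4: "(\<lambda>n. 4 / real (Suc n)) \<longlonglongrightarrow> 0"
    using LIMSEQ_Suc[OF lim_const_over_n[of 4]] by simp
  obtain l where l: "l \<in> E" "(\<lambda>n. dist_sq (\<sigma> n) l) \<longlonglongrightarrow> 0"
  proof (rule strong_complete[OF \<sigma>E _ lim4])
    fix n m :: nat assume "n \<le> m"
    then have "1 / real (Suc m) \<le> 1 / real (Suc n)" by (intro divide_left_mono) auto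
    moreover have "4 / real (Suc n) = 4 * (1 / real (Suc n))" by simp
    \<comment> \<open>In \<open>2 * gaussian (\<sigma> n) + 2 * gaussian (\<sigma> m) - 4 *
      w\<close> the multiples of \<open>w\<close> cancel, and each of the two errors contributes at
      most \<open>2 / real (Suc n)\<close>.\<close>
    ultimately show "dist_sq (\<sigma> n) (\<sigma> m) \<le> 4 / real (Suc n)"
      using dist_sq_gaussian[OF \<sigma>(1) \<sigma>(1) w, of n m] \<sigma>(2)[of n] \<sigma>(2)[of m] by linarith
  qed
  have lA: "l \<in> energy_cone_on \<kappa> A"
  proof (rule ccontr)
    assume "l \<notin> energy_cone_on \<kappa> A"
    then have lW: "l \<in> topspace (subtopology (strong_topology \<kappa>) E) - energy_cone_on \<kappa> A"
      using l(1) cone_space Metric_space.topspace_mtopology[OF Metric_space_energy] by (auto simp: strong_topology_def)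
    have "openin (subtopology (strong_topology \<kappa>) E) (topspace (subtopology (strong_topology \<kappa>) E) - energy_cone_on \<kappa> A)"
      using cl by (simp add: closedin_def)
    from strong_eventually[OF this lW l(1) \<sigma>E l(2)]
    have "\<forall>\<^sub>F n in sequentially. False"
      using unitD(5)[OF gauss_classD(1)[OF \<sigma>(1)]] by (auto elim: eventually_mono)
    then show False by simp
  qed
  obtain w0 where w0: "0 < w0" "\<And>\<mu>. \<mu> \<in> unit A \<Longrightarrow> w0 \<le> ener \<mu> \<mu>"
    using finite_capacity[OF cap] by metis
  have "emeasure (borel_of l) UNIV = 1"
    by (rule unit_mass_limit[OF w0 gauss_classD(1)[OF \<sigma>(1)] l])
  then have lu: "l \<in> unit A" using lA by (simp add: unit_cone_on_def)
  \<comment> \<open>The shifted integral of \<psi>, solved for from the Gauss functional. All terms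
    on the right converge: the functional because the sequence is minimizing, the energies by strong
    convergence.\<close>
  define r where "r n = (gaussian (\<sigma> n) - ener (\<sigma> n) (\<sigma> n)) / 2 - field_energy (\<sigma> n) + cutoff" for n
  have r: "r n = (LINT x|borel_of (\<sigma> n). real_of_ereal (\<psi> x)) + cutoff" for n
    by (simp add: r_def gaussian_def field_integral_def field_simps)
  have glim: "(\<lambda>n. gaussian (\<sigma> n)) \<longlonglongrightarrow> w"
  proof (rule tendsto_sandwich[OF _ _ tendsto_const])
    show "\<forall>\<^sub>F n in sequentially. w \<le> gaussian (\<sigma> n)" using w \<sigma>(1) by simp
    show "\<forall>\<^sub>F n in sequentially. gaussian (\<sigma> n) \<le> w + 1 / real (Suc n)" using \<sigma>(2) by (simp add: less_imp_le)
    have "(\<lambda>n. w + 1 / real (Suc n)) \<longlonglongrightarrow> w + 0"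
      by (intro tendsto_add tendsto_const LIMSEQ_Suc[OF lim_const_over_n[of 1]])
    then show "(\<lambda>n. w + 1 / real (Suc n)) \<longlonglongrightarrow> w" by simp
  qed
  have felim: "(\<lambda>n. field_energy (\<sigma> n)) \<longlonglongrightarrow> field_energy l"
  proof -
    have "(\<lambda>n. ener (\<sigma> n) (pos_part \<theta>) - ener (\<sigma> n) (neg_part \<theta>)) \<longlonglongrightarrow> ener l (pos_part \<theta>) - ener l (neg_part \<theta>)"
      by (intro tendsto_diff ener_limit(1)[OF l(1) \<sigma>E l(2)] \<theta>_parts)
    moreover have "field_energy \<mu> = ener \<mu> (pos_part \<theta>) - ener \<mu> (neg_part \<theta>)" if "\<mu> \<in> E" for \<mu>
      unfolding field_energy_def using ener_sym cone_pos[OF that] cone_pos \<theta>_parts by metis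
    ultimately show ?thesis using \<sigma>E l(1) by simp
  qed
  define R where "R = (w - ener l l) / 2 - field_energy l + cutoff"
  have rlim: "r \<longlonglongrightarrow> R"
    unfolding r_def[abs_def] R_def
    by (intro tendsto_intros glim felim ener_limit(2)[OF l(1) \<sigma>E l(2)]) simp
  note rs = Riesz_Markov[OF lc cone_pos[OF \<sigma>E]] and rl = Riesz_Markov[OF lc cone_pos[OF l(1)]]
  have i\<psi>: "radon_integrable (\<sigma> n) \<psi>" for n using gauss_classD[OF \<sigma>(1)] f_integrable_iff by blast
  have r0: "0 \<le> r n" for n unfolding r by (rule shifted_integral(2)[OF gauss_classD(1)[OF \<sigma>(1)] i\<psi>])
  have R0: "0 \<le> R" using LIMSEQ_le_const[OF rlim, of 0] r0 by blast
  \<comment> \<open>Vague lower semicontinuity: each minorant in \<open>Cc\<close> of the shifted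
    function satisfies \<open>\<sigma> n \<phi> \<le> r n\<close>, and this inequality passes to the
    limit.\<close>
  have "(\<integral>\<^sup>+x. shifted x \<partial>borel_of l) = (SUP \<phi>\<in>below shifted. ennreal (l \<phi>))"
    by (rule nn_integral_lsc[OF lc cone_pos[OF l(1)] rl shifted_lsc])
  also have "\<dots> \<le> ennreal R"
  proof (rule SUP_least)
    fix \<phi> assume \<phi>: "\<phi> \<in> below shifted"
    have "\<sigma> n \<phi> \<le> r n" for n
    proof -
      have "ennreal (\<sigma> n \<phi>) = (\<integral>\<^sup>+x. ennreal (\<phi> x) \<partial>borel_of (\<sigma> n))"
        by (rule representsD(7)[OF rs belowD(1,2)[OF \<phi>]])
      also have "\<dots> \<le> (\<integral>\<^sup>+x. shifted x \<partial>borel_of (\<sigma> n))" by (intro nn_integral_mono belowD(3)[OF \<phi>])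
      also have "\<dots> = ennreal (r n)" unfolding r by (rule shifted_integral(1)[OF gauss_classD(1)[OF \<sigma>(1)] i\<psi>])
      finally show ?thesis using r0[of n] by simp
    qed
    then have "l \<phi> \<le> R" by (intro LIMSEQ_le[OF vague_limit[OF l(1) \<sigma>E l(2)] rlim]) auto
    then show "ennreal (l \<phi>) \<le> ennreal R" by (rule ennreal_leI)
  qed
  finally have leR: "(\<integral>\<^sup>+x. shifted x \<partial>borel_of l) \<le> ennreal R" .
  then have "(\<integral>\<^sup>+x. shifted x \<partial>borel_of l) < top" by (rule le_less_trans) simp
  then have il: "radon_integrable l \<psi>" by (rule shifted_integral(3)[OF lu])
  have lG: "l \<in> G" using lu il f_integrable_iff[OF l(1)] by (simp add: gauss_class_def)
  have "(LINT x|borel_of l. real_of_ereal (\<psi> x)) + cutoff \<le> R"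
    using leR R0 unfolding shifted_integral(1)[OF lu il] by simp
  then have "gaussian l \<le> w" by (simp add: gaussian_def field_integral_def R_def field_simps)
  then show ?thesis using w[OF lG] lG by (intro bexI[of _ l]) auto
qed

lemma gauss_solution:
  assumes "-\<infinity> < gauss_inf \<kappa> f A" "gauss_inf \<kappa> f A < \<infinity>"
    and cl: "closedin (subtopology (strong_topology \<kappa>) E) (energy_cone_on \<kappa> A)"
    and cap: "inner_cap \<kappa> A < \<infinity>"
  shows "\<exists>\<nu>\<in>G.
    gauss_energy \<kappa> f \<nu> = gauss_inf \<kappa> f A \<and>
    (\<forall>\<mu>\<in>G. gauss_energy \<kappa> f \<mu> = gauss_inf \<kappa> f A \<longrightarrow> \<mu> = \<nu>) \<and>
    (\<exists>c::real.
       integral_defined \<nu> (weighted_potential \<kappa> f \<nu>) \<and>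
       ereal c = radon_integral \<nu> (weighted_potential \<kappa> f \<nu>) \<and>
       ereal c = gauss_inf \<kappa> f A - radon_integral \<nu> f \<and>
       nearly_everywhere_on \<kappa> A
         (\<lambda>x. field_defined \<kappa> \<theta> x \<and> ereal c \<le> weighted_potential \<kappa> f \<nu> x) \<and>
       (AE x in borel_of \<nu>.
          field_defined \<kappa> \<theta> x \<and> weighted_potential \<kappa> f \<nu> x \<le> ereal c)) \<and>
    (\<forall>\<mu>\<in>G.
       \<mu> = \<nu> \<longleftrightarrow>
       nearly_everywhere_on \<kappa> A
         (\<lambda>x. field_defined \<kappa> \<theta> x \<and>
              radon_integral \<mu> (weighted_potential \<kappa> f \<mu>) \<le> weighted_potential \<kappa> f \<mu> x)) \<and>
    (\<forall>\<mu>\<in>G.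
       \<mu> = \<nu> \<longleftrightarrow>
       (AE x in borel_of \<mu>.
          field_defined \<kappa> \<theta> x \<and>
          weighted_potential \<kappa> f \<mu> x \<le> gauss_inf \<kappa> f A - radon_integral \<mu> f))"
proof -
  obtain w where gw: "gauss_inf \<kappa> f A = ereal w" using assms(1,2) by (cases "gauss_inf \<kappa> f A") auto
  have w: "w \<le> gaussian \<tau>" if "\<tau> \<in> G" for \<tau>
  proof -
    have "gauss_inf \<kappa> f A \<le> gauss_energy \<kappa> f \<tau>" unfolding gauss_inf_def by (rule INF_lower[OF that])
    then show ?thesis by (simp add: gw gauss_energy_eq[OF that])
  qed
  have inf: "\<exists>\<tau>\<in>G. gaussian \<tau> < w + e" if e: "0 < e" for e
  proof -
    have "gauss_inf \<kappa> f A < ereal (w + e)" using e by (simp add: gw)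
    then obtain \<tau> where "\<tau> \<in> G" "gauss_energy \<kappa> f \<tau> < ereal (w + e)" unfolding gauss_inf_def INF_less_iff by blast
    then show ?thesis using gauss_energy_eq by auto
  qed
  obtain l where l: "l \<in> G" "gaussian l = w" using minimizer_exists[OF w inf cl cap] by blast
  note lE = gauss_classD(2)[OF l(1)] and li = gauss_classD(3)[OF l(1)]
  have uniq: "\<mu> = l" if "\<mu> \<in> G" "gaussian \<mu> \<le> w" for \<mu>
    by (rule gaussian_le_imp_eq[OF that(1) l(1) w that(2)]) (simp_all add: l(2))
  define c where "c = ener l l + field_integral l"
  have wp: "radon_integral \<mu> (weighted_potential \<kappa> f \<mu>) = ereal (ener \<mu> \<mu> + field_integral \<mu>)" if "\<mu> \<in> G" for \<mu>
    by (rule weighted_potential_integral(2)[OF gauss_classD(2)[OF that] gauss_classD(2,3)[OF that]])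
  have fi: "gauss_inf \<kappa> f A - radon_integral \<mu> f = ereal (w - field_integral \<mu>)" if "\<mu> \<in> G" for \<mu>
    using f_integral(1)[OF gauss_classD(2,3)[OF that]] by (simp add: gw)
  have c_eq: "c = w - field_integral l" using l(2) by (simp add: c_def gaussian_def)
  have ne: "nearly_everywhere_on \<kappa> A (\<lambda>x. field_defined \<kappa> \<theta> x \<and> ereal c \<le> weighted_potential \<kappa> f l x)"
    using variational_inequality[OF l(1)] w l(2) unfolding c_def by (intro exceptional_set_empty[OF lE]) simp
  note W = weighted_potential_integral[OF lE lE li]
  have ae: "AE x in borel_of l. field_defined \<kappa> \<theta> x \<and> weighted_potential \<kappa> f l x \<le> ereal c"
  proof -
    interpret prob_space "borel_of l" by (rule unit_prob[OF gauss_classD(1)[OF l(1)]])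
    \<comment> \<open>The weighted potential of \<open>l\<close> minus \<open>c\<close> is
      nonnegative almost everywhere for \<open>l\<close>, and its integral is 0 by the choice of
      \<open>c\<close>; hence it vanishes almost everywhere.\<close>
    let ?g = "\<lambda>x. real_pot l x + (real_of_ereal (\<psi> x) + real_field x) - c"
    have nn: "AE x in borel_of l. 0 \<le> ?g x"
      using nearly_everywhere_imp_AE[OF lE ne gauss_classD(1)[OF l(1)]] W(5) by eventually_elim simp
    have "integrable (borel_of l) ?g" using W(3) by simp
    moreover have "(LINT x|borel_of l. ?g x) = 0"
      using W(3) by (simp add: Bochner_Integration.integral_diff W(4) prob_space c_def)
    ultimately have "AE x in borel_of l. ?g x = 0" using integral_nonneg_eq_0_iff_AE nn by blast
    then show ?thesis using W(5) f_AE[OF lE] by eventually_elim simp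
  qed
  have char1: "\<mu> = l" if \<mu>: "\<mu> \<in> G" and
      n: "nearly_everywhere_on \<kappa> A (\<lambda>x. field_defined \<kappa> \<theta> x \<and> ereal (ener \<mu> \<mu> + field_integral \<mu>) \<le> weighted_potential \<kappa> f \<mu> x)" for \<mu>
  proof (rule uniq[OF \<mu>])
    note mE = gauss_classD(2)[OF \<mu>]
    interpret prob_space "borel_of l" by (rule unit_prob[OF gauss_classD(1)[OF l(1)]])
    note V = weighted_potential_integral[OF mE lE li]
    have "AE x in borel_of l. ener \<mu> \<mu> + field_integral \<mu> \<le> real_pot \<mu> x + (real_of_ereal (\<psi> x) + real_field x)"
      using nearly_everywhere_imp_AE[OF mE n gauss_classD(1)[OF l(1)]] V(5) by eventually_elim simp
    then have "ener \<mu> \<mu> + field_integral \<mu> \<le> (LINT x|borel_of l. real_pot \<mu> x + (real_of_ereal (\<psi> x) + real_field x))"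
      by (rule integral_ge_const[OF V(3)])
    then have "ener \<mu> \<mu> + field_integral \<mu> \<le> ener \<mu> l + field_integral l" unfolding V(4) .
    \<comment> \<open>Doubling the last inequality and using
      \<open>2 * ener \<mu> l \<le> ener \<mu> \<mu> + ener l l\<close> gives
      \<open>gaussian \<mu> \<le> gaussian l\<close>.\<close>
    then show "gaussian \<mu> \<le> w"
      using dist_sq_nonneg[OF mE lE] l(2) unfolding dist_sq_def gaussian_def by linarith
  qed
  have char2: "\<mu> = l" if \<mu>: "\<mu> \<in> G" and
      a: "AE x in borel_of \<mu>. field_defined \<kappa> \<theta> x \<and> weighted_potential \<kappa> f \<mu> x \<le> ereal (w - field_integral \<mu>)" for \<mu>
  proof (rule uniq[OF \<mu>])
    note mE = gauss_classD(2)[OF \<mu>]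
    interpret prob_space "borel_of \<mu>" by (rule unit_prob[OF gauss_classD(1)[OF \<mu>]])
    note V = weighted_potential_integral[OF mE mE gauss_classD(3)[OF \<mu>]]
    have "AE x in borel_of \<mu>. real_pot \<mu> x + (real_of_ereal (\<psi> x) + real_field x) \<le> w - field_integral \<mu>"
      using a V(5) by eventually_elim simp
    then have "(LINT x|borel_of \<mu>. real_pot \<mu> x + (real_of_ereal (\<psi> x) + real_field x)) \<le> w - field_integral \<mu>"
      by (rule integral_le_const[OF V(3)])
    \<comment> \<open>The integrated inequality reads \<open>ener \<mu> \<mu> + field_integral \<mu>
      \<le> w - field_integral \<mu>\<close>. The upper bound thus already contains the minimal
      value, and this forces \<mu> to attain it.\<close>
    then show "gaussian \<mu> \<le> w" unfolding V(4) gaussian_def by linarith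
  qed
  show ?thesis
  proof (intro bexI[OF _ l(1)] conjI ballI impI iffI exI[of _ c])
    show "gauss_energy \<kappa> f l = gauss_inf \<kappa> f A" by (simp add: gauss_energy_eq l gw)
    show "\<mu> = l" if "\<mu> \<in> G" "gauss_energy \<kappa> f \<mu> = gauss_inf \<kappa> f A" for \<mu>
      using that uniq by (simp add: gauss_energy_eq gw)
    show "integral_defined l (weighted_potential \<kappa> f l)"
      using W(1) by (simp add: integral_defined_def radon_integrable_def)
    show "ereal c = radon_integral l (weighted_potential \<kappa> f l)" by (simp add: wp[OF l(1)] c_def)
    show "ereal c = gauss_inf \<kappa> f A - radon_integral l f" by (simp add: fi[OF l(1)] c_eq)
    show "nearly_everywhere_on \<kappa> A (\<lambda>x. field_defined \<kappa> \<theta> x \<and> ereal c \<le> weighted_potential \<kappa> f l x)" by (rule ne)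
    show "AE x in borel_of l. field_defined \<kappa> \<theta> x \<and> weighted_potential \<kappa> f l x \<le> ereal c" by (rule ae)
  next
    fix \<mu> assume "\<mu> \<in> G" "\<mu> = l"
    then show "nearly_everywhere_on \<kappa> A (\<lambda>x. field_defined \<kappa> \<theta> x \<and> radon_integral \<mu> (weighted_potential \<kappa> f \<mu>) \<le> weighted_potential \<kappa> f \<mu> x)"
      using ne by (simp add: wp c_def)
  next
    fix \<mu> assume "\<mu> \<in> G" "nearly_everywhere_on \<kappa> A (\<lambda>x. field_defined \<kappa> \<theta> x \<and> radon_integral \<mu> (weighted_potential \<kappa> f \<mu>) \<le> weighted_potential \<kappa> f \<mu> x)"
    then show "\<mu> = l" using char1 by (simp add: wp)
  next
    fix \<mu> assume "\<mu> = l"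
    show "AE x in borel_of \<mu>. field_defined \<kappa> \<theta> x \<and> weighted_potential \<kappa> f \<mu> x \<le> gauss_inf \<kappa> f A - radon_integral \<mu> f"
      using ae unfolding \<open>\<mu> = l\<close> fi[OF l(1)] c_eq .
  next
    fix \<mu> assume "\<mu> \<in> G" "AE x in borel_of \<mu>. field_defined \<kappa> \<theta> x \<and> weighted_potential \<kappa> f \<mu> x \<le> gauss_inf \<kappa> f A - radon_integral \<mu> f"
    then show "\<mu> = l" using char2 by (simp add: fi)
  qed
qed

end

theorem theorem1p2:
  fixes \<kappa> :: "'a::t2_space \<times> 'a \<Rightarrow> ereal"
    and \<psi> f :: "'a \<Rightarrow> ereal"
    and \<theta> :: "('a \<Rightarrow> real) \<Rightarrow> real"
    and A :: "'a set"
  assumes "locally_compact_space (euclidean :: 'a topology)"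
    and "perfect_kernel \<kappa>"
    and "\<psi> \<in> Phi"
    and "\<theta> \<in> energy_space \<kappa>"
    and "f = external_field \<kappa> \<psi> \<theta>"
    and "-\<infinity> < gauss_inf \<kappa> f A" and "gauss_inf \<kappa> f A < \<infinity>"
    and "closedin (subtopology (strong_topology \<kappa>) (energy_cone \<kappa>)) (energy_cone_on \<kappa> A)"
    and "inner_cap \<kappa> A < \<infinity>"
  shows "\<exists>\<nu>\<in>gauss_class \<kappa> f A.
    gauss_energy \<kappa> f \<nu> = gauss_inf \<kappa> f A \<and>
    (\<forall>\<mu>\<in>gauss_class \<kappa> f A. gauss_energy \<kappa> f \<mu> = gauss_inf \<kappa> f A \<longrightarrow> \<mu> = \<nu>) \<and>
    (\<exists>c::real.
       integral_defined \<nu> (weighted_potential \<kappa> f \<nu>) \<and>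
       ereal c = radon_integral \<nu> (weighted_potential \<kappa> f \<nu>) \<and>
       ereal c = gauss_inf \<kappa> f A - radon_integral \<nu> f \<and>
       nearly_everywhere_on \<kappa> A
         (\<lambda>x. field_defined \<kappa> \<theta> x \<and> ereal c \<le> weighted_potential \<kappa> f \<nu> x) \<and>
       (AE x in borel_of \<nu>.
          field_defined \<kappa> \<theta> x \<and> weighted_potential \<kappa> f \<nu> x \<le> ereal c)) \<and>
    (\<forall>\<mu>\<in>gauss_class \<kappa> f A.
       \<mu> = \<nu> \<longleftrightarrow>
       nearly_everywhere_on \<kappa> A
         (\<lambda>x. field_defined \<kappa> \<theta> x \<and>
              radon_integral \<mu> (weighted_potential \<kappa> f \<mu>) \<le> weighted_potential \<kappa> f \<mu> x)) \<and>
    (\<forall>\<mu>\<in>gauss_class \<kappa> f A.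
       \<mu> = \<nu> \<longleftrightarrow>
       (AE x in borel_of \<mu>.
          field_defined \<kappa> \<theta> x \<and>
          weighted_potential \<kappa> f \<mu> x \<le> gauss_inf \<kappa> f A - radon_integral \<mu> f))"
proof -
  interpret gauss_problem \<kappa> \<psi> \<theta> A
    using assms(1-4) by unfold_locales (simp_all add: perfect_kernel_def)
  show ?thesis using gauss_solution assms(6-9) unfolding assms(5) by blast
qed

end
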